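(* Let $n\ge 1$, $L\ge 1$, $1<p<\infty$, $s\in(0,1)$, and let $\Omega\subset\mathbb{R}^n$ be a Lipschitz domain (possibly $\Omega=\mathbb{R}^n$). Let $\mathcal{N}\subset\mathbb{R}^L$ be either the unit sphere $\mathbb{S}^{L-1}$, or a compact connected Riemannian homogeneous manifold without boundary that is isometrically and equivariantly embedded into $\mathbb{R}^L$. Then for every $u_0\in W^{s,p}(\Omega,\mathcal{N})$ there exists $u:\Omega\times(0,\infty)\to\mathcal{N}$ which is a weak solution of $$\begin{cases}\partial_t u+E_{s,p}'(u,\cdot)\perp T_u\mathcal{N} & \text{in }\Omega\times(0,\infty),\\ u(\cdot,0)=u_0 & \text{in }\Omega,\end{cases}$$ in the following sense: (i) $u\in L^\infty(0,\infty;W^{s,p}(\Omega))$; (ii) $\partial_t u\in L^2(0,\infty;L^2(\Omega))$; (iii) for every $0<T<\infty$ and every $\varphi\in L^\infty(0,T;W^{s,p}_0(\Omega,\mathbb{R}^L))\cap L^\infty(\Omega\times[0,T],\mathbb{R}^L)$, $$\int_0^T\int_{\Omega}\big\langle\partial_t u,\,P_{\mathcal{N}}(u)(\varphi)\big\rangle\,dx\,dt+\int_0^T E_{s,p}'\big(u(\cdot,t),\,P_{\mathcal{N}}(u(\cdot,t))(\varphi(\cdot,t))\big)\,dt=0;$$ (iv) $\displaystyle\lim_{t\to0^+}\|u(\cdot,t)-u_0\|_{L^2(\Omega)}=0.$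
   Context: $W^{s,p}(\Omega,\mathbb{R}^L)$ is the usual fractional Sobolev (Sobolev–Slobodeckij) space of $\mathbb{R}^L$-valued functions $u\in L^p(\Omega)$ with finite Gagliardo energy $$E_{s,p}(u)=\frac1p\int_{\Omega\times\Omega}\frac{|u(x)-u(y)|^p}{|x-y|^{n+sp}}\,dx\,dy,$$ and $W^{s,p}(\Omega,\mathcal{N})=\{u\in W^{s,p}(\Omega,\mathbb{R}^L): u(x)\in\mathcal{N}\text{ for a.e. }x\in\Omega\}$. $W_0^{s,p}(\Omega,\mathbb{R}^L)$ is the closure of $C_0^\infty(\Omega,\mathbb{R}^L)$ in $W^{s,p}(\Omega,\mathbb{R}^L)$. For $v\in W^{s,p}(\Omega,\mathcal{N})$ and an $\mathbb{R}^L$-valued test map $\varphi$, the Fréchet derivative is $$E_{s,p}'(v,\varphi)=\int_{\Omega\times\Omega}\frac{|v(x)-v(y)|^{p-2}\langle v(x)-v(y),\varphi(x)-\varphi(y)\rangle}{|x-y|^{n+sp}}\,dx\,dy,$$ where $|a|^{p-2}a$ is interpreted as $0$ when $a=0$. For $y\in\mathcal{N}$, $P_{\mathcal{N}}(y):\mathbb{R}^L\to T_y\mathcal{N}$ is the orthogonal projection onto the tangent space $T_y\mathcal{N}\subset\mathbb{R}^L$. A compact Riemannian manifold $\mathcal{N}$ is homogeneous if a compact Lie group $G$ acts on it transitively by isometries. An embedding $\Psi:\mathcal{N}\to\mathbb{R}^L$ is equivariant if there is an orthogonal representation $\rho$ of $G$ on $\mathbb{R}^L$ such that $\Psi(gp)=\rho(g)\Psi(p)$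 for all $g\in G$, $p\in\mathcal{N}$; $\mathcal{N}$ is identified with its image $\Psi(\mathcal{N})$. The property $u:\Omega\times(0,\infty)\to\mathcal{N}$ is understood almost everywhere, and $\partial_t u$ is the distributional time derivative. *)

theory Defs
  imports "HOL-Analysis.Analysis" "HOL-Algebra.Group"
begin

section \<open>Smooth functions\<close>

text \<open>Intended for open \<open>S\<close>: \<open>f\<close> is of class \<open>C\<^sup>k\<close> on \<open>S\<close>.\<close>

primrec higher_differentiable_on ::
    "nat \<Rightarrow> 'a::real_normed_vector set \<Rightarrow> ('a \<Rightarrow> 'b::real_normed_vector) \<Rightarrow> bool" where
  "higher_differentiable_on 0 S f \<longleftrightarrow> continuous_on S f"
| "higher_differentiable_on (Suc k) S f \<longleftrightarrow>
     (\<forall>x\<in>S. f differentiable (at x)) \<and>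
     (\<forall>v. higher_differentiable_on k S (\<lambda>x. frechet_derivative f (at x) v))"

definition smooth_on :: "'a::real_normed_vector set \<Rightarrow> ('a \<Rightarrow> 'b::real_normed_vector) \<Rightarrow> bool" where
  "smooth_on S f \<longleftrightarrow> (\<forall>k. higher_differentiable_on k S f)"

definition test_functions ::
    "'a::real_normed_vector set \<Rightarrow> ('a \<Rightarrow> 'b::real_normed_vector) set" where
  "test_functions S =
     {f. smooth_on UNIV f \<and> compact (closure {x. f x \<noteq> 0}) \<and> closure {x. f x \<noteq> 0} \<subseteq> S}"

section \<open>Lipschitz domains\<close>

text \<open>Near each boundary point the domain is, in a suitable orthonormal frame whose last vector is
  \<open>e\<close>, the strict epigraph of a Lipschitz function \<open>\<gamma>\<close> on the hyperplane orthogonal to \<open>e\<close>. The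
  constants may depend on the point, and the domain need not be bounded.\<close>

definition lipschitz_domain :: "'a::euclidean_space set \<Rightarrow> bool" where
  "lipschitz_domain \<Omega> \<longleftrightarrow> open \<Omega> \<and> connected \<Omega> \<and> \<Omega> \<noteq> {} \<and>
     (\<forall>z\<in>frontier \<Omega>. \<exists>e r C \<gamma>. norm e = 1 \<and> r > 0 \<and> C-lipschitz_on {y. y \<bullet> e = 0} \<gamma> \<and>
        (\<forall>x\<in>ball z r. x \<in> \<Omega> \<longleftrightarrow> \<gamma> (x - (x \<bullet> e) *\<^sub>R e) < x \<bullet> e))"

section \<open>Submanifolds of Euclidean space\<close>

definition smooth_submanifold :: "nat \<Rightarrow> 'a::euclidean_space set \<Rightarrow> bool" where
  "smooth_submanifold k M \<longleftrightarrow>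
     (\<forall>q\<in>M. \<exists>U V (f :: 'a \<Rightarrow> 'a) g S. open U \<and> open V \<and> q \<in> U \<and> homeomorphism U V f g \<and>
        smooth_on U f \<and> smooth_on V g \<and> subspace S \<and> dim S = k \<and> f ` (M \<inter> U) = S \<inter> V)"

text \<open>Smoothness of a map defined on a subset of Euclidean space that need not be open.\<close>

definition smooth_map_on ::
    "'a::euclidean_space set \<Rightarrow> ('a \<Rightarrow> 'b::euclidean_space) \<Rightarrow> bool" where
  "smooth_map_on M f \<longleftrightarrow>
     (\<forall>q\<in>M. \<exists>U F. open U \<and> q \<in> U \<and> smooth_on U F \<and> (\<forall>x\<in>M \<inter> U. F x = f x))"

definition tangent_space :: "'a::euclidean_space set \<Rightarrow> 'a \<Rightarrow> 'a set" where
  "tangent_space M q =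
     {v. \<exists>c \<epsilon>. \<epsilon> > 0 \<and> smooth_on {-\<epsilon><..<\<epsilon>} c \<and> c ` {-\<epsilon><..<\<epsilon>} \<subseteq> M \<and> c (0::real) = q \<and>
            (c has_vector_derivative v) (at 0)}"

definition tangent_proj :: "'a::euclidean_space set \<Rightarrow> 'a \<Rightarrow> 'a \<Rightarrow> 'a" where
  "tangent_proj M q v =
     (THE w. w \<in> tangent_space M q \<and> (\<forall>z\<in>tangent_space M q. orthogonal (v - w) z))"

section \<open>Equivariantly embedded homogeneous manifolds\<close>

text \<open>The underlying manifold of a Lie group is taken to be a submanifold of some Euclidean space
  (no loss of generality, by Whitney's embedding theorem). The group structure is arbitrary; it is
  unrelated to the linear structure of the ambient space.\<close>

definition compact_lie_group :: "('g::euclidean_space) monoid \<Rightarrow> bool" where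
  "compact_lie_group G \<longleftrightarrow> group G \<and> compact (carrier G) \<and>
     (\<exists>k. smooth_submanifold k (carrier G)) \<and>
     smooth_map_on (carrier G \<times> carrier G) (\<lambda>(g, h). g \<otimes>\<^bsub>G\<^esub> h) \<and>
     smooth_map_on (carrier G) (\<lambda>g. inv\<^bsub>G\<^esub> g)"

definition orthogonal_representation ::
    "('g::euclidean_space) monoid \<Rightarrow> ('g \<Rightarrow> 'a::euclidean_space \<Rightarrow> 'a) \<Rightarrow> bool" where
  "orthogonal_representation G \<rho> \<longleftrightarrow>
     (\<forall>g\<in>carrier G. orthogonal_transformation (\<rho> g)) \<and>
     \<rho> \<one>\<^bsub>G\<^esub> = id \<and>
     (\<forall>g\<in>carrier G. \<forall>h\<in>carrier G. \<rho> (g \<otimes>\<^bsub>G\<^esub> h) = \<rho> g \<circ> \<rho> h) \<and>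
     (\<forall>x. continuous_on (carrier G) (\<lambda>g. \<rho> g x))"

text \<open>The manifold \<open>N\<close> is identified with its image under the isometric equivariant embedding, so
  that its Riemannian metric is the one induced from the ambient space and the action of \<open>G\<close> on
  \<open>N\<close> is \<open>g \<cdot> q = \<rho> g q\<close>. This action is by isometries because each \<open>\<rho> g\<close> is a linear isometry
  preserving \<open>N\<close>.\<close>

definition equivariant_homogeneous_manifold ::
    "('g::euclidean_space) monoid \<Rightarrow> ('g \<Rightarrow> 'a::euclidean_space \<Rightarrow> 'a) \<Rightarrow> 'a set \<Rightarrow> bool" where
  "equivariant_homogeneous_manifold G \<rho> N \<longleftrightarrow>
     compact N \<and> connected N \<and> (\<exists>k. smooth_submanifold k N) \<and>
     compact_lie_group G \<and> orthogonal_representation G \<rho> \<and>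
     (\<forall>g\<in>carrier G. \<forall>q\<in>N. \<rho> g q \<in> N) \<and>
     (\<forall>q\<in>N. \<forall>q'\<in>N. \<exists>g\<in>carrier G. \<rho> g q = q')"

section \<open>Function spaces\<close>

text \<open>Elements of function spaces are represented by functions on the whole type, of which only the
  restriction to the domain matters, and functions agreeing almost everywhere are not identified.
  Accordingly the norms below are only seminorms.\<close>

definition Lp_space ::
    "real \<Rightarrow> 'a::euclidean_space set \<Rightarrow> ('a \<Rightarrow> 'b::euclidean_space) set" where
  "Lp_space p \<Omega> = {f. f \<in> borel_measurable (lebesgue_on \<Omega>) \<and>
     integrable (lebesgue_on \<Omega>) (\<lambda>x. norm (f x) powr p)}"

definition Lp_norm ::
    "real \<Rightarrow> 'a::euclidean_space set \<Rightarrow> ('a \<Rightarrow> 'b::euclidean_space) \<Rightarrow> real" where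
  "Lp_norm p \<Omega> f = (LINT x|lebesgue_on \<Omega>. norm (f x) powr p) powr (1 / p)"

definition Linfty_space :: "'a::euclidean_space set \<Rightarrow> ('a \<Rightarrow> 'b::euclidean_space) set" where
  "Linfty_space \<Omega> = {f. f \<in> borel_measurable (lebesgue_on \<Omega>) \<and>
     (\<exists>C. AE x in lebesgue_on \<Omega>. norm (f x) \<le> C)}"

definition locally_integrable_on ::
    "('a::euclidean_space \<Rightarrow> 'b::euclidean_space) \<Rightarrow> 'a set \<Rightarrow> bool" where
  "locally_integrable_on f \<Omega> \<longleftrightarrow>
     (\<forall>K. compact K \<and> K \<subseteq> \<Omega> \<longrightarrow> f absolutely_integrable_on K)"

subsection \<open>Fractional Sobolev spaces\<close>

definition gagliardo_integrand ::
    "real \<Rightarrow> real \<Rightarrow> ('a::euclidean_space \<Rightarrow> 'b::euclidean_space) \<Rightarrow> 'a \<times> 'a \<Rightarrow> real" where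
  "gagliardo_integrand s p u = (\<lambda>(x, y).
     norm (u x - u y) powr p / norm (x - y) powr (real DIM('a) + s * p))"

definition gagliardo_energy ::
    "real \<Rightarrow> real \<Rightarrow> 'a::euclidean_space set \<Rightarrow> ('a \<Rightarrow> 'b::euclidean_space) \<Rightarrow> real" where
  "gagliardo_energy s p \<Omega> u =
     1 / p * (LINT z|lebesgue_on (\<Omega> \<times> \<Omega>). gagliardo_integrand s p u z)"

definition sobolev ::
    "real \<Rightarrow> real \<Rightarrow> 'a::euclidean_space set \<Rightarrow> ('a \<Rightarrow> 'b::euclidean_space) set" where
  "sobolev s p \<Omega> = {u \<in> Lp_space p \<Omega>.
     integrable (lebesgue_on (\<Omega> \<times> \<Omega>)) (gagliardo_integrand s p u)}"

definition sobolev_norm ::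
    "real \<Rightarrow> real \<Rightarrow> 'a::euclidean_space set \<Rightarrow> ('a \<Rightarrow> 'b::euclidean_space) \<Rightarrow> real" where
  "sobolev_norm s p \<Omega> u =
     (Lp_norm p \<Omega> u powr p + p * gagliardo_energy s p \<Omega> u) powr (1 / p)"

definition sobolev_into ::
    "real \<Rightarrow> real \<Rightarrow> 'a::euclidean_space set \<Rightarrow> 'b::euclidean_space set \<Rightarrow> ('a \<Rightarrow> 'b) set" where
  "sobolev_into s p \<Omega> N = {u \<in> sobolev s p \<Omega>. AE x in lebesgue_on \<Omega>. u x \<in> N}"

definition sobolev0 ::
    "real \<Rightarrow> real \<Rightarrow> 'a::euclidean_space set \<Rightarrow> ('a \<Rightarrow> 'b::euclidean_space) set" where
  "sobolev0 s p \<Omega> = {u \<in> sobolev s p \<Omega>.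
     \<forall>\<epsilon>>0. \<exists>\<psi>\<in>test_functions \<Omega> \<inter> sobolev s p \<Omega>. sobolev_norm s p \<Omega> (\<lambda>x. u x - \<psi> x) < \<epsilon>}"

text \<open>The formula for \<open>E\<^sub>s\<^sub>,\<^sub>p'(v, \<phi>)\<close>. Where \<open>v x = v y\<close>, the integrand is \<open>0\<close> for every \<open>p\<close>.\<close>

definition energy_deriv_integrand ::
    "real \<Rightarrow> real \<Rightarrow> ('a::euclidean_space \<Rightarrow> 'b::euclidean_space) \<Rightarrow> ('a \<Rightarrow> 'b) \<Rightarrow> 'a \<times> 'a \<Rightarrow> real"
  where
  "energy_deriv_integrand s p v \<phi> = (\<lambda>(x, y).
     norm (v x - v y) powr (p - 2) * ((v x - v y) \<bullet> (\<phi> x - \<phi> y)) /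
       norm (x - y) powr (real DIM('a) + s * p))"

definition energy_deriv ::
    "real \<Rightarrow> real \<Rightarrow> 'a::euclidean_space set \<Rightarrow> ('a \<Rightarrow> 'b::euclidean_space) \<Rightarrow> ('a \<Rightarrow> 'b) \<Rightarrow> real"
  where
  "energy_deriv s p \<Omega> v \<phi> =
     (LINT z|lebesgue_on (\<Omega> \<times> \<Omega>). energy_deriv_integrand s p v \<phi> z)"

subsection \<open>Bochner spaces\<close>

text \<open>Here \<open>X\<close> is a vector space of functions with (semi)norm \<open>nrm\<close>. The condition
  \<open>simple_function M (S k)\<close> asks for finitely many values, each attained on a measurable set.\<close>

definition strongly_measurable ::
    "'t measure \<Rightarrow> ('a \<Rightarrow> 'b::real_vector) set \<Rightarrow> (('a \<Rightarrow> 'b) \<Rightarrow> real) \<Rightarrow> ('t \<Rightarrow> 'a \<Rightarrow> 'b) \<Rightarrow> bool"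
  where
  "strongly_measurable M X nrm f \<longleftrightarrow>
     (AE t in M. f t \<in> X) \<and>
     (\<exists>S::nat \<Rightarrow> 't \<Rightarrow> 'a \<Rightarrow> 'b. (\<forall>k. simple_function M (S k) \<and> S k ` space M \<subseteq> X) \<and>
        (AE t in M. (\<lambda>k. nrm (\<lambda>x. S k t x - f t x)) \<longlonglongrightarrow> 0))"

definition bochner_Lp ::
    "real \<Rightarrow> 't measure \<Rightarrow> ('a \<Rightarrow> 'b::real_vector) set \<Rightarrow> (('a \<Rightarrow> 'b) \<Rightarrow> real) \<Rightarrow>
      ('t \<Rightarrow> 'a \<Rightarrow> 'b) set" where
  "bochner_Lp q M X nrm =
     {f. strongly_measurable M X nrm f \<and> integrable M (\<lambda>t. nrm (f t) powr q)}"

definition bochner_Linfty ::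
    "'t measure \<Rightarrow> ('a \<Rightarrow> 'b::real_vector) set \<Rightarrow> (('a \<Rightarrow> 'b) \<Rightarrow> real) \<Rightarrow> ('t \<Rightarrow> 'a \<Rightarrow> 'b) set"
  where
  "bochner_Linfty M X nrm =
     {f. strongly_measurable M X nrm f \<and> (\<exists>C. AE t in M. nrm (f t) \<le> C)}"

section \<open>Distributional time derivative\<close>

definition distributional_time_deriv ::
    "'a::euclidean_space set \<Rightarrow> ('a \<times> real \<Rightarrow> 'b::euclidean_space) \<Rightarrow> ('a \<times> real \<Rightarrow> 'b) \<Rightarrow> bool"
  where
  "distributional_time_deriv \<Omega> u w \<longleftrightarrow>
     locally_integrable_on u (\<Omega> \<times> {0<..}) \<and> locally_integrable_on w (\<Omega> \<times> {0<..}) \<and>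
     (\<forall>\<psi>::'a \<times> real \<Rightarrow> real. \<psi> \<in> test_functions (\<Omega> \<times> {0<..}) \<longrightarrow>
        (LINT z|lebesgue_on (\<Omega> \<times> {0<..}). frechet_derivative \<psi> (at z) (0, 1) *\<^sub>R u z) =
        - (LINT z|lebesgue_on (\<Omega> \<times> {0<..}). \<psi> z *\<^sub>R w z))"

section \<open>Weak solutions of the flow\<close>

text \<open>Functions on \<open>\<Omega> \<times> (0,\<infinity>)\<close> are of type \<open>'a \<times> real \<Rightarrow> 'b\<close>, space variable first. Lebesgue
  integrals of non-integrable functions are \<open>0\<close> by convention, so the integrability
  that makes the integrals in (iii) and the norm in (iv) meaningful is stated explicitly.\<close>

definition weak_solution ::
    "real \<Rightarrow> real \<Rightarrow> 'a::euclidean_space set \<Rightarrow> 'b::euclidean_space set \<Rightarrow> ('a \<Rightarrow> 'b) \<Rightarrow>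
      ('a \<times> real \<Rightarrow> 'b) \<Rightarrow> bool" where
  "weak_solution s p \<Omega> N u0 u \<longleftrightarrow>
     \<comment> \<open>(i)\<close>
     (\<lambda>t x. u (x, t)) \<in> bochner_Linfty (lebesgue_on {0<..}) (sobolev s p \<Omega>) (sobolev_norm s p \<Omega>) \<and>
     (\<exists>ut. distributional_time_deriv \<Omega> u ut \<and>
       \<comment> \<open>(ii)\<close>
       (\<lambda>t x. ut (x, t)) \<in> bochner_Lp 2 (lebesgue_on {0<..}) (Lp_space 2 \<Omega>) (Lp_norm 2 \<Omega>) \<and>
       \<comment> \<open>(iii)\<close>
       (\<forall>T>0. \<forall>\<phi>::'a \<times> real \<Rightarrow> 'b.
          (\<lambda>t x. \<phi> (x, t)) \<in>
              bochner_Linfty (lebesgue_on {0<..<T}) (sobolev0 s p \<Omega>) (sobolev_norm s p \<Omega>) \<longrightarrow>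
          \<phi> \<in> Linfty_space (\<Omega> \<times> {0..T}) \<longrightarrow>
          integrable (lebesgue_on (\<Omega> \<times> {0<..<T}))
            (\<lambda>z. ut z \<bullet> tangent_proj N (u z) (\<phi> z)) \<and>
          (AE t in lebesgue_on {0<..<T}. integrable (lebesgue_on (\<Omega> \<times> \<Omega>))
            (energy_deriv_integrand s p (\<lambda>x. u (x, t))
              (\<lambda>x. tangent_proj N (u (x, t)) (\<phi> (x, t))))) \<and>
          integrable (lebesgue_on {0<..<T})
            (\<lambda>t. energy_deriv s p \<Omega> (\<lambda>x. u (x, t))
              (\<lambda>x. tangent_proj N (u (x, t)) (\<phi> (x, t)))) \<and>
          (LINT t|lebesgue_on {0<..<T}. LINT x|lebesgue_on \<Omega>.
             ut (x, t) \<bullet> tangent_proj N (u (x, t)) (\<phi> (x, t))) +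
          (LINT t|lebesgue_on {0<..<T}. energy_deriv s p \<Omega> (\<lambda>x. u (x, t))
             (\<lambda>x. tangent_proj N (u (x, t)) (\<phi> (x, t)))) = 0)) \<and>
     \<comment> \<open>(iv)\<close>
     (\<forall>\<^sub>F t in at_right 0. (\<lambda>x. u (x, t) - u0 x) \<in> Lp_space 2 \<Omega>) \<and>
     ((\<lambda>t. Lp_norm 2 \<Omega> (\<lambda>x. u (x, t) - u0 x)) \<longlongrightarrow> 0) (at_right 0)"

end

theory Submission
  imports Defs "HOL-Library.Diagonal_Subsequence"
begin

text \<open>The manifold is an orbit of a compact group of orthogonal maps. If it is not a point of norm \<open>0\<close>,
  all its elements have the same positive norm, so that the existence of \<open>u0\<close> forces \<open>\<Omega>\<close> to have finite
  measure. Minimizing movements then yield discrete flows. Varying a minimizer along one-parameter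
  subgroups \<open>exp (s \<eta> A)\<close> gives a discrete equation tested with the infinitesimal isometries \<open>\<eta> A u\<close>. Since
  \<open>A\<close> is skew-symmetric, \<open>\<langle>u(x) - u(y), A (u(x) - u(y))\<rangle> = 0\<close>, and the remaining terms of the equation are
  of lower order in the increments of \<open>u\<close>: they pass to the limit under convergence almost everywhere,
  which a Rellich type argument provides. Finally the orthogonal projection onto the tangent space is a
  combination of infinitesimal isometries with Lipschitz coefficients, so that testing with these
  suffices.\<close>

subsection \<open>Compact groups of orthogonal maps\<close>

text \<open>The obstacle is that the energy bound makes the increments du of the approximations only
  bounded in L^p, while the equation is nonlinear in them. Testing with a general tangential map
  leaves a term of size |du|^p, bounded in L^1 but possibly concentrating. Testing with
  \<open>\<eta> A u\<close> removes exactly that term and leaves |du|^(p-1) |d\<eta>|, which Young's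
  inequality bounds by a small multiple of |du|^p plus a fixed integrable function. Two
  constructions pay for this restriction. The tangent space has to be the set of all W q with W in
  the Lie algebra; this is derived from compactness of the group inside the linear maps, by the
  argument of the closed subgroup theorem, not from a smooth structure on the group. And the
  coefficients of the projection have to be Lipschitz in the point, so that composing them with u
  and a bounded Sobolev map gives a Sobolev function again; here homogeneity helps once more,
  because every object at k q0 is the conjugate by k of the object at q0. The discrete time
  derivatives are only bounded in L^2. Their limit is reached strongly, along averages of tails, and
  such averages keep every limit of linear pairings.\<close>

typedef (overloaded) 'a endo = "UNIV :: ('a::euclidean_space \<Rightarrow>\<^sub>L 'a) set"
  morphisms blin Endo ..

lemma Endo_blin [simp]: "Endo (blin a) = a" "blin (Endo f) = f"
  by (simp_all add: blin_inverse Endo_inverse)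

definition act :: "'a::euclidean_space endo \<Rightarrow> 'a \<Rightarrow> 'a" where
  "act a x = blinfun_apply (blin a) x"

lemma endo_eqI: "(\<And>x. act a x = act b x) \<Longrightarrow> a = b"
  by (simp add: act_def blin_inject[symmetric] blinfun_eqI)

text \<open>The wrapper type exists to make composition a ring multiplication, so that
  \<open>exp\<close>, powers and their laws in Banach algebras apply to linear maps.\<close>

instantiation endo :: (euclidean_space) real_normed_algebra_1
begin

definition "0 = Endo 0"
definition "1 = Endo id_blinfun"
definition "a + b = Endo (blin a + blin b)"
definition "- a = Endo (- blin a)"
definition "a - b = Endo (blin a - blin b)"
definition "a * b = Endo (blin a o\<^sub>L blin b)"
definition "c *\<^sub>R a = Endo (c *\<^sub>R blin a)"
definition "norm a = norm (blin a)"
definition dist_endo :: "'a endo \<Rightarrow> 'a endo \<Rightarrow> real" where "dist_endo a b = norm (a - b)"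
definition sgn_endo :: "'a endo \<Rightarrow> 'a endo" where "sgn_endo a = inverse (norm a) *\<^sub>R a"
definition [code del]: "(uniformity :: ('a endo \<times> 'a endo) filter) = (INF e\<in>{0 <..}. principal {(x, y). dist x y < e})"
definition open_endo :: "'a endo set \<Rightarrow> bool" where [code del]:
  "open_endo U = (\<forall>x\<in>U. \<forall>\<^sub>F (x', y) in uniformity. x' = x \<longrightarrow> y \<in> U)"

lemmas endo_defs = zero_endo_def one_endo_def plus_endo_def uminus_endo_def minus_endo_def
  times_endo_def scaleR_endo_def norm_endo_def

lemma act_simps_aux:
  "act 0 x = 0" "act 1 x = x" "act (a + b) x = act a x + act b x" "act (- a) x = - act a x"
  "act (a - b) x = act a x - act b x" "act (a * b) x = act a (act b x)"
  "act (c *\<^sub>R a) x = c *\<^sub>R act a x"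
  by (simp_all add: act_def endo_defs blinfun.bilinear_simps)

lemma act_linear_aux: "act a (x + y) = act a x + act a y" "act a (c *\<^sub>R x) = c *\<^sub>R act a x"
  by (simp_all add: act_def blinfun.bilinear_simps)

instance
proof
  fix a b c :: "'a endo" and r q :: real
  have nz: "norm (id_blinfun :: 'a \<Rightarrow>\<^sub>L 'a) = 1"
    by simp
  show "norm (1 :: 'a endo) = 1" by (simp add: endo_defs nz)
  show "(0::'a endo) \<noteq> 1"
    using nz by (metis Endo_blin(2) norm_zero one_endo_def zero_endo_def zero_neq_one)
  show "norm (a * b) \<le> norm a * norm b" by (simp add: endo_defs norm_blinfun_compose)
  show "norm a = 0 \<longleftrightarrow> a = 0"
    by (metis Endo_blin norm_endo_def norm_eq_zero zero_endo_def)
  show "norm (a + b) \<le> norm a + norm b" by (simp add: endo_defs norm_triangle_ineq)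
  show "norm (r *\<^sub>R a) = \<bar>r\<bar> * norm a" by (simp add: endo_defs)
  show "dist a b = norm (a - b)" by (rule dist_endo_def)
  show "sgn a = inverse (norm a) *\<^sub>R a" by (rule sgn_endo_def)
  show "(uniformity :: ('a endo \<times> 'a endo) filter) = (INF e\<in>{0 <..}. principal {(x, y). dist x y < e})"
    by (rule uniformity_endo_def)
  show "open U = (\<forall>x\<in>U. \<forall>\<^sub>F (x', y) in uniformity. x' = x \<longrightarrow> y \<in> U)" for U :: "'a endo set"
    by (rule open_endo_def)
qed (auto intro!: endo_eqI simp: act_simps_aux act_linear_aux algebra_simps)

end

lemmas act_simps [simp] = act_simps_aux

lemma bounded_bilinear_act: "bounded_bilinear act"
proof
  show "\<exists>K. \<forall>a b. norm (act a (b::'a)) \<le> norm a * norm b * K"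
    by (rule exI[of _ 1]) (simp add: act_def norm_endo_def norm_blinfun)
qed (simp_all add: act_linear_aux)

interpretation act: bounded_bilinear act by (rule bounded_bilinear_act)

lemma norm_act_le: "norm (act a x) \<le> norm a * norm x"
  by (simp add: act_def norm_endo_def norm_blinfun)

lemma norm_endo_le: "0 \<le> c \<Longrightarrow> (\<And>x. norm (act a x) \<le> c * norm x) \<Longrightarrow> norm a \<le> c"
  by (simp add: act_def norm_endo_def norm_blinfun_bound)

lemma dist_blin: "dist (blin a) (blin b) = dist a b"
  by (simp add: dist_norm norm_endo_def minus_endo_def)

lemma tendsto_blin_iff: "((\<lambda>i. blin (f i)) \<longlongrightarrow> blin a) F \<longleftrightarrow> (f \<longlongrightarrow> a) F"
  by (simp add: tendsto_iff dist_blin)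

text \<open>Heine-Borel serves twice: it yields completeness, hence \<open>exp\<close>, and it turns
  bounded difference quotients of group elements into candidates for Lie algebra elements.\<close>

instance endo :: (euclidean_space) heine_borel
proof
  fix f :: "nat \<Rightarrow> 'a endo" assume "bounded (range f)"
  then obtain C where C: "\<And>i. norm (f i) \<le> C" by (auto simp: bounded_iff)
  then have "bounded (range (\<lambda>i. blin (f i)))" by (auto simp: bounded_iff norm_endo_def)
  then obtain l r where "strict_mono r" "((\<lambda>i. blin (f i)) \<circ> r) \<longlonglongrightarrow> l"
    using bounded_imp_convergent_subsequence by blast
  then show "\<exists>l r. strict_mono r \<and> (f \<circ> r) \<longlonglongrightarrow> l"
    by (intro exI[of _ "Endo l"] exI[of _ r]) (simp add: tendsto_blin_iff[symmetric] o_def)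
qed

instance endo :: (euclidean_space) banach ..

definition endo_of :: "('a::euclidean_space \<Rightarrow> 'a) \<Rightarrow> 'a endo" where
  "endo_of f = Endo (Blinfun f)"

lemma act_endo_of: "linear f \<Longrightarrow> act (endo_of f) x = f x"
  by (simp add: act_def endo_of_def bounded_linear_Blinfun_apply linear_conv_bounded_linear)

lemma linear_act: "linear (act a)"
  by (simp add: act.bounded_linear_right bounded_linear.linear)

section \<open>One-parameter groups of endomorphisms\<close>

lemma exp_difference_quotient:
  fixes W :: "'a::{real_normed_algebra_1, banach}"
  shows "((\<lambda>h. (1 / h) *\<^sub>R (exp (h *\<^sub>R W) - 1)) \<longlongrightarrow> W) (at 0)"
proof -
  have "((\<lambda>t. exp (t *\<^sub>R W)) has_vector_derivative W) (at 0)"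
    using exp_scaleR_has_vector_derivative_right[of W 0 UNIV] by simp
  then have "((\<lambda>h. (1 / norm h) *\<^sub>R (exp (h *\<^sub>R W) - exp (0 *\<^sub>R W) - h *\<^sub>R W)) \<longlongrightarrow> 0) (at 0)"
    by (simp add: has_vector_derivative_def has_derivative_at_within divide_inverse)
  then have "((\<lambda>h. norm ((1 / norm h) *\<^sub>R (exp (h *\<^sub>R W) - 1 - h *\<^sub>R W))) \<longlongrightarrow> 0) (at 0)"
    by (intro tendsto_norm_zero) simp
  then have "((\<lambda>h. norm ((1 / h) *\<^sub>R (exp (h *\<^sub>R W) - 1) - W)) \<longlongrightarrow> 0) (at 0)"
  proof (rule Lim_transform_eventually)
    show "\<forall>\<^sub>F h in at 0. norm ((1 / norm h) *\<^sub>R (exp (h *\<^sub>R W) - 1 - h *\<^sub>R W)) =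
        norm ((1 / h) *\<^sub>R (exp (h *\<^sub>R W) - 1) - W)"
    proof (rule eventually_at_filter[THEN iffD2], intro always_eventually allI impI)
      fix h :: real assume "h \<noteq> 0"
      then have "(1 / h) *\<^sub>R (exp (h *\<^sub>R W) - 1) - W = (1 / h) *\<^sub>R (exp (h *\<^sub>R W) - 1 - h *\<^sub>R W)"
        by (simp add: scaleR_right_diff_distrib)
      then show "norm ((1 / norm h) *\<^sub>R (exp (h *\<^sub>R W) - 1 - h *\<^sub>R W)) =
        norm ((1 / h) *\<^sub>R (exp (h *\<^sub>R W) - 1) - W)" by simp
    qed
  qed
  then show ?thesis by (simp add: tendsto_norm_zero_iff LIM_zero_iff)
qed

lemma exp_scaleR_add: 
  fixes W :: "'a::{real_normed_algebra_1, banach}"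
  shows "exp ((a + b) *\<^sub>R W) = exp (a *\<^sub>R W) * exp (b *\<^sub>R W)"
  by (simp add: scaleR_add_left exp_add_commuting)

lemma tendsto_exp_scaleR:
  fixes W :: "'a::{real_normed_algebra_1, banach}"
  assumes "(f \<longlongrightarrow> a) F"
  shows "((\<lambda>j. exp (f j *\<^sub>R W)) \<longlongrightarrow> exp (a *\<^sub>R W)) F"
proof (rule isCont_tendsto_compose[OF _ assms])
  show "isCont (\<lambda>t. exp (t *\<^sub>R W)) a"
    by (rule has_vector_derivative_continuous[OF exp_scaleR_has_vector_derivative_right])
qed

lemma exp_scaleR_power:
  fixes W :: "'a::{real_normed_algebra_1, banach}"
  shows "exp (a *\<^sub>R W) ^ m = exp ((real m * a) *\<^sub>R W)"
  by (induction m) (simp_all add: distrib_right exp_scaleR_add)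

text \<open>Telescoping replaces one factor at a time; the factors on the left are contractions,
  those on the right are powers of \<open>b\<close>. With m of order 1/\<epsilon>, an error
  o(\<epsilon>) in one factor becomes o(1) in the m-th power.\<close>

lemma norm_power_diff_le:
  fixes a b :: "'a::real_normed_algebra_1"
  assumes "norm a \<le> 1" "\<And>i. i \<le> m \<Longrightarrow> norm (b ^ i) \<le> B"
  shows "norm (a ^ m - b ^ m) \<le> real m * norm (a - b) * B"
  using assms(2)
proof (induction m)
  case (Suc m)
  have B: "norm (b ^ m) \<le> B" using Suc.prems by simp
  have "a ^ Suc m - b ^ Suc m = a * (a ^ m - b ^ m) + (a - b) * b ^ m"
    by (simp add: algebra_simps)
  then have "norm (a ^ Suc m - b ^ Suc m) \<le> norm (a * (a ^ m - b ^ m)) + norm ((a - b) * b ^ m)"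
    by (metis norm_triangle_ineq)
  also have "\<dots> \<le> norm a * norm (a ^ m - b ^ m) + norm (a - b) * norm (b ^ m)"
    by (intro add_mono norm_mult_ineq)
  also have "\<dots> \<le> 1 * norm (a ^ m - b ^ m) + norm (a - b) * B"
    by (intro add_mono mult_mono assms(1) B order_refl) auto
  also have "\<dots> \<le> real m * norm (a - b) * B + norm (a - b) * B"
    using Suc.IH Suc.prems by simp
  finally show ?case by (simp add: algebra_simps)
qed simp

lemma tendsto_nat_floor_mult:
  fixes \<epsilon> :: "nat \<Rightarrow> real"
  assumes "\<And>j. 0 < \<epsilon> j" "\<epsilon> \<longlonglongrightarrow> 0" "0 \<le> s"
  shows "(\<lambda>j. real (nat \<lfloor>s / \<epsilon> j\<rfloor>) * \<epsilon> j) \<longlonglongrightarrow> s"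
proof (rule tendsto_sandwich[where f = "\<lambda>j. s - \<epsilon> j" and h = "\<lambda>j. s"])
  have "s - \<epsilon> j \<le> real (nat \<lfloor>s / \<epsilon> j\<rfloor>) * \<epsilon> j \<and> real (nat \<lfloor>s / \<epsilon> j\<rfloor>) * \<epsilon> j \<le> s" for j
  proof -
    have *: "real (nat \<lfloor>s / \<epsilon> j\<rfloor>) = of_int \<lfloor>s / \<epsilon> j\<rfloor>"
      using assms(1)[of j] assms(3) by simp
    have "s / \<epsilon> j - 1 \<le> of_int \<lfloor>s / \<epsilon> j\<rfloor>" "of_int \<lfloor>s / \<epsilon> j\<rfloor> \<le> s / \<epsilon> j" by linarith+
    then have "(s / \<epsilon> j - 1) * \<epsilon> j \<le> of_int \<lfloor>s / \<epsilon> j\<rfloor> * \<epsilon> j" "of_int \<lfloor>s / \<epsilon> j\<rfloor> * \<epsilon> j \<le> (s / \<epsilon> j) * \<epsilon> j"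
      using assms(1)[of j] by (meson less_imp_le mult_right_mono)+
    then show ?thesis unfolding * using assms(1)[of j] by (simp add: left_diff_distrib)
  qed
  then show "\<forall>\<^sub>F j in sequentially. s - \<epsilon> j \<le> real (nat \<lfloor>s / \<epsilon> j\<rfloor>) * \<epsilon> j"
    "\<forall>\<^sub>F j in sequentially. real (nat \<lfloor>s / \<epsilon> j\<rfloor>) * \<epsilon> j \<le> s" by simp_all
  show "(\<lambda>j. s - \<epsilon> j) \<longlonglongrightarrow> s" using tendsto_diff[OF tendsto_const assms(2), of s] by simp
qed simp

lemma act_exp_has_vector_derivative:
  "((\<lambda>t. act (exp (t *\<^sub>R W)) y) has_vector_derivative act (exp (t *\<^sub>R W)) (act W y)) (at t)"
proof -
  have "((\<lambda>t. act (exp (t *\<^sub>R W)) y) has_vector_derivative act (exp (t *\<^sub>R W) * W) y) (at t)"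
    by (rule bounded_linear.has_vector_derivative[OF act.bounded_linear_left
          exp_scaleR_has_vector_derivative_right])
  then show ?thesis by simp
qed

text \<open>Each derivative of the curve is a curve of the same kind started at another vector,
  which is why the induction runs over all \<open>y\<close>.\<close>

lemma higher_differentiable_on_act_exp:
  "higher_differentiable_on k S (\<lambda>t. act (exp (t *\<^sub>R W)) y)"
proof (induction k arbitrary: y)
  case 0
  show ?case
    unfolding higher_differentiable_on.simps
    by (intro continuous_at_imp_continuous_on ballI
        has_vector_derivative_continuous[OF act_exp_has_vector_derivative])
next
  case (Suc k)
  have d: "((\<lambda>t. act (exp (t *\<^sub>R W)) y) has_derivative (\<lambda>v. v *\<^sub>R act (exp (t *\<^sub>R W)) (act W y))) (at t)" for t
    using act_exp_has_vector_derivative by (simp add: has_vector_derivative_def)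
  have "frechet_derivative (\<lambda>t. act (exp (t *\<^sub>R W)) y) (at t) v = act (exp (t *\<^sub>R W)) (act W (v *\<^sub>R y))" for t v
    by (simp add: frechet_derivative_at[OF d, symmetric] act.scaleR_right)
  moreover have "(\<lambda>t. act (exp (t *\<^sub>R W)) y) differentiable (at t)" for t
    using d differentiableI by blast
  ultimately show ?case using Suc by simp
qed

section \<open>The Lie algebra of a compact group of orthogonal maps\<close>

locale orthogonal_group =
  fixes K :: "'a::euclidean_space endo set"
  assumes compact_K: "compact K"
    and one_K: "1 \<in> K"
    and mult_K: "\<And>a b. a \<in> K \<Longrightarrow> b \<in> K \<Longrightarrow> a * b \<in> K"
    and inv_K: "\<And>a. a \<in> K \<Longrightarrow> \<exists>b\<in>K. a * b = 1 \<and> b * a = 1"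
    and norm_act_K: "\<And>a x. a \<in> K \<Longrightarrow> norm (act a x) = norm x"
begin

text \<open>This is the Lie algebra in the sense of the closed subgroup theorem; it needs no charts
  of the group.\<close>

definition lie :: "'a endo set" where "lie = {W. \<forall>s. exp (s *\<^sub>R W) \<in> K}"

lemma norm_K_le: "a \<in> K \<Longrightarrow> norm a \<le> 1"
  by (rule norm_endo_le) (simp_all add: norm_act_K)

lemma power_K: "a \<in> K \<Longrightarrow> a ^ m \<in> K"
  by (induction m) (simp_all add: one_K mult_K)

lemma inverse_exp_K: "exp x \<in> K \<Longrightarrow> exp (- x) \<in> K"
proof -
  assume "exp x \<in> K"
  then obtain b where b: "b \<in> K" "b * exp x = 1" using inv_K by blast
  have "b = b * (exp x * exp (- x))" by (simp add: exp_minus_inverse)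
  also have "\<dots> = exp (- x)" by (simp add: mult.assoc[symmetric] b)
  finally show ?thesis using b by simp
qed

text \<open>The core of the closed subgroup theorem. For s \<ge> 0 the power of \<open>k j\<close>
  with about s / \<epsilon> factors lies in \<open>K\<close> and is close to the same power of
  exp(\<epsilon> W), that is to exp(s W); closedness of \<open>K\<close> does the rest. Negative
  times come from inverses.\<close>

lemma lie_limitI:
  assumes k: "\<And>j. k j \<in> K" and \<epsilon>: "\<And>j. 0 < \<epsilon> j" "\<epsilon> \<longlonglongrightarrow> 0"
    and lim: "(\<lambda>j. (1 / \<epsilon> j) *\<^sub>R (k j - 1)) \<longlonglongrightarrow> W"
  shows "W \<in> lie"
proof -
  have pos: "exp (s *\<^sub>R W) \<in> K" if s: "0 \<le> s" for s
  proof -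
    define e where "e j = exp (\<epsilon> j *\<^sub>R W)" for j
    define m where "m j = nat \<lfloor>s / \<epsilon> j\<rfloor>" for j
    \<comment> \<open>All powers of \<open>e j\<close> up to \<open>m j\<close> are exponentials of
      multiples of \<open>W\<close> by times in [0, s], so this one constant bounds them.\<close>
    define B where "B = exp (s * norm W)"
    define d where "d j = (1 / \<epsilon> j) *\<^sub>R (k j - e j)" for j
    have m\<epsilon>: "(\<lambda>j. real (m j) * \<epsilon> j) \<longlonglongrightarrow> s"
      unfolding m_def by (rule tendsto_nat_floor_mult) fact+
    have m_le: "real (m j) * \<epsilon> j \<le> s" for j
    proof -
      have "real (m j) \<le> s / \<epsilon> j" using \<epsilon>(1)[of j] s by (simp add: m_def)
      then show ?thesis using \<epsilon>(1)[of j] by (simp add: field_simps)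
    qed
    have "filterlim \<epsilon> (at 0) sequentially"
      using \<epsilon> by (auto simp: filterlim_at less_imp_neq[symmetric])
    then have "(\<lambda>j. (1 / \<epsilon> j) *\<^sub>R (e j - 1)) \<longlonglongrightarrow> W"
      unfolding e_def by (rule filterlim_compose[OF exp_difference_quotient])
    from tendsto_diff[OF lim this] have d0: "d \<longlonglongrightarrow> 0"
      by (simp add: d_def[abs_def] scaleR_diff_right)
    have "norm (e j ^ i) \<le> B" if "i \<le> m j" for i j
    proof -
      have "real i * \<epsilon> j \<le> s"
        using mult_right_mono[of "real i" "real (m j)" "\<epsilon> j"] that m_le[of j] \<epsilon>(1)[of j] by linarith
      then have "norm ((real i * \<epsilon> j) *\<^sub>R W) \<le> s * norm W"
        using \<epsilon>(1)[of j] by (simp add: mult_right_mono)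
      then show ?thesis
        unfolding e_def exp_scaleR_power B_def
        by (intro order_trans[OF norm_exp iffD2[OF exp_le_cancel_iff]])
    qed
    then have "norm (k j ^ m j - e j ^ m j) \<le> real (m j) * norm (k j - e j) * B" for j
      by (intro norm_power_diff_le norm_K_le k)
    also have "real (m j) * norm (k j - e j) * B = (real (m j) * \<epsilon> j) * norm (d j) * B" for j
      using \<epsilon>(1)[of j] by (simp add: d_def)
    finally have bd: "norm (k j ^ m j - e j ^ m j) \<le> (real (m j) * \<epsilon> j) * norm (d j) * B" for j .
    have "(\<lambda>j. (real (m j) * \<epsilon> j) * norm (d j) * B) \<longlonglongrightarrow> s * norm (0 :: 'a endo) * B"
      by (intro tendsto_intros m\<epsilon> d0)
    then have "(\<lambda>j. k j ^ m j - e j ^ m j) \<longlonglongrightarrow> 0"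
      by (intro Lim_null_comparison[OF always_eventually[OF allI[OF bd]]]) simp
    moreover have "(\<lambda>j. e j ^ m j) \<longlonglongrightarrow> exp (s *\<^sub>R W)"
      unfolding e_def exp_scaleR_power by (intro tendsto_exp_scaleR m\<epsilon>)
    ultimately have "(\<lambda>j. k j ^ m j) \<longlonglongrightarrow> exp (s *\<^sub>R W)"
      using tendsto_add by fastforce
    then show ?thesis
      using closed_sequentially[OF compact_imp_closed[OF compact_K], of "\<lambda>j. k j ^ m j"] power_K k by auto
  qed
  have "exp (s *\<^sub>R W) \<in> K" for s
    using pos[of s] inverse_exp_K[OF pos[of "- s"]] by (cases "0 \<le> s") auto
  then show ?thesis by (simp add: lie_def)
qed

lemma lie_scaleR: "W \<in> lie \<Longrightarrow> c *\<^sub>R W \<in> lie"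
  by (simp add: lie_def)

lemma exp_quotient_nat:
  "(\<lambda>j. real (Suc j) *\<^sub>R (exp ((1 / real (Suc j)) *\<^sub>R W) - 1)) \<longlonglongrightarrow> (W :: 'a endo)"
proof -
  have "filterlim (\<lambda>j. 1 / real (Suc j)) (at 0) sequentially"
    using LIMSEQ_inverse_real_of_nat by (auto simp: filterlim_at inverse_eq_divide)
  from filterlim_compose[OF exp_difference_quotient this] show ?thesis by simp
qed

text \<open>With v = exp(V/j) and w = exp(W/j), v w - 1 = (v - 1) w + (w - 1); multiplied by j the
  right side tends to V + W, because w tends to 1.\<close>

lemma lie_add:
  assumes "V \<in> lie" "W \<in> lie" shows "V + W \<in> lie"
proof (rule lie_limitI)
  define v w where "v j = exp ((1 / real (Suc j)) *\<^sub>R V)" and "w j = exp ((1 / real (Suc j)) *\<^sub>R W)" for j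
  show "v j * w j \<in> K" for j using assms by (auto simp: lie_def v_def w_def intro!: mult_K)
  show "0 < 1 / real (Suc j)" for j by simp
  show "(\<lambda>j. 1 / real (Suc j)) \<longlonglongrightarrow> 0" using LIMSEQ_inverse_real_of_nat by (simp add: inverse_eq_divide)
  have V: "(\<lambda>j. real (Suc j) *\<^sub>R (v j - 1)) \<longlonglongrightarrow> V" and W: "(\<lambda>j. real (Suc j) *\<^sub>R (w j - 1)) \<longlonglongrightarrow> W"
    unfolding v_def w_def by (rule exp_quotient_nat)+
  have "(\<lambda>j. 1 / real (Suc j)) \<longlonglongrightarrow> 0"
    using LIMSEQ_inverse_real_of_nat by (simp add: inverse_eq_divide)
  then have "w \<longlonglongrightarrow> exp (0 *\<^sub>R W)"
    unfolding w_def by (rule tendsto_exp_scaleR)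
  then have "(\<lambda>j. (real (Suc j) *\<^sub>R (v j - 1)) * w j + real (Suc j) *\<^sub>R (w j - 1)) \<longlonglongrightarrow> V * exp (0 *\<^sub>R W) + W"
    by (intro tendsto_intros V W)
  then show "(\<lambda>j. (1 / (1 / real (Suc j))) *\<^sub>R (v j * w j - 1)) \<longlonglongrightarrow> V + W"
    by (simp add: algebra_simps)
qed

lemma zero_lie: "0 \<in> lie" by (simp add: lie_def one_K)

text \<open>Invariance under the adjoint action: conjugation maps the difference quotients of
  exp(W/j) to those of elements of \<open>K\<close> with limit a W b.\<close>

lemma lie_conj:
  assumes "W \<in> lie" "a \<in> K" "b \<in> K" "a * b = 1" shows "a * W * b \<in> lie"
proof (rule lie_limitI)
  define w where "w j = exp ((1 / real (Suc j)) *\<^sub>R W)" for j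
  show "a * w j * b \<in> K" for j using assms by (auto simp: lie_def w_def intro!: mult_K)
  show "0 < 1 / real (Suc j)" for j by simp
  show "(\<lambda>j. 1 / real (Suc j)) \<longlonglongrightarrow> 0" using LIMSEQ_inverse_real_of_nat by (simp add: inverse_eq_divide)
  have "(\<lambda>j. a * (real (Suc j) *\<^sub>R (w j - 1)) * b) \<longlonglongrightarrow> a * W * b"
    unfolding w_def by (intro tendsto_intros exp_quotient_nat)
  moreover have "a * (real (Suc j) *\<^sub>R (w j - 1)) * b = (1 / (1 / real (Suc j))) *\<^sub>R (a * w j * b - 1)" for j
    by (simp add: algebra_simps assms(4) del: of_nat_Suc)
  ultimately show "(\<lambda>j. (1 / (1 / real (Suc j))) *\<^sub>R (a * w j * b - 1)) \<longlonglongrightarrow> a * W * b" by simp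
qed

text \<open>The squared norm is constant along the curve exp(tW) x; its derivative at 0 is twice the
  inner product in question.\<close>

lemma lie_skew:
  assumes "W \<in> lie" shows "act W x \<bullet> x = 0"
proof -
  let ?f = "\<lambda>t. act (exp (t *\<^sub>R W)) x"
  have "((\<lambda>t. ?f t \<bullet> ?f t) has_vector_derivative (?f 0 \<bullet> act (exp (0 *\<^sub>R W)) (act W x) + act (exp (0 *\<^sub>R W)) (act W x) \<bullet> ?f 0)) (at 0)"
    by (rule bounded_bilinear.has_vector_derivative[OF bounded_bilinear_inner]) (rule act_exp_has_vector_derivative)+
  moreover have "(\<lambda>t. ?f t \<bullet> ?f t) = (\<lambda>t. x \<bullet> x)"
    using assms norm_act_K by (auto simp: lie_def dot_square_norm)
  ultimately have "((\<lambda>t::real. x \<bullet> x) has_vector_derivative (2 * (act W x \<bullet> x))) (at 0)"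
    by (simp add: inner_commute)
  then show ?thesis using vector_derivative_unique_at[OF _ has_vector_derivative_const] by fastforce
qed

lemma exp_fixes:
  fixes W :: "'a endo"
  assumes "act W q = 0" shows "act (exp (s *\<^sub>R W)) q = q"
proof -
  have "((\<lambda>t. act (exp (t *\<^sub>R W)) q) has_derivative (\<lambda>h. 0)) (at t within UNIV)" for t
    using act_exp_has_vector_derivative[of W q t] assms by (simp add: has_vector_derivative_def act.zero_right)
  from has_derivative_zero_constant[OF convex_UNIV this]
  obtain c where "\<And>t. act (exp (t *\<^sub>R W)) q = c" by blast
  then show ?thesis using act_simps(2)[of q] by (metis exp_zero scaleR_zero_left)
qed

end

lemma has_vector_derivative_sequentially:
  fixes c :: "real \<Rightarrow> 'a::real_normed_vector"
  assumes d: "(c has_vector_derivative v) (at 0)" and t: "t \<longlonglongrightarrow> 0" "\<And>n. t n \<noteq> (0::real)"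
  shows "(\<lambda>n. (1 / t n) *\<^sub>R (c (t n) - c 0)) \<longlonglongrightarrow> v"
proof -
  have "((\<lambda>h. norm (c (0 + h) - c 0 - h *\<^sub>R v) / norm h) \<longlongrightarrow> 0) (at 0)"
    using d unfolding has_vector_derivative_def has_derivative_at by simp
  moreover have "filterlim t (at 0) sequentially"
    using t by (auto simp: filterlim_at)
  ultimately have "(\<lambda>n. norm (c (0 + t n) - c 0 - t n *\<^sub>R v) / norm (t n)) \<longlonglongrightarrow> 0"
    by (rule filterlim_compose)
  moreover have "norm (c (0 + t n) - c 0 - t n *\<^sub>R v) / norm (t n) =
      norm ((1 / t n) *\<^sub>R (c (t n) - c 0) - v)" for n
  proof -
    have "(1 / t n) *\<^sub>R (c (t n) - c 0) - v = (1 / t n) *\<^sub>R (c (t n) - c 0 - t n *\<^sub>R v)"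
      using t(2)[of n] by (simp add: scaleR_diff_right)
    then show ?thesis by (simp add: divide_inverse)
  qed
  ultimately have "(\<lambda>n. norm ((1 / t n) *\<^sub>R (c (t n) - c 0) - v)) \<longlonglongrightarrow> 0" by simp
  then show ?thesis by (simp only: tendsto_norm_zero_iff LIM_zero_iff)
qed

section \<open>Tangent spaces of an orbit\<close>

locale homogeneous_orbit = orthogonal_group K for K :: "'a::euclidean_space endo set" +
  fixes N :: "'a set"
  assumes act_N: "\<And>k q. k \<in> K \<Longrightarrow> q \<in> N \<Longrightarrow> act k q \<in> N"
    and transitive: "\<And>q q'. q \<in> N \<Longrightarrow> q' \<in> N \<Longrightarrow> \<exists>k\<in>K. act k q = q'"
begin

text \<open>A group element carrying q to y is determined only up to the stabiliser of q. Choosing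
  one nearest to the identity rules out spurious motion along the stabiliser, which could make
  difference quotients blow up.\<close>

lemma exists_least_displacement:
  assumes "q \<in> N" "y \<in> N"
  obtains k where "k \<in> K" "act k q = y" "\<And>k'. k' \<in> K \<Longrightarrow> act k' q = y \<Longrightarrow> norm (k - 1) \<le> norm (k' - 1)"
proof -
  have "closed {k. act k q = y}"
    by (intro closed_Collect_eq linear_continuous_on[OF act.bounded_linear_left] continuous_on_const)
  then have "compact (K \<inter> {k. act k q = y})"
    by (rule compact_Int_closed[OF compact_K])
  moreover have "K \<inter> {k. act k q = y} \<noteq> {}" using transitive[OF assms] by auto
  moreover have "continuous_on (K \<inter> {k. act k q = y}) (\<lambda>k. norm (k - 1))"
    by (intro continuous_intros)
  ultimately obtain k where "k \<in> K \<inter> {k. act k q = y}" "\<forall>k'\<in>K \<inter> {k. act k q = y}. norm (k - 1) \<le> norm (k' - 1)"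
    using continuous_attains_inf by blast
  then show ?thesis using that by auto
qed

text \<open>Suppose |k n - 1| is not O(t n). Along a subsequence the normalised displacements
  converge to some W in \<open>lie\<close>, and W q = 0 because the curve itself moves q only by O(t
  n), which is of lower order. Then exp(-\<epsilon> W) fixes q, and composing with it gives an
  element with the same target and a displacement o(\<epsilon>), where \<epsilon> is the minimal
  displacement: a contradiction.\<close>

lemma least_displacement_bound:
  assumes q: "q \<in> N" and c0: "c 0 = q" and d: "(c has_vector_derivative v) (at (0::real))"
    and t: "t \<longlonglongrightarrow> 0" "\<And>n::nat. 0 < t n"
    and k: "\<And>n. k n \<in> K" "\<And>n. act (k n) q = c (t n)"
    and least: "\<And>n k'. k' \<in> K \<Longrightarrow> act k' q = c (t n) \<Longrightarrow> norm (k n - 1) \<le> norm (k' - 1)"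
  shows "\<exists>C. \<forall>n. norm (k n - 1) \<le> C * t n"
proof (rule ccontr)
  assume "\<not> ?thesis"
  then have "\<exists>n. norm (k n - 1) > real (Suc m) * t n" for m
    using not_le by blast
  then obtain j where j: "\<And>m. norm (k (j m) - 1) > real (Suc m) * t (j m)" by metis
  \<comment> \<open>Displacements in \<open>K\<close> are at most 2, so a quotient above
    \<open>Suc m\<close> is possible only at a time of order 1/m.\<close>
  have t_le: "t (j m) \<le> 2 * inverse (real (Suc m))" for m
  proof -
    have "norm (k (j m) - 1) \<le> norm (k (j m)) + norm (1 :: 'a endo)" by (rule norm_triangle_ineq4)
    also have "\<dots> \<le> 2" using norm_K_le[OF k(1)[of "j m"]] by simp
    finally have "real (Suc m) * t (j m) \<le> 2" using j[of m] by simp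
    then show ?thesis by (simp add: field_simps)
  qed
  have tj: "(\<lambda>m. t (j m)) \<longlonglongrightarrow> 0"
    by (rule tendsto_sandwich[OF _ _ tendsto_const tendsto_mult_right_zero[OF LIMSEQ_inverse_real_of_nat, of 2]])
      (use t_le t(2) in \<open>auto intro: always_eventually less_imp_le\<close>)
  obtain \<kappa> r where \<kappa>: "\<kappa> \<in> K" "strict_mono r" "((\<lambda>m. k (j m)) \<circ> r) \<longlonglongrightarrow> \<kappa>"
    using compact_K[unfolded compact_def, rule_format, of "\<lambda>m. k (j m)"] k by auto
  define a where "a m = j (r m)" for m
  have ka: "(\<lambda>m. k (a m)) \<longlonglongrightarrow> \<kappa>" using \<kappa>(3) by (simp add: o_def a_def)
  have ta: "(\<lambda>m. t (a m)) \<longlonglongrightarrow> 0"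
    using LIMSEQ_subseq_LIMSEQ[OF tj \<kappa>(2)] by (simp add: o_def a_def)
  have "isCont c 0" using d by (rule has_vector_derivative_continuous)
  from isCont_tendsto_compose[OF this ta] have ca: "(\<lambda>m. c (t (a m))) \<longlonglongrightarrow> q" by (simp add: c0)
  have "(\<lambda>m. act (k (a m)) q) \<longlonglongrightarrow> act \<kappa> q" by (intro act.tendsto ka tendsto_const)
  with ca have \<kappa>q: "act \<kappa> q = q" by (simp add: k LIMSEQ_unique)
  obtain \<kappa>' where \<kappa>': "\<kappa>' \<in> K" "\<kappa> * \<kappa>' = 1" "\<kappa>' * \<kappa> = 1" using inv_K \<kappa>(1) by blast
  have "act \<kappa>' q = act (\<kappa>' * \<kappa>) q" by (simp add: \<kappa>q)
  then have \<kappa>'q: "act \<kappa>' q = q" by (simp add: \<kappa>')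
  define \<epsilon> where "\<epsilon> m = norm (k (a m) - 1)" for m
  have \<epsilon>t: "\<epsilon> m > real (Suc m) * t (a m)" for m
  proof -
    have "real (Suc m) * t (a m) \<le> real (Suc (r m)) * t (a m)"
      using seq_suble[OF \<kappa>(2), of m] t(2)[of "a m"] by (intro mult_right_mono) auto
    then show ?thesis using j[of "r m"] by (simp add: \<epsilon>_def a_def)
  qed
  have \<epsilon>pos: "0 < \<epsilon> m" for m
    using \<epsilon>t[of m] t(2)[of "a m"] by (smt (verit) mult_nonneg_nonneg of_nat_0_le_iff)
  \<comment> \<open>The limit \<kappa> of the chosen elements fixes q, and so does its inverse.
    Multiplying by that inverse keeps the target and brings the elements close to 1; minimality
    transfers this to the chosen ones.\<close>
  have \<epsilon>0: "\<epsilon> \<longlonglongrightarrow> 0"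
  proof (rule tendsto_sandwich[OF _ _ tendsto_const])
    show "\<forall>\<^sub>F m in sequentially. 0 \<le> \<epsilon> m" by (simp add: \<epsilon>_def)
    show "\<forall>\<^sub>F m in sequentially. \<epsilon> m \<le> norm (k (a m) * \<kappa>' - 1)"
      unfolding \<epsilon>_def by (intro always_eventually allI least mult_K k \<kappa>') (simp add: k \<kappa>'q)
    have "(\<lambda>m. norm (k (a m) * \<kappa>' - 1)) \<longlonglongrightarrow> norm (\<kappa> * \<kappa>' - 1)" by (intro tendsto_intros ka)
    then show "(\<lambda>m. norm (k (a m) * \<kappa>' - 1)) \<longlonglongrightarrow> 0" by (simp add: \<kappa>')
  qed
  define Q where "Q m = (1 / \<epsilon> m) *\<^sub>R (k (a m) - 1)" for m
  have "norm (Q m) = 1" for m using \<epsilon>pos[of m] by (simp add: Q_def \<epsilon>_def)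
  then have "bounded (range Q)" by (auto simp: bounded_iff)
  then obtain W r' where r': "strict_mono r'" and QW: "(Q \<circ> r') \<longlonglongrightarrow> W"
    using bounded_imp_convergent_subsequence by blast
  have \<epsilon>r': "(\<lambda>m. \<epsilon> (r' m)) \<longlonglongrightarrow> 0" using LIMSEQ_subseq_LIMSEQ[OF \<epsilon>0 r'] by (simp add: o_def)
  have W: "W \<in> lie"
    by (rule lie_limitI[of "\<lambda>m. k (a (r' m))" "\<lambda>m. \<epsilon> (r' m)"])
      (use k \<epsilon>pos \<epsilon>r' QW in \<open>auto simp: Q_def o_def\<close>)
  have "(\<lambda>m. (1 / t (a m)) *\<^sub>R (c (t (a m)) - c 0)) \<longlonglongrightarrow> v"
    using t(2) by (intro has_vector_derivative_sequentially[OF d ta]) (metis less_irrefl)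
  moreover have "(\<lambda>m. t (a m) / \<epsilon> m) \<longlonglongrightarrow> 0"
  proof (rule tendsto_sandwich[OF _ _ tendsto_const LIMSEQ_inverse_real_of_nat])
    show "\<forall>\<^sub>F m in sequentially. 0 \<le> t (a m) / \<epsilon> m"
      using t(2) \<epsilon>pos by (intro always_eventually allI) (simp add: less_imp_le)
    show "\<forall>\<^sub>F m in sequentially. t (a m) / \<epsilon> m \<le> inverse (real (Suc m))"
      using \<epsilon>t \<epsilon>pos by (intro always_eventually allI) (simp add: field_simps less_imp_le)
  qed
  ultimately have "(\<lambda>m. (t (a m) / \<epsilon> m) *\<^sub>R ((1 / t (a m)) *\<^sub>R (c (t (a m)) - c 0))) \<longlonglongrightarrow> 0 *\<^sub>R v"
    by (intro tendsto_scaleR)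
  moreover have "(t (a m) / \<epsilon> m) *\<^sub>R ((1 / t (a m)) *\<^sub>R (c (t (a m)) - c 0)) = act (Q m) q" for m
    using t(2)[of "a m"] by (simp add: Q_def k c0)
  ultimately have "(\<lambda>m. act (Q m) q) \<longlonglongrightarrow> 0" by simp
  from LIMSEQ_subseq_LIMSEQ[OF this r'] have "(\<lambda>m. act (Q (r' m)) q) \<longlonglongrightarrow> 0" by (simp add: o_def)
  moreover have "(\<lambda>m. act (Q (r' m)) q) \<longlonglongrightarrow> act W q"
    using QW by (intro act.tendsto tendsto_const) (simp add: o_def)
  ultimately have Wq: "act W q = 0" by (simp add: LIMSEQ_unique)
  \<comment> \<open>Minimality against the competitor \<open>k (a m)\<close> composed with the
    inverse of exp(\<epsilon> W), divided by \<epsilon>. The right side tends to |W - W|.\<close>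
  have one_le: "1 \<le> norm (Q m - (1 / \<epsilon> m) *\<^sub>R (exp (\<epsilon> m *\<^sub>R W) - 1))" for m
  proof -
    have eK: "exp ((- \<epsilon> m) *\<^sub>R W) \<in> K" using W unfolding lie_def by blast
    have inv: "exp (\<epsilon> m *\<^sub>R W) * exp ((- \<epsilon> m) *\<^sub>R W) = 1"
      using exp_minus_inverse[of "\<epsilon> m *\<^sub>R W"] by simp
    have "act (k (a m) * exp ((- \<epsilon> m) *\<^sub>R W)) q = c (t (a m))"
      by (simp only: act_simps exp_fixes[OF Wq] k)
    then have "\<epsilon> m \<le> norm (k (a m) * exp ((- \<epsilon> m) *\<^sub>R W) - 1)"
      using least[OF mult_K[OF k(1) eK]] by (simp add: \<epsilon>_def)
    also have "k (a m) * exp ((- \<epsilon> m) *\<^sub>R W) - 1 = (k (a m) - exp (\<epsilon> m *\<^sub>R W)) * exp ((- \<epsilon> m) *\<^sub>R W)"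
      by (simp only: left_diff_distrib inv)
    also have "norm \<dots> \<le> norm (k (a m) - exp (\<epsilon> m *\<^sub>R W)) * norm (exp ((- \<epsilon> m) *\<^sub>R W))"
      by (rule norm_mult_ineq)
    also have "\<dots> \<le> norm (k (a m) - exp (\<epsilon> m *\<^sub>R W)) * 1"
      by (intro mult_left_mono norm_K_le eK) simp
    also have "k (a m) - exp (\<epsilon> m *\<^sub>R W) = \<epsilon> m *\<^sub>R (Q m - (1 / \<epsilon> m) *\<^sub>R (exp (\<epsilon> m *\<^sub>R W) - 1))"
      using \<epsilon>pos[of m] by (simp add: Q_def scaleR_diff_right)
    finally show ?thesis using \<epsilon>pos[of m] by simp
  qed
  have "filterlim (\<lambda>m. \<epsilon> (r' m)) (at 0) sequentially"
    using \<epsilon>r' \<epsilon>pos by (auto simp: filterlim_at less_imp_neq[symmetric])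
  from filterlim_compose[OF exp_difference_quotient[of W] this] QW
  have "(\<lambda>m. norm (Q (r' m) - (1 / \<epsilon> (r' m)) *\<^sub>R (exp (\<epsilon> (r' m) *\<^sub>R W) - 1))) \<longlonglongrightarrow> norm (W - W)"
    by (intro tendsto_norm tendsto_diff) (simp_all add: o_def)
  then have "1 \<le> norm (W - W)"
    using one_le by (intro LIMSEQ_le_const) auto
  then show False by simp
qed

text \<open>Elements of \<open>lie\<close> give exponential curves in the orbit. Conversely a curve
  in the orbit is lifted to the group, at a sequence of times only, by least displacements; their
  quotients are bounded, and any limit is an element of \<open>lie\<close> that maps q to the
  velocity.\<close>

theorem tangent_space_eq:
  assumes q: "q \<in> N"
  shows "tangent_space N q = (\<lambda>W. act W q) ` lie"
proof (intro equalityI subsetI)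
  fix v assume "v \<in> (\<lambda>W. act W q) ` lie"
  then obtain W where W: "W \<in> lie" "v = act W q" by blast
  let ?c = "\<lambda>t. act (exp (t *\<^sub>R W)) q"
  have "smooth_on {-1<..<1} ?c"
    by (simp add: smooth_on_def higher_differentiable_on_act_exp)
  moreover have "?c ` {-1<..<1} \<subseteq> N" using W q by (auto simp: lie_def intro!: act_N)
  moreover have "(?c has_vector_derivative v) (at 0)"
    using act_exp_has_vector_derivative[of W q 0] by (simp add: W)
  ultimately show "v \<in> tangent_space N q"
    unfolding tangent_space_def by (intro CollectI exI[of _ ?c] exI[of _ 1]) auto
next
  fix v assume "v \<in> tangent_space N q"
  then obtain c \<epsilon> where c: "0 < \<epsilon>" "c ` {-\<epsilon><..<\<epsilon>} \<subseteq> N" "c (0::real) = q" "(c has_vector_derivative v) (at 0)"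
    unfolding tangent_space_def by auto
  \<comment> \<open>The double \<open>Suc\<close> keeps every \<open>t n\<close> strictly below
    \<epsilon>, inside the interval where the curve is known to stay in \<open>N\<close>.\<close>
  define t where "t n = \<epsilon> * inverse (real (Suc (Suc n)))" for n
  have t: "0 < t n" "t n \<in> {-\<epsilon><..<\<epsilon>}" for n
  proof -
    show "0 < t n" using c(1) by (simp add: t_def)
    have "\<epsilon> * inverse (real (Suc (Suc n))) < \<epsilon> * 1"
      using c(1) by (intro mult_strict_left_mono) (simp_all add: field_simps)
    then have "t n < \<epsilon>" by (simp add: t_def)
    then show "t n \<in> {-\<epsilon><..<\<epsilon>}" using \<open>0 < t n\<close> c(1) by simp
  qed
  have t0: "t \<longlonglongrightarrow> 0"
    unfolding t_def using tendsto_mult_right_zero[OF LIMSEQ_Suc[OF LIMSEQ_inverse_real_of_nat]] by simp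
  have cN: "c (t n) \<in> N" for n using c(2) t(2) by blast
  have "\<exists>k. k \<in> K \<and> act k q = c (t n) \<and> (\<forall>k'\<in>K. act k' q = c (t n) \<longrightarrow> norm (k - 1) \<le> norm (k' - 1))" for n
    by (rule exists_least_displacement[OF q cN[of n]]) blast
  then obtain k where k: "\<And>n. k n \<in> K" "\<And>n. act (k n) q = c (t n)"
      "\<And>n k'. k' \<in> K \<Longrightarrow> act k' q = c (t n) \<Longrightarrow> norm (k n - 1) \<le> norm (k' - 1)"
    by metis
  obtain C where C: "\<And>n. norm (k n - 1) \<le> C * t n"
    using least_displacement_bound[OF q c(3,4) t0 t(1) k] by auto
  define Q where "Q n = (1 / t n) *\<^sub>R (k n - 1)" for n
  have "norm (Q n) = norm (k n - 1) / t n" for n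
    using t(1)[of n] by (simp add: Q_def del: scaleR_diff_right)
  then have "norm (Q n) \<le> C" for n using C[of n] t(1)[of n] by (simp add: divide_le_eq)
  then have "bounded (range Q)" by (auto simp: bounded_iff)
  then obtain W r where r: "strict_mono r" and QW: "(Q \<circ> r) \<longlonglongrightarrow> W"
    using bounded_imp_convergent_subsequence by blast
  have tr: "(\<lambda>n. t (r n)) \<longlonglongrightarrow> 0" using LIMSEQ_subseq_LIMSEQ[OF t0 r] by (simp add: o_def)
  have W: "W \<in> lie"
    by (rule lie_limitI[of "\<lambda>m. k (r m)" "\<lambda>m. t (r m)"])
      (use k t tr QW in \<open>auto simp: Q_def o_def\<close>)
  have "(\<lambda>n. act (Q (r n)) q) \<longlonglongrightarrow> act W q"
    using QW by (intro act.tendsto tendsto_const) (simp add: o_def)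
  moreover have "(\<lambda>n. (1 / t (r n)) *\<^sub>R (c (t (r n)) - c 0)) \<longlonglongrightarrow> v"
    using t(1) by (intro has_vector_derivative_sequentially[OF c(4) tr]) (metis less_irrefl)
  moreover have "(1 / t (r n)) *\<^sub>R (c (t (r n)) - c 0) = act (Q (r n)) q" for n
    by (simp add: Q_def k c)
  ultimately have "v = act W q" by (simp add: LIMSEQ_unique)
  then show "v \<in> (\<lambda>W. act W q) ` lie" using W by blast
qed

lemma tangent_projI:
  assumes q: "q \<in> N" and W: "W \<in> lie" and orth: "\<And>V. V \<in> lie \<Longrightarrow> (\<phi> - act W q) \<bullet> act V q = 0"
  shows "tangent_proj N q \<phi> = act W q"
  unfolding tangent_proj_def tangent_space_eq[OF q]
proof (rule the_equality)
  show "act W q \<in> (\<lambda>W. act W q) ` lie \<and> (\<forall>z\<in>(\<lambda>W. act W q) ` lie. orthogonal (\<phi> - act W q) z)"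
    using W orth by (auto simp: orthogonal_def)
next
  fix w assume w: "w \<in> (\<lambda>W. act W q) ` lie \<and> (\<forall>z\<in>(\<lambda>W. act W q) ` lie. orthogonal (\<phi> - w) z)"
  then obtain V where V: "V \<in> lie" "w = act V q" by blast
  have VW: "V + (-1) *\<^sub>R W \<in> lie" using V W by (intro lie_add lie_scaleR)
  have "(\<phi> - act W q) \<bullet> act (V + (-1) *\<^sub>R W) q = 0" by (rule orth[OF VW])
  moreover have "(\<phi> - w) \<bullet> act (V + (-1) *\<^sub>R W) q = 0" using w VW by (auto simp: orthogonal_def)
  ultimately have "(w - act W q) \<bullet> (w - act W q) = 0" by (simp add: V inner_diff_left algebra_simps)
  then show "w = act W q" by simp
qed

end

section \<open>A Lipschitz formula for the projection onto the tangent space\<close>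

lemma inner_matrix_eq_trace: "(A :: real^'n^'n) \<bullet> B = trace (transpose A ** B)"
proof -
  have "A \<bullet> B = (\<Sum>i\<in>UNIV. \<Sum>j\<in>UNIV. A $ i $ j * B $ i $ j)"
    by (simp add: inner_vec_def)
  also have "\<dots> = (\<Sum>j\<in>UNIV. \<Sum>i\<in>UNIV. A $ i $ j * B $ i $ j)" by (rule sum.swap)
  finally show ?thesis by (simp add: trace_def matrix_matrix_mult_def transpose_def)
qed

text \<open>In the Frobenius product the adjoint of conjugation is conjugation with the transpose.
  For orthogonal Q it follows that projections onto conjugation-invariant subspaces commute with
  conjugation.\<close>

lemma inner_matrix_conj:
  "(A :: real^'n^'n) \<bullet> (Q ** B ** transpose Q) = (transpose Q ** A ** Q) \<bullet> B"
proof -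
  have "A \<bullet> (Q ** B ** transpose Q) = trace ((transpose A ** Q ** B) ** transpose Q)"
    by (simp add: inner_matrix_eq_trace matrix_mul_assoc)
  also have "\<dots> = trace (transpose Q ** (transpose A ** Q ** B))" by (rule trace_mul_sym)
  also have "\<dots> = trace (transpose (transpose Q ** A ** Q) ** B)"
    by (simp add: matrix_transpose_mul matrix_mul_assoc)
  finally show ?thesis by (simp add: inner_matrix_eq_trace)
qed

definition outer_matrix :: "real^'n \<Rightarrow> real^'n \<Rightarrow> real^'n^'n" where
  "outer_matrix x y = (\<chi> i j. x $ i * y $ j)"

lemma inner_outer_matrix: "A \<bullet> outer_matrix x y = (A *v y) \<bullet> x"
  by (simp add: inner_vec_def outer_matrix_def matrix_vector_mult_def sum_distrib_left sum_distrib_right mult_ac)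

text \<open>Matrices carry the Frobenius inner product, whereas \<open>endo\<close> has only the
  operator norm; orthonormal bases and dimension counts therefore take place on the matrix
  side.\<close>

definition mat_of :: "(real^'n) endo \<Rightarrow> real^'n^'n" where "mat_of W = matrix (act W)"

lemma mat_of_vector [simp]: "mat_of W *v x = act W x"
  by (simp add: mat_of_def matrix_works linear_act)

lemma mat_of_eqI: "(\<And>x. A *v x = act W x) \<Longrightarrow> mat_of W = A"
  by (simp add: matrix_eq)

lemma mat_of_linear: "linear mat_of"
  by (rule linearI; rule mat_of_eqI) (simp_all add: matrix_vector_mult_add_rdistrib scaleR_matrix_vector_assoc[symmetric])

lemma mat_of_mult: "mat_of (V * W) = mat_of V ** mat_of W"
  by (rule mat_of_eqI) (simp add: matrix_vector_mul_assoc[symmetric])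

lemma mat_of_inject: "mat_of V = mat_of W \<longleftrightarrow> V = W"
  by (metis endo_eqI mat_of_vector)

lemma (in orthogonal_group) inner_act_K:
  assumes "k \<in> K" shows "act k x \<bullet> act k y = x \<bullet> y"
proof -
  have "orthogonal_transformation (act k)"
    using assms by (simp add: orthogonal_transformation linear_act norm_act_K)
  then show ?thesis by (simp add: orthogonal_transformation_def)
qed

lemma decreasing_nat_stationary: 
  assumes "\<And>m. f (Suc m) \<le> (f m :: nat)" obtains m where "f (Suc m) = f m"
proof -
  have False if "\<And>m. f (Suc m) \<noteq> f m"
  proof -
    have "f m + m \<le> f 0" for m
    proof (induction m)
      case (Suc m)
      then show ?case using assms[of m] that[of m] by simp
    qed simp
    from this[of "Suc (f 0)"] show False by simp
  qed
  then show thesis using that by blast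
qed

text \<open>\<open>B\<close> is an orthonormal basis of the Lie algebra in the Frobenius product.
  Orthonormality makes \<open>M\<close> below independent of the basis, and so compatible with
  conjugation.\<close>

locale homogeneous_orbit_matrix = homogeneous_orbit K N
  for K :: "(real^'n) endo set" and N +
  fixes q0 B
  assumes q0: "q0 \<in> N"
    and B: "B \<subseteq> mat_of ` lie" "finite B" "pairwise orthogonal B" "\<And>A. A \<in> B \<Longrightarrow> norm A = 1"
      "span B = mat_of ` lie"
begin

text \<open>The frame operator of the vectors A q. Its range is the tangent space at q, and any map
  acting as a pseudoinverse of it yields the orthogonal projection with coefficients in the
  frame.\<close>

definition M :: "real^'n \<Rightarrow> (real^'n) endo" where
  "M q = endo_of (\<lambda>\<phi>. \<Sum>A\<in>B. ((A *v q) \<bullet> \<phi>) *\<^sub>R (A *v q))"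

lemma act_M: "act (M q) \<phi> = (\<Sum>A\<in>B. ((A *v q) \<bullet> \<phi>) *\<^sub>R (A *v q))"
  unfolding M_def
  by (rule act_endo_of, rule linearI)
    (simp_all add: inner_add_right scaleR_add_left sum.distrib scaleR_sum_right)

lemma M_symmetric: "act (M q) x \<bullet> y = x \<bullet> act (M q) y"
  by (simp add: act_M inner_sum_left inner_sum_right) (simp add: inner_commute mult_ac)

text \<open>The pairing of M \<psi> with \<psi> is the sum of the squared frame coefficients of
  \<psi>, so the kernel of M is orthogonal to all A q and to their span.\<close>

lemma lie_annihilated:
  assumes "act (M q) \<psi> = 0" "V \<in> lie" shows "act V q \<bullet> \<psi> = 0"
proof -
  have "(\<Sum>A\<in>B. ((A *v q) \<bullet> \<psi>)\<^sup>2) = act (M q) \<psi> \<bullet> \<psi>"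
    by (simp add: act_M inner_sum_left power2_eq_square)
  then have "(A *v q) \<bullet> \<psi> = 0" if "A \<in> B" for A
    using that B(2) assms(1) by (simp add: sum_nonneg_eq_0_iff)
  note base = this
  have "mat_of V \<in> span B" using assms(2) B(5) by blast
  then have "(mat_of V *v q) \<bullet> \<psi> = 0"
  proof (induction rule: span_induct_alt)
    case (step c A' A)
    then show ?case
      using base by (simp add: matrix_vector_mult_add_rdistrib scaleR_matrix_vector_assoc[symmetric] inner_add_left)
  qed simp
  then show ?thesis by simp
qed

definition proj_lie :: "real^'n^'n \<Rightarrow> real^'n^'n" where "proj_lie X = (\<Sum>A\<in>B. (A \<bullet> X) *\<^sub>R A)"

lemma proj_lie_in: "proj_lie X \<in> mat_of ` lie"
  unfolding proj_lie_def B(5)[symmetric] by (intro span_sum span_scale span_base)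

lemma inner_proj_lie:
  assumes "A \<in> mat_of ` lie" shows "A \<bullet> proj_lie X = A \<bullet> X"
proof -
  have "A \<in> span B" using assms B(5) by simp
  then show ?thesis
  proof (induction rule: span_induct_alt)
    case (step c A' A)
    have "A' \<bullet> proj_lie X = (\<Sum>C\<in>B. (C \<bullet> X) * (A' \<bullet> C))" by (simp add: proj_lie_def inner_sum_right)
    also have "\<dots> = (\<Sum>C\<in>B. if C = A' then C \<bullet> X else 0)"
      using B(3,4) step by (intro sum.cong) (auto simp: pairwise_def orthogonal_def dot_square_norm)
    finally show ?case using step B(2) by (simp add: inner_add_left)
  qed simp
qed

lemma proj_lie_unique:
  assumes "P \<in> mat_of ` lie" "\<And>A. A \<in> mat_of ` lie \<Longrightarrow> A \<bullet> P = A \<bullet> X" shows "P = proj_lie X"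
proof -
  let ?D = "P - proj_lie X"
  have "?D \<in> mat_of ` lie" using assms(1) proj_lie_in[of X] unfolding B(5)[symmetric] by (rule span_diff)
  then have "?D \<bullet> ?D = 0" using assms(2) inner_proj_lie by (simp add: inner_diff_right)
  then show ?thesis by simp
qed

text \<open>A description of \<open>M q\<close> that does not mention the basis: project the
  rank-one matrix of \<phi> and q onto the Lie algebra and apply the result to q.\<close>

lemma act_M_proj: "act (M q) \<phi> = proj_lie (outer_matrix \<phi> q) *v q"
proof -
  have "proj_lie X *v q = (\<Sum>A\<in>B. (A \<bullet> X) *\<^sub>R (A *v q))" for X
    using B(2) unfolding proj_lie_def
    by (induction B rule: finite_induct)
      (simp_all add: matrix_vector_mult_add_rdistrib scaleR_matrix_vector_assoc)
  then show ?thesis by (simp add: act_M inner_outer_matrix)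
qed

text \<open>Conjugation by k preserves both the Frobenius product and the Lie algebra, so it
  commutes with \<open>proj_lie\<close>; the basis-free form of \<open>M\<close> transfers
  this.\<close>

lemma M_equivariant:
  assumes k: "k \<in> K" "k' \<in> K" "k * k' = 1" "k' * k = 1"
  shows "M (act k q) = k * M q * k'"
proof (rule endo_eqI)
  fix \<phi>
  let ?Q = "mat_of k" and ?Q' = "mat_of k'"
  have kk: "act k' (act k x) = x" "act k (act k' x) = x" for x
    using k(3,4) by (metis act_simps(2,6))+
  have tr: "transpose ?Q = ?Q'"
  proof -
    have "act k x \<bullet> y = x \<bullet> act k' y" for x y
      using inner_act_K[OF k(1), of x "act k' y"] by (simp add: kk)
    then have "adjoint (act k) = act k'" by (intro adjoint_unique) auto
    then show ?thesis using matrix_adjoint[OF linear_act, of k] by (simp add: mat_of_def)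
  qed
  let ?X = "outer_matrix (act k' \<phi>) q"
  have "?Q ** proj_lie ?X ** ?Q' = proj_lie (outer_matrix \<phi> (act k q))"
  proof (rule proj_lie_unique)
    obtain W where W: "W \<in> lie" "proj_lie ?X = mat_of W" using proj_lie_in by blast
    then show "?Q ** proj_lie ?X ** ?Q' \<in> mat_of ` lie"
      using lie_conj[OF W(1) k(1-3)] by (simp add: mat_of_mult[symmetric])
    fix A assume "A \<in> mat_of ` lie"
    then obtain V where V: "V \<in> lie" "A = mat_of V" by blast
    have C: "?Q' ** A ** ?Q \<in> mat_of ` lie"
      using lie_conj[OF V(1) k(2,1,4)] V(2) by (simp add: mat_of_mult[symmetric])
    have "A \<bullet> (?Q ** proj_lie ?X ** ?Q') = (?Q' ** A ** ?Q) \<bullet> proj_lie ?X"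
      unfolding tr[symmetric] by (rule inner_matrix_conj)
    also have "\<dots> = (?Q' ** A ** ?Q) \<bullet> ?X" by (rule inner_proj_lie[OF C])
    also have "\<dots> = act k' (act V (act k q)) \<bullet> act k' \<phi>"
      by (simp add: inner_outer_matrix V matrix_vector_mul_assoc[symmetric])
    also have "\<dots> = A \<bullet> outer_matrix \<phi> (act k q)"
      by (simp add: inner_act_K[OF k(2)] inner_outer_matrix V)
    finally show "A \<bullet> (?Q ** proj_lie ?X ** ?Q') = A \<bullet> outer_matrix \<phi> (act k q)" .
  qed
  then have "act (M (act k q)) \<phi> = (?Q ** proj_lie ?X ** ?Q') *v act k q" by (simp add: act_M_proj)
  also have "\<dots> = act k (act (M q) (act k' \<phi>))"
    by (simp add: matrix_vector_mul_assoc[symmetric] kk act_M_proj)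
  finally show "act (M (act k q)) \<phi> = act (k * M q * k') \<phi>" by simp
qed

text \<open>The elements of the algebra generated by \<open>M q0\<close> extend to Lipschitz maps on the orbit by
  conjugation; this is how the pseudoinverse of \<open>M\<close> becomes a Lipschitz function of the point.\<close>

definition extendable :: "(real^'n) endo set" where
  "extendable = {Y. \<exists>F. (\<exists>C. C-lipschitz_on N F) \<and>
     (\<forall>k\<in>K. \<forall>k'\<in>K. k * k' = 1 \<longrightarrow> k' * k = 1 \<longrightarrow> F (act k q0) = k * Y * k')}"

lemma norm_N: assumes "q \<in> N" shows "norm q = norm q0"
  using transitive[OF q0 assms] norm_act_K by auto

lemma orbit_cases:
  assumes "q \<in> N"
  obtains k k' where "k \<in> K" "k' \<in> K" "k * k' = 1" "k' * k = 1" "q = act k q0"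
  using transitive[OF q0 assms] inv_K by metis

lemma one_extendable: "1 \<in> extendable"
  unfolding extendable_def by (auto intro!: exI[of _ "\<lambda>_. 1"] exI[of _ 0] simp: lipschitz_on_def)

lemma norm_conj_le: assumes "k \<in> K" "k' \<in> K" shows "norm (k * Y * k') \<le> norm Y"
proof -
  have "norm (k * Y * k') \<le> norm k * norm Y * norm k'"
    by (rule order_trans[OF norm_mult_ineq mult_right_mono[OF norm_mult_ineq norm_ge_zero]])
  also have "\<dots> \<le> 1 * norm Y * 1" by (intro mult_mono norm_K_le assms) auto
  finally show ?thesis by simp
qed

lemma scaleR_extendable: "Y \<in> extendable \<Longrightarrow> c *\<^sub>R Y \<in> extendable"
proof -
  assume "Y \<in> extendable"
  then obtain F C where "C-lipschitz_on N F"
    "\<forall>k\<in>K. \<forall>k'\<in>K. k * k' = 1 \<longrightarrow> k' * k = 1 \<longrightarrow> F (act k q0) = k * Y * k'"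
    by (auto simp: extendable_def)
  then show ?thesis
    unfolding extendable_def
    by (intro CollectI exI[of _ "\<lambda>q. c *\<^sub>R F q"] conjI exI[of _ "\<bar>c\<bar> * C"] lipschitz_on_cmult) auto
qed

lemma add_extendable: "Y \<in> extendable \<Longrightarrow> Z \<in> extendable \<Longrightarrow> Y + Z \<in> extendable"
proof -
  assume "Y \<in> extendable" "Z \<in> extendable"
  then obtain F C G D where "C-lipschitz_on N F" "D-lipschitz_on N G"
    "\<forall>k\<in>K. \<forall>k'\<in>K. k * k' = 1 \<longrightarrow> k' * k = 1 \<longrightarrow> F (act k q0) = k * Y * k'"
    "\<forall>k\<in>K. \<forall>k'\<in>K. k * k' = 1 \<longrightarrow> k' * k = 1 \<longrightarrow> G (act k q0) = k * Z * k'"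
    unfolding extendable_def by blast
  then show ?thesis
    unfolding extendable_def
    by (intro CollectI exI[of _ "\<lambda>q. F q + G q"] conjI exI[of _ "C + D"] lipschitz_on_add)
      (auto simp: distrib_left distrib_right)
qed

text \<open>The inner factors k' k cancel, so the conjugates multiply to the conjugate of the
  product. The product of the two maps is Lipschitz because conjugation by \<open>K\<close> does not
  increase norms and both maps are thus bounded on the orbit.\<close>

lemma mult_extendable: "Y \<in> extendable \<Longrightarrow> Z \<in> extendable \<Longrightarrow> Y * Z \<in> extendable"
proof -
  assume "Y \<in> extendable" "Z \<in> extendable"
  then obtain F C G D where L: "C-lipschitz_on N F" "D-lipschitz_on N G"
    and F: "\<And>k k'. k \<in> K \<Longrightarrow> k' \<in> K \<Longrightarrow> k * k' = 1 \<Longrightarrow> k' * k = 1 \<Longrightarrow> F (act k q0) = k * Y * k'"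
    and G: "\<And>k k'. k \<in> K \<Longrightarrow> k' \<in> K \<Longrightarrow> k * k' = 1 \<Longrightarrow> k' * k = 1 \<Longrightarrow> G (act k q0) = k * Z * k'"
    unfolding extendable_def by blast
  have bF: "norm (F q) \<le> norm Y" if "q \<in> N" for q
    by (rule orbit_cases[OF that]) (simp add: F norm_conj_le)
  have bG: "norm (G q) \<le> norm Z" if "q \<in> N" for q
    by (rule orbit_cases[OF that]) (simp add: G norm_conj_le)
  have "(norm Y * D + C * norm Z)-lipschitz_on N (\<lambda>q. F q * G q)"
  proof (rule lipschitz_onI)
    fix q q' assume q: "q \<in> N" "q' \<in> N"
    have "F q * G q - F q' * G q' = F q * (G q - G q') + (F q - F q') * G q'" by (simp add: algebra_simps)
    then have "norm (F q * G q - F q' * G q') \<le> norm (F q) * norm (G q - G q') + norm (F q - F q') * norm (G q')"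
      by (simp only:) (rule order_trans[OF norm_triangle_ineq add_mono[OF norm_mult_ineq norm_mult_ineq]])
    also have "\<dots> \<le> norm Y * (D * dist q q') + (C * dist q q') * norm Z"
      using bF[OF q(1)] bG[OF q(2)] lipschitz_onD[OF L(1) q] lipschitz_onD[OF L(2) q]
        lipschitz_on_nonneg[OF L(1)]
      by (intro add_mono mult_mono) (simp_all add: dist_norm)
    finally show "dist (F q * G q) (F q' * G q') \<le> (norm Y * D + C * norm Z) * dist q q'"
      by (simp add: dist_norm algebra_simps)
  next
    show "0 \<le> norm Y * D + C * norm Z"
      using L[THEN lipschitz_on_nonneg] by simp
  qed
  moreover have "F (act k q0) * G (act k q0) = k * (Y * Z) * k'"
    if "k \<in> K" "k' \<in> K" "k * k' = 1" "k' * k = 1" for k k'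
  proof -
    have "F (act k q0) * G (act k q0) = k * Y * (k' * k) * Z * k'" by (simp add: F[OF that] G[OF that] mult.assoc)
    then show ?thesis by (simp add: that mult.assoc)
  qed
  ultimately show ?thesis
    unfolding extendable_def by (intro CollectI exI[of _ "\<lambda>q. F q * G q"]) blast
qed

lemma power_extendable: "Y \<in> extendable \<Longrightarrow> Y ^ m \<in> extendable"
  by (induction m) (simp_all add: one_extendable mult_extendable)

lemma zero_extendable: "0 \<in> extendable"
  using scaleR_extendable[OF one_extendable, of 0] by simp

lemma matrix_vector_bound: obtains c where "0 \<le> c" "\<And>A x. A \<in> B \<Longrightarrow> norm (A *v x) \<le> c * norm x"
proof
  show "0 \<le> (\<Sum>A\<in>B. onorm ((*v) A))" by (intro sum_nonneg onorm_pos_le) simp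
  fix A x assume "A \<in> B"
  then have "onorm ((*v) A) \<le> (\<Sum>A\<in>B. onorm ((*v) A))"
    using B(2) by (intro member_le_sum) (auto intro!: onorm_pos_le)
  then show "norm (A *v x) \<le> (\<Sum>A\<in>B. onorm ((*v) A)) * norm x"
    using onorm[of "(*v) A" x] by (meson matrix_vector_mul_bounded_linear mult_right_mono norm_ge_zero order_trans)
qed

lemma M_lipschitz: "\<exists>C. C-lipschitz_on N M"
proof -
  obtain c where c: "0 \<le> c" "\<And>A x. A \<in> B \<Longrightarrow> norm (A *v x) \<le> c * norm x"
    by (rule matrix_vector_bound) blast
  define L where "L = real (card B) * (2 * c * c * norm q0)"
  have "L-lipschitz_on N M"
  proof (rule lipschitz_onI)
    fix q q' assume q: "q \<in> N" "q' \<in> N"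
    have "norm (M q - M q') \<le> L * dist q q'"
    proof (rule norm_endo_le)
      show "0 \<le> L * dist q q'" using c(1) by (simp add: L_def)
      fix \<phi>
      have "act (M q - M q') \<phi> = (\<Sum>A\<in>B. ((A *v q) \<bullet> \<phi>) *\<^sub>R (A *v q) - ((A *v q') \<bullet> \<phi>) *\<^sub>R (A *v q'))"
        by (simp add: act_M sum_subtractf)
      also have "norm \<dots> \<le> real (card B) * (2 * c * c * norm q0 * dist q q' * norm \<phi>)"
      proof (rule sum_norm_bound)
        fix A assume A: "A \<in> B"
        have d: "norm (A *v q - A *v q') \<le> c * dist q q'"
          using c(2)[OF A, of "q - q'"] by (simp add: matrix_vector_mult_diff_distrib dist_norm)
        have b: "norm (A *v q) \<le> c * norm q0" "norm (A *v q') \<le> c * norm q0"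
          using c(2)[OF A, of q] c(2)[OF A, of q'] norm_N q by auto
        have "((A *v q) \<bullet> \<phi>) *\<^sub>R (A *v q) - ((A *v q') \<bullet> \<phi>) *\<^sub>R (A *v q') =
            ((A *v q) \<bullet> \<phi>) *\<^sub>R (A *v q - A *v q') + ((A *v q - A *v q') \<bullet> \<phi>) *\<^sub>R (A *v q')"
          by (simp add: algebra_simps inner_diff_left)
        also have "norm \<dots> \<le> \<bar>(A *v q) \<bullet> \<phi>\<bar> * norm (A *v q - A *v q') + \<bar>(A *v q - A *v q') \<bullet> \<phi>\<bar> * norm (A *v q')"
          by (rule norm_triangle_le) simp
        also have "\<dots> \<le> (norm (A *v q) * norm \<phi>) * norm (A *v q - A *v q') + (norm (A *v q - A *v q') * norm \<phi>) * norm (A *v q')"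
          by (intro add_mono mult_right_mono Cauchy_Schwarz_ineq2) auto
        also have "\<dots> \<le> ((c * norm q0) * norm \<phi>) * (c * dist q q') + ((c * dist q q') * norm \<phi>) * (c * norm q0)"
          using b d c(1) by (intro add_mono mult_mono) auto
        finally show "norm (((A *v q) \<bullet> \<phi>) *\<^sub>R (A *v q) - ((A *v q') \<bullet> \<phi>) *\<^sub>R (A *v q'))
            \<le> 2 * c * c * norm q0 * dist q q' * norm \<phi>" by (simp add: mult_ac)
      qed
      finally show "norm (act (M q - M q') \<phi>) \<le> L * dist q q' * norm \<phi>" by (simp add: L_def mult_ac)
    qed
    then show "dist (M q) (M q') \<le> L * dist q q'" by (simp add: dist_norm)
  next
    show "0 \<le> L" using c(1) by (simp add: L_def)
  qed
  then show ?thesis by blast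
qed

lemma M_extendable: "M q0 \<in> extendable"
  unfolding extendable_def using M_lipschitz M_equivariant by (intro CollectI exI[of _ M]) blast

text \<open>For a symmetric map the kernel of the square equals the kernel of the map, since |M w|^2
  is the inner product of M M w with w.\<close>

lemma power_M_cancel: "M q0 ^ m * Z = 0 \<Longrightarrow> M q0 * Z = 0"
proof (induction m)
  case (Suc m)
  show ?case
  proof (cases m)
    case (Suc i)
    have "act (M q0 ^ m * Z) x = 0" for x
    proof -
      let ?w = "act (M q0 ^ i * Z) x"
      have "act (M q0) (act (M q0) ?w) = 0"
        using arg_cong[OF Suc.prems, of "\<lambda>a. act a x"] by (simp add: Suc act.zero_left)
      then have "act (M q0) ?w \<bullet> act (M q0) ?w = 0" by (simp add: M_symmetric)
      then show ?thesis by (simp add: Suc)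
    qed
    then show ?thesis using Suc.IH by (metis act_simps(1) endo_eqI)
  qed (use Suc.prems in simp)
qed simp

text \<open>The spans of the powers of M from the m-th on decrease, so two consecutive ones agree.
  Then M^m = M^(m+1) Y with Y extendable, and symmetry allows all but one factor M to be cancelled
  on the left. In this way the pseudoinverse is found inside a set that is closed under the algebra
  operations, with no spectral decomposition.\<close>

lemma pseudoinverse: "\<exists>Y\<in>extendable. M q0 * (M q0 * Y) = M q0"
proof -
  define S where "S m = span (mat_of ` {M q0 ^ j | j. m \<le> j})" for m
  have mono: "S (Suc m) \<subseteq> S m" for m
    unfolding S_def by (intro span_mono image_mono) (auto intro: Suc_leD)
  have "dim (S (Suc m)) \<le> dim (S m)" for m by (intro dim_subset mono)
  then obtain m where "dim (S (Suc m)) = dim (S m)" by (rule decreasing_nat_stationary)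
  then have "S (Suc m) = S m"
    using subspace_dim_equal[OF _ _ mono] by (simp add: S_def)
  moreover have "mat_of (M q0 ^ m) \<in> S m" unfolding S_def by (intro span_base) auto
  moreover have "S (Suc m) \<subseteq> mat_of ` {M q0 ^ Suc m * Y | Y. Y \<in> extendable}" (is "_ \<subseteq> ?R")
    unfolding S_def
  proof (rule span_minimal)
    show "mat_of ` {M q0 ^ j | j. Suc m \<le> j} \<subseteq> ?R"
    proof (intro image_mono subsetI)
      fix x assume "x \<in> {M q0 ^ j | j. Suc m \<le> j}"
      then obtain j where j: "x = M q0 ^ j" "Suc m \<le> j" by blast
      then have "x = M q0 ^ Suc m * M q0 ^ (j - Suc m)" by (metis le_add_diff_inverse power_add)
      then show "x \<in> {M q0 ^ Suc m * Y | Y. Y \<in> extendable}" using power_extendable[OF M_extendable] by blast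
    qed
    have "subspace {M q0 ^ Suc m * Y | Y. Y \<in> extendable}"
    proof (rule subspaceI)
      show "0 \<in> {M q0 ^ Suc m * Y | Y. Y \<in> extendable}"
        using zero_extendable by (intro CollectI exI[of _ 0]) simp
    next
      fix x y assume "x \<in> {M q0 ^ Suc m * Y | Y. Y \<in> extendable}" "y \<in> {M q0 ^ Suc m * Y | Y. Y \<in> extendable}"
      then show "x + y \<in> {M q0 ^ Suc m * Y | Y. Y \<in> extendable}"
        using add_extendable by (auto simp flip: distrib_left)
    next
      fix c x assume "x \<in> {M q0 ^ Suc m * Y | Y. Y \<in> extendable}"
      then show "c *\<^sub>R x \<in> {M q0 ^ Suc m * Y | Y. Y \<in> extendable}"
        using scaleR_extendable by (auto simp flip: mult_scaleR_right)
    qed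
    then show "subspace ?R" by (rule linear_subspace_image[OF mat_of_linear])
  qed
  ultimately obtain Y where Y: "Y \<in> extendable" "mat_of (M q0 ^ m) = mat_of (M q0 ^ Suc m * Y)" by blast
  then have "M q0 ^ m * (1 - M q0 * Y) = 0"
    by (simp add: mat_of_inject right_diff_distrib power_Suc2 mult.assoc del: power_Suc)
  then have "M q0 * (1 - M q0 * Y) = 0" by (rule power_M_cancel)
  then have "M q0 * (M q0 * Y) = M q0" by (simp add: right_diff_distrib)
  then show ?thesis using Y(1) by blast
qed

text \<open>The candidate for the projection is M F \<phi>, which is tangent by construction.
  Conjugating M M Y = M shows that M annihilates \<phi> - M F \<phi>, hence this remainder is
  orthogonal to the tangent space.\<close>

lemma tangent_proj_representation_aux:
  obtains F C b where "C-lipschitz_on N F" "0 \<le> b" "\<And>q. q \<in> N \<Longrightarrow> norm (F q) \<le> b"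
    "\<And>q \<phi>. q \<in> N \<Longrightarrow> tangent_proj N q \<phi> = (\<Sum>A\<in>B. ((A *v q) \<bullet> act (F q) \<phi>) *\<^sub>R (A *v q))"
proof -
  obtain Y where Y: "Y \<in> extendable" "M q0 * (M q0 * Y) = M q0" using pseudoinverse by blast
  obtain F C where L: "C-lipschitz_on N F"
    and F: "\<And>k k'. k \<in> K \<Longrightarrow> k' \<in> K \<Longrightarrow> k * k' = 1 \<Longrightarrow> k' * k = 1 \<Longrightarrow> F (act k q0) = k * Y * k'"
    using Y(1) unfolding extendable_def by blast
  have bF: "norm (F q) \<le> norm Y" if "q \<in> N" for q
    by (rule orbit_cases[OF that]) (simp add: F norm_conj_le)
  have MMF: "M q * (M q * F q) = M q" if q: "q \<in> N" for q
  proof (rule orbit_cases[OF q])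
    fix k k' assume k: "k \<in> K" "k' \<in> K" "k * k' = 1" "k' * k = 1" "q = act k q0"
    have "M q * (M q * F q) = k * M q0 * (k' * k) * M q0 * (k' * k) * Y * k'"
      by (simp add: k(5) F[OF k(1-4)] M_equivariant[OF k(1-4)] mult.assoc)
    also have "\<dots> = k * (M q0 * (M q0 * Y)) * k'" by (simp add: k(4) mult.assoc)
    also have "\<dots> = M q" by (simp add: Y(2) k(5) M_equivariant[OF k(1-4)])
    finally show ?thesis .
  qed
  have "tangent_proj N q \<phi> = (\<Sum>A\<in>B. ((A *v q) \<bullet> act (F q) \<phi>) *\<^sub>R (A *v q))" if q: "q \<in> N" for q \<phi>
  proof -
    have "(\<Sum>A\<in>B. ((A *v q) \<bullet> act (F q) \<phi>) *\<^sub>R A) \<in> mat_of ` lie"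
      unfolding B(5)[symmetric] by (intro span_sum span_scale span_base)
    then obtain W where W: "W \<in> lie" "mat_of W = (\<Sum>A\<in>B. ((A *v q) \<bullet> act (F q) \<phi>) *\<^sub>R A)" by force
    have "act W q = (\<Sum>A\<in>B. ((A *v q) \<bullet> act (F q) \<phi>) *\<^sub>R A) *v q" by (simp flip: W(2))
    also have "\<dots> = (\<Sum>A\<in>B. ((A *v q) \<bullet> act (F q) \<phi>) *\<^sub>R (A *v q))"
      using B(2) by (induction B rule: finite_induct)
        (simp_all add: matrix_vector_mult_add_rdistrib scaleR_matrix_vector_assoc)
    finally have Wq: "act W q = (\<Sum>A\<in>B. ((A *v q) \<bullet> act (F q) \<phi>) *\<^sub>R (A *v q))" .
    have WM: "act W q = act (M q) (act (F q) \<phi>)" by (simp add: Wq act_M)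
    have "act (M q) (\<phi> - act W q) = 0"
      unfolding WM using arg_cong[OF MMF[OF q], of "\<lambda>a. act a \<phi>"] by (simp add: act.diff_right)
    then have "(\<phi> - act W q) \<bullet> act V q = 0" if "V \<in> lie" for V
      using lie_annihilated[OF _ that] by (subst inner_commute) blast
    from tangent_projI[OF q W(1) this] show ?thesis by (simp add: Wq)
  qed
  then show thesis using that[OF L norm_ge_zero[of Y]] bF by blast
qed

end

lemma (in homogeneous_orbit) subspace_lie: "subspace lie"
  by (rule subspaceI) (auto intro: zero_lie lie_add lie_scaleR)

text \<open>Infinitesimal isometries span the tangent spaces, and the coefficients of the orthogonal
  projection with respect to them can be chosen Lipschitz.\<close>

theorem tangent_proj_representation:
  fixes K :: "(real^'n) endo set"
  assumes "homogeneous_orbit K N"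
  obtains I :: "(real^'n) endo set" and h L where
    "finite I" "I \<subseteq> orthogonal_group.lie K" "0 \<le> (L::real)"
    "\<And>q \<phi>. q \<in> N \<Longrightarrow> tangent_proj N q \<phi> = (\<Sum>A\<in>I. h A q \<phi> *\<^sub>R act A q)"
    "\<And>A q \<phi>. A \<in> I \<Longrightarrow> q \<in> N \<Longrightarrow> \<bar>h A q \<phi>\<bar> \<le> L * norm \<phi>"
    "\<And>A q q' \<phi> \<phi>'. A \<in> I \<Longrightarrow> q \<in> N \<Longrightarrow> q' \<in> N \<Longrightarrow>
       \<bar>h A q \<phi> - h A q' \<phi>'\<bar> \<le> L * (norm (q - q') * norm \<phi> + norm (\<phi> - \<phi>'))"
proof (cases "N = {}")
  case True
  show thesis by (rule that[of "{}" 0]) (auto simp: True)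
next
  case False
  then obtain q0 where q0: "q0 \<in> N" by blast
  interpret homogeneous_orbit K N by fact
  have "subspace (mat_of ` lie)" by (rule linear_subspace_image[OF mat_of_linear subspace_lie])
  then obtain B where B: "B \<subseteq> mat_of ` lie" "pairwise orthogonal B" "\<And>x. x \<in> B \<Longrightarrow> norm x = 1"
    "independent B" "card B = dim (mat_of ` lie)" "span B = mat_of ` lie"
    by (rule orthonormal_basis_subspace) blast
  have finB: "finite B" using B(4) independent_imp_finite by blast
  interpret homogeneous_orbit_matrix K N q0 B
    by unfold_locales (use q0 B finB in auto)
  obtain F C b where F: "C-lipschitz_on N F" "0 \<le> b" "\<And>q. q \<in> N \<Longrightarrow> norm (F q) \<le> b"
    and P: "\<And>q \<phi>. q \<in> N \<Longrightarrow> tangent_proj N q \<phi> = (\<Sum>A\<in>B. ((A *v q) \<bullet> act (F q) \<phi>) *\<^sub>R (A *v q))"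
    by (rule tangent_proj_representation_aux) blast
  obtain c where c: "0 \<le> c" "\<And>A x. A \<in> B \<Longrightarrow> norm (A *v x) \<le> c * norm x"
    by (rule matrix_vector_bound) blast
  have C: "0 \<le> C" using F(1) by (rule lipschitz_on_nonneg)
  define I where "I = mat_of -` B"
  have inj: "inj_on mat_of I" by (auto simp: inj_on_def mat_of_inject)
  have img: "mat_of ` I = B" using B(1) by (auto simp: I_def)
  define h where "h W q \<phi> = act W q \<bullet> act (F q) \<phi>" for W q \<phi>
  define R where "R = norm q0"
  \<comment> \<open>Here \<open>c\<close> bounds the frame fields, \<open>R\<close> is the norm on
    the orbit, and \<open>b\<close> and \<open>C\<close> are the bound and the Lipschitz constant of
    F. Varying q costs c b + c R C, varying \<phi> costs c R b.\<close>
  define L where "L = c * b + c * R * C + c * R * b"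
  have R: "0 \<le> R" by (simp add: R_def)
  have L: "c * b + c * R * C \<le> L" "c * R * b \<le> L" "0 \<le> L"
    using c(1) C F(2) R by (simp_all add: L_def)
  have cI: "norm (act W x) \<le> c * norm x" if "W \<in> I" for W x
    using c(2)[of "mat_of W" x] that by (simp add: I_def)
  show thesis
  proof (rule that)
    show "finite I" using finB inj img by (metis finite_imageD)
    show "I \<subseteq> lie" using B(1) by (auto simp: I_def mat_of_inject dest!: subsetD)
    show "0 \<le> L" by (rule L)
    show "tangent_proj N q \<phi> = (\<Sum>A\<in>I. h A q \<phi> *\<^sub>R act A q)" if "q \<in> N" for q \<phi>
      unfolding P[OF that] img[symmetric] sum.reindex[OF inj] by (simp add: h_def)
    show "\<bar>h A q \<phi>\<bar> \<le> L * norm \<phi>" if "A \<in> I" "q \<in> N" for A q \<phi>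
    proof -
      have "\<bar>h A q \<phi>\<bar> \<le> norm (act A q) * norm (act (F q) \<phi>)"
        unfolding h_def by (rule Cauchy_Schwarz_ineq2)
      also have "\<dots> \<le> (c * R) * (b * norm \<phi>)"
      proof (rule mult_mono)
        show "norm (act A q) \<le> c * R" using cI[OF that(1), of q] norm_N[OF that(2)] by (simp add: R_def)
        show "norm (act (F q) \<phi>) \<le> b * norm \<phi>"
          using F(3)[OF that(2)] norm_act_le[of "F q" \<phi>] by (meson mult_right_mono norm_ge_zero order_trans)
      qed (use c(1) R in auto)
      also have "\<dots> \<le> L * norm \<phi>" using L(2) by (simp add: mult_right_mono mult.assoc[symmetric])
      finally show ?thesis .
    qed
    show "\<bar>h A q \<phi> - h A q' \<phi>'\<bar> \<le> L * (norm (q - q') * norm \<phi> + norm (\<phi> - \<phi>'))"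
      if A: "A \<in> I" and q: "q \<in> N" "q' \<in> N" for A q q' \<phi> \<phi>'
    proof -
      have "h A q \<phi> - h A q' \<phi>' = act A (q - q') \<bullet> act (F q) \<phi> + act A q' \<bullet> act (F q - F q') \<phi>
          + act A q' \<bullet> act (F q') (\<phi> - \<phi>')"
        by (simp add: h_def act.diff_right inner_diff_left inner_diff_right)
      then have "\<bar>h A q \<phi> - h A q' \<phi>'\<bar> \<le> norm (act A (q - q')) * norm (act (F q) \<phi>)
          + norm (act A q') * norm (act (F q - F q') \<phi>) + norm (act A q') * norm (act (F q') (\<phi> - \<phi>'))"
        by (smt (verit) Cauchy_Schwarz_ineq2)
      also have "\<dots> \<le> (c * norm (q - q')) * (b * norm \<phi>) + (c * R) * ((C * norm (q - q')) * norm \<phi>)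
          + (c * R) * (b * norm (\<phi> - \<phi>'))"
      proof -
        have 1: "norm (act (F q) \<phi>) \<le> b * norm \<phi>" "norm (act (F q') (\<phi> - \<phi>')) \<le> b * norm (\<phi> - \<phi>')"
          using F(3) q norm_act_le by (meson mult_right_mono norm_ge_zero order_trans)+
        have 2: "norm (act A q') \<le> c * R" using cI[OF A, of q'] norm_N[OF q(2)] by (simp add: R_def)
        have "norm (F q - F q') \<le> C * norm (q - q')"
          using lipschitz_onD[OF F(1) q] by (simp add: dist_norm)
        then have 3: "norm (act (F q - F q') \<phi>) \<le> (C * norm (q - q')) * norm \<phi>"
          using norm_act_le by (meson mult_right_mono norm_ge_zero order_trans)
        show ?thesis
          using 1 2 3 cI[OF A, of "q - q'"] c(1) R by (intro add_mono mult_mono) auto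
      qed
      also have "\<dots> = (c * b + c * R * C) * (norm (q - q') * norm \<phi>) + (c * R * b) * norm (\<phi> - \<phi>')"
        by (simp add: algebra_simps)
      also have "\<dots> \<le> L * (norm (q - q') * norm \<phi>) + L * norm (\<phi> - \<phi>')"
        using L by (intro add_mono mult_right_mono) auto
      finally show ?thesis by (simp add: algebra_simps)
    qed
  qed
qed

section \<open>Both kinds of targets as orbits of compact groups of orthogonal maps\<close>

lemma continuous_on_endo:
  fixes F :: "'t::topological_space \<Rightarrow> 'a::euclidean_space endo"
  assumes "\<And>x. continuous_on S (\<lambda>g. act (F g) x)" shows "continuous_on S F"
  unfolding continuous_on_def
proof
  fix g assume g: "g \<in> S"
  \<comment> \<open>In finite dimensions the operator norm is controlled by the values on a basis;
    this upgrades the pointwise continuity of a representation to continuity in norm.\<close>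
  have le: "norm (a - b) \<le> (\<Sum>e\<in>Basis. norm (act a e - act b e))" for a b :: "'a endo"
  proof (rule norm_endo_le)
    fix x :: 'a
    have "act (a - b) x = act (a - b) (\<Sum>e\<in>Basis. (x \<bullet> e) *\<^sub>R e)" by (simp only: euclidean_representation)
    also have "\<dots> = (\<Sum>e\<in>Basis. (x \<bullet> e) *\<^sub>R act (a - b) e)" by (simp only: act.sum_right act.scaleR_right)
    finally have "norm (act (a - b) x) \<le> (\<Sum>e\<in>Basis. norm ((x \<bullet> e) *\<^sub>R act (a - b) e))"
      by (simp only: norm_sum)
    also have "\<dots> \<le> (\<Sum>e\<in>Basis. norm (act a e - act b e) * norm x)"
      by (intro sum_mono) (simp add: Basis_le_norm mult.commute[of "\<bar>_\<bar>"] mult_left_mono)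
    finally show "norm (act (a - b) x) \<le> (\<Sum>e\<in>Basis. norm (act a e - act b e)) * norm x"
      by (simp add: sum_distrib_right)
  qed (simp add: sum_nonneg)
  have "((\<lambda>g'. \<Sum>e\<in>Basis. norm (act (F g') e - act (F g) e)) \<longlongrightarrow> (\<Sum>e\<in>(Basis::'a set). norm (act (F g) e - act (F g) e))) (at g within S)"
    using assms g unfolding continuous_on_def by (intro tendsto_intros) auto
  then have "((\<lambda>g'. F g' - F g) \<longlongrightarrow> 0) (at g within S)"
    by (intro Lim_null_comparison[OF always_eventually[OF allI[OF le]]]) simp
  then show "(F \<longlongrightarrow> F g) (at g within S)" by (rule LIM_zero_cancel)
qed

lemma homogeneous_orbit_sphere:
  "homogeneous_orbit {a. \<forall>x. norm (act a x) = norm x} (sphere (0::real^'n) 1)"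
proof
  let ?K = "{a. \<forall>x::real^'n. norm (act a x) = norm x}"
  have "closed {a. norm (act a x) = norm x}" for x :: "real^'n"
    by (intro closed_Collect_eq continuous_on_norm linear_continuous_on[OF act.bounded_linear_left] continuous_on_const)
  then have "closed ?K" by (simp add: closed_Collect_all)
  moreover have "bounded ?K"
    unfolding bounded_iff by (intro exI[of _ 1]) (auto intro!: norm_endo_le)
  ultimately show "compact ?K" by (simp add: compact_eq_bounded_closed)
  fix a assume a: "a \<in> ?K"
  then have o: "orthogonal_transformation (act a)" by (simp add: orthogonal_transformation linear_act)
  have oi: "orthogonal_transformation (inv_into UNIV (act a))" by (rule orthogonal_transformation_inv[OF o])
  then have l: "linear (inv_into UNIV (act a))" by (rule orthogonal_transformation_linear)
  have b: "bij (act a)" by (rule orthogonal_transformation_bij[OF o])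
  show "\<exists>b\<in>?K. a * b = 1 \<and> b * a = 1"
  proof (intro bexI[of _ "endo_of (inv_into UNIV (act a))"] conjI endo_eqI)
    show "endo_of (inv_into UNIV (act a)) \<in> ?K"
      using oi by (simp add: act_endo_of[OF l] orthogonal_transformation_norm)
  qed (use b in \<open>simp_all add: act_endo_of[OF l] bij_is_surj surj_f_inv_f bij_is_inj inv_f_f\<close>)
next
  fix q q' :: "real^'n" assume "q \<in> sphere 0 1" "q' \<in> sphere 0 1"
  then obtain f where f: "orthogonal_transformation f" "f q = q'"
    using orthogonal_transformation_exists[of q q'] by auto
  then show "\<exists>k\<in>{a. \<forall>x. norm (act a x) = norm x}. act k q = q'"
    using act_endo_of[OF orthogonal_transformation_linear[OF f(1)]]
    by (intro bexI[of _ "endo_of f"]) (simp_all add: orthogonal_transformation_norm)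
qed simp_all

lemma homogeneous_orbit_equivariant:
  assumes "equivariant_homogeneous_manifold G \<rho> N"
  shows "homogeneous_orbit ((\<lambda>g. endo_of (\<rho> g)) ` carrier G) N"
proof -
  have G: "group G" "compact (carrier G)"
    and \<rho>: "\<And>g. g \<in> carrier G \<Longrightarrow> orthogonal_transformation (\<rho> g)" "\<rho> \<one>\<^bsub>G\<^esub> = id"
      "\<And>g h. g \<in> carrier G \<Longrightarrow> h \<in> carrier G \<Longrightarrow> \<rho> (g \<otimes>\<^bsub>G\<^esub> h) = \<rho> g \<circ> \<rho> h"
      "\<And>x. continuous_on (carrier G) (\<lambda>g. \<rho> g x)"
    and N: "\<And>g q. g \<in> carrier G \<Longrightarrow> q \<in> N \<Longrightarrow> \<rho> g q \<in> N"
      "\<And>q q'. q \<in> N \<Longrightarrow> q' \<in> N \<Longrightarrow> \<exists>g\<in>carrier G. \<rho> g q = q'"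
    using assms
    by (auto simp: equivariant_homogeneous_manifold_def compact_lie_group_def orthogonal_representation_def)
  interpret group G by fact
  have act: "act (endo_of (\<rho> g)) x = \<rho> g x" if "g \<in> carrier G" for g x
    by (rule act_endo_of[OF orthogonal_transformation_linear[OF \<rho>(1)[OF that]]])
  have mult: "endo_of (\<rho> g) * endo_of (\<rho> h) = endo_of (\<rho> (g \<otimes>\<^bsub>G\<^esub> h))"
    if "g \<in> carrier G" "h \<in> carrier G" for g h
    using act[OF m_closed[OF that]] by (intro endo_eqI) (simp add: act[OF that(1)] act[OF that(2)] \<rho>(3)[OF that])
  have one: "endo_of (\<rho> \<one>\<^bsub>G\<^esub>) = 1" using act[OF one_closed] by (intro endo_eqI) (simp add: \<rho>(2))
  show ?thesis
  proof
    have "continuous_on (carrier G) (\<lambda>g. endo_of (\<rho> g))"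
    proof (rule continuous_on_endo)
      show "continuous_on (carrier G) (\<lambda>g. act (endo_of (\<rho> g)) x)" for x
        using \<rho>(4)[of x] by (rule continuous_on_eq) (simp add: act)
    qed
    then show "compact ((\<lambda>g. endo_of (\<rho> g)) ` carrier G)" using G(2) by (rule compact_continuous_image)
    show "1 \<in> (\<lambda>g. endo_of (\<rho> g)) ` carrier G" using one by (metis imageI one_closed)
    show "\<exists>b\<in>(\<lambda>g. endo_of (\<rho> g)) ` carrier G. a * b = 1 \<and> b * a = 1"
      if "a \<in> (\<lambda>g. endo_of (\<rho> g)) ` carrier G" for a
    proof -
      obtain g where g: "g \<in> carrier G" "a = endo_of (\<rho> g)" using \<open>a \<in> _\<close> by blast
      then show ?thesis
        by (intro bexI[of _ "endo_of (\<rho> (inv\<^bsub>G\<^esub> g))"]) (simp_all add: mult one)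
    qed
    show "norm (act a x) = norm x" if "a \<in> (\<lambda>g. endo_of (\<rho> g)) ` carrier G" for a x
      using that \<rho>(1) by (auto simp: act orthogonal_transformation_norm)
    show "act k q \<in> N" if "k \<in> (\<lambda>g. endo_of (\<rho> g)) ` carrier G" "q \<in> N" for k q
      using that N(1) by (auto simp: act)
    show "\<exists>k\<in>(\<lambda>g. endo_of (\<rho> g)) ` carrier G. act k q = q'" if "q \<in> N" "q' \<in> N" for q q'
      using N(2)[OF that] by (auto simp: act)
    show "a * b \<in> (\<lambda>g. endo_of (\<rho> g)) ` carrier G"
      if "a \<in> (\<lambda>g. endo_of (\<rho> g)) ` carrier G" "b \<in> (\<lambda>g. endo_of (\<rho> g)) ` carrier G" for a b
      using that by (auto simp: mult)
  qed
qed

lemma (in homogeneous_orbit) compact_orbit: "compact N"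
proof (cases "N = {}")
  case False
  then obtain q where q: "q \<in> N" by blast
  have "N = (\<lambda>k. act k q) ` K" using transitive[OF q] act_N q by auto
  moreover have "compact ((\<lambda>k. act k q) ` K)"
    by (intro compact_continuous_image compact_K linear_continuous_on[OF act.bounded_linear_left])
  ultimately show ?thesis by simp
qed simp

lemma (in homogeneous_orbit) norm_orbit_eq: "q \<in> N \<Longrightarrow> q' \<in> N \<Longrightarrow> norm q = norm q'"
  using transitive norm_act_K by metis

lemma (in homogeneous_orbit) act_exp_N: "W \<in> lie \<Longrightarrow> q \<in> N \<Longrightarrow> act (exp (s *\<^sub>R W)) q \<in> N"
  by (simp add: lie_def act_N)

lemma (in orthogonal_group) norm_act_exp: "W \<in> lie \<Longrightarrow> norm (act (exp (s *\<^sub>R W)) x) = norm x"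
  by (simp add: lie_def norm_act_K)

lemma (in orthogonal_group) norm_act_exp_diff_le:
  assumes "W \<in> lie"
  shows "norm (act (exp (a *\<^sub>R W)) x - act (exp (b *\<^sub>R W)) x) \<le> norm W * \<bar>a - b\<bar> * norm x"
proof -
  have d: "((\<lambda>t. act (exp (t *\<^sub>R W)) x) has_derivative (\<lambda>h. h *\<^sub>R act (exp (t *\<^sub>R W)) (act W x))) (at t within UNIV)" for t
    using act_exp_has_vector_derivative[of W x t] by (simp add: has_vector_derivative_def)
  have "onorm (\<lambda>h. h *\<^sub>R act (exp (t *\<^sub>R W)) (act W x)) \<le> norm W * norm x" for t
    by (rule onorm_le) (simp add: norm_act_exp[OF assms] mult.commute[of _ "\<bar>_\<bar>"] mult_left_mono norm_act_le)
  from differentiable_bound[OF convex_UNIV d this UNIV_I UNIV_I, of a b]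
  show ?thesis by (simp add: mult_ac)
qed

subsection \<open>Compactness in fractional Sobolev spaces\<close>

text \<open>Abstract diagonal argument. The diagonal sequence is a subsequence of the n-th
  refinement only from some index on; \<open>tail\<close> bridges this gap, while \<open>sub\<close>
  keeps properties already achieved.\<close>

lemma diagonal_subsequence:
  assumes I: "countable I"
    and ex: "\<And>i s. i \<in> I \<Longrightarrow> strict_mono (s :: nat \<Rightarrow> nat) \<Longrightarrow> \<exists>r. strict_mono (r :: nat \<Rightarrow> nat) \<and> P i (s \<circ> r)"
    and sub: "\<And>i s r. i \<in> I \<Longrightarrow> strict_mono (r :: nat \<Rightarrow> nat) \<Longrightarrow> P i s \<Longrightarrow> P i (s \<circ> r)"
    and tail: "\<And>i s k. i \<in> I \<Longrightarrow> P i (s \<circ> (+) (k :: nat)) \<Longrightarrow> P i s"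
  obtains r :: "nat \<Rightarrow> nat" where "strict_mono r" "\<And>i. i \<in> I \<Longrightarrow> P i r"
proof (cases "I = {}")
  case True
  then show thesis using that[of id] by (simp add: strict_mono_def)
next
  case False
  interpret subseqs "\<lambda>n. P (from_nat_into I n)"
    by unfold_locales (use ex from_nat_into[OF False] in blast)
  show thesis
  proof (rule that)
    show "strict_mono diagseq" by (rule subseq_diagseq)
    fix i assume i: "i \<in> I"
    then obtain n where n: "from_nat_into I n = i" using from_nat_into_surj[OF I] by blast
    have "P (from_nat_into I n) (diagseq \<circ> (+) (Suc n))"
      by (rule diagseq_holds) (use sub from_nat_into[OF False] in blast)
    then show "P i diagseq" using tail[OF i] n by simp
  qed
qed

lemma diagonal_convergent_subsequence:
  fixes a :: "'i \<Rightarrow> nat \<Rightarrow> 'b::heine_borel"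
  assumes "countable I" "\<And>i. i \<in> I \<Longrightarrow> bounded (range (a i))"
  obtains r :: "nat \<Rightarrow> nat" where "strict_mono r" "\<And>i. i \<in> I \<Longrightarrow> convergent (\<lambda>j. a i (r j))"
proof (rule diagonal_subsequence[of I "\<lambda>i s. convergent (\<lambda>j. a i (s j))"])
  fix i and s :: "nat \<Rightarrow> nat" assume "i \<in> I" "strict_mono s"
  have "bounded (range (\<lambda>j. a i (s j)))"
    by (rule bounded_subset[OF assms(2)[OF \<open>i \<in> I\<close>]]) auto
  then obtain l r where "strict_mono r" "((\<lambda>j. a i (s j)) \<circ> r) \<longlonglongrightarrow> l"
    using bounded_imp_convergent_subsequence by blast
  then show "\<exists>r. strict_mono r \<and> convergent (\<lambda>j. a i ((s \<circ> r) j))" by (auto simp: convergent_def o_def)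
next
  fix i and s r :: "nat \<Rightarrow> nat" assume "strict_mono r" "convergent (\<lambda>j. a i (s j))"
  then show "convergent (\<lambda>j. a i ((s \<circ> r) j))"
    using convergent_subseq_convergent[of "\<lambda>j. a i (s j)" r] by (simp add: o_def)
next
  fix i and s :: "nat \<Rightarrow> nat" and k assume "convergent (\<lambda>j. a i ((s \<circ> (+) k) j))"
  then have "convergent (\<lambda>j. (\<lambda>n. a i (s n)) (j + k))" by (simp add: add.commute)
  then show "convergent (\<lambda>j. a i (s j))" by (subst (asm) convergent_ignore_initial_segment)
qed (use assms(1) that in blast)+

section \<open>Measures for the domain and for the singular kernel\<close>

definition domain_measure :: "'a::euclidean_space set \<Rightarrow> 'a measure" where
  "domain_measure \<Omega> = density lborel (\<lambda>x. ennreal (indicator \<Omega> x))"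

text \<open>With the kernel moved into the measure, the Gagliardo energy is a plain L^p norm of
  increments, and the flow can be built without reference to the kernel. Using Borel sets on the
  whole type lets Borel functions be used without restriction. On the diagonal the density is a
  division by 0, hence 0.\<close>

definition gagliardo_measure :: "real \<Rightarrow> 'a::euclidean_space set \<Rightarrow> ('a \<times> 'a) measure" where
  "gagliardo_measure \<alpha> \<Omega> = density lborel (\<lambda>z. ennreal (indicator (\<Omega> \<times> \<Omega>) z / norm (fst z - snd z) powr \<alpha>))"

lemma sets_domain_measure [measurable_cong, simp]: "sets (domain_measure \<Omega>) = sets borel"
  by (simp add: domain_measure_def)

lemma space_domain_measure [simp]: "space (domain_measure \<Omega>) = UNIV"
  by (simp add: domain_measure_def)

lemma sets_gagliardo_measure [measurable_cong, simp]: "sets (gagliardo_measure \<alpha> \<Omega>) = sets borel"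
  by (simp add: gagliardo_measure_def)

lemma space_gagliardo_measure [simp]: "space (gagliardo_measure \<alpha> \<Omega>) = UNIV"
  by (simp add: gagliardo_measure_def)

lemma measurable_fst_borel [measurable]: "(fst :: 'a::second_countable_topology \<times> 'b::second_countable_topology \<Rightarrow> 'a) \<in> borel_measurable borel"
  by (intro borel_measurable_continuous_onI continuous_intros)

lemma measurable_snd_borel [measurable]: "(snd :: 'a::second_countable_topology \<times> 'b::second_countable_topology \<Rightarrow> 'b) \<in> borel_measurable borel"
  by (intro borel_measurable_continuous_onI continuous_intros)

lemma borel_Times_open [measurable]:
  "open A \<Longrightarrow> open B \<Longrightarrow> A \<times> B \<in> sets borel"
  by (intro borel_open open_Times)

lemma integral_domain_measure:
  fixes f :: "'a::euclidean_space \<Rightarrow> 'b::euclidean_space"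
  assumes "open \<Omega>" "f \<in> borel_measurable borel"
  shows "integral\<^sup>L (domain_measure \<Omega>) f = (LINT x|lborel. indicator \<Omega> x *\<^sub>R f x)"
  unfolding domain_measure_def using assms by (intro integral_density) auto

lemma integrable_domain_measure:
  fixes f :: "'a::euclidean_space \<Rightarrow> 'b::euclidean_space"
  assumes "open \<Omega>" "f \<in> borel_measurable borel"
  shows "integrable (domain_measure \<Omega>) f \<longleftrightarrow> integrable lborel (\<lambda>x. indicator \<Omega> x *\<^sub>R f x)"
  unfolding domain_measure_def using assms by (intro integrable_density) auto

lemma integral_gagliardo_measure:
  fixes f :: "'a::euclidean_space \<times> 'a \<Rightarrow> 'b::euclidean_space"
  assumes "open \<Omega>" "f \<in> borel_measurable borel"
  shows "integral\<^sup>L (gagliardo_measure \<alpha> \<Omega>) f =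
    (LINT z|lborel. (indicator (\<Omega> \<times> \<Omega>) z / norm (fst z - snd z) powr \<alpha>) *\<^sub>R f z)"
  unfolding gagliardo_measure_def using assms by (intro integral_density) auto

lemma integrable_gagliardo_measure:
  fixes f :: "'a::euclidean_space \<times> 'a \<Rightarrow> 'b::euclidean_space"
  assumes "open \<Omega>" "f \<in> borel_measurable borel"
  shows "integrable (gagliardo_measure \<alpha> \<Omega>) f \<longleftrightarrow>
    integrable lborel (\<lambda>z. (indicator (\<Omega> \<times> \<Omega>) z / norm (fst z - snd z) powr \<alpha>) *\<^sub>R f z)"
  unfolding gagliardo_measure_def using assms by (intro integrable_density) auto

lemma integrable_bounded_on_finite_set:
  fixes f :: "'a \<Rightarrow> 'b::{banach, second_countable_topology}"
  assumes "A \<in> sets M" "emeasure M A < \<infinity>" "f \<in> borel_measurable M" "\<And>x. norm (f x) \<le> C"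
  shows "integrable M (\<lambda>x. indicator A x *\<^sub>R f x)"
proof (rule Bochner_Integration.integrable_bound)
  show "integrable M (\<lambda>x. C * indicator A x)" using assms(1,2) by (intro integrable_mult_right integrable_real_indicator)
  show "AE x in M. norm (indicator A x *\<^sub>R f x) \<le> norm (C * indicator A x)"
    using order_trans[OF assms(4) abs_ge_self] by (intro AE_I2) (auto simp: indicator_def)
qed (use assms in measurable)

text \<open>Either d is at most the threshold \<theta>, or (d/\<theta>)^(p-1) is at least 1. This
  makes an L^1 norm small up to a multiple of an energy, in place of Hoelder's inequality.\<close>

lemma le_add_powr:
  fixes d :: real
  assumes "0 \<le> d" "0 < \<theta>" "1 \<le> p" shows "d \<le> \<theta> + \<theta> powr (1 - p) * d powr p"
proof (cases "d \<le> \<theta>")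
  case True
  then show ?thesis by (smt (verit) mult_nonneg_nonneg powr_ge_zero)
next
  case False
  then have "1 \<le> (d / \<theta>) powr (p - 1)" using assms by (intro ge_one_powr_ge_zero) auto
  then have "d * 1 \<le> d * (d / \<theta>) powr (p - 1)" using assms by (intro mult_left_mono)
  also have "\<dots> = \<theta> powr (1 - p) * d powr p"
    using False assms by (simp add: powr_divide powr_diff field_simps)
  finally show ?thesis using assms by simp
qed

text \<open>Two points of the ball are less than 2 r apart, so there the kernel is at least
  (2r)^(-\<alpha>): the unweighted p-th power costs a factor (2r)^\<alpha> times the energy on the
  ball.\<close>

lemma mean_oscillation_ball_le:
  fixes v :: "'a::euclidean_space \<Rightarrow> 'b::euclidean_space"
  assumes v[measurable]: "v \<in> borel_measurable borel" and R: "\<And>x. norm (v x) \<le> R"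
    and p: "1 \<le> p" and \<alpha>: "0 \<le> \<alpha>" and \<Omega>: "open \<Omega>" and r: "0 < r" "ball a r \<subseteq> \<Omega>" and \<theta>: "0 < \<theta>"
    and int: "integrable (gagliardo_measure \<alpha> \<Omega>) (\<lambda>z. norm (v (fst z) - v (snd z)) powr p)"
  shows "(LINT z|lborel. indicator (ball a r \<times> ball a r) z * norm (v (fst z) - v (snd z)))
     \<le> \<theta> * (measure lborel (ball a r))\<^sup>2 + \<theta> powr (1 - p) * (2 * r) powr \<alpha> *
        (LINT z|gagliardo_measure \<alpha> \<Omega>. indicator (ball a r \<times> ball a r) z * norm (v (fst z) - v (snd z)) powr p)"
proof -
  let ?Q = "ball a r" and ?d = "\<lambda>z. norm (v (fst z) - v (snd z))"
  define k where "k = (\<lambda>z::'a \<times> 'a. indicator (\<Omega> \<times> \<Omega>) z / norm (fst z - snd z) powr \<alpha>)"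
  have QQ: "emeasure lborel (?Q \<times> ?Q) < \<infinity>"
    by (intro emeasure_bounded_finite bounded_Times bounded_ball)
  have d: "?d z \<le> 2 * R" for z
    using R[of "fst z"] R[of "snd z"] norm_triangle_ineq4[of "v (fst z)" "v (snd z)"] by linarith
  have [measurable]: "open \<Omega>" by fact
  have int2: "integrable lborel (\<lambda>z. k z * (indicator (?Q \<times> ?Q) z * ?d z powr p))"
  proof -
    have "integrable (gagliardo_measure \<alpha> \<Omega>) (\<lambda>z. ?d z powr p * indicator (?Q \<times> ?Q) z)"
      by (rule integrable_real_mult_indicator[OF _ int]) simp
    then show ?thesis
      by (subst (asm) integrable_gagliardo_measure) (auto simp: \<Omega> k_def mult_ac)
  qed
  have 1: "indicator (?Q \<times> ?Q) z * ?d z \<le> \<theta> * indicator (?Q \<times> ?Q) z +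
      \<theta> powr (1 - p) * (2 * r) powr \<alpha> * (k z * (indicator (?Q \<times> ?Q) z * ?d z powr p))" for z
  proof (cases "z \<in> ?Q \<times> ?Q \<and> fst z \<noteq> snd z")
    case True
    then have z: "z \<in> \<Omega> \<times> \<Omega>" using r(2) by auto
    have "norm (fst z - snd z) < 2 * r"
      using True dist_triangle_less_add[of "fst z" a r "snd z" r] by (auto simp: dist_norm[symmetric] dist_commute)
    then have "norm (fst z - snd z) powr \<alpha> \<le> (2 * r) powr \<alpha>" using \<alpha> by (intro powr_mono2) auto
    then have "1 \<le> (2 * r) powr \<alpha> * k z" using True z by (simp add: k_def field_simps)
    then have "\<theta> powr (1 - p) * ?d z powr p * 1 \<le> \<theta> powr (1 - p) * ?d z powr p * ((2 * r) powr \<alpha> * k z)"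
      by (intro mult_left_mono) auto
    then show ?thesis using le_add_powr[OF norm_ge_zero \<theta> p, of "v (fst z) - v (snd z)"] True
      by (simp add: mult_ac)
  next
    case False
    then show ?thesis using \<theta> by (auto simp: indicator_def mem_Times_iff k_def)
  qed
  have meas: "measure lborel (?Q \<times> ?Q) = (measure lborel ?Q)\<^sup>2"
  proof -
    have "emeasure (lborel \<Otimes>\<^sub>M lborel) (?Q \<times> ?Q) = emeasure lborel ?Q * emeasure lborel ?Q"
      by (intro lborel.emeasure_pair_measure_Times) auto
    then show ?thesis by (simp add: lborel_prod measure_def enn2real_mult power2_eq_square)
  qed
  have "(LINT z|lborel. indicator (?Q \<times> ?Q) z * ?d z) \<le>
    (LINT z|lborel. \<theta> * indicator (?Q \<times> ?Q) z + \<theta> powr (1 - p) * (2 * r) powr \<alpha> * (k z * (indicator (?Q \<times> ?Q) z * ?d z powr p)))"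
  proof (rule integral_mono)
    show "integrable lborel (\<lambda>z. indicator (?Q \<times> ?Q) z * ?d z)"
      using integrable_bounded_on_finite_set[of "?Q \<times> ?Q" lborel ?d "2 * R"] QQ d by simp
    show "integrable lborel (\<lambda>z. \<theta> * indicator (?Q \<times> ?Q) z + \<theta> powr (1 - p) * (2 * r) powr \<alpha> * (k z * (indicator (?Q \<times> ?Q) z * ?d z powr p)))"
      using QQ by (intro Bochner_Integration.integrable_add integrable_mult_right integrable_real_indicator int2) auto
  qed (rule 1)
  also have "\<dots> = \<theta> * measure lborel (?Q \<times> ?Q) + \<theta> powr (1 - p) * (2 * r) powr \<alpha> * (LINT z|lborel. k z * (indicator (?Q \<times> ?Q) z * ?d z powr p))"
    using QQ int2 by simp
  also have "(LINT z|lborel. k z * (indicator (?Q \<times> ?Q) z * ?d z powr p)) =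
      (LINT z|gagliardo_measure \<alpha> \<Omega>. indicator (?Q \<times> ?Q) z * ?d z powr p)"
    by (subst integral_gagliardo_measure) (auto simp: \<Omega> k_def)
  finally show ?thesis by (simp add: meas)
qed

text \<open>For x in the ball of measure m, m v(x) differs from the integral of v over the ball by
  at most the oscillation of v around x, and likewise for w. Subtracting and integrating in x leaves
  the two double integrals and the difference of the integrals over the ball.\<close>

lemma L1_dist_le_oscillation:
  fixes v w :: "'a::euclidean_space \<Rightarrow> 'b::euclidean_space"
  assumes v[measurable]: "v \<in> borel_measurable borel" and w[measurable]: "w \<in> borel_measurable borel"
    and R: "\<And>x. norm (v x) \<le> R" "\<And>x. norm (w x) \<le> R" and r: "0 < r"
  shows "measure lborel (ball a r) * (LINT x|lborel. indicator (ball a r) x * norm (v x - w x))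
    \<le> (LINT z|lborel. indicator (ball a r \<times> ball a r) z * norm (v (fst z) - v (snd z)))
     + (LINT z|lborel. indicator (ball a r \<times> ball a r) z * norm (w (fst z) - w (snd z)))
     + measure lborel (ball a r) * norm ((LINT x|lborel. indicator (ball a r) x *\<^sub>R v x) - (LINT x|lborel. indicator (ball a r) x *\<^sub>R w x))"
proof -
  let ?Q = "ball a r" and ?m = "measure lborel (ball a r)"
  let ?V = "LINT x|lborel. indicator ?Q x *\<^sub>R v x" and ?W = "LINT x|lborel. indicator ?Q x *\<^sub>R w x"
  have Q: "emeasure lborel ?Q < \<infinity>" by (intro emeasure_bounded_finite bounded_ball)
  have QQ: "emeasure lborel (?Q \<times> ?Q) < \<infinity>"
    by (intro emeasure_bounded_finite bounded_Times bounded_ball)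
  note ib = integrable_bounded_on_finite_set[of ?Q lborel, OF _ Q, simplified]
  have i1: "integrable lborel (\<lambda>y. indicator ?Q y *\<^sub>R u y)" if "u \<in> borel_measurable borel" "\<And>x. norm (u x) \<le> R" for u :: "'a \<Rightarrow> 'b"
    using that by (intro ib)
  have i2: "integrable lborel (\<lambda>y. indicator ?Q y * norm (u x - u y))"
    if [measurable]: "u \<in> borel_measurable borel" and "\<And>x. norm (u x) \<le> R" for u :: "'a \<Rightarrow> 'b" and x
    using ib[of "\<lambda>y. norm (u x - u y)" "R + R"] order_trans[OF norm_triangle_ineq4 add_mono[OF that(2) that(2)]] by simp
  have i3: "integrable (lborel \<Otimes>\<^sub>M lborel) (\<lambda>z. indicator (?Q \<times> ?Q) z * norm (u (fst z) - u (snd z)))"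
    if [measurable]: "u \<in> borel_measurable borel" and "\<And>x. norm (u x) \<le> R" for u :: "'a \<Rightarrow> 'b"
    using integrable_bounded_on_finite_set[of "?Q \<times> ?Q" lborel "\<lambda>z. norm (u (fst z) - u (snd z))" "R + R"] QQ
      order_trans[OF norm_triangle_ineq4 add_mono[OF that(2) that(2)]] by (simp add: lborel_prod)
  have it: "(LINT z|lborel. indicator (?Q \<times> ?Q) z * norm (u (fst z) - u (snd z))) =
      (LINT x|lborel. indicator ?Q x * (LINT y|lborel. indicator ?Q y * norm (u x - u y)))"
    "integrable lborel (\<lambda>x. indicator ?Q x * (LINT y|lborel. indicator ?Q y * norm (u x - u y)))"
    if u: "u \<in> borel_measurable borel" "\<And>x. norm (u x) \<le> R" for u :: "'a \<Rightarrow> 'b"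
    using lborel_pair.integral_fst'[OF i3[OF u]] lborel_pair.integrable_fst'[OF i3[OF u]]
    by (simp_all add: lborel_prod indicator_times mult.assoc)
  have pt: "?m * (indicator ?Q x * norm (v x - w x)) \<le> indicator ?Q x * (LINT y|lborel. indicator ?Q y * norm (v x - v y))
      + indicator ?Q x * (LINT y|lborel. indicator ?Q y * norm (w x - w y)) + norm (?V - ?W) * indicator ?Q x" for x
  proof (cases "x \<in> ?Q")
    case True
    have c: "(LINT y|lborel. indicator ?Q y *\<^sub>R e) = ?m *\<^sub>R e" for e :: 'b
      using Q by (simp add: has_bochner_integral_integral_eq[OF has_bochner_integral_indicator])
    have dv: "(LINT y|lborel. indicator ?Q y *\<^sub>R (u x - u y)) = ?m *\<^sub>R u x - (LINT y|lborel. indicator ?Q y *\<^sub>R u y)"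
      if "u \<in> borel_measurable borel" "\<And>x. norm (u x) \<le> R" for u :: "'a \<Rightarrow> 'b"
      unfolding scaleR_diff_right using i1[OF that] Q
      by (subst Bochner_Integration.integral_diff) (auto simp: c intro!: integrable_scaleR_left integrable_real_indicator)
    have nd: "norm (?m *\<^sub>R u x - (LINT y|lborel. indicator ?Q y *\<^sub>R u y)) \<le> (LINT y|lborel. indicator ?Q y * norm (u x - u y))"
      if "u \<in> borel_measurable borel" "\<And>x. norm (u x) \<le> R" for u :: "'a \<Rightarrow> 'b"
      unfolding dv[OF that, symmetric]
      by (rule order_trans[OF integral_norm_bound]) simp
    have "?m * norm (v x - w x) = norm (?m *\<^sub>R (v x - w x))" by simp
    also have "?m *\<^sub>R (v x - w x) = (?m *\<^sub>R v x - ?V) - (?m *\<^sub>R w x - ?W) + (?V - ?W)" by (simp add: algebra_simps)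
    also have "norm \<dots> \<le> norm (?m *\<^sub>R v x - ?V) + norm (?m *\<^sub>R w x - ?W) + norm (?V - ?W)"
      by (rule order_trans[OF norm_triangle_ineq add_right_mono[OF norm_triangle_ineq4]])
    also have "\<dots> \<le> (LINT y|lborel. indicator ?Q y * norm (v x - v y)) + (LINT y|lborel. indicator ?Q y * norm (w x - w y)) + norm (?V - ?W)"
      by (intro add_mono nd v w R order_refl)
    finally show ?thesis using True by simp
  qed simp
  have "?m * (LINT x|lborel. indicator ?Q x * norm (v x - w x)) = (LINT x|lborel. ?m * (indicator ?Q x * norm (v x - w x)))" by simp
  also have "\<dots> \<le> (LINT x|lborel. indicator ?Q x * (LINT y|lborel. indicator ?Q y * norm (v x - v y))
      + indicator ?Q x * (LINT y|lborel. indicator ?Q y * norm (w x - w y)) + norm (?V - ?W) * indicator ?Q x)"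
  proof (rule integral_mono)
    show "integrable lborel (\<lambda>x. ?m * (indicator ?Q x * norm (v x - w x)))"
      using ib[of "\<lambda>y. norm (v y - w y)" "R + R"] order_trans[OF norm_triangle_ineq4 add_mono[OF R]]
      by (intro integrable_mult_right) simp
    show "integrable lborel (\<lambda>x. indicator ?Q x * (LINT y|lborel. indicator ?Q y * norm (v x - v y))
      + indicator ?Q x * (LINT y|lborel. indicator ?Q y * norm (w x - w y)) + norm (?V - ?W) * indicator ?Q x)"
      using Q by (intro Bochner_Integration.integrable_add it v w R integrable_mult_right integrable_real_indicator) auto
  qed (rule pt)
  also have "\<dots> = (LINT z|lborel. indicator (?Q \<times> ?Q) z * norm (v (fst z) - v (snd z)))
     + (LINT z|lborel. indicator (?Q \<times> ?Q) z * norm (w (fst z) - w (snd z))) + norm (?V - ?W) * ?m"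
    using Q by (simp add: it v w R)
  finally show ?thesis by (simp add: mult.commute)
qed


lemma sum_integral_disjoint_le:
  fixes f :: "'a \<Rightarrow> real"
  assumes F: "finite F" "disjoint_family_on S F" "\<And>i. i \<in> F \<Longrightarrow> S i \<in> sets M"
    and f: "integrable M f" "\<And>z. 0 \<le> f z"
  shows "(\<Sum>i\<in>F. LINT z|M. indicator (S i) z * f z) \<le> integral\<^sup>L M f"
proof -
  have i: "integrable M (\<lambda>z. indicator (S i) z * f z)" if "i \<in> F" for i
    using integrable_real_mult_indicator[OF F(3)[OF that] f(1)] by (simp add: mult.commute)
  have "(\<Sum>i\<in>F. LINT z|M. indicator (S i) z * f z) = (LINT z|M. (\<Sum>i\<in>F. indicator (S i) z * f z))"
    using i by (subst Bochner_Integration.integral_sum) auto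
  also have "\<dots> \<le> integral\<^sup>L M f"
  proof (rule integral_mono[OF _ f(1)])
    show "integrable M (\<lambda>z. \<Sum>i\<in>F. indicator (S i) z * f z)" using i by auto
    show "(\<Sum>i\<in>F. indicator (S i) z * f z) \<le> f z" for z
      unfolding sum_distrib_right[symmetric] indicator_UN_disjoint[OF F(1,2), symmetric]
      using f(2)[of z] by (auto simp: indicator_def)
  qed
  finally show ?thesis .
qed

lemma ball_covering:
  fixes \<Omega> :: "'a::euclidean_space set"
  assumes \<Omega>: "open \<Omega>" and \<delta>: "0 < \<delta>"
  obtains C :: "('a \<times> real) set" where "countable C"
    "\<And>c. c \<in> C \<Longrightarrow> 0 < snd c \<and> snd c < \<delta> \<and> ball (fst c) (snd c) \<subseteq> \<Omega>"
    "disjoint_family_on (\<lambda>c. ball (fst c) (snd c)) C"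
    "negligible (\<Omega> - (\<Union>c\<in>C. ball (fst c) (snd c)))"
proof -
  let ?K = "{c. 0 < snd c \<and> snd c < \<delta> \<and> ball (fst c) (snd c) \<subseteq> \<Omega>}"
  have *: "\<exists>c. c \<in> ?K \<and> x \<in> ball (fst c) (snd c) \<and> snd c < d" if x: "x \<in> \<Omega>" "0 < d" for x d
  proof -
    obtain e where e: "0 < e" "ball x e \<subseteq> \<Omega>" using \<Omega> x(1) openE by blast
    let ?r = "min (e / 2) (min (d / 2) (\<delta> / 2))"
    have "ball x ?r \<subseteq> ball x e" using e(1) by (intro subset_ball) auto
    then show ?thesis using e x(2) \<delta> by (intro exI[of _ "(x, ?r)"]) auto
  qed
  obtain C where C: "countable C" "C \<subseteq> ?K"
     "pairwise (\<lambda>i j. disjnt (ball (fst i) (snd i)) (ball (fst j) (snd j))) C"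
     "negligible (\<Omega> - (\<Union>i\<in>C. ball (fst i) (snd i)))"
    by (rule Vitali_covering_theorem_balls[of \<Omega> ?K fst snd, OF *]) 
  have "disjoint_family_on (\<lambda>c. ball (fst c) (snd c)) C"
    using C(3) unfolding pairwise_def disjoint_family_on_def disjnt_def by blast
  then show thesis using that C by blast
qed

lemma finite_ball_subcovering:
  fixes \<Omega> :: "'a::euclidean_space set"
  assumes \<Omega>: "open \<Omega>" "emeasure lborel \<Omega> < \<infinity>" and C: "countable C"
    "\<And>c. c \<in> C \<Longrightarrow> ball (fst c) (snd c) \<subseteq> \<Omega>"
    "negligible (\<Omega> - (\<Union>c\<in>C. ball (fst c) (snd c)))" and e: "0 < e"
  obtains F where "finite F" "F \<subseteq> C"
    "measure lborel (\<Omega> - (\<Union>c\<in>F. ball (fst c) (snd c))) < e"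
proof (cases "C = {}")
  case True
  then have "negligible \<Omega>" using C(3) by simp
  then have "emeasure lebesgue \<Omega> = 0" using \<Omega>(1) by (simp add: negligible_iff_emeasure0 lmeasurable_open)
  then have "measure lborel \<Omega> = 0" using \<Omega>(1) by (simp add: measure_def)
  then show thesis using that[of "{}"] e by simp
next
  case False
  let ?b = "\<lambda>c. ball (fst c) (snd c)"
  define A where "A k = (\<Union>i<k. ?b (from_nat_into C i))" for k
  have "?b (from_nat_into C i) \<subseteq> \<Omega>" for i by (rule C(2)[OF from_nat_into[OF False]])
  then have A: "A k \<in> sets lborel" "A k \<subseteq> \<Omega>" for k
    unfolding A_def by (auto simp del: mem_ball)
  have UA: "(\<Union>k. A k) = (\<Union>c\<in>C. ?b c)"
  proof -
    have "(\<Union>k. A k) = (\<Union>i. ?b (from_nat_into C i))" unfolding A_def by blast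
    also have "\<dots> = (\<Union>c\<in>range (from_nat_into C). ?b c)" by blast
    finally show ?thesis by (simp add: range_from_nat_into[OF False C(1)])
  qed
  have "(\<lambda>k. measure lborel (A k)) \<longlonglongrightarrow> measure lborel (\<Union>k. A k)"
  proof (rule Lim_measure_incseq)
    show "incseq A" by (force simp: incseq_def A_def)
    have "emeasure lborel (\<Union>k. A k) \<le> emeasure lborel \<Omega>" using A \<Omega> by (intro emeasure_mono) auto
    then show "emeasure lborel (\<Union>k. A k) \<noteq> \<infinity>" using \<Omega>(2) by (auto simp: top_unique)
  qed (use A in auto)
  moreover have "measure lborel (\<Union>k. A k) = measure lborel \<Omega>"
  proof -
    have "\<Omega> - (\<Union>k. A k) \<in> null_sets lebesgue" using C(3) unfolding UA negligible_iff_null_sets .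
    moreover have "\<Omega> - (\<Union>k. A k) \<in> sets lborel" using A \<Omega>(1) by auto
    ultimately have "emeasure lborel (\<Omega> - (\<Union>k. A k)) = 0" by (simp add: null_sets_def)
    then have n: "\<Omega> - (\<Union>k. A k) \<in> null_sets lborel" using A \<Omega>(1) by (auto intro!: null_setsI)
    have "(\<Union>k. A k) = \<Omega> - (\<Omega> - (\<Union>k. A k))" using A by blast
    then show ?thesis using measure_Diff_null_set[OF _ n, of \<Omega>] \<Omega>(1) by simp
  qed
  ultimately have "(\<lambda>k. measure lborel (A k)) \<longlonglongrightarrow> measure lborel \<Omega>" by simp
  then have "\<forall>\<^sub>F k in sequentially. measure lborel \<Omega> - e < measure lborel (A k)"
    using e by (intro order_tendstoD) auto
  then obtain k where k: "measure lborel \<Omega> - e < measure lborel (A k)" by (auto simp: eventually_sequentially)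
  show thesis
  proof (rule that)
    have "measure lborel (\<Omega> - A k) = measure lborel \<Omega> - measure lborel (A k)"
      using A \<Omega> by (intro measure_Diff) auto
    then show "measure lborel (\<Omega> - (\<Union>c\<in>from_nat_into C ` {..<k}. ?b c)) < e"
      using k by (simp add: A_def)
  qed (use from_nat_into[OF False] in auto)
qed

text \<open>The volume r^n cancels against (2r)^(n + \<sigma>) and leaves r^\<sigma>, which is small
  for small balls. This gain is the source of compactness, with \<sigma> = s p later.\<close>

lemma ball_ratio:
  assumes "0 < r" "r < \<delta>" "0 < \<sigma>"
  shows "(2 * r) powr (real DIM('a) + \<sigma>) / measure lborel (ball (a::'a::euclidean_space) r)
     \<le> 2 powr (real DIM('a) + \<sigma>) / unit_ball_vol (real DIM('a)) * \<delta> powr \<sigma>"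
proof -
  have m: "measure lborel (ball a r) = unit_ball_vol (real DIM('a)) * r powr real DIM('a)"
    using content_ball[of r a] assms(1) by (simp add: powr_realpow)
  have "(2 * r) powr (real DIM('a) + \<sigma>) = 2 powr (real DIM('a) + \<sigma>) * (r powr real DIM('a) * r powr \<sigma>)"
    using assms by (simp add: powr_mult powr_add)
  then have "(2 * r) powr (real DIM('a) + \<sigma>) / measure lborel (ball a r) =
     2 powr (real DIM('a) + \<sigma>) / unit_ball_vol (real DIM('a)) * r powr \<sigma>"
    using assms(1) by (simp add: m)
  also have "\<dots> \<le> 2 powr (real DIM('a) + \<sigma>) / unit_ball_vol (real DIM('a)) * \<delta> powr \<sigma>"
    using assms by (intro mult_left_mono powr_mono2) auto
  finally show ?thesis .
qed

text \<open>A fractional Rellich theorem without any regularity of the domain: on small balls a function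
  of bounded energy is close to its mean, and the means converge along a diagonal sequence.\<close>

theorem gagliardo_compactness:
  fixes v :: "nat \<Rightarrow> 'a::euclidean_space \<Rightarrow> 'b::euclidean_space"
  assumes v[measurable]: "\<And>j. v j \<in> borel_measurable borel" and R: "\<And>j x. norm (v j x) \<le> R"
    and p: "1 \<le> p" and \<sigma>: "0 < \<sigma>" and \<Omega>: "open \<Omega>" "emeasure lborel \<Omega> < \<infinity>"
    and int: "\<And>j. integrable (gagliardo_measure (real DIM('a) + \<sigma>) \<Omega>) (\<lambda>z. norm (v j (fst z) - v j (snd z)) powr p)"
    and C: "\<And>j. (LINT z|gagliardo_measure (real DIM('a) + \<sigma>) \<Omega>. norm (v j (fst z) - v j (snd z)) powr p) \<le> C"
  obtains r :: "nat \<Rightarrow> nat" where "strict_mono r" "AE x in domain_measure \<Omega>. convergent (\<lambda>j. v (r j) x)"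
proof -
  let ?\<alpha> = "real DIM('a) + \<sigma>" and ?m = "measure lborel" and ?b = "\<lambda>c::'a \<times> real. ball (fst c) (snd c)"
  let ?\<nu> = "gagliardo_measure ?\<alpha> \<Omega>"
  have [measurable]: "\<Omega> \<in> sets borel" using \<Omega>(1) by simp
  have R0: "0 \<le> R" using R[of 0 0] norm_ge_zero order_trans by blast
  have C0: "0 \<le> C" using C[of 0] by (rule order_trans[rotated]) simp
  \<comment> \<open>One covering by disjoint balls of radius below 1/(m+1) is fixed for each m in
    advance, so that countably many balls occur in total and a single diagonal subsequence makes all
    their means converge.\<close>
  define good where "good m K \<longleftrightarrow> countable K \<and>
      (\<forall>c\<in>K. 0 < snd c \<and> snd c < inverse (real (Suc m)) \<and> ?b c \<subseteq> \<Omega>) \<and>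
      disjoint_family_on ?b K \<and> negligible (\<Omega> - (\<Union>c\<in>K. ?b c))" for m K
  have "\<exists>K. good m K" for m
  proof -
    have "0 < inverse (real (Suc m))" by simp
    then obtain K where "countable K"
      "\<And>c. c \<in> K \<Longrightarrow> 0 < snd c \<and> snd c < inverse (real (Suc m)) \<and> ?b c \<subseteq> \<Omega>"
      "disjoint_family_on ?b K" "negligible (\<Omega> - (\<Union>c\<in>K. ?b c))"
      by (rule ball_covering[OF \<Omega>(1)]) blast
    then show ?thesis unfolding good_def by blast
  qed
  then obtain K where "\<And>m. good m (K m)" by metis
  then have K: "\<And>m. countable (K m)"
      "\<And>m c. c \<in> K m \<Longrightarrow> 0 < snd c \<and> snd c < inverse (real (Suc m)) \<and> ?b c \<subseteq> \<Omega>"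
      "\<And>m. disjoint_family_on ?b (K m)" "\<And>m. negligible (\<Omega> - (\<Union>c\<in>K m. ?b c))"
    unfolding good_def by blast+
  define a where "a c j = (LINT x|lborel. indicator (?b c) x *\<^sub>R v j x)" for c j
  have fin: "emeasure lborel (?b c) < \<infinity>" for c by (intro emeasure_bounded_finite bounded_ball)
  have abd: "norm (a c j) \<le> R * ?m (?b c)" for c j
  proof -
    have "norm (a c j) \<le> (LINT x|lborel. R * indicator (?b c) x)"
      unfolding a_def
    proof (rule order_trans[OF integral_norm_bound integral_mono])
      show "integrable lborel (\<lambda>x. norm (indicator (?b c) x *\<^sub>R v j x))"
        by (intro integrable_norm integrable_bounded_on_finite_set[of _ _ _ R]) (use fin R in auto)
      show "integrable lborel (\<lambda>x. R * indicator (?b c) x)" using fin by simp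
    qed (use R R0 in \<open>auto simp: indicator_def\<close>)
    then show ?thesis by simp
  qed
  have cK: "countable (\<Union>m. K m)" using K(1) by simp
  have bK: "bounded (range (a c))" for c using abd[of c] by (auto simp: bounded_iff)
  have "\<exists>r0. strict_mono r0 \<and> (\<forall>c\<in>(\<Union>m. K m). convergent (\<lambda>j. a c (r0 j)))"
    by (rule diagonal_convergent_subsequence[of _ a, OF cK bK]) (intro exI conjI ballI)
  then obtain r0 :: "nat \<Rightarrow> nat" where r0: "strict_mono r0" and conv: "\<And>c. c \<in> (\<Union>m. K m) \<Longrightarrow> convergent (\<lambda>j. a c (r0 j))"
    by blast
  define w where "w j = v (r0 j)" for j
  have w[measurable]: "w j \<in> borel_measurable borel" for j by (simp add: w_def)
  have wR: "norm (w j x) \<le> R" for j x by (simp add: w_def R)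
  have idom: "integrable (domain_measure \<Omega>) u \<longleftrightarrow> integrable lborel (\<lambda>x. indicator \<Omega> x *\<^sub>R u x)"
    if "u \<in> borel_measurable borel" for u :: "'a \<Rightarrow> 'b"
    by (rule integrable_domain_measure[OF \<Omega>(1) that])
  have wint: "integrable (domain_measure \<Omega>) (w j)" for j
    unfolding idom[OF w] by (rule integrable_bounded_on_finite_set[of _ _ _ R]) (use \<Omega> wR in auto)
  have cauchy: "\<exists>M. \<forall>i\<ge>M. \<forall>j\<ge>M. (LINT x|domain_measure \<Omega>. norm (w i x - w j x)) < e" if e: "0 < e" for e
  proof -
    define V where "V = ?m \<Omega>"
    have V: "0 \<le> V" by (simp add: V_def)
    \<comment> \<open>Four errors share e, each below e/4: the threshold \<theta>, the energies
      weighted with \<kappa> (small balls), the part of \<Omega> outside finitely many balls, and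
      the differences of the means on those balls.\<close>
    define \<theta> where "\<theta> = e / (8 * (V + 1))"
    have \<theta>: "0 < \<theta>" "2 * \<theta> * V < e / 4"
    proof -
      show "0 < \<theta>" using e V by (simp add: \<theta>_def)
      have "2 * \<theta> * V < 2 * \<theta> * (V + 1)" using \<open>0 < \<theta>\<close> by simp
      also have "\<dots> = e / 4" using V by (simp add: \<theta>_def field_simps)
      finally show "2 * \<theta> * V < e / 4" .
    qed
    define \<kappa> where "\<kappa> m = \<theta> powr (1 - p) * (2 powr ?\<alpha> / unit_ball_vol (real DIM('a)) * inverse (real (Suc m)) powr \<sigma>)" for m
    have \<kappa>pos: "0 \<le> \<kappa> m" for m by (simp add: \<kappa>_def)
    have "(\<lambda>m. inverse (real (Suc m)) powr \<sigma>) \<longlonglongrightarrow> 0"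
      using tendsto_powr'[OF LIMSEQ_inverse_real_of_nat tendsto_const, of \<sigma>] \<sigma> by simp
    then have "(\<lambda>m. \<kappa> m * (2 * C)) \<longlonglongrightarrow> \<theta> powr (1 - p) * (2 powr ?\<alpha> / unit_ball_vol (real DIM('a)) * 0) * (2 * C)"
      unfolding \<kappa>_def by (intro tendsto_intros)
    then have "\<forall>\<^sub>F m in sequentially. \<kappa> m * (2 * C) < e / 4" using e by (intro order_tendstoD) auto
    then obtain m where m: "\<kappa> m * (2 * C) < e / 4" by (auto simp: eventually_sequentially)
    have eR: "0 < e / (8 * (R + 1))" using e R0 by simp
    have Ks: "?b c \<subseteq> \<Omega>" if "c \<in> K m" for c using K(2)[OF that] by blast
    obtain F where F: "finite F" "F \<subseteq> K m" and Fm: "?m (\<Omega> - (\<Union>c\<in>F. ?b c)) < e / (8 * (R + 1))"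
      by (rule finite_ball_subcovering[OF \<Omega> K(1)[of m] Ks K(4)[of m] eR])
    have Rm: "2 * R * ?m (\<Omega> - (\<Union>c\<in>F. ?b c)) < e / 4"
    proof -
      have "2 * R * ?m (\<Omega> - (\<Union>c\<in>F. ?b c)) \<le> 2 * (R + 1) * ?m (\<Omega> - (\<Union>c\<in>F. ?b c))"
        by (intro mult_right_mono) auto
      also have "\<dots> < 2 * (R + 1) * (e / (8 * (R + 1)))" using Fm R0 by (intro mult_strict_left_mono) auto
      also have "\<dots> = e / 4" using R0 by (simp add: field_simps)
      finally show ?thesis .
    qed
    have Fd: "disjoint_family_on ?b F" using K(3)[of m] F(2) by (rule disjoint_family_on_mono[rotated])
    have Fd2: "disjoint_family_on (\<lambda>c. ?b c \<times> ?b c) F"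
      using Fd by (simp add: disjoint_family_on_def Times_Int_Times)
    define \<eta> where "\<eta> = e / (4 * (real (card F) + 1))"
    have \<eta>: "0 < \<eta>" "real (card F) * \<eta> < e / 4"
      using e by (auto simp: \<eta>_def field_simps)
    have "\<forall>\<^sub>F M in sequentially. \<forall>i\<ge>M. \<forall>j\<ge>M. norm (a c (r0 i) - a c (r0 j)) < \<eta>" if "c \<in> F" for c
    proof -
      have "Cauchy (\<lambda>j. a c (r0 j))" using conv[of c] that F(2) by (intro convergent_Cauchy) auto
      then obtain M where "\<forall>i\<ge>M. \<forall>j\<ge>M. norm (a c (r0 i) - a c (r0 j)) < \<eta>"
        using \<eta>(1) unfolding Cauchy_iff by blast
      then show ?thesis unfolding eventually_sequentially by (intro exI[of _ M]) (meson order_trans)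
    qed
    then have "\<forall>\<^sub>F M in sequentially. \<forall>c\<in>F. \<forall>i\<ge>M. \<forall>j\<ge>M. norm (a c (r0 i) - a c (r0 j)) < \<eta>"
      using F(1) by (simp add: eventually_ball_finite_distrib)
    then obtain M where "\<forall>c\<in>F. \<forall>i\<ge>M. \<forall>j\<ge>M. norm (a c (r0 i) - a c (r0 j)) < \<eta>"
      unfolding eventually_sequentially by blast
    then have M: "\<And>c i j. c \<in> F \<Longrightarrow> M \<le> i \<Longrightarrow> M \<le> j \<Longrightarrow> norm (a c (r0 i) - a c (r0 j)) < \<eta>"
      by blast
    have "(LINT x|domain_measure \<Omega>. norm (w i x - w j x)) < e" if ij: "M \<le> i" "M \<le> j" for i j
    proof -
      let ?g = "\<lambda>x. norm (w i x - w j x)"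
      let ?I = "\<lambda>k c. LINT z|?\<nu>. indicator (?b c \<times> ?b c) z * norm (w k (fst z) - w k (snd z)) powr p"
      have gR: "?g x \<le> 2 * R" for x
        using norm_triangle_ineq4[of "w i x" "w j x"] wR[of i x] wR[of j x] by linarith
      have ig: "integrable lborel (\<lambda>x. indicator A x * ?g x)" if "A \<in> sets borel" "emeasure lborel A < \<infinity>" for A
        using integrable_bounded_on_finite_set[of A lborel ?g "2 * R"] that gR by simp
      have osc: "(LINT x|lborel. indicator (?b c) x * ?g x) \<le>
          2 * \<theta> * ?m (?b c) + \<kappa> m * (?I i c + ?I j c) + \<eta>" if c: "c \<in> F" for c
      proof -
        have cK: "0 < snd c" "snd c < inverse (real (Suc m))" "?b c \<subseteq> \<Omega>" using K(2) F(2) c by blast+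
        let ?B = "?m (?b c)"
        have B: "0 < ?B" using cK(1) by (simp add: content_ball_pos)
        let ?t = "\<theta> powr (1 - p) * (2 * snd c) powr ?\<alpha>"
        have 1: "(LINT z|lborel. indicator (?b c \<times> ?b c) z * norm (w k (fst z) - w k (snd z)))
            \<le> \<theta> * ?B\<^sup>2 + ?t * ?I k c" for k
          by (rule mean_oscillation_ball_le[OF w wR p _ \<Omega>(1) cK(1,3) \<theta>(1)])
            (use int \<sigma> in \<open>auto simp: w_def\<close>)
        have "?B * norm (a c (r0 i) - a c (r0 j)) \<le> ?B * \<eta>" 
          using M[OF c ij] B by (intro mult_left_mono) auto
        then have "?B * (LINT x|lborel. indicator (?b c) x * ?g x)
            \<le> (\<theta> * ?B\<^sup>2 + ?t * ?I i c) + (\<theta> * ?B\<^sup>2 + ?t * ?I j c) + ?B * \<eta>"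
          using L1_dist_le_oscillation[OF w[of i] w[of j] wR wR cK(1), where a = "fst c"] 1[of i] 1[of j]
          unfolding a_def w_def[symmetric] by linarith
        also have "\<dots> = ?B * (2 * \<theta> * ?B + ?t / ?B * (?I i c + ?I j c) + \<eta>)"
          using B by (simp add: field_simps power2_eq_square)
        finally have "(LINT x|lborel. indicator (?b c) x * ?g x) \<le> 2 * \<theta> * ?B + ?t / ?B * (?I i c + ?I j c) + \<eta>"
          using B by simp
        moreover have "?t / ?B * (?I i c + ?I j c) \<le> \<kappa> m * (?I i c + ?I j c)"
        proof (rule mult_right_mono)
          have "\<theta> powr (1 - p) * ((2 * snd c) powr ?\<alpha> / ?B) \<le> \<kappa> m"
            unfolding \<kappa>_def by (intro mult_left_mono ball_ratio cK \<sigma>) auto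
          then show "?t / ?B \<le> \<kappa> m" by simp
          show "0 \<le> ?I i c + ?I j c" by (intro add_nonneg_nonneg integral_nonneg) auto
        qed
        ultimately show ?thesis by linarith
      qed
      have sI: "(\<Sum>c\<in>F. ?I k c) \<le> C" for k
      proof -
        have "(\<Sum>c\<in>F. ?I k c) \<le> (LINT z|?\<nu>. norm (w k (fst z) - w k (snd z)) powr p)"
          by (rule sum_integral_disjoint_le[OF F(1) Fd2]) (use int in \<open>auto simp: w_def\<close>)
        also have "\<dots> \<le> C" using C by (simp add: w_def)
        finally show ?thesis .
      qed
      have Um: "(\<Union>c\<in>F. ?b c) \<in> sets borel" by (intro borel_open open_UN ballI open_ball)
      have Us: "(\<Union>c\<in>F. ?b c) \<subseteq> \<Omega>" using K(2) F(2) by blast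
      have sB: "(\<Sum>c\<in>F. ?m (?b c)) \<le> V"
      proof -
        have "(\<Sum>c\<in>F. ?m (?b c)) = ?m (\<Union>c\<in>F. ?b c)"
          using fin by (intro measure_finite_Union[OF F(1) _ Fd, symmetric]) (auto simp: top_unique less_top)
        also have "\<dots> \<le> V" unfolding V_def
          using Us Um \<Omega> by (intro measure_mono_fmeasurable) (auto simp: fmeasurable_def)
        finally show ?thesis .
      qed
      have Dm: "\<Omega> - (\<Union>c\<in>F. ?b c) \<in> sets borel" using Um by simp
      have Df: "emeasure lborel (\<Omega> - (\<Union>c\<in>F. ?b c)) < \<infinity>"
        using \<Omega> by (intro le_less_trans[OF emeasure_mono \<Omega>(2)]) auto
      have "(LINT x|domain_measure \<Omega>. ?g x) = (LINT x|lborel. indicator \<Omega> x * ?g x)"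
        by (subst integral_domain_measure[OF \<Omega>(1)]) auto
      also have "\<dots> = (LINT x|lborel. indicator (\<Omega> - (\<Union>c\<in>F. ?b c)) x * ?g x + (\<Sum>c\<in>F. indicator (?b c) x * ?g x))"
      proof (intro Bochner_Integration.integral_cong refl)
        fix x
        have "indicator \<Omega> x = indicator (\<Omega> - (\<Union>c\<in>F. ?b c)) x + (indicator (\<Union>c\<in>F. ?b c) x :: real)"
          using Us by (cases "x \<in> (\<Union>c\<in>F. ?b c)"; cases "x \<in> \<Omega>") (simp_all add: indicator_def subset_eq del: UN_iff mem_ball, blast?)
        then show "indicator \<Omega> x * ?g x = indicator (\<Omega> - (\<Union>c\<in>F. ?b c)) x * ?g x + (\<Sum>c\<in>F. indicator (?b c) x * ?g x)"
          by (simp only: indicator_UN_disjoint[OF F(1) Fd] distrib_right sum_distrib_right)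
      qed
      also have "\<dots> = (LINT x|lborel. indicator (\<Omega> - (\<Union>c\<in>F. ?b c)) x * ?g x) + (\<Sum>c\<in>F. LINT x|lborel. indicator (?b c) x * ?g x)"
        using ig[OF Dm Df] ig fin by (subst Bochner_Integration.integral_add) auto
      finally have split: "(LINT x|domain_measure \<Omega>. ?g x) = (LINT x|lborel. indicator (\<Omega> - (\<Union>c\<in>F. ?b c)) x * ?g x)
          + (\<Sum>c\<in>F. LINT x|lborel. indicator (?b c) x * ?g x)" .
      have "(LINT x|lborel. indicator A x * ?g x) \<le> 2 * R * ?m A" if "A \<in> sets borel" "emeasure lborel A < \<infinity>" for A
      proof -
        have "(LINT x|lborel. indicator A x * ?g x) \<le> (LINT x|lborel. 2 * R * indicator A x)"
          using gR that by (intro integral_mono ig integrable_mult_right integrable_real_indicator) (auto simp: indicator_def)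
        then show ?thesis by simp
      qed
      from this[OF Dm Df]
      have rest: "(LINT x|lborel. indicator (\<Omega> - (\<Union>c\<in>F. ?b c)) x * ?g x) \<le> 2 * R * ?m (\<Omega> - (\<Union>c\<in>F. ?b c))" .
      have "(\<Sum>c\<in>F. LINT x|lborel. indicator (?b c) x * ?g x) \<le> (\<Sum>c\<in>F. 2 * \<theta> * ?m (?b c) + \<kappa> m * (?I i c + ?I j c) + \<eta>)"
        by (intro sum_mono osc)
      also have "\<dots> = 2 * \<theta> * (\<Sum>c\<in>F. ?m (?b c)) + \<kappa> m * ((\<Sum>c\<in>F. ?I i c) + (\<Sum>c\<in>F. ?I j c)) + real (card F) * \<eta>"
        by (simp add: sum.distrib sum_distrib_left distrib_left)
      also have "\<dots> \<le> 2 * \<theta> * V + \<kappa> m * (C + C) + real (card F) * \<eta>"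
        using \<theta>(1) \<kappa>pos[of m] by (intro add_mono mult_left_mono sB sI order_refl) auto
      finally have "(\<Sum>c\<in>F. LINT x|lborel. indicator (?b c) x * ?g x) \<le> 2 * \<theta> * V + \<kappa> m * (2 * C) + real (card F) * \<eta>"
        by simp
      then show ?thesis using split rest Rm \<theta>(2) m \<eta>(2) by linarith
    qed
    then show ?thesis by blast
  qed
  obtain r1 where r1: "strict_mono r1" "AE x in domain_measure \<Omega>. Cauchy (\<lambda>i. w (r1 i) x)"
    by (rule cauchy_L1_AE_cauchy_subseq[OF wint cauchy])
  show thesis
  proof (rule that)
    show "strict_mono (r0 \<circ> r1)" using r0 r1(1) by (rule strict_mono_o)
    show "AE x in domain_measure \<Omega>. convergent (\<lambda>j. v ((r0 \<circ> r1) j) x)"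
      using r1(2) by eventually_elim (simp add: w_def Cauchy_convergent_iff)
  qed
qed

section \<open>The gradient of the p-th power of the norm, and two convergence theorems\<close>

definition dual_map :: "real \<Rightarrow> 'b::real_normed_vector \<Rightarrow> 'b" where
  "dual_map p a = norm a powr (p - 2) *\<^sub>R a"

lemma norm_dual_map: assumes "1 < p" shows "norm (dual_map p a) = norm a powr (p - 1)"
proof (cases "a = 0")
  case False
  then have "norm a powr (p - 2) * norm a powr 1 = norm a powr (p - 1)"
    by (subst powr_add[symmetric]) simp
  then show ?thesis using False by (simp add: dual_map_def)
qed (simp add: dual_map_def)

lemma inner_dual_map_self: "dual_map p a \<bullet> a = norm a powr p"
proof (cases "a = 0")
  case False
  then have "norm a powr (p - 2) * norm a powr 2 = norm a powr p"
    by (subst powr_add[symmetric]) simp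
  then show ?thesis using False by (simp add: dual_map_def dot_square_norm powr_numeral)
qed (simp add: dual_map_def)

lemma isCont_dual_map:
  assumes "1 < p" shows "isCont (dual_map p) (a :: 'b::real_normed_vector)"
proof (cases "a = 0")
  case True
  have "((\<lambda>x::'b. norm x powr (p - 1)) \<longlongrightarrow> norm (0::'b) powr (p - 1)) (at 0)"
    using assms by (intro tendsto_powr' tendsto_intros) auto
  then have "((\<lambda>x::'b. norm (dual_map p x)) \<longlongrightarrow> 0) (at 0)"
    using assms by (simp add: norm_dual_map[OF assms])
  moreover have "dual_map p (0::'b) = 0" by (simp add: dual_map_def)
  ultimately have "(dual_map p \<longlongrightarrow> dual_map p (0::'b)) (at 0)"
    using tendsto_norm_zero_cancel by metis
  then show ?thesis using True by (simp only: isCont_def)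
next
  case False
  then show ?thesis unfolding dual_map_def by (intro continuous_intros) auto
qed

lemma tendsto_dual_map:
  "1 < p \<Longrightarrow> (f \<longlongrightarrow> l) F \<Longrightarrow> ((\<lambda>x. dual_map p (f x)) \<longlongrightarrow> dual_map p l) F"
  by (rule isCont_tendsto_compose[OF isCont_dual_map])

lemma dual_map_measurable [measurable]:
  "dual_map p \<in> borel_measurable (borel :: 'b::{second_countable_topology, real_normed_vector} measure)"
  unfolding dual_map_def by measurable

text \<open>The subgradient inequality for |a|^p / p at b: it is Young's inequality for |b|^(p-1)
  |a| with the conjugate exponents p and p/(p-1).\<close>

lemma convexity_powr_norm:
  fixes a b :: "'b::real_inner"
  assumes p: "1 < p"
  shows "norm b powr p / p - norm a powr p / p \<le> dual_map p b \<bullet> (b - a)"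
proof -
  define q where "q = p / (p - 1)"
  have q: "1 < q" "1 / p + 1 / q = 1" "(p - 1) * q = p" using p by (auto simp: q_def field_simps)
  have "dual_map p b \<bullet> a \<le> norm (dual_map p b) * norm a" by (rule norm_cauchy_schwarz)
  also have "\<dots> = norm a * norm b powr (p - 1)" by (simp add: norm_dual_map[OF p])
  also have "\<dots> \<le> norm a powr p / p + (norm b powr (p - 1)) powr q / q"
    using p q by (intro Youngs_inequality) auto
  also have "(norm b powr (p - 1)) powr q = norm b powr p" by (simp add: powr_powr q(3))
  also have "norm b powr p / q = norm b powr p - norm b powr p / p"
  proof -
    have "1 / q = 1 - 1 / p" using q(2) by simp
    then have "norm b powr p * (1 / q) = norm b powr p * (1 - 1 / p)" by simp
    then show ?thesis by (simp add: right_diff_distrib)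
  qed
  finally show ?thesis by (simp add: inner_diff_right inner_dual_map_self)
qed

text \<open>Young's inequality with a small factor in front of a^p, by comparing b with \<delta> a.
  This is what makes the first variation nearly dominated in the sense used below.\<close>

lemma powr_mult_le_eps:
  fixes a b :: real
  assumes "1 < p" "0 < \<delta>" "0 \<le> a" "0 \<le> b"
  shows "a powr (p - 1) * b \<le> \<delta> * a powr p + \<delta> powr (1 - p) * b powr p"
proof (cases "b \<le> \<delta> * a")
  case True
  then have "a powr (p - 1) * b \<le> a powr (p - 1) * (\<delta> * a)" by (intro mult_left_mono) auto
  also have "\<dots> = \<delta> * (a powr (p - 1) * a powr 1)" using assms by simp
  also have "a powr (p - 1) * a powr 1 = a powr p" by (subst powr_add[symmetric]) simp
  finally show ?thesis by (smt (verit) mult_nonneg_nonneg powr_ge_zero)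
next
  case False
  then have b: "0 < b" "a < b / \<delta>" using assms by (auto simp: field_simps) (smt (verit) mult_nonneg_nonneg)
  have "a powr (p - 1) * b \<le> (b / \<delta>) powr (p - 1) * b"
    using assms b by (intro mult_right_mono powr_mono2) auto
  also have "\<dots> = \<delta> powr (1 - p) * (b powr (p - 1) * b powr 1)"
    using assms b by (simp add: powr_divide powr_diff field_simps)
  also have "b powr (p - 1) * b powr 1 = b powr p" by (subst powr_add[symmetric]) simp
  finally show ?thesis using assms by (smt (verit) mult_nonneg_nonneg powr_ge_zero)
qed

lemma powr_add_le:
  fixes a b :: real
  assumes "0 \<le> p" "0 \<le> a" "0 \<le> b" shows "(a + b) powr p \<le> 2 powr p * (a powr p + b powr p)"
proof -
  have "(a + b) powr p \<le> (2 * max a b) powr p" using assms by (intro powr_mono2) auto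
  also have "\<dots> = 2 powr p * (max a b) powr p" using assms by (simp add: powr_mult)
  also have "\<dots> \<le> 2 powr p * (a powr p + b powr p)" by (intro mult_left_mono) (auto simp: max_def)
  finally show ?thesis .
qed

lemma fatou_integral_le:
  fixes f :: "nat \<Rightarrow> 'a \<Rightarrow> real"
  assumes int: "\<And>j. integrable M (f j)" and nn: "\<And>j x. 0 \<le> f j x" and C: "\<And>j. integral\<^sup>L M (f j) \<le> C"
    and lim: "AE x in M. (\<lambda>j. f j x) \<longlonglongrightarrow> g x" and g[measurable]: "g \<in> borel_measurable M"
  shows "integrable M g \<and> integral\<^sup>L M g \<le> C"
proof -
  have C0: "0 \<le> C" by (rule order_trans[OF Bochner_Integration.integral_nonneg C[of 0]]) (simp add: nn)
  have g0: "AE x in M. 0 \<le> g x"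
    using lim by eventually_elim (rule LIMSEQ_le_const, auto simp: nn)
  have [measurable]: "f j \<in> borel_measurable M" for j using int by auto
  have "(\<integral>\<^sup>+x. ennreal (g x) \<partial>M) = (\<integral>\<^sup>+x. liminf (\<lambda>j. ennreal (f j x)) \<partial>M)"
  proof (rule nn_integral_cong_AE)
    show "AE x in M. ennreal (g x) = liminf (\<lambda>j. ennreal (f j x))"
      using lim by eventually_elim
        (rule lim_imp_Liminf[OF trivial_limit_sequentially tendsto_ennrealI, symmetric])
  qed
  also have "\<dots> \<le> liminf (\<lambda>j. \<integral>\<^sup>+x. ennreal (f j x) \<partial>M)" by (rule nn_integral_liminf) simp
  also have "\<dots> \<le> liminf (\<lambda>j. ennreal C)"
    by (rule Liminf_mono) (simp add: nn_integral_eq_integral[OF int] nn C ennreal_leI)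
  also have "\<dots> = ennreal C" by (simp add: Liminf_const)
  finally have le: "(\<integral>\<^sup>+x. ennreal (g x) \<partial>M) \<le> ennreal C" .
  have i: "integrable M g"
    by (rule integrableI_nonneg[OF g g0]) (rule le_less_trans[OF le], simp)
  then show ?thesis using le g0 C0 by (simp add: nn_integral_eq_integral)
qed

text \<open>A form of Vitali's convergence theorem: domination only up to a small multiple of an
  \<open>L\<^sup>1\<close>-bounded sequence.\<close>

lemma tendsto_integral_nearly_dominated:
  fixes a :: "nat \<Rightarrow> 'a \<Rightarrow> real"
  assumes [measurable]: "\<And>j. a j \<in> borel_measurable M" "a' \<in> borel_measurable M"
    and lim: "AE x in M. (\<lambda>j. a j x) \<longlonglongrightarrow> a' x"
    and b: "\<And>j. integrable M (b j)" "\<And>j x. 0 \<le> b j x" "\<And>j. integral\<^sup>L M (b j) \<le> C"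
    and b': "integrable M b'" "\<And>x. 0 \<le> b' x" "integral\<^sup>L M b' \<le> C"
    and dom: "\<And>\<delta>::real. 0 < \<delta> \<Longrightarrow> \<exists>G. integrable M G \<and> (\<forall>x. 0 \<le> G x) \<and>
      (\<forall>j x. \<bar>a j x\<bar> \<le> \<delta> * b j x + G x) \<and> (\<forall>x. \<bar>a' x\<bar> \<le> \<delta> * b' x + G x)"
  shows "(\<lambda>j. integral\<^sup>L M (a j)) \<longlonglongrightarrow> integral\<^sup>L M a'"
proof -
  have C0: "0 \<le> C" by (rule order_trans[OF Bochner_Integration.integral_nonneg b'(3)]) (simp add: b'(2))
  have ia: "integrable M (a j)" for j
  proof -
    obtain G where G: "integrable M G" "\<And>x. 0 \<le> G x" "\<And>x. \<bar>a j x\<bar> \<le> 1 * b j x + G x" using dom[of 1] by auto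
    show ?thesis
      by (rule Bochner_Integration.integrable_bound[OF Bochner_Integration.integrable_add[OF b(1)[of j] G(1)]])
        (use G b in \<open>auto simp: abs_of_nonneg intro!: AE_I2\<close>)
  qed
  have ia': "integrable M a'"
  proof -
    obtain G where G: "integrable M G" "\<And>x. 0 \<le> G x" "\<And>x. \<bar>a' x\<bar> \<le> 1 * b' x + G x" using dom[of 1] by auto
    show ?thesis
      by (rule Bochner_Integration.integrable_bound[OF Bochner_Integration.integrable_add[OF b'(1) G(1)]])
        (use G b' in \<open>auto simp: abs_of_nonneg intro!: AE_I2\<close>)
  qed
  show ?thesis
  proof (rule LIMSEQ_I)
    fix e :: real assume e: "0 < e"
    define \<delta> where "\<delta> = e / (4 * (C + 1))"
    have \<delta>: "0 < \<delta>" "2 * \<delta> * C < e / 2" 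
    proof -
      show "0 < \<delta>" using e C0 by (simp add: \<delta>_def)
      then have "2 * \<delta> * C < 2 * \<delta> * (C + 1)" by simp
      also have "\<dots> = e / 2" using C0 by (simp add: \<delta>_def field_simps)
      finally show "2 * \<delta> * C < e / 2" .
    qed
    from dom[OF \<delta>(1)] obtain G where G: "integrable M G" "\<And>x. 0 \<le> G x"
      "\<And>j x. \<bar>a j x\<bar> \<le> \<delta> * b j x + G x" "\<And>x. \<bar>a' x\<bar> \<le> \<delta> * b' x + G x" by auto
    \<comment> \<open>The excess of |a j - a'| over the small multiple of the bounds is at most 2 G
      and tends to 0, so dominated convergence applies to it. The discarded part integrates to at
      most 2 \<delta> C, uniformly in j.\<close>
    define c where "c j x = max 0 (\<bar>a j x - a' x\<bar> - \<delta> * (b j x + b' x))" for j x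
    have [measurable]: "b j \<in> borel_measurable M" "b' \<in> borel_measurable M" for j using b b' by auto
    have c1: "c j x \<le> 2 * G x" for j x
      using G(2)[of x] G(3)[of j x] G(4)[of x] by (simp add: c_def distrib_left)
    have c0: "0 \<le> c j x" for j x by (simp add: c_def)
    have c2: "c j x \<le> \<bar>a j x - a' x\<bar>" for j x
      using b(2)[of j x] b'(2)[of x] \<delta>(1) by (simp add: c_def)
    have climit: "(\<lambda>j. integral\<^sup>L M (c j)) \<longlonglongrightarrow> integral\<^sup>L M (\<lambda>x. 0)"
    proof (rule integral_dominated_convergence[where w = "\<lambda>x. 2 * G x"])
      show "AE x in M. (\<lambda>j. c j x) \<longlonglongrightarrow> 0"
        using lim
      proof eventually_elim
        case (elim x)
        then have "(\<lambda>j. a j x - a' x) \<longlonglongrightarrow> 0" by (rule LIM_zero)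
        then have "(\<lambda>j. \<bar>a j x - a' x\<bar>) \<longlonglongrightarrow> 0" by (rule tendsto_rabs_zero)
        then show ?case
          by (rule tendsto_sandwich[OF always_eventually always_eventually tendsto_const, rotated 2])
            (auto simp: c0 c2)
      qed
    qed (use G c0 c1 in \<open>auto simp: c_def[abs_def] abs_of_nonneg\<close>)
    have ic: "integrable M (c j)" for j
      by (rule Bochner_Integration.integrable_bound[of M "\<lambda>x. 2 * G x"])
        (use G c0 c1 in \<open>auto simp: c_def[abs_def] abs_of_nonneg\<close>)
    have "\<forall>\<^sub>F j in sequentially. integral\<^sup>L M (c j) < e / 2"
      using climit e by (intro order_tendstoD) auto
    then obtain j0 where j0: "\<And>j. j0 \<le> j \<Longrightarrow> integral\<^sup>L M (c j) < e / 2" by (auto simp: eventually_sequentially)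
    have "norm (integral\<^sup>L M (a j) - integral\<^sup>L M a') < e" if "j0 \<le> j" for j
    proof -
      have "norm (integral\<^sup>L M (a j) - integral\<^sup>L M a') = norm (LINT x|M. a j x - a' x)"
        using ia ia' by simp
      also have "\<dots> \<le> (LINT x|M. norm (a j x - a' x))" by (rule integral_norm_bound)
      also have "\<dots> \<le> (LINT x|M. c j x + \<delta> * (b j x + b' x))"
        using ia ia' ic b(1) b'(1) by (intro integral_mono) (auto simp: c_def)
      also have "\<dots> = integral\<^sup>L M (c j) + \<delta> * (integral\<^sup>L M (b j) + integral\<^sup>L M b')"
        using ic b(1) b'(1) by simp
      also have "\<dots> \<le> integral\<^sup>L M (c j) + \<delta> * (C + C)"
        using b(3)[of j] b'(3) \<delta>(1) by (intro add_left_mono mult_left_mono add_mono) auto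
      also have "\<dots> < e" using j0[OF that] \<delta>(2) by (simp add: algebra_simps)
      finally show ?thesis .
    qed
    then show "\<exists>j0. \<forall>j\<ge>j0. norm (integral\<^sup>L M (a j) - integral\<^sup>L M a') < e" by blast
  qed
qed

subsection \<open>Square integrable functions\<close>

definition square_integrable :: "'a measure \<Rightarrow> ('a \<Rightarrow> 'b::euclidean_space) \<Rightarrow> bool" where
  "square_integrable M f \<longleftrightarrow> f \<in> borel_measurable M \<and> integrable M (\<lambda>x. (norm (f x))\<^sup>2)"

lemma square_integrable_measurable [measurable_dest]: "square_integrable M f \<Longrightarrow> f \<in> borel_measurable M"
  by (simp add: square_integrable_def)

lemma norm_add_sq_le: "(norm (a + b :: 'b::real_normed_vector))\<^sup>2 \<le> 2 * ((norm a)\<^sup>2 + (norm b)\<^sup>2)"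
proof -
  have "(norm (a + b))\<^sup>2 \<le> (norm a + norm b)\<^sup>2" by (intro power_mono norm_triangle_ineq) simp
  also have "\<dots> \<le> 2 * ((norm a)\<^sup>2 + (norm b)\<^sup>2)"
    using zero_le_power2[of "norm a - norm b"] by (simp add: power2_sum power2_diff)
  finally show ?thesis .
qed

lemma square_integrable_scaleR: "square_integrable M f \<Longrightarrow> square_integrable M (\<lambda>x. c *\<^sub>R f x)"
  by (auto simp: square_integrable_def power_mult_distrib)

lemma square_integrable_add:
  assumes "square_integrable M f" "square_integrable M g" shows "square_integrable M (\<lambda>x. f x + g x)"
  unfolding square_integrable_def
proof
  have [measurable]: "f \<in> borel_measurable M" "g \<in> borel_measurable M" using assms by (auto simp: square_integrable_def)
  show "(\<lambda>x. f x + g x) \<in> borel_measurable M" by simp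
  show "integrable M (\<lambda>x. (norm (f x + g x))\<^sup>2)"
    by (rule Bochner_Integration.integrable_bound[of M "\<lambda>x. 2 * ((norm (f x))\<^sup>2 + (norm (g x))\<^sup>2)"])
      (use assms norm_add_sq_le in \<open>auto simp: square_integrable_def\<close>)
qed

lemma square_integrable_diff:
  "square_integrable M f \<Longrightarrow> square_integrable M g \<Longrightarrow> square_integrable M (\<lambda>x. f x - g x)"
  using square_integrable_add[of M f "\<lambda>x. (-1) *\<^sub>R g x"] square_integrable_scaleR[of M g "-1"] by simp

lemma product_le_eps: assumes "0 < (\<delta>::real)" shows "a * b \<le> \<delta> * a\<^sup>2 + b\<^sup>2 / \<delta>"
proof -
  have "0 \<le> (sqrt \<delta> * a - b / sqrt \<delta>)\<^sup>2" by simp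
  also have "\<dots> = \<delta> * a\<^sup>2 - 2 * (a * b) + b\<^sup>2 / \<delta>"
    using assms by (simp add: power2_diff power_mult_distrib power_divide)
  finally have "2 * (a * b) \<le> \<delta> * a\<^sup>2 + b\<^sup>2 / \<delta>" by simp
  moreover have "0 \<le> \<delta> * a\<^sup>2 + b\<^sup>2 / \<delta>" using assms by simp
  ultimately show ?thesis by linarith
qed

lemma integrable_norm_product:
  assumes "square_integrable M f" "square_integrable M g"
  shows "integrable M (\<lambda>x. norm (f x) * norm (g x))"
proof (rule Bochner_Integration.integrable_bound[of M "\<lambda>x. (norm (f x))\<^sup>2 + (norm (g x))\<^sup>2"])
  have [measurable]: "f \<in> borel_measurable M" "g \<in> borel_measurable M" using assms by (auto simp: square_integrable_def)
  show "(\<lambda>x. norm (f x) * norm (g x)) \<in> borel_measurable M" by simp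
qed (use assms product_le_eps[of 1] in \<open>auto simp: square_integrable_def\<close>)

lemma integrable_inner:
  assumes "square_integrable M f" "square_integrable M g"
  shows "integrable M (\<lambda>x. f x \<bullet> g x)"
proof (rule Bochner_Integration.integrable_bound[OF integrable_norm_product[OF assms]])
  have [measurable]: "f \<in> borel_measurable M" "g \<in> borel_measurable M" using assms by (auto simp: square_integrable_def)
  show "(\<lambda>x. f x \<bullet> g x) \<in> borel_measurable M" by simp
qed (simp add: Cauchy_Schwarz_ineq2)

lemma tendsto_integral_norm_product:
  assumes f: "\<And>k. square_integrable M (f k)" and f0: "(\<lambda>k. LINT x|M. (norm (f k x))\<^sup>2) \<longlonglongrightarrow> 0"
    and g: "\<And>k. square_integrable M (g k)" and C: "\<And>k. (LINT x|M. (norm (g k x))\<^sup>2) \<le> C"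
  shows "(\<lambda>k. LINT x|M. norm (f k x) * norm (g k x)) \<longlonglongrightarrow> 0"
proof (rule LIMSEQ_I)
  fix e :: real assume e: "0 < e"
  have C0: "0 \<le> C" using C[of 0] by (rule order_trans[rotated]) simp
  \<comment> \<open>This \<delta> is large: it makes the contribution C/\<delta> of the bounded
    factor small, and the factor tending to 0 absorbs it on the other side.\<close>
  define \<delta> where "\<delta> = 2 * (C + 1) / e"
  have \<delta>: "0 < \<delta>" using e C0 by (simp add: \<delta>_def)
  have C\<delta>: "C / \<delta> < e / 2" using e C0 by (simp add: \<delta>_def field_simps)
  have "\<forall>\<^sub>F k in sequentially. (LINT x|M. (norm (f k x))\<^sup>2) < e / (2 * \<delta>)"
    using f0 e \<delta> by (intro order_tendstoD) auto
  then obtain k0 where k0: "\<And>k. k0 \<le> k \<Longrightarrow> (LINT x|M. (norm (f k x))\<^sup>2) < e / (2 * \<delta>)"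
    by (auto simp: eventually_sequentially)
  have "norm ((LINT x|M. norm (f k x) * norm (g k x)) - 0) < e" if "k0 \<le> k" for k
  proof -
    have "(LINT x|M. norm (f k x) * norm (g k x)) \<le> (LINT x|M. \<delta> * (norm (f k x))\<^sup>2 + (norm (g k x))\<^sup>2 / \<delta>)"
      using integrable_norm_product[OF f[of k] g[of k]] f[of k] g[of k]
      by (intro integral_mono product_le_eps \<delta>) (auto simp: square_integrable_def)
    also have "\<dots> = \<delta> * (LINT x|M. (norm (f k x))\<^sup>2) + (LINT x|M. (norm (g k x))\<^sup>2) / \<delta>"
      using f[of k] g[of k] by (auto simp: square_integrable_def)
    also have "\<dots> \<le> \<delta> * (LINT x|M. (norm (f k x))\<^sup>2) + C / \<delta>"
      using C[of k] \<delta> by (intro add_left_mono divide_right_mono) auto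
    also have "\<dots> < \<delta> * (e / (2 * \<delta>)) + e / 2"
      using k0[OF that] \<delta> C\<delta> by (intro add_strict_mono mult_strict_left_mono) auto
    also have "\<dots> = e" using \<delta> by simp
    finally show ?thesis by simp
  qed
  then show "\<exists>k0. \<forall>k\<ge>k0. norm ((LINT x|M. norm (f k x) * norm (g k x)) - 0) < e" by blast
qed

text \<open>An integrable weight with values in (0, 1] turns a Cauchy sequence in L^2 into one in
  L^1 even when the measure is infinite, so a subsequence converges almost everywhere. Fatou's lemma
  along it then bounds the L^2 distance to the limit.\<close>

lemma (in sigma_finite_measure) L2_complete:
  fixes f :: "nat \<Rightarrow> 'a \<Rightarrow> 'b::euclidean_space"
  assumes f: "\<And>n. square_integrable M (f n)"
    and cauchy: "\<And>e. 0 < e \<Longrightarrow> \<exists>n. \<forall>i\<ge>n. \<forall>j\<ge>n. (LINT x|M. (norm (f i x - f j x))\<^sup>2) < e"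
  shows "\<exists>w. square_integrable M w \<and> (\<lambda>n. LINT x|M. (norm (f n x - w x))\<^sup>2) \<longlonglongrightarrow> 0"
proof -
  obtain \<phi> :: "'a \<Rightarrow> real" where \<phi>: "\<phi> \<in> borel_measurable M" "\<And>x. 0 < \<phi> x" "\<And>x. \<phi> x \<le> 1" "integrable M \<phi>"
    by (rule obtain_positive_integrable_function) blast
  note \<phi>(1)[measurable]
  have fm[measurable]: "f n \<in> borel_measurable M" for n using f[of n] by (simp add: square_integrable_def)
  have d: "square_integrable M (\<lambda>x. f i x - f j x)" for i j by (intro square_integrable_diff f)
  have pt: "norm (\<phi> x *\<^sub>R a) \<le> \<delta> * \<phi> x + (norm a)\<^sup>2 / \<delta>" if "0 < \<delta>" for x and a :: 'b and \<delta>
  proof -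
    have "norm (\<phi> x *\<^sub>R a) = \<phi> x * norm a" using \<phi>(2)[of x] by simp
    also have "\<dots> \<le> \<delta> * (\<phi> x)\<^sup>2 + (norm a)\<^sup>2 / \<delta>" by (rule product_le_eps[OF that])
    finally have "norm (\<phi> x *\<^sub>R a) \<le> \<delta> * (\<phi> x)\<^sup>2 + (norm a)\<^sup>2 / \<delta>" .
    moreover have "\<delta> * (\<phi> x)\<^sup>2 \<le> \<delta> * \<phi> x"
      using \<phi>(2,3)[of x] that by (intro mult_left_mono) (simp_all add: power2_eq_square mult_left_le)
    ultimately show ?thesis by linarith
  qed
  have i1: "integrable M (\<lambda>x. \<phi> x *\<^sub>R g x)" if g: "square_integrable M g" for g :: "'a \<Rightarrow> 'b"
  proof (rule Bochner_Integration.integrable_bound[of M "\<lambda>x. 1 * \<phi> x + (norm (g x))\<^sup>2 / 1"])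
    show "integrable M (\<lambda>x. 1 * \<phi> x + (norm (g x))\<^sup>2 / 1)" using g \<phi> by (simp add: square_integrable_def)
    have [measurable]: "g \<in> borel_measurable M" using g by (simp add: square_integrable_def)
    show "(\<lambda>x. \<phi> x *\<^sub>R g x) \<in> borel_measurable M" by measurable
    show "AE x in M. norm (\<phi> x *\<^sub>R g x) \<le> norm (1 * \<phi> x + (norm (g x))\<^sup>2 / 1)"
      by (intro AE_I2 order_trans[OF pt[of 1]]) auto
  qed
  have "\<exists>n. \<forall>i\<ge>n. \<forall>j\<ge>n. (LINT x|M. norm (\<phi> x *\<^sub>R f i x - \<phi> x *\<^sub>R f j x)) < e" if e: "0 < e" for e
  proof -
    define \<Phi> where "\<Phi> = integral\<^sup>L M \<phi>"
    have \<Phi>: "0 \<le> \<Phi>" unfolding \<Phi>_def using \<phi>(2) by (intro Bochner_Integration.integral_nonneg) (auto intro: less_imp_le)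
    define \<delta> where "\<delta> = e / (2 * (\<Phi> + 1))"
    have \<delta>: "0 < \<delta>" "\<delta> * \<Phi> < e / 2"
    proof -
      show "0 < \<delta>" using e \<Phi> by (simp add: \<delta>_def)
      then have "\<delta> * \<Phi> < \<delta> * (\<Phi> + 1)" by simp
      also have "\<dots> = e / 2" using \<Phi> by (simp add: \<delta>_def field_simps)
      finally show "\<delta> * \<Phi> < e / 2" .
    qed
    obtain n where n: "\<And>i j. n \<le> i \<Longrightarrow> n \<le> j \<Longrightarrow> (LINT x|M. (norm (f i x - f j x))\<^sup>2) < \<delta> * (e / 2)"
      using cauchy[of "\<delta> * (e / 2)"] \<delta> e by auto
    have "(LINT x|M. norm (\<phi> x *\<^sub>R f i x - \<phi> x *\<^sub>R f j x)) < e" if ij: "n \<le> i" "n \<le> j" for i j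
    proof -
      have "(LINT x|M. norm (\<phi> x *\<^sub>R f i x - \<phi> x *\<^sub>R f j x)) \<le> (LINT x|M. \<delta> * \<phi> x + (norm (f i x - f j x))\<^sup>2 / \<delta>)"
      proof (rule integral_mono)
        show "integrable M (\<lambda>x. norm (\<phi> x *\<^sub>R f i x - \<phi> x *\<^sub>R f j x))"
          using integrable_norm[OF i1[OF d[of i j]]] by (simp only: scaleR_diff_right)
        show "integrable M (\<lambda>x. \<delta> * \<phi> x + (norm (f i x - f j x))\<^sup>2 / \<delta>)"
          using d[of i j] \<phi> by (simp add: square_integrable_def)
        show "norm (\<phi> x *\<^sub>R f i x - \<phi> x *\<^sub>R f j x) \<le> \<delta> * \<phi> x + (norm (f i x - f j x))\<^sup>2 / \<delta>" for x
          using pt[OF \<delta>(1), of x "f i x - f j x"] by (simp only: scaleR_diff_right)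
      qed
      also have "\<dots> = \<delta> * \<Phi> + (LINT x|M. (norm (f i x - f j x))\<^sup>2) / \<delta>"
        using d[of i j] \<phi> by (simp add: \<Phi>_def square_integrable_def)
      also have "\<dots> < e / 2 + (\<delta> * (e / 2)) / \<delta>"
        using \<delta> n[OF ij] by (intro add_strict_mono divide_strict_right_mono) auto
      also have "\<dots> = e" using \<delta> by simp
      finally show ?thesis .
    qed
    then show ?thesis by blast
  qed
  then obtain r where r: "strict_mono r" "AE x in M. Cauchy (\<lambda>i. \<phi> x *\<^sub>R f (r i) x)"
    using cauchy_L1_AE_cauchy_subseq[of M "\<lambda>n x. \<phi> x *\<^sub>R f n x", OF i1[OF f]] by blast
  define w where "w x = lim (\<lambda>i. f (r i) x)" for x
  have [measurable]: "w \<in> borel_measurable M" unfolding w_def by measurable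
  have lim: "AE x in M. (\<lambda>i. f (r i) x) \<longlonglongrightarrow> w x"
    using r(2)
  proof eventually_elim
    case (elim x)
    then have "convergent (\<lambda>i. \<phi> x *\<^sub>R f (r i) x)" by (simp add: Cauchy_convergent_iff)
    then obtain l where "(\<lambda>i. \<phi> x *\<^sub>R f (r i) x) \<longlonglongrightarrow> l" by (auto simp: convergent_def)
    then have "(\<lambda>i. (1 / \<phi> x) *\<^sub>R (\<phi> x *\<^sub>R f (r i) x)) \<longlonglongrightarrow> (1 / \<phi> x) *\<^sub>R l" by (intro tendsto_intros)
    then have "(\<lambda>i. f (r i) x) \<longlonglongrightarrow> (1 / \<phi> x) *\<^sub>R l" using \<phi>(2)[of x] by simp
    then have "convergent (\<lambda>i. f (r i) x)" by (rule convergentI)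
    then show ?case unfolding w_def by (simp add: convergent_LIMSEQ_iff)
  qed
  have close: "integrable M (\<lambda>x. (norm (f i x - w x))\<^sup>2) \<and> (LINT x|M. (norm (f i x - w x))\<^sup>2) \<le> e"
    if n: "\<And>i j. n \<le> i \<Longrightarrow> n \<le> j \<Longrightarrow> (LINT x|M. (norm (f i x - f j x))\<^sup>2) < e" and i: "n \<le> i" for n i e
  proof (rule fatou_integral_le[where f = "\<lambda>j x. (norm (f i x - f (r (n + j)) x))\<^sup>2"])
    show "integrable M (\<lambda>x. (norm (f i x - f (r (n + j)) x))\<^sup>2)" for j
      using d by (simp add: square_integrable_def)
    have "n \<le> r (n + j)" for j using seq_suble[OF r(1), of "n + j"] by simp
    then show "(LINT x|M. (norm (f i x - f (r (n + j)) x))\<^sup>2) \<le> e" for j using n[OF i] by (simp add: less_imp_le)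
    show "AE x in M. (\<lambda>j. (norm (f i x - f (r (n + j)) x))\<^sup>2) \<longlonglongrightarrow> (norm (f i x - w x))\<^sup>2"
      using lim
    proof eventually_elim
      case (elim x)
      then have "(\<lambda>j. f (r (j + n)) x) \<longlonglongrightarrow> w x" by (rule LIMSEQ_ignore_initial_segment)
      then show ?case by (intro tendsto_intros) (simp add: add.commute)
    qed
  qed auto
  have sq: "square_integrable M (\<lambda>x. f n x - w x)" if "n \<ge> n0" 
    "\<And>i j. n0 \<le> i \<Longrightarrow> n0 \<le> j \<Longrightarrow> (LINT x|M. (norm (f i x - f j x))\<^sup>2) < e" for n n0 e
    using close[of n0 e n] that by (simp add: square_integrable_def)
  obtain n1 where n1: "\<And>i j. n1 \<le> i \<Longrightarrow> n1 \<le> j \<Longrightarrow> (LINT x|M. (norm (f i x - f j x))\<^sup>2) < 1"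
    using cauchy[of 1] by auto
  have "square_integrable M w"
  proof -
    have "square_integrable M (\<lambda>x. f n1 x - w x)" using sq[of n1 n1 1] n1 by simp
    from square_integrable_diff[OF f[of n1] this] show ?thesis by simp
  qed
  moreover have "(\<lambda>n. LINT x|M. (norm (f n x - w x))\<^sup>2) \<longlonglongrightarrow> 0"
  proof (rule LIMSEQ_I)
    fix e :: real assume "0 < e"
    then obtain n where n: "\<And>i j. n \<le> i \<Longrightarrow> n \<le> j \<Longrightarrow> (LINT x|M. (norm (f i x - f j x))\<^sup>2) < e / 2"
      using cauchy[of "e / 2"] by auto
    have "norm ((LINT x|M. (norm (f i x - w x))\<^sup>2) - 0) < e" if "n \<le> i" for i
      using close[OF n that] \<open>0 < e\<close> by simp
    then show "\<exists>n. \<forall>i\<ge>n. norm ((LINT x|M. (norm (f i x - w x))\<^sup>2) - 0) < e" by blast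
  qed
  ultimately show ?thesis by blast
qed

text \<open>Closure under midpoints gives the dyadic convex combinations; the parallelogram law asks
  for no others.\<close>

inductive_set midhull :: "('a \<Rightarrow> 'b::real_vector) set \<Rightarrow> ('a \<Rightarrow> 'b) set" for S where
  base: "f \<in> S \<Longrightarrow> f \<in> midhull S"
| mid: "f \<in> midhull S \<Longrightarrow> g \<in> midhull S \<Longrightarrow> (\<lambda>x. (1 / 2) *\<^sub>R (f x + g x)) \<in> midhull S"

lemma midhull_mono: "S \<subseteq> T \<Longrightarrow> midhull S \<subseteq> midhull T"
proof
  fix f assume "S \<subseteq> T" "f \<in> midhull S"
  from this(2,1) show "f \<in> midhull T" by induction (auto intro: midhull.intros)
qed

lemma midhull_square_integrable:
  assumes "g \<in> midhull S" "\<And>f. f \<in> S \<Longrightarrow> square_integrable M f \<and> (LINT x|M. (norm (f x))\<^sup>2) \<le> C"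
  shows "square_integrable M g \<and> (LINT x|M. (norm (g x))\<^sup>2) \<le> C"
  using assms(1)
proof induction
  case (mid f g)
  then have sq: "square_integrable M (\<lambda>x. (1 / 2) *\<^sub>R (f x + g x))"
    by (intro square_integrable_scaleR square_integrable_add) auto
  have "(LINT x|M. (norm ((1 / 2) *\<^sub>R (f x + g x)))\<^sup>2) \<le> (LINT x|M. ((norm (f x))\<^sup>2 + (norm (g x))\<^sup>2) / 2)"
  proof (rule integral_mono)
    show "integrable M (\<lambda>x. (norm ((1 / 2) *\<^sub>R (f x + g x)))\<^sup>2)" using sq by (simp add: square_integrable_def)
    show "integrable M (\<lambda>x. ((norm (f x))\<^sup>2 + (norm (g x))\<^sup>2) / 2)" using mid by (simp add: square_integrable_def)
    show "(norm ((1 / 2) *\<^sub>R (f x + g x)))\<^sup>2 \<le> ((norm (f x))\<^sup>2 + (norm (g x))\<^sup>2) / 2" for x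
      using norm_add_sq_le[of "f x" "g x"] by (simp add: power_divide)
  qed
  also have "\<dots> = ((LINT x|M. (norm (f x))\<^sup>2) + (LINT x|M. (norm (g x))\<^sup>2)) / 2"
    using mid by (simp add: square_integrable_def)
  also have "\<dots> \<le> C" using mid by simp
  finally show ?case using sq by simp
qed (use assms(2) in blast)

lemma parallelogram_bound:
  fixes a b c d d' i i' :: real
  assumes "a < d + i" "b < d' + i'" "d \<le> c" "i' \<le> i"
  shows "2 * a + 2 * b - 4 * c \<le> 2 * (d + i) + 2 * (d' + i) - 4 * d"
  using assms by simp

text \<open>Choosing elements of almost minimal norm in the convex hulls of the tails turns a bounded
  sequence into a Cauchy sequence, by the parallelogram law; this replaces weak compactness.\<close>

lemma (in sigma_finite_measure) L2_midhull_convergent: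
  fixes f :: "nat \<Rightarrow> 'a \<Rightarrow> 'b::euclidean_space"
  assumes f: "\<And>n. square_integrable M (f n)" "\<And>n. (LINT x|M. (norm (f n x))\<^sup>2) \<le> C"
  shows "\<exists>g w. (\<forall>k. g k \<in> midhull (f ` {k..})) \<and> square_integrable M w \<and>
    (\<lambda>k. LINT x|M. (norm (g k x - w x))\<^sup>2) \<longlonglongrightarrow> 0"
proof -
  define H where "H k = midhull (f ` {k..})" for k
  let ?I = "\<lambda>g. LINT x|M. (norm (g x :: 'b))\<^sup>2"
  define d where "d k = Inf (?I ` H k)" for k
  have H: "square_integrable M g \<and> ?I g \<le> C" if "g \<in> H k" for g k
    using that f unfolding H_def by (intro midhull_square_integrable[of g "f ` {k..}"]) auto
  have ne: "H k \<noteq> {}" for k unfolding H_def using midhull.base[of "f k" "f ` {k..}"] by auto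
  have Hmono: "H l \<subseteq> H k" if "k \<le> l" for k l
    unfolding H_def using that by (intro midhull_mono image_mono) auto
  have bdd: "bdd_below (?I ` H k)" for k by (rule bdd_belowI[of _ 0]) auto
  have dle: "d k \<le> ?I g" if "g \<in> H k" for k g unfolding d_def by (intro cInf_lower bdd imageI that)
  have dmono: "d k \<le> d l" if "k \<le> l" for k l
    unfolding d_def by (intro cInf_superset_mono image_mono Hmono that bdd) (use ne in auto)
  have dC: "d k \<le> C" for k
  proof -
    obtain g where "g \<in> H k" using ne[of k] by blast
    then show ?thesis using dle[of g k] H[of g k] by linarith
  qed
  obtain dl where "d \<longlonglongrightarrow> dl"
    by (rule incseq_convergent[of d C]) (use dmono dC in \<open>auto simp: incseq_def\<close>)
  then have "convergent d" by (rule convergentI)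
  then have dcauchy: "Cauchy d" by (rule convergent_Cauchy)
  have "\<exists>g\<in>H k. ?I g < d k + inverse (real (Suc k))" for k
  proof -
    have "Inf (?I ` H k) < d k + inverse (real (Suc k))" by (simp add: d_def)
    then show ?thesis using cInf_less_iff[OF _ bdd, of k] ne[of k] by auto
  qed
  then obtain g where g: "\<And>k. g k \<in> H k" "\<And>k. ?I (g k) < d k + inverse (real (Suc k))" by metis
  have gs: "square_integrable M (g k)" for k using H g(1) by blast
  \<comment> \<open>The midpoint of \<open>g k\<close> and \<open>g l\<close> still belongs to the
    k-th hull, so its squared norm is at least \<open>d k\<close>. The parallelogram law then leaves
    only the gap between the infima, which increase and are bounded, and the slack in choosing
    near-minimisers.\<close>
  have para: "(LINT x|M. (norm (g k x - g l x))\<^sup>2) \<le> 2 * (d l - d k) + 4 * inverse (real (Suc k))" if kl: "k \<le> l" for k l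
  proof -
    let ?m = "\<lambda>x. (1 / 2) *\<^sub>R (g k x + g l x)"
    have "?m \<in> H k" using g(1)[of k] Hmono[OF kl] g(1)[of l] unfolding H_def by (intro midhull.mid) auto
    then have m: "d k \<le> ?I ?m" "square_integrable M ?m" using dle H by blast+
    have "(LINT x|M. (norm (g k x - g l x))\<^sup>2) = (LINT x|M. 2 * (norm (g k x))\<^sup>2 + 2 * (norm (g l x))\<^sup>2 - 4 * (norm (?m x))\<^sup>2)"
    proof (intro Bochner_Integration.integral_cong refl)
      fix x
      have "4 * (norm (?m x))\<^sup>2 = (norm (g k x + g l x))\<^sup>2" by (simp add: power_divide)
      then show "(norm (g k x - g l x))\<^sup>2 = 2 * (norm (g k x))\<^sup>2 + 2 * (norm (g l x))\<^sup>2 - 4 * (norm (?m x))\<^sup>2"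
        by (simp add: power2_norm_eq_inner inner_add_left inner_add_right inner_diff_left inner_diff_right)
    qed
    also have "\<dots> = 2 * ?I (g k) + 2 * ?I (g l) - 4 * ?I ?m"
      using gs[of k] gs[of l] m(2) by (simp add: square_integrable_def)
    also have "\<dots> \<le> 2 * (d k + inverse (real (Suc k))) + 2 * (d l + inverse (real (Suc k))) - 4 * d k"
    proof -
      have "inverse (real (Suc l)) \<le> inverse (real (Suc k))" using kl by (intro le_imp_inverse_le) auto
      then show ?thesis by (rule parallelogram_bound[OF g(2)[of k] g(2)[of l] m(1)])
    qed
    finally show ?thesis by (simp add: algebra_simps)
  qed
  have "\<exists>n. \<forall>i\<ge>n. \<forall>j\<ge>n. (LINT x|M. (norm (g i x - g j x))\<^sup>2) < e" if e: "0 < e" for e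
  proof -
    obtain n1 where n1: "\<And>i j. n1 \<le> i \<Longrightarrow> n1 \<le> j \<Longrightarrow> \<bar>d i - d j\<bar> < e / 4"
      using dcauchy[unfolded Cauchy_iff, rule_format, of "e / 4"] e by auto
    obtain n2 where n2: "\<And>i. n2 \<le> i \<Longrightarrow> inverse (real (Suc i)) < e / 8"
      using order_tendstoD(2)[OF LIMSEQ_inverse_real_of_nat, of "e / 8"] e by (auto simp: eventually_sequentially)
    have *: "(LINT x|M. (norm (g i x - g j x))\<^sup>2) < e" if "max n1 n2 \<le> i" "i \<le> j" for i j
    proof -
      have "n1 \<le> i" "n2 \<le> i" "n1 \<le> j" using that by auto
      then have "d j - d i < e / 4" "inverse (real (Suc i)) < e / 8"
        using le_less_trans[OF abs_ge_self n1[of j i]] n2[of i] by blast+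
      then have "2 * (d j - d i) + 4 * inverse (real (Suc i)) < 2 * (e / 4) + 4 * (e / 8)"
        by (intro add_strict_mono mult_strict_left_mono) auto
      then show ?thesis using para[OF that(2)] by simp
    qed
    have "(LINT x|M. (norm (g i x - g j x))\<^sup>2) < e" if "max n1 n2 \<le> i" "max n1 n2 \<le> j" for i j
      using *[of i j] *[of j i] that by (cases "i \<le> j") (auto simp: norm_minus_commute)
    then show ?thesis by blast
  qed
  from L2_complete[OF gs this] show ?thesis using g(1) unfolding H_def by blast
qed

text \<open>The flow is built over abstract measures. The domain and the kernel enter through
  finiteness of \<mu>, through \<open>AE_nu\<close>, which carries convergence from points to
  increments, and through the Rellich property \<open>compactness\<close>.\<close>

locale energy_flow = homogeneous_orbit K N for K :: "'b::euclidean_space endo set" and N +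
  fixes \<mu> :: "'a::euclidean_space measure" and \<nu> :: "('a \<times> 'a) measure" and p :: real
  assumes p: "1 < p"
    and sets_mu [measurable_cong, simp]: "sets \<mu> = sets borel"
    and finite_mu: "finite_measure \<mu>"
    and sets_nu [measurable_cong, simp]: "sets \<nu> = sets borel"
    and sigma_finite_nu: "sigma_finite_measure \<nu>"
    and AE_nu: "\<And>P. AE x in \<mu>. P x \<Longrightarrow> AE z in \<nu>. P (fst z) \<and> P (snd z)"
    and N_nonempty: "N \<noteq> {}"
    and compactness: "\<And>(v :: nat \<Rightarrow> 'a \<Rightarrow> 'b) C. (\<And>j. v j \<in> borel_measurable borel) \<Longrightarrow> (\<And>j x. v j x \<in> N) \<Longrightarrow>
      (\<And>j. integrable \<nu> (\<lambda>z. norm (v j (fst z) - v j (snd z)) powr p)) \<Longrightarrow>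
      (\<And>j. (LINT z|\<nu>. norm (v j (fst z) - v j (snd z)) powr p) \<le> C) \<Longrightarrow>
      \<exists>r :: nat \<Rightarrow> nat. strict_mono r \<and> (AE x in \<mu>. convergent (\<lambda>j. v (r j) x))"
begin

sublocale mu: finite_measure \<mu> by (rule finite_mu)
sublocale nu: sigma_finite_measure \<nu> by (rule sigma_finite_nu)

lemma space_mu [simp]: "space \<mu> = UNIV" and space_nu [simp]: "space \<nu> = UNIV"
  using sets_eq_imp_space_eq[OF sets_mu] sets_eq_imp_space_eq[OF sets_nu] by simp_all

definition R :: real where "R = norm (SOME q. q \<in> N)"

lemma norm_N: "q \<in> N \<Longrightarrow> norm q = R"
  unfolding R_def by (rule norm_orbit_eq) (simp_all add: some_in_eq N_nonempty)

lemma R_nonneg: "0 \<le> R" by (simp add: R_def)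

lemma norm_diff_N: "q \<in> N \<Longrightarrow> q' \<in> N \<Longrightarrow> norm (q - q') \<le> 2 * R"
  using norm_triangle_ineq4[of q q'] norm_N[of q] norm_N[of q'] by simp

definition incr :: "('a \<Rightarrow> 'c::real_normed_vector) \<Rightarrow> 'a \<times> 'a \<Rightarrow> 'c" where
  "incr v z = v (fst z) - v (snd z)"

lemma incr_measurable [measurable]:
  fixes v :: "'a \<Rightarrow> 'c::euclidean_space"
  assumes [measurable]: "v \<in> borel_measurable borel" shows "incr v \<in> borel_measurable borel"
  unfolding incr_def by measurable

text \<open>Representatives are Borel and take values in \<open>N\<close> at every point, so that
  pointwise estimates on increments have no exceptional sets.\<close>

definition adm :: "('a \<Rightarrow> 'b) \<Rightarrow> bool" where
  "adm v \<longleftrightarrow> v \<in> borel_measurable borel \<and> (\<forall>x. v x \<in> N) \<and> integrable \<nu> (\<lambda>z. norm (incr v z) powr p)"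

text \<open>This is p times the energy of the problem; the factor 1/p is put back wherever the
  energy is minimised.\<close>

definition En :: "('a \<Rightarrow> 'b) \<Rightarrow> real" where "En v = (LINT z|\<nu>. norm (incr v z) powr p)"

definition d2 :: "('a \<Rightarrow> 'b) \<Rightarrow> ('a \<Rightarrow> 'b) \<Rightarrow> real" where "d2 v w = (LINT x|\<mu>. (norm (v x - w x))\<^sup>2)"

lemma En_nonneg: "0 \<le> En v" by (simp add: En_def)
lemma d2_nonneg: "0 \<le> d2 v w" by (simp add: d2_def)

lemma admD: "adm v \<Longrightarrow> v \<in> borel_measurable borel" "adm v \<Longrightarrow> v x \<in> N"
  "adm v \<Longrightarrow> integrable \<nu> (\<lambda>z. norm (incr v z) powr p)"
  by (simp_all add: adm_def)

lemma integrable_mu_bounded: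
  fixes f :: "'a \<Rightarrow> 'c::euclidean_space"
  assumes "f \<in> borel_measurable borel" "\<And>x. norm (f x) \<le> C" shows "integrable \<mu> f"
proof (rule mu.integrable_const_bound[of _ C])
  show "f \<in> borel_measurable \<mu>" using assms(1) by (simp add: measurable_cong_sets[OF sets_mu refl])
qed (use assms(2) in simp)

lemma d2_integrable: assumes "adm v" "adm w" shows "integrable \<mu> (\<lambda>x. (norm (v x - w x))\<^sup>2)"
proof (rule integrable_mu_bounded[where C = "(2 * R)\<^sup>2"])
  have [measurable]: "v \<in> borel_measurable borel" "w \<in> borel_measurable borel" using assms admD by auto
  show "(\<lambda>x. (norm (v x - w x))\<^sup>2) \<in> borel_measurable borel" by measurable
  show "norm ((norm (v x - w x))\<^sup>2) \<le> (2 * R)\<^sup>2" for x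
    using power_mono[OF norm_diff_N[OF admD(2)[OF assms(1)] admD(2)[OF assms(2)], of x x] norm_ge_zero, of 2] by simp
qed

lemma d2_tendsto:
  assumes v: "\<And>j. adm (v j)" "adm v'" "adm w" and lim: "AE x in \<mu>. (\<lambda>j. v j x) \<longlonglongrightarrow> v' x"
  shows "(\<lambda>j. d2 (v j) w) \<longlonglongrightarrow> d2 v' w"
  unfolding d2_def
proof (rule integral_dominated_convergence[where w = "\<lambda>x. (2 * R)\<^sup>2"])
  have [measurable]: "v j \<in> borel_measurable borel" "v' \<in> borel_measurable borel" "w \<in> borel_measurable borel" for j
    using v admD by auto
  show "(\<lambda>x. (norm (v' x - w x))\<^sup>2) \<in> borel_measurable \<mu>" by measurable
  show "(\<lambda>x. (norm (v j x - w x))\<^sup>2) \<in> borel_measurable \<mu>" for j by measurable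
  show "AE x in \<mu>. (\<lambda>j. (norm (v j x - w x))\<^sup>2) \<longlonglongrightarrow> (norm (v' x - w x))\<^sup>2"
    using lim by eventually_elim (intro tendsto_intros)
  show "AE x in \<mu>. norm ((norm (v j x - w x))\<^sup>2) \<le> (2 * R)\<^sup>2" for j
    using power_mono[OF norm_diff_N[OF admD(2)[OF v(1)] admD(2)[OF v(3)]] norm_ge_zero, of j _ _ 2]
    by (intro AE_I2) simp
qed simp

lemma incr_tendsto_AE:
  assumes "AE x in \<mu>. (\<lambda>j. v j x) \<longlonglongrightarrow> v' x"
  shows "AE z in \<nu>. (\<lambda>j. incr (v j) z) \<longlonglongrightarrow> incr v' z"
  using AE_nu[OF assms] by eventually_elim (auto simp: incr_def intro!: tendsto_diff)

text \<open>Lower semicontinuity of the energy under convergence almost everywhere: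
  \<open>AE_nu\<close> gives convergence of the increments and Fatou's lemma the bound.\<close>

lemma adm_limit:
  assumes v: "\<And>j. adm (v j)" "\<And>j. En (v j) \<le> C" and lim: "AE x in \<mu>. (\<lambda>j. v j x) \<longlonglongrightarrow> v' x"
    and v': "v' \<in> borel_measurable borel" "\<And>x. v' x \<in> N"
  shows "adm v' \<and> En v' \<le> C"
proof -
  have [measurable]: "incr v' \<in> borel_measurable borel" using v'(1) by (rule incr_measurable)
  have "integrable \<nu> (\<lambda>z. norm (incr v' z) powr p) \<and> (LINT z|\<nu>. norm (incr v' z) powr p) \<le> C"
  proof (rule fatou_integral_le[where f = "\<lambda>j z. norm (incr (v j) z) powr p"])
    show "AE z in \<nu>. (\<lambda>j. norm (incr (v j) z) powr p) \<longlonglongrightarrow> norm (incr v' z) powr p"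
      using incr_tendsto_AE[OF lim]
    proof eventually_elim
      case (elim z)
      then show ?case using p by (intro tendsto_powr' tendsto_norm tendsto_const) auto
    qed
    show "integrable \<nu> (\<lambda>z. norm (incr (v j) z) powr p)" for j by (rule admD(3)[OF v(1)])
    show "(LINT z|\<nu>. norm (incr (v j) z) powr p) \<le> C" for j using v(2)[of j] by (simp only: En_def)
    show "(\<lambda>z. norm (incr v' z) powr p) \<in> borel_measurable \<nu>" by measurable
  qed simp
  then show ?thesis using v' by (simp add: adm_def En_def)
qed

lemma limit_in_N:
  fixes v :: "nat \<Rightarrow> 'c::euclidean_space \<Rightarrow> 'b"
  assumes v[measurable]: "\<And>j. v j \<in> borel_measurable borel" and N: "\<And>j x. v j x \<in> N"
  shows "\<exists>v'. v' \<in> borel_measurable borel \<and> (\<forall>x. v' x \<in> N) \<and> (\<forall>x. convergent (\<lambda>j. v j x) \<longrightarrow> (\<lambda>j. v j x) \<longlonglongrightarrow> v' x)"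
proof -
  obtain q where q: "q \<in> N" using N_nonempty by blast
  \<comment> \<open>A fixed point of \<open>N\<close> fills the set where the sequence diverges, so
    the limit lies in \<open>N\<close> everywhere.\<close>
  define v' where "v' x = (if Cauchy (\<lambda>j. v j x) then lim (\<lambda>j. v j x) else q)" for x
  have "v' \<in> borel_measurable borel" unfolding v'_def by measurable
  moreover have lim: "(\<lambda>j. v j x) \<longlonglongrightarrow> v' x" if "convergent (\<lambda>j. v j x)" for x
    using that by (simp add: v'_def Cauchy_convergent_iff convergent_LIMSEQ_iff)
  moreover have "v' x \<in> N" for x
  proof (cases "Cauchy (\<lambda>j. v j x)")
    case True
    then have "(\<lambda>j. v j x) \<longlonglongrightarrow> v' x" using lim by (simp add: Cauchy_convergent_iff)
    then show ?thesis using closed_sequentially[OF compact_imp_closed[OF compact_orbit], of "\<lambda>j. v j x"] N by blast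
  qed (simp add: v'_def q)
  ultimately show ?thesis by blast
qed

lemma bounded_energy_subsequence:
  assumes v: "\<And>j. adm (v j)" "\<And>j. En (v j) \<le> C"
  shows "\<exists>r v'. strict_mono (r :: nat \<Rightarrow> nat) \<and> adm v' \<and> En v' \<le> C \<and> (AE x in \<mu>. (\<lambda>j. v (r j) x) \<longlonglongrightarrow> v' x)"
proof -
  obtain r :: "nat \<Rightarrow> nat" where r: "strict_mono r" "AE x in \<mu>. convergent (\<lambda>j. v (r j) x)"
    using compactness[of v C] v by (auto simp: adm_def En_def incr_def)
  have "\<exists>v'. v' \<in> borel_measurable borel \<and> (\<forall>x. v' x \<in> N) \<and> (\<forall>x. convergent (\<lambda>j. v (r j) x) \<longrightarrow> (\<lambda>j. v (r j) x) \<longlonglongrightarrow> v' x)"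
    by (rule limit_in_N) (use v admD in auto)
  then obtain v' where v': "v' \<in> borel_measurable borel" "\<And>x. v' x \<in> N"
      "\<And>x. convergent (\<lambda>j. v (r j) x) \<Longrightarrow> (\<lambda>j. v (r j) x) \<longlonglongrightarrow> v' x" by blast
  have lim: "AE x in \<mu>. (\<lambda>j. v (r j) x) \<longlonglongrightarrow> v' x" using r(2) by eventually_elim (rule v'(3))
  have "adm v' \<and> En v' \<le> C" by (rule adm_limit[OF v lim v'(1,2)])
  then show ?thesis using r(1) lim by blast
qed

subsection \<open>Minimizing movements\<close>

definition step_energy :: "real \<Rightarrow> ('a \<Rightarrow> 'b) \<Rightarrow> ('a \<Rightarrow> 'b) \<Rightarrow> real" where
  "step_energy h v w = En w / p + d2 w v / (2 * h)"

text \<open>The direct method: a minimising sequence has bounded energy, hence a subsequence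
  converging almost everywhere. The energy is lower semicontinuous along it and the distance term
  converges, because \<open>N\<close> is bounded and \<mu> finite.\<close>

lemma minimizer_exists:
  assumes h: "0 < h" and v: "adm v"
  shows "\<exists>w. adm w \<and> (\<forall>w'. adm w' \<longrightarrow> step_energy h v w \<le> step_energy h v w')"
proof -
  define S where "S = {step_energy h v w | w. adm w}"
  have nn: "0 \<le> step_energy h v w" for w using h p by (simp add: step_energy_def En_nonneg d2_nonneg)
  have S: "S \<noteq> {}" "bdd_below S" using v nn by (auto simp: S_def intro!: bdd_belowI[of _ 0])
  define m where "m = Inf S"
  have "\<exists>w. adm w \<and> step_energy h v w < m + inverse (real (Suc j))" for j
    using cInf_less_iff[OF S, of "m + inverse (real (Suc j))"] by (auto simp: m_def S_def)
  then obtain w where w: "\<And>j. adm (w j)" "\<And>j. step_energy h v (w j) < m + inverse (real (Suc j))" by metis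
  have "En (w j) \<le> p * (m + 1)" for j
  proof -
    have "inverse (real (Suc j)) \<le> 1" by (simp add: field_simps)
    then have "En (w j) / p + d2 (w j) v / (2 * h) \<le> m + 1" using w(2)[of j] by (simp add: step_energy_def)
    moreover have "0 \<le> d2 (w j) v / (2 * h)" using h by (simp add: d2_nonneg)
    ultimately have "En (w j) / p \<le> m + 1" by simp
    then show ?thesis using p by (simp add: field_simps)
  qed
  with w(1) have "\<exists>r w'. strict_mono (r :: nat \<Rightarrow> nat) \<and> adm w' \<and> En w' \<le> p * (m + 1) \<and> (AE x in \<mu>. (\<lambda>j. w (r j) x) \<longlonglongrightarrow> w' x)"
    by (rule bounded_energy_subsequence)
  then obtain r w' where r: "strict_mono (r :: nat \<Rightarrow> nat)" and w': "adm w'" and lim: "AE x in \<mu>. (\<lambda>j. w (r j) x) \<longlonglongrightarrow> w' x"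
    by (elim exE conjE)
  have d: "(\<lambda>j. d2 (w (r j)) v) \<longlonglongrightarrow> d2 w' v" by (rule d2_tendsto[OF w(1) w' v lim])
  have "step_energy h v w' \<le> m"
  proof (rule field_le_epsilon)
    fix e :: real assume e: "0 < e"
    \<comment> \<open>Lower semicontinuity is available as the inheritance of an upper bound. The
      almost minimal value and the convergent distance term give such a bound on the energies from
      some index on.\<close>
    have "(\<lambda>j. p * (m + inverse (real (Suc (r j))) - d2 (w (r j)) v / (2 * h))) \<longlonglongrightarrow> p * (m + 0 - d2 w' v / (2 * h))"
      using h LIMSEQ_subseq_LIMSEQ[OF LIMSEQ_inverse_real_of_nat r] by (intro tendsto_intros d) (simp_all add: o_def)
    moreover have "p * (m + 0 - d2 w' v / (2 * h)) < p * (m + e - d2 w' v / (2 * h))" using e p by simp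
    ultimately have "\<forall>\<^sub>F j in sequentially. p * (m + inverse (real (Suc (r j))) - d2 (w (r j)) v / (2 * h)) < p * (m + e - d2 w' v / (2 * h))"
      by (rule order_tendstoD)
    then obtain j0 where j0: "\<And>j. j0 \<le> j \<Longrightarrow> p * (m + inverse (real (Suc (r j))) - d2 (w (r j)) v / (2 * h)) < p * (m + e - d2 w' v / (2 * h))"
      by (auto simp: eventually_sequentially)
    have En_le: "En (w (r (j0 + j))) \<le> p * (m + e - d2 w' v / (2 * h))" for j
    proof -
      have "En (w (r (j0 + j))) / p < m + inverse (real (Suc (r (j0 + j)))) - d2 (w (r (j0 + j))) v / (2 * h)"
        using w(2)[of "r (j0 + j)"] by (simp add: step_energy_def)
      then have "En (w (r (j0 + j))) < p * (m + inverse (real (Suc (r (j0 + j)))) - d2 (w (r (j0 + j))) v / (2 * h))"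
        using p by (simp add: pos_divide_less_eq mult.commute)
      then show ?thesis using j0[of "j0 + j"] by simp
    qed
    have "AE x in \<mu>. (\<lambda>j. w (r (j0 + j)) x) \<longlonglongrightarrow> w' x"
      using lim by eventually_elim (subst add.commute, rule LIMSEQ_ignore_initial_segment)
    from adm_limit[OF w(1) En_le this admD(1,2)[OF w']]
    have "En w' \<le> p * (m + e - d2 w' v / (2 * h))" by simp
    then have "En w' / p \<le> m + e - d2 w' v / (2 * h)" using p by (simp add: pos_divide_le_eq mult.commute)
    then show "step_energy h v w' \<le> m + e" by (simp add: step_energy_def)
  qed
  moreover have "m \<le> step_energy h v u" if "adm u" for u
    unfolding m_def by (rule cInf_lower) (use that S in \<open>auto simp: S_def\<close>)
  ultimately have "step_energy h v w' \<le> step_energy h v u" if "adm u" for u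
    using that order_trans by blast
  then show ?thesis using w' by blast
qed

definition test :: "('a \<Rightarrow> real) \<Rightarrow> bool" where
  "test \<eta> \<longleftrightarrow> \<eta> \<in> borel_measurable borel \<and> (\<exists>c. \<forall>x. \<bar>\<eta> x\<bar> \<le> c) \<and> integrable \<nu> (\<lambda>z. \<bar>incr \<eta> z\<bar> powr p)"

text \<open>By skew-symmetry of \<open>A\<close>, the first variation \<open>|du|\<^bsup>p-2\<^esup> \<langle>du, d(\<eta> A u)\<rangle>\<close> does not
  contain the term quadratic in the increments of \<open>u\<close>. This is what makes it stable under
  convergence almost everywhere.\<close>

definition var_integrand :: "('a \<Rightarrow> 'b) \<Rightarrow> 'b endo \<Rightarrow> ('a \<Rightarrow> real) \<Rightarrow> 'a \<times> 'a \<Rightarrow> real" where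
  "var_integrand u A \<eta> z = (dual_map p (incr u z) \<bullet> act A (u (snd z))) * incr \<eta> z"

definition variation :: "('a \<Rightarrow> 'b) \<Rightarrow> 'b endo \<Rightarrow> ('a \<Rightarrow> real) \<Rightarrow> real" where
  "variation u A \<eta> = (LINT z|\<nu>. var_integrand u A \<eta> z)"

text \<open>A discrete product rule with \<eta> taken at the first point and u at the second. The
  term \<eta> A du is orthogonal to du since A is skew, and \<open>dual_map\<close> only rescales
  du.\<close>

lemma var_integrand_eq:
  assumes "A \<in> lie"
  shows "dual_map p (incr u z) \<bullet> incr (\<lambda>x. \<eta> x *\<^sub>R act A (u x)) z = var_integrand u A \<eta> z"
proof -
  have "incr (\<lambda>x. \<eta> x *\<^sub>R act A (u x)) z = \<eta> (fst z) *\<^sub>R act A (incr u z) + incr \<eta> z *\<^sub>R act A (u (snd z))"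
    by (simp add: incr_def act.diff_right algebra_simps)
  moreover have "dual_map p (incr u z) \<bullet> act A (incr u z) = 0"
    using lie_skew[OF assms, of "incr u z"] by (simp add: dual_map_def inner_commute)
  ultimately show ?thesis by (simp add: var_integrand_def inner_add_right)
qed

lemma act_measurable [measurable]:
  fixes f :: "'c \<Rightarrow> 'b"
  assumes "f \<in> borel_measurable M" shows "(\<lambda>x. act A (f x)) \<in> borel_measurable M"
  by (rule borel_measurable_continuous_on[OF linear_continuous_on[OF act.bounded_linear_right] assms])

lemma var_integrand_measurable [measurable]:
  assumes [measurable]: "u \<in> borel_measurable borel" "\<eta> \<in> borel_measurable borel"
  shows "var_integrand u A \<eta> \<in> borel_measurable borel"
  unfolding var_integrand_def by measurable

lemma var_integrand_le:
  assumes "u (snd z) \<in> N"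
  shows "\<bar>var_integrand u A \<eta> z\<bar> \<le> norm (incr u z) powr (p - 1) * (norm A * R * \<bar>incr \<eta> z\<bar>)"
proof -
  have "\<bar>dual_map p (incr u z) \<bullet> act A (u (snd z))\<bar> \<le> norm (dual_map p (incr u z)) * norm (act A (u (snd z)))"
    by (rule Cauchy_Schwarz_ineq2)
  also have "\<dots> \<le> norm (incr u z) powr (p - 1) * (norm A * R)"
    using norm_act_le[of A "u (snd z)"] by (intro mult_mono) (auto simp: norm_dual_map[OF p] norm_N[OF assms])
  finally show ?thesis unfolding var_integrand_def abs_mult
    by (simp add: mult_right_mono mult.assoc[symmetric])
qed

lemma var_integrand_le_eps:
  assumes "u (snd z) \<in> N" "0 < \<delta>"
  shows "\<bar>var_integrand u A \<eta> z\<bar> \<le> \<delta> * norm (incr u z) powr p + \<delta> powr (1 - p) * (norm A * R * \<bar>incr \<eta> z\<bar>) powr p"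
  by (rule order_trans[OF var_integrand_le[of u z, OF assms(1)] powr_mult_le_eps[OF p assms(2)]])
    (simp_all add: R_nonneg)

end

section \<open>The Euler-Lagrange equation of a single step\<close>

context energy_flow begin

lemma act_exp_measurable [measurable]:
  assumes [measurable]: "t \<in> borel_measurable M" "q \<in> borel_measurable M"
  shows "(\<lambda>x. act (exp (t x *\<^sub>R A)) (q x :: 'b)) \<in> borel_measurable M"
proof (rule borel_measurable_continuous_Pair[OF assms])
  have "continuous_on UNIV (\<lambda>t::real. exp (t *\<^sub>R A))"
    by (intro continuous_at_imp_continuous_on ballI
        has_vector_derivative_continuous[OF exp_scaleR_has_vector_derivative_right])
  from continuous_on_compose2[OF this continuous_on_fst[OF continuous_on_id]]
  show "continuous_on UNIV (\<lambda>x :: real \<times> 'b. act (exp (fst x *\<^sub>R A)) (snd x))"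
    by (intro act.continuous_on continuous_on_snd continuous_on_id) auto
qed

lemma act_exp_diff_le:
  assumes "A \<in> lie"
  shows "norm (act (exp (a *\<^sub>R A)) x - x) \<le> norm A * \<bar>a\<bar> * norm x"
  using norm_act_exp_diff_le[OF assms, of a x 0] by simp

text \<open>Rotating both values by the rotation at the first point preserves the length of the
  increment; only the change of the angle f between the two points costs something.\<close>

lemma incr_rotation_le:
  assumes A: "A \<in> lie" and u: "\<And>x. u x \<in> N"
  shows "norm (incr (\<lambda>x. act (exp (f x *\<^sub>R A)) (u x)) z) \<le> norm (incr u z) + norm A * R * \<bar>incr f z\<bar>"
proof -
  obtain x y where z: "z = (x, y)" by (cases z)
  have "incr (\<lambda>x. act (exp (f x *\<^sub>R A)) (u x)) z = act (exp (f x *\<^sub>R A)) (u x - u y)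
      + (act (exp (f x *\<^sub>R A)) (u y) - act (exp (f y *\<^sub>R A)) (u y))"
    by (simp add: z incr_def act.diff_right)
  also have "norm \<dots> \<le> norm (act (exp (f x *\<^sub>R A)) (u x - u y)) + norm (act (exp (f x *\<^sub>R A)) (u y) - act (exp (f y *\<^sub>R A)) (u y))"
    by (rule norm_triangle_ineq)
  also have "\<dots> \<le> norm (u x - u y) + norm A * \<bar>f x - f y\<bar> * norm (u y)"
    by (intro add_mono norm_act_exp_diff_le A) (simp add: norm_act_exp[OF A])
  finally show ?thesis by (simp add: z incr_def norm_N[OF u] mult_ac)
qed

lemma incr_displacement_le:
  assumes A: "A \<in> lie" and u: "\<And>x. u x \<in> N"
  shows "norm (incr (\<lambda>x. act (exp (f x *\<^sub>R A)) (u x) - u x) z) \<le>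
    norm A * \<bar>f (fst z)\<bar> * norm (incr u z) + norm A * R * \<bar>incr f z\<bar>"
proof -
  obtain x y where z: "z = (x, y)" by (cases z)
  have "incr (\<lambda>x. act (exp (f x *\<^sub>R A)) (u x) - u x) z = (act (exp (f x *\<^sub>R A)) (u x - u y) - (u x - u y))
      + (act (exp (f x *\<^sub>R A)) (u y) - act (exp (f y *\<^sub>R A)) (u y))"
    by (simp add: z incr_def act.diff_right)
  also have "norm \<dots> \<le> norm (act (exp (f x *\<^sub>R A)) (u x - u y) - (u x - u y)) + norm (act (exp (f x *\<^sub>R A)) (u y) - act (exp (f y *\<^sub>R A)) (u y))"
    by (rule norm_triangle_ineq)
  also have "\<dots> \<le> norm A * \<bar>f x\<bar> * norm (u x - u y) + norm A * \<bar>f x - f y\<bar> * norm (u y)"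
    by (intro add_mono norm_act_exp_diff_le act_exp_diff_le A)
  finally show ?thesis by (simp add: z incr_def norm_N[OF u] mult_ac)
qed

lemma integrable_sum_powr:
  assumes u: "adm u" and \<eta>: "test \<eta>" and M: "0 \<le> M"
  shows "integrable \<nu> (\<lambda>z. (M * (norm (incr u z) + \<bar>incr \<eta> z\<bar>)) powr p)"
proof (rule Bochner_Integration.integrable_bound[of \<nu> "\<lambda>z. M powr p * (2 powr p * (norm (incr u z) powr p + \<bar>incr \<eta> z\<bar> powr p))"])
  have [measurable]: "u \<in> borel_measurable borel" "\<eta> \<in> borel_measurable borel" using u \<eta> by (auto simp: adm_def test_def)
  show "(\<lambda>z. (M * (norm (incr u z) + \<bar>incr \<eta> z\<bar>)) powr p) \<in> borel_measurable \<nu>" by measurable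
  show "integrable \<nu> (\<lambda>z. M powr p * (2 powr p * (norm (incr u z) powr p + \<bar>incr \<eta> z\<bar> powr p)))"
    using u \<eta> by (simp add: adm_def test_def)
  have "(M * (norm (incr u z) + \<bar>incr \<eta> z\<bar>)) powr p \<le> M powr p * (2 powr p * (norm (incr u z) powr p + \<bar>incr \<eta> z\<bar> powr p))" for z
  proof -
    have "(norm (incr u z) + \<bar>incr \<eta> z\<bar>) powr p \<le> 2 powr p * (norm (incr u z) powr p + \<bar>incr \<eta> z\<bar> powr p)"
      by (rule powr_add_le) (use p in simp_all)
    from mult_left_mono[OF this powr_ge_zero[of M p]] show ?thesis using M by (simp only: powr_mult)
  qed
  then show "AE z in \<nu>. norm ((M * (norm (incr u z) + \<bar>incr \<eta> z\<bar>)) powr p) \<le> norm (M powr p * (2 powr p * (norm (incr u z) powr p + \<bar>incr \<eta> z\<bar> powr p)))"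
    by (intro AE_I2) (simp add: abs_of_nonneg)
qed

lemma adm_rotation:
  assumes A: "A \<in> lie" and u: "adm u" and \<eta>: "test \<eta>"
  shows "adm (\<lambda>x. act (exp ((\<epsilon> * \<eta> x) *\<^sub>R A)) (u x))" (is "adm ?w")
  unfolding adm_def
proof (intro conjI allI)
  have [measurable]: "u \<in> borel_measurable borel" "\<eta> \<in> borel_measurable borel" using u \<eta> by (auto simp: adm_def test_def)
  show [measurable]: "?w \<in> borel_measurable borel" by measurable
  show "?w x \<in> N" for x by (rule act_exp_N[OF A admD(2)[OF u]])
  show "integrable \<nu> (\<lambda>z. norm (incr ?w z) powr p)"
  proof (rule Bochner_Integration.integrable_bound[OF integrable_sum_powr[OF u \<eta>, of "1 + norm A * R * \<bar>\<epsilon>\<bar>"]])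
    show "0 \<le> 1 + norm A * R * \<bar>\<epsilon>\<bar>" using R_nonneg by simp
    show "(\<lambda>z. norm (incr ?w z) powr p) \<in> borel_measurable \<nu>" by measurable
    have "norm (incr ?w z) \<le> (1 + norm A * R * \<bar>\<epsilon>\<bar>) * (norm (incr u z) + \<bar>incr \<eta> z\<bar>)" for z
    proof -
      have "norm (incr ?w z) \<le> norm (incr u z) + norm A * R * \<bar>incr (\<lambda>x. \<epsilon> * \<eta> x) z\<bar>"
        by (rule incr_rotation_le[OF A admD(2)[OF u]])
      also have "\<bar>incr (\<lambda>x. \<epsilon> * \<eta> x) z\<bar> = \<bar>\<epsilon>\<bar> * \<bar>incr \<eta> z\<bar>"
        by (simp add: incr_def right_diff_distrib[symmetric] abs_mult)
      also have "norm (incr u z) + norm A * R * (\<bar>\<epsilon>\<bar> * \<bar>incr \<eta> z\<bar>) \<le> (1 + norm A * R * \<bar>\<epsilon>\<bar>) * (norm (incr u z) + \<bar>incr \<eta> z\<bar>)"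
        using R_nonneg by (simp add: algebra_simps)
      finally show ?thesis .
    qed
    then show "AE z in \<nu>. norm (norm (incr ?w z) powr p) \<le> norm (((1 + norm A * R * \<bar>\<epsilon>\<bar>) * (norm (incr u z) + \<bar>incr \<eta> z\<bar>)) powr p)"
      using p by (intro AE_I2) (simp add: powr_mono2)
  qed
qed

lemma energy_difference_le:
  assumes w: "adm w" and u: "adm u"
    and i: "integrable \<nu> (\<lambda>z. dual_map p (incr w z) \<bullet> incr (\<lambda>x. w x - u x) z)"
  shows "En w / p - En u / p \<le> (LINT z|\<nu>. dual_map p (incr w z) \<bullet> incr (\<lambda>x. w x - u x) z)"
proof -
  have "En w / p - En u / p = (LINT z|\<nu>. norm (incr w z) powr p / p - norm (incr u z) powr p / p)"
    using w u by (simp add: En_def adm_def)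
  also have "\<dots> \<le> (LINT z|\<nu>. dual_map p (incr w z) \<bullet> incr (\<lambda>x. w x - u x) z)"
  proof (rule integral_mono[OF _ i])
    show "integrable \<nu> (\<lambda>z. norm (incr w z) powr p / p - norm (incr u z) powr p / p)"
      using w u by (simp add: adm_def)
    have "incr (\<lambda>x. w x - u x) z = incr w z - incr u z" for z by (simp add: incr_def)
    then show "norm (incr w z) powr p / p - norm (incr u z) powr p / p \<le> dual_map p (incr w z) \<bullet> incr (\<lambda>x. w x - u x) z" for z
      using convexity_powr_norm[OF p, of "incr w z" "incr u z"] by simp
  qed
  finally show ?thesis .
qed

lemma integrable_mu_inner:
  assumes [measurable]: "f \<in> borel_measurable borel" "g \<in> borel_measurable borel"
    and b: "\<And>x. norm (f x) \<le> C" "\<And>x. norm (g x) \<le> (D::real)"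
  shows "integrable \<mu> (\<lambda>x. (f x :: 'b) \<bullet> g x)"
proof (rule integrable_mu_bounded[where C = "C * D"])
  show "norm (f x \<bullet> g x) \<le> C * D" for x
  proof -
    have "0 \<le> C" by (rule order_trans[OF norm_ge_zero b(1)])
    then have "norm (f x) * norm (g x) \<le> C * D" by (intro mult_mono b) simp_all
    with Cauchy_Schwarz_ineq2[of "f x" "g x"] show ?thesis by simp
  qed
qed measurable

lemma distance_difference_le:
  assumes w: "adm w" and u: "adm u" and v: "adm v"
  shows "d2 w v - d2 u v \<le> 2 * (LINT x|\<mu>. (w x - v x) \<bullet> (w x - u x))"
proof -
  have [measurable]: "u \<in> borel_measurable borel" "v \<in> borel_measurable borel" "w \<in> borel_measurable borel"
    using w u v admD by auto
  have "d2 w v - d2 u v = (LINT x|\<mu>. (norm (w x - v x))\<^sup>2 - (norm (u x - v x))\<^sup>2)"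
    using d2_integrable w u v by (simp add: d2_def)
  also have "\<dots> \<le> (LINT x|\<mu>. 2 * ((w x - v x) \<bullet> (w x - u x)))"
  proof (rule integral_mono)
    show "integrable \<mu> (\<lambda>x. (norm (w x - v x))\<^sup>2 - (norm (u x - v x))\<^sup>2)"
      using d2_integrable w u v by simp
    show "integrable \<mu> (\<lambda>x. 2 * ((w x - v x) \<bullet> (w x - u x)))"
      by (intro integrable_mult_right integrable_mu_inner[where C = "2 * R" and D = "2 * R"])
        (use norm_diff_N admD(2) w u v in auto)
    show "(norm (w x - v x))\<^sup>2 - (norm (u x - v x))\<^sup>2 \<le> 2 * ((w x - v x) \<bullet> (w x - u x))" for x
    proof -
      have "0 \<le> (w x - u x) \<bullet> (w x - u x)" by simp
      then show ?thesis
        by (simp add: power2_norm_eq_inner inner_diff_left inner_diff_right inner_commute)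
    qed
  qed
  finally show ?thesis by simp
qed

text \<open>The competitor exp(\<epsilon> \<eta> A) u stays in \<open>N\<close>. The changes in
  energy and squared distance are bounded, by convexity, by pairings evaluated at the competitor; no
  derivative of the p-th power is taken. Divided by \<epsilon>, these pairings converge by dominated
  convergence. The equality follows by applying this to -\<eta> as well.\<close>

lemma euler_lagrange_le:
  assumes h: "0 < h" and u: "adm u" and v: "adm v"
    and min: "\<And>w. adm w \<Longrightarrow> step_energy h v u \<le> step_energy h v w"
    and A: "A \<in> lie" and \<eta>: "test \<eta>"
  shows "0 \<le> (1 / h) * (LINT x|\<mu>. (u x - v x) \<bullet> (\<eta> x *\<^sub>R act A (u x))) + variation u A \<eta>"
proof -
  obtain c where c: "\<And>x. \<bar>\<eta> x\<bar> \<le> c" using \<eta> by (auto simp: test_def)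
  have c0: "0 \<le> c" using order_trans[OF abs_ge_zero c] .
  have [measurable]: "u \<in> borel_measurable borel" "\<eta> \<in> borel_measurable borel" "v \<in> borel_measurable borel"
    using u v \<eta> by (auto simp: adm_def test_def)
  define \<epsilon> where "\<epsilon> n = inverse (real (Suc n))" for n
  have \<epsilon>: "0 < \<epsilon> n" "\<epsilon> n \<le> 1" for n by (auto simp: \<epsilon>_def field_simps)
  have \<epsilon>0: "\<epsilon> \<longlonglongrightarrow> 0" unfolding \<epsilon>_def by (rule LIMSEQ_inverse_real_of_nat)
  define w where "w n x = act (exp ((\<epsilon> n * \<eta> x) *\<^sub>R A)) (u x)" for n x
  define D where "D n x = (1 / \<epsilon> n) *\<^sub>R (w n x - u x)" for n x
  have w: "adm (w n)" for n unfolding w_def by (rule adm_rotation[OF A u \<eta>])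
  have [measurable]: "w n \<in> borel_measurable borel" for n by (rule admD(1)[OF w])
  have [measurable]: "D n \<in> borel_measurable borel" for n unfolding D_def by measurable
  \<comment> \<open>One constant for both increment bounds: 1 and |A| R come from rotating u, while
    |A| c and |A| R come from the difference quotient of the rotation.\<close>
  define M where "M = 1 + norm A * c + norm A * R"
  have M0: "0 \<le> M" using c0 R_nonneg by (simp add: M_def)
  have M: "1 \<le> M" "norm A * R \<le> M" "norm A * c \<le> M" using c0 R_nonneg by (simp_all add: M_def)
  let ?S = "\<lambda>z. norm (incr u z) + \<bar>incr \<eta> z\<bar>"
  have i\<epsilon>: "\<bar>incr (\<lambda>x. \<epsilon> n * \<eta> x) z\<bar> = \<epsilon> n * \<bar>incr \<eta> z\<bar>" for n z
    using \<epsilon>(1)[of n] by (simp add: incr_def right_diff_distrib[symmetric] abs_mult)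
  have bw: "norm (incr (w n) z) \<le> M * ?S z" for n z
  proof -
    have "norm (incr (w n) z) \<le> norm (incr u z) + norm A * R * (\<epsilon> n * \<bar>incr \<eta> z\<bar>)"
      unfolding w_def i\<epsilon>[symmetric] by (rule incr_rotation_le[OF A admD(2)[OF u]])
    also have "\<dots> \<le> M * norm (incr u z) + M * (1 * \<bar>incr \<eta> z\<bar>)"
      using M \<epsilon>[of n] mult_right_mono[OF M(1), of "norm (incr u z)"]
      by (intro add_mono mult_mono) (auto simp: less_imp_le)
    finally show ?thesis by (simp add: distrib_left)
  qed
  have bD: "norm (incr (D n) z) \<le> M * ?S z" for n z
  proof -
    have "incr (D n) z = (1 / \<epsilon> n) *\<^sub>R incr (\<lambda>x. act (exp ((\<epsilon> n * \<eta> x) *\<^sub>R A)) (u x) - u x) z"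
      by (simp add: incr_def D_def w_def scaleR_diff_right)
    then have "norm (incr (D n) z) = (1 / \<epsilon> n) * norm (incr (\<lambda>x. act (exp ((\<epsilon> n * \<eta> x) *\<^sub>R A)) (u x) - u x) z)"
      using \<epsilon>(1)[of n] by simp
    also have "\<dots> \<le> (1 / \<epsilon> n) * (norm A * \<bar>\<epsilon> n * \<eta> (fst z)\<bar> * norm (incr u z) + norm A * R * (\<epsilon> n * \<bar>incr \<eta> z\<bar>))"
      unfolding i\<epsilon>[symmetric] using \<epsilon>(1)[of n]
      by (intro mult_left_mono incr_displacement_le[OF A admD(2)[OF u]]) auto
    also have "\<dots> = norm A * \<bar>\<eta> (fst z)\<bar> * norm (incr u z) + norm A * R * \<bar>incr \<eta> z\<bar>"
      using \<epsilon>(1)[of n] by (simp add: abs_mult field_simps)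
    also have "\<dots> \<le> norm A * c * norm (incr u z) + norm A * R * \<bar>incr \<eta> z\<bar>"
      by (intro add_right_mono mult_right_mono mult_left_mono c) auto
    also have "\<dots> \<le> M * norm (incr u z) + M * \<bar>incr \<eta> z\<bar>"
      using M by (intro add_mono mult_right_mono) auto
    finally show ?thesis by (simp add: distrib_left)
  qed
  have bDx: "norm (D n x) \<le> norm A * c * R" for n x
  proof -
    have "norm (D n x) = (1 / \<epsilon> n) * norm (act (exp ((\<epsilon> n * \<eta> x) *\<^sub>R A)) (u x) - u x)"
      using \<epsilon>(1)[of n] by (simp add: D_def w_def)
    also have "\<dots> \<le> (1 / \<epsilon> n) * (norm A * \<bar>\<epsilon> n * \<eta> x\<bar> * norm (u x))"
      using \<epsilon>(1)[of n] by (intro mult_left_mono act_exp_diff_le[OF A]) auto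
    also have "\<dots> = norm A * \<bar>\<eta> x\<bar> * R"
      using \<epsilon>(1)[of n] by (simp add: abs_mult norm_N[OF admD(2)[OF u]])
    also have "\<dots> \<le> norm A * c * R"
      using R_nonneg by (intro mult_right_mono mult_left_mono c) auto
    finally show ?thesis .
  qed
  have limw: "(\<lambda>n. w n x) \<longlonglongrightarrow> u x" for x
  proof -
    have "(\<lambda>n. act (exp ((\<epsilon> n * \<eta> x) *\<^sub>R A)) (u x)) \<longlonglongrightarrow> act (exp ((0 * \<eta> x) *\<^sub>R A)) (u x)"
      by (intro act.tendsto tendsto_exp_scaleR tendsto_intros \<epsilon>0)
    then show ?thesis by (simp add: w_def)
  qed
  have limD: "(\<lambda>n. D n x) \<longlonglongrightarrow> \<eta> x *\<^sub>R act A (u x)" for x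
  proof -
    have "((\<lambda>t. act (exp (t *\<^sub>R (\<eta> x *\<^sub>R A))) (u x)) has_vector_derivative act (\<eta> x *\<^sub>R A) (u x)) (at 0)"
      using act_exp_has_vector_derivative[of "\<eta> x *\<^sub>R A" "u x" 0] by simp
    from has_vector_derivative_sequentially[OF this \<epsilon>0]
    show ?thesis using \<epsilon>(1) by (simp add: D_def w_def less_imp_neq[symmetric])
  qed
  let ?F = "\<lambda>n z. dual_map p (incr (w n) z) \<bullet> incr (D n) z"
  let ?G = "\<lambda>n x. (w n x - v x) \<bullet> D n x"
  have Fbound: "norm (?F n z) \<le> (M * ?S z) powr p" for n z
  proof -
    have "norm (?F n z) \<le> norm (dual_map p (incr (w n) z)) * norm (incr (D n) z)"
      using Cauchy_Schwarz_ineq2 by simp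
    also have "\<dots> \<le> (M * ?S z) powr (p - 1) * (M * ?S z)"
      unfolding norm_dual_map[OF p] using p bw[of n z] bD[of n z] by (intro mult_mono powr_mono2) auto
    also have "\<dots> = (M * ?S z) powr (p - 1) * (M * ?S z) powr 1" using M by simp
    also have "\<dots> = (M * ?S z) powr p" by (subst powr_add[symmetric]) simp
    finally show ?thesis .
  qed
  have iF: "integrable \<nu> (?F n)" for n
    by (rule Bochner_Integration.integrable_bound[OF integrable_sum_powr[OF u \<eta> M0]])
      (use Fbound in \<open>auto intro!: AE_I2\<close>)
  have pos: "0 \<le> (LINT z|\<nu>. ?F n z) + (1 / h) * (LINT x|\<mu>. ?G n x)" for n
  proof -
    have e1: "w n x - u x = \<epsilon> n *\<^sub>R D n x" for x using \<epsilon>(1)[of n] by (simp add: D_def)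
    have e2: "dual_map p (incr (w n) z) \<bullet> incr (\<lambda>x. w n x - u x) z = \<epsilon> n * ?F n z" for z
      by (simp add: e1) (simp add: incr_def scaleR_diff_right[symmetric])
    have "En (w n) / p - En u / p \<le> \<epsilon> n * (LINT z|\<nu>. ?F n z)"
      using energy_difference_le[OF w u, of n] iF[of n] by (simp add: e2)
    moreover have "d2 (w n) v - d2 u v \<le> 2 * (\<epsilon> n * (LINT x|\<mu>. ?G n x))"
      using distance_difference_le[OF w u v, of n] by (simp add: e1)
    moreover have "En u / p + d2 u v / (2 * h) \<le> En (w n) / p + d2 (w n) v / (2 * h)"
      using min[OF w] by (simp add: step_energy_def)
    ultimately have "0 \<le> \<epsilon> n * (LINT z|\<nu>. ?F n z) + (2 * (\<epsilon> n * (LINT x|\<mu>. ?G n x))) / (2 * h)"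
      using h divide_right_mono[of "d2 (w n) v - d2 u v" "2 * (\<epsilon> n * (LINT x|\<mu>. ?G n x))" "2 * h"]
      by (simp add: diff_divide_distrib)
    then have "0 \<le> \<epsilon> n * ((LINT z|\<nu>. ?F n z) + (1 / h) * (LINT x|\<mu>. ?G n x))"
      by (simp add: distrib_left)
    then show ?thesis using \<epsilon>(1)[of n] by (simp add: zero_le_mult_iff)
  qed
  have "(\<lambda>n. LINT z|\<nu>. ?F n z) \<longlonglongrightarrow> (LINT z|\<nu>. var_integrand u A \<eta> z)"
  proof (rule integral_dominated_convergence[where w = "\<lambda>z. (M * ?S z) powr p"])
    show "AE z in \<nu>. (\<lambda>n. ?F n z) \<longlonglongrightarrow> var_integrand u A \<eta> z"
    proof (rule AE_I2)
      fix z
      have "(\<lambda>n. incr (w n) z) \<longlonglongrightarrow> incr u z" unfolding incr_def by (intro tendsto_diff limw)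
      moreover have "(\<lambda>n. incr (D n) z) \<longlonglongrightarrow> incr (\<lambda>x. \<eta> x *\<^sub>R act A (u x)) z"
        unfolding incr_def by (intro tendsto_diff limD)
      ultimately show "(\<lambda>n. ?F n z) \<longlonglongrightarrow> var_integrand u A \<eta> z"
        unfolding var_integrand_eq[OF A, symmetric] by (intro tendsto_inner tendsto_dual_map p)
    qed
  qed (use Fbound integrable_sum_powr[OF u \<eta> M0] in auto)
  moreover have "(\<lambda>n. LINT x|\<mu>. ?G n x) \<longlonglongrightarrow> (LINT x|\<mu>. (u x - v x) \<bullet> (\<eta> x *\<^sub>R act A (u x)))"
  proof (rule integral_dominated_convergence[where w = "\<lambda>x. 2 * R * (norm A * c * R)"])
    show "AE x in \<mu>. (\<lambda>n. ?G n x) \<longlonglongrightarrow> (u x - v x) \<bullet> (\<eta> x *\<^sub>R act A (u x))"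
      by (intro AE_I2 tendsto_inner tendsto_diff tendsto_const limw limD)
    have "norm (?G n x) \<le> 2 * R * (norm A * c * R)" for n x
    proof -
      have "norm (?G n x) \<le> norm (w n x - v x) * norm (D n x)" using Cauchy_Schwarz_ineq2 by simp
      also have "\<dots> \<le> 2 * R * (norm A * c * R)"
        using norm_diff_N[OF admD(2)[OF w] admD(2)[OF v]] bDx R_nonneg by (intro mult_mono) auto
      finally show ?thesis .
    qed
    then show "AE x in \<mu>. norm (?G n x) \<le> 2 * R * (norm A * c * R)" for n by simp
  qed simp_all
  ultimately have "(\<lambda>n. (LINT z|\<nu>. ?F n z) + (1 / h) * (LINT x|\<mu>. ?G n x)) \<longlonglongrightarrow>
      (LINT z|\<nu>. var_integrand u A \<eta> z) + (1 / h) * (LINT x|\<mu>. (u x - v x) \<bullet> (\<eta> x *\<^sub>R act A (u x)))"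
    by (intro tendsto_intros)
  from LIMSEQ_le_const[OF this, of 0] pos show ?thesis by (auto simp: variation_def)
qed

lemma test_uminus: "test \<eta> \<Longrightarrow> test (\<lambda>x. - \<eta> x)"
proof -
  assume \<eta>: "test \<eta>"
  have "\<bar>incr (\<lambda>x. - \<eta> x) z\<bar> = \<bar>incr \<eta> z\<bar>" for z by (simp add: incr_def)
  then show ?thesis using \<eta> by (auto simp: test_def)
qed

lemma euler_lagrange:
  assumes h: "0 < h" and u: "adm u" and v: "adm v"
    and min: "\<And>w. adm w \<Longrightarrow> step_energy h v u \<le> step_energy h v w"
    and A: "A \<in> lie" and \<eta>: "test \<eta>"
  shows "(1 / h) * (LINT x|\<mu>. (u x - v x) \<bullet> (\<eta> x *\<^sub>R act A (u x))) + variation u A \<eta> = 0"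
proof -
  have "var_integrand u A (\<lambda>x. - \<eta> x) z = - var_integrand u A \<eta> z" for z
    by (simp add: var_integrand_def incr_def right_diff_distrib)
  then have "variation u A (\<lambda>x. - \<eta> x) = - variation u A \<eta>" by (simp add: variation_def)
  moreover have "0 \<le> (1 / h) * (LINT x|\<mu>. (u x - v x) \<bullet> ((- \<eta> x) *\<^sub>R act A (u x))) + variation u A (\<lambda>x. - \<eta> x)"
    by (rule euler_lagrange_le[OF h u v min A test_uminus[OF \<eta>]])
  ultimately have "(1 / h) * (LINT x|\<mu>. (u x - v x) \<bullet> (\<eta> x *\<^sub>R act A (u x))) + variation u A \<eta> \<le> 0" by simp
  with euler_lagrange_le[OF h u v min A \<eta>] show ?thesis by (rule antisym[rotated])
qed

text \<open>Minimality of each step is recorded through two consequences: the comparison with not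
  moving at all, which gives the energy inequality, and the Euler-Lagrange equation.\<close>

definition discrete_flow :: "real \<Rightarrow> ('a \<Rightarrow> 'b) \<Rightarrow> (nat \<Rightarrow> 'a \<Rightarrow> 'b) \<Rightarrow> bool" where
  "discrete_flow h u0 U \<longleftrightarrow> U 0 = u0 \<and> (\<forall>k. adm (U k)) \<and>
    (\<forall>k. step_energy h (U k) (U (Suc k)) \<le> En (U k) / p) \<and>
    (\<forall>k. \<forall>A\<in>lie. \<forall>\<eta>. test \<eta> \<longrightarrow>
      (1 / h) * (LINT x|\<mu>. (U (Suc k) x - U k x) \<bullet> (\<eta> x *\<^sub>R act A (U (Suc k) x))) + variation (U (Suc k)) A \<eta> = 0)"

lemma discrete_flow_exists:
  assumes h: "0 < h" and u0: "adm u0" shows "\<exists>U. discrete_flow h u0 U"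
proof -
  define nxt where "nxt v = (SOME w. adm w \<and> (\<forall>w'. adm w' \<longrightarrow> step_energy h v w \<le> step_energy h v w'))" for v
  have nxt: "adm (nxt v)" "\<And>w'. adm w' \<Longrightarrow> step_energy h v (nxt v) \<le> step_energy h v w'" if "adm v" for v
    using someI_ex[OF minimizer_exists[OF h that], folded nxt_def] by blast+
  define U where "U k = (nxt ^^ k) u0" for k
  have U: "adm (U k)" for k by (induction k) (simp_all add: U_def u0 nxt)
  have S: "U (Suc k) = nxt (U k)" for k by (simp add: U_def)
  have "step_energy h (U k) (U (Suc k)) \<le> En (U k) / p" for k
    using nxt(2)[OF U[of k] U[of k]] by (simp add: S step_energy_def d2_def)
  moreover have "(1 / h) * (LINT x|\<mu>. (U (Suc k) x - U k x) \<bullet> (\<eta> x *\<^sub>R act A (U (Suc k) x))) + variation (U (Suc k)) A \<eta> = 0"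
    if "A \<in> lie" "test \<eta>" for k A \<eta>
    by (rule euler_lagrange[OF h U U _ that]) (simp add: S nxt(2)[OF U])
  ultimately have "discrete_flow h u0 U" using U by (simp add: discrete_flow_def U_def)
  then show ?thesis by blast
qed

lemma discrete_flow_energy:
  assumes h: "0 < h" and U: "discrete_flow h u0 U"
  shows "En (U k) / p + (\<Sum>i<k. d2 (U (Suc i)) (U i)) / (2 * h) \<le> En u0 / p"
proof (induction k)
  case 0
  then show ?case using U by (simp add: discrete_flow_def)
next
  case (Suc k)
  have "En (U (Suc k)) / p + d2 (U (Suc k)) (U k) / (2 * h) \<le> En (U k) / p"
    using U by (simp add: discrete_flow_def step_energy_def)
  with Suc show ?case by (simp add: add_divide_distrib)
qed

lemma discrete_flow_bounds:
  assumes h: "0 < h" and U: "discrete_flow h u0 U"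
  shows "En (U k) \<le> En u0" "(\<Sum>i<k. d2 (U (Suc i)) (U i)) \<le> 2 * h * (En u0 / p)"
proof -
  have s: "0 \<le> (\<Sum>i<k. d2 (U (Suc i)) (U i)) / (2 * h)" using h by (intro divide_nonneg_nonneg sum_nonneg d2_nonneg) auto
  with discrete_flow_energy[OF h U, of k] have "En (U k) / p \<le> En u0 / p" by simp
  then show "En (U k) \<le> En u0" using p by (simp add: divide_le_cancel)
  have "0 \<le> En (U k) / p" using p by (simp add: En_nonneg)
  with discrete_flow_energy[OF h U, of k] have "(\<Sum>i<k. d2 (U (Suc i)) (U i)) / (2 * h) \<le> En u0 / p" by simp
  then show "(\<Sum>i<k. d2 (U (Suc i)) (U i)) \<le> 2 * h * (En u0 / p)" using h by (simp add: pos_divide_le_eq mult_ac)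
qed

text \<open>The square of a sum of m increments is at most m times the sum of their squares, and all
  squared increments together are O(h). Since m h is the elapsed time, this is Hoelder continuity in
  time of exponent 1/2 with values in L^2.\<close>

lemma discrete_flow_d2:
  assumes h: "0 < h" and U: "discrete_flow h u0 U"
  shows "d2 (U (i + m)) (U i) \<le> real m * (2 * h * (En u0 / p))"
proof -
  have a: "adm (U k)" for k using U by (simp add: discrete_flow_def)
  have [measurable]: "U k \<in> borel_measurable borel" for k by (rule admD(1)[OF a])
  have pt: "(norm (U (i + m) x - U i x))\<^sup>2 \<le> real m * (\<Sum>l<m. (norm (U (Suc (i + l)) x - U (i + l) x))\<^sup>2)" for x
  proof -
    have e: "U (i + m) x - U i x = (\<Sum>l<m. U (Suc (i + l)) x - U (i + l) x)"
      using sum_lessThan_telescope[of "\<lambda>l. U (i + l) x" m] by simp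
    have "norm (U (i + m) x - U i x) \<le> (\<Sum>l<m. norm (U (Suc (i + l)) x - U (i + l) x))"
      unfolding e by (rule norm_sum)
    then have "(norm (U (i + m) x - U i x))\<^sup>2 \<le> (\<Sum>l<m. norm (U (Suc (i + l)) x - U (i + l) x))\<^sup>2" by (rule power_mono) simp
    also have "\<dots> \<le> (\<Sum>l<m. (norm (U (Suc (i + l)) x - U (i + l) x))\<^sup>2) * card {..<m}"
      by (rule sum_squared_le_sum_of_squares)
    finally show ?thesis by (simp add: mult.commute)
  qed
  have ii: "integrable \<mu> (\<lambda>x. (norm (U k x - U l x))\<^sup>2)" for k l by (rule d2_integrable[OF a a])
  have "d2 (U (i + m)) (U i) \<le> (LINT x|\<mu>. real m * (\<Sum>l<m. (norm (U (Suc (i + l)) x - U (i + l) x))\<^sup>2))"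
    unfolding d2_def by (rule integral_mono[OF ii _ pt]) (intro integrable_mult_right Bochner_Integration.integrable_sum ii)
  also have "\<dots> = real m * (\<Sum>l<m. d2 (U (Suc (i + l))) (U (i + l)))"
    using ii by (simp add: d2_def)
  also have "(\<Sum>l<m. d2 (U (Suc (i + l))) (U (i + l))) = (\<Sum>l\<in>(+) i ` {..<m}. d2 (U (Suc l)) (U l))"
    by (simp add: sum.reindex)
  also have "real m * \<dots> \<le> real m * (\<Sum>l<i + m. d2 (U (Suc l)) (U l))"
    by (intro mult_left_mono sum_mono2) (auto simp: d2_nonneg)
  also have "\<dots> \<le> real m * (2 * h * (En u0 / p))"
    by (intro mult_left_mono discrete_flow_bounds[OF h U]) simp
  finally show ?thesis .
qed

end

subsection \<open>Compactness in time\<close>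

lemma sigma_finite_domain_measure: "open \<Omega> \<Longrightarrow> sigma_finite_measure (domain_measure \<Omega>)"
  unfolding domain_measure_def
  by (subst sigma_finite_measure.sigma_finite_iff_density_finite[OF lborel.sigma_finite_measure_axioms]) auto

text \<open>If the claim failed, there would be a bad pair of indices beyond each n; along these
  pairs dominated convergence with the constant C applies and contradicts the lower bound e.\<close>

lemma double_limit_integral:
  fixes g :: "nat \<Rightarrow> nat \<Rightarrow> 'a \<Rightarrow> real"
  assumes "finite_measure M" and [measurable]: "\<And>i j. g i j \<in> borel_measurable M"
    and g: "\<And>i j t. 0 \<le> g i j t" "\<And>i j t. g i j t \<le> C"
    and lim: "\<And>t e. 0 < e \<Longrightarrow> \<exists>n. \<forall>i\<ge>n. \<forall>j\<ge>n. g i j t < e" and e: "0 < e"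
  shows "\<exists>n. \<forall>i\<ge>n. \<forall>j\<ge>n. integral\<^sup>L M (g i j) < e"
proof (rule ccontr)
  interpret finite_measure M by fact
  assume "\<not> ?thesis"
  then have "\<exists>i j. n \<le> i \<and> n \<le> j \<and> e \<le> integral\<^sup>L M (g i j)" for n by (meson not_le)
  then obtain i j where ij: "\<And>n. n \<le> i n" "\<And>n. n \<le> j n" "\<And>n. e \<le> integral\<^sup>L M (g (i n) (j n))" by metis
  have "(\<lambda>n. integral\<^sup>L M (g (i n) (j n))) \<longlonglongrightarrow> integral\<^sup>L M (\<lambda>t. 0)"
  proof (rule integral_dominated_convergence[where w = "\<lambda>t. C"])
    show "AE t in M. (\<lambda>n. g (i n) (j n) t) \<longlonglongrightarrow> 0"
    proof (intro AE_I2 LIMSEQ_I)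
      fix t and \<epsilon> :: real assume "0 < \<epsilon>"
      then obtain n where "\<forall>i\<ge>n. \<forall>j\<ge>n. g i j t < \<epsilon>" using lim by blast
      then have "norm (g (i m) (j m) t - 0) < \<epsilon>" if "n \<le> m" for m
        using ij(1,2)[of m] that g(1)[of "i m" "j m" t] by (simp add: abs_of_nonneg order_trans[OF that])
      then show "\<exists>n. \<forall>m\<ge>n. norm (g (i m) (j m) t - 0) < \<epsilon>" by blast
    qed
    show "AE t in M. norm (g (i n) (j n) t) \<le> C" for n using g by (intro AE_I2) simp
  qed simp_all
  from LIMSEQ_le_const[OF this] ij(3) e show False by fastforce
qed

section \<open>Piecewise constant interpolation in time\<close>

context energy_flow begin

definition st :: "('a \<times> real) measure" where "st = \<mu> \<Otimes>\<^sub>M domain_measure {0<..}"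

sublocale time: sigma_finite_measure "domain_measure {0<..} :: real measure"
  by (rule sigma_finite_domain_measure) simp
sublocale mu_time: pair_sigma_finite \<mu> "domain_measure {0<..} :: real measure" ..

lemma sets_st [measurable_cong, simp]: "sets st = sets borel"
proof -
  have "sets st = sets (borel \<Otimes>\<^sub>M borel :: ('a \<times> real) measure)" unfolding st_def by (rule sets_pair_measure_cong) simp_all
  then show ?thesis by (simp only: borel_prod)
qed

lemma space_st [simp]: "space st = UNIV"
  using sets_eq_imp_space_eq[OF sets_st] by simp

sublocale st: sigma_finite_measure st
  unfolding st_def by (rule mu_time.sigma_finite_measure_axioms)

lemma borel_measurable_st: "f \<in> borel_measurable borel \<Longrightarrow> f \<in> borel_measurable st"
  by (simp only: measurable_cong_sets[OF sets_st refl])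

lemma swap_measurable:
  fixes f :: "'a \<times> real \<Rightarrow> 'c::topological_space" and T :: "real measure"
  assumes f: "f \<in> borel_measurable borel" and T: "sets T = sets borel"
  shows "(\<lambda>(t, x). f (x, t)) \<in> borel_measurable (T \<Otimes>\<^sub>M \<mu>)"
proof -
  have s: "sets (T \<Otimes>\<^sub>M \<mu>) = sets (borel :: (real \<times> 'a) measure)"
    using sets_pair_measure_cong[OF T sets_mu] by (simp only: borel_prod)
  have "(\<lambda>z :: real \<times> 'a. (snd z, fst z)) \<in> borel_measurable borel"
    by (intro borel_measurable_continuous_onI continuous_intros)
  from measurable_compose[OF this f] show ?thesis
    by (simp only: measurable_cong_sets[OF s refl] case_prod_beta')
qed

lemma slice_measurable [measurable]:
  fixes f :: "'a \<times> real \<Rightarrow> 'c::euclidean_space"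
  assumes "f \<in> borel_measurable borel" shows "(\<lambda>x. f (x, t)) \<in> borel_measurable borel"
  using assms by (rule measurable_compose[rotated]) (intro borel_measurable_continuous_onI continuous_intros)

text \<open>Twice the initial energy. The factor 2 undoes the 1/2 in the penalty d2 / (2 h) of a
  step, and one constant then serves both for the L^2 norm of the time derivative and for the
  modulus of continuity in time.\<close>

definition E0 :: "('a \<Rightarrow> 'b) \<Rightarrow> real" where "E0 u0 = 2 * (En u0 / p)"

lemma E0_nonneg: "0 \<le> E0 u0" using p by (simp add: E0_def En_nonneg)

text \<open>What the limit needs to know about the interpolant u and its backward difference
  quotient D. The last clause, finitely many values up to each time, is kept for strong
  measurability in the Bochner sense.\<close>

definition approx :: "('a \<Rightarrow> 'b) \<Rightarrow> real \<Rightarrow> ('a \<times> real \<Rightarrow> 'b) \<Rightarrow> ('a \<times> real \<Rightarrow> 'b) \<Rightarrow> bool" where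
  "approx u0 h u D \<longleftrightarrow> u \<in> borel_measurable borel \<and> (\<forall>t. adm (\<lambda>x. u (x, t)) \<and> En (\<lambda>x. u (x, t)) \<le> En u0) \<and>
    (\<forall>x t. t \<le> 0 \<longrightarrow> u (x, t) = u0 x) \<and>
    (\<forall>t s. d2 (\<lambda>x. u (x, t)) (\<lambda>x. u (x, s)) \<le> E0 u0 * (\<bar>t - s\<bar> + h)) \<and>
    (\<forall>x t. D (x, t) = (1 / h) *\<^sub>R (u (x, t) - u (x, t - h))) \<and>
    square_integrable st D \<and> (LINT z|st. (norm (D z))\<^sup>2) \<le> E0 u0 \<and>
    (\<forall>t>0. \<forall>A\<in>lie. \<forall>\<eta>. test \<eta> \<longrightarrow>
      (LINT x|\<mu>. D (x, t) \<bullet> (\<eta> x *\<^sub>R act A (u (x, t)))) + variation (\<lambda>x. u (x, t)) A \<eta> = 0) \<and>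
    (\<exists>\<kappa> V. \<kappa> \<in> borel \<rightarrow>\<^sub>M count_space UNIV \<and> (\<forall>T. finite (\<kappa> ` {..T})) \<and> (\<forall>k :: nat. adm (V k)) \<and>
      (\<forall>x t. u (x, t) = V (\<kappa> t) x))"

lemma d2_commute: "d2 v w = d2 w v" by (simp add: d2_def norm_minus_commute)

text \<open>Rounding up the later time overshoots by at most one step, and rounding up the earlier
  one only helps; hence the additional h.\<close>

lemma nat_ceiling_diff_le:
  assumes h: "0 < h" and st: "s \<le> t"
  shows "(real (nat \<lceil>t / h\<rceil>) - real (nat \<lceil>s / h\<rceil>)) * h \<le> \<bar>t - s\<bar> + h"
proof (cases "\<lceil>t / h\<rceil> \<le> 0")
  case True
  then have "(real (nat \<lceil>t / h\<rceil>) - real (nat \<lceil>s / h\<rceil>)) * h \<le> 0" using h by (simp add: mult_nonpos_nonneg)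
  then show ?thesis using h by linarith
next
  case False
  then have "real (nat \<lceil>t / h\<rceil>) \<le> t / h + 1" by linarith
  moreover have "s / h \<le> real (nat \<lceil>s / h\<rceil>)" by linarith
  ultimately have "real (nat \<lceil>t / h\<rceil>) - real (nat \<lceil>s / h\<rceil>) \<le> t / h + 1 - s / h" by linarith
  then have "(real (nat \<lceil>t / h\<rceil>) - real (nat \<lceil>s / h\<rceil>)) * h \<le> (t / h + 1 - s / h) * h"
    using h by (intro mult_right_mono) auto
  also have "\<dots> = t - s + h" using h by (simp add: field_simps)
  finally show ?thesis using st by simp
qed

lemma nat_ceiling_shift: "0 < h \<Longrightarrow> nat \<lceil>(t - h) / h\<rceil> = nat \<lceil>t / h\<rceil> - 1"
proof -
  assume h: "0 < h"
  have "(t - h) / h = t / h - 1" using h by (simp add: diff_divide_distrib)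
  then show ?thesis by simp
qed

lemma interpolant_d2_le:
  assumes h: "0 < h" and U: "discrete_flow h u0 U"
  shows "d2 (U (nat \<lceil>t / h\<rceil>)) (U (nat \<lceil>s / h\<rceil>)) \<le> E0 u0 * (\<bar>t - s\<bar> + h)"
proof -
  have *: "d2 (U (nat \<lceil>t / h\<rceil>)) (U (nat \<lceil>s / h\<rceil>)) \<le> E0 u0 * (\<bar>t - s\<bar> + h)" if st: "s \<le> t" for s t
  proof -
    define k i where "k = nat \<lceil>t / h\<rceil>" and "i = nat \<lceil>s / h\<rceil>"
    have ik: "i \<le> k" unfolding k_def i_def using st h by (intro nat_mono ceiling_mono divide_right_mono) auto
    have "d2 (U (i + (k - i))) (U i) \<le> real (k - i) * (2 * h * (En u0 / p))" by (rule discrete_flow_d2[OF h U])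
    also have "\<dots> = E0 u0 * ((real k - real i) * h)" using ik by (simp add: E0_def of_nat_diff)
    also have "\<dots> \<le> E0 u0 * (\<bar>t - s\<bar> + h)"
      unfolding k_def i_def by (intro mult_left_mono nat_ceiling_diff_le h st E0_nonneg)
    finally show ?thesis using ik by (simp add: k_def i_def)
  qed
  show ?thesis using *[of s t] *[of t s] by (cases "s \<le> t") (auto simp: d2_commute abs_minus_commute)
qed

text \<open>On (k h, (k+1) h] the function D does not depend on time and its squared norm is d k /
  h^2. Integrating over an interval of length h leaves d k / h, and the sum of the d k is bounded by
  h times \<open>E0\<close>.\<close>

lemma difference_quotient_bound:
  assumes h: "0 < h" and U: "discrete_flow h u0 U"
    and D: "\<And>x t. D (x, t) = (1 / h) *\<^sub>R (U (nat \<lceil>t / h\<rceil>) x - U (nat \<lceil>t / h\<rceil> - 1) x)"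
    and Dm[measurable]: "D \<in> borel_measurable borel"
  shows "square_integrable st D \<and> (LINT z|st. (norm (D z))\<^sup>2) \<le> E0 u0"
proof -
  have a: "adm (U k)" for k using U by (simp add: discrete_flow_def)
  define d where "d k = d2 (U (Suc k)) (U k)" for k
  have d0: "0 \<le> d k" for k by (simp add: d_def d2_nonneg)
  have inner: "(\<integral>\<^sup>+x. ennreal ((norm (D (x, t)))\<^sup>2) \<partial>\<mu>) \<le>
      (\<Sum>k. ennreal (d k / h\<^sup>2) * indicator {real k * h<..real (Suc k) * h} t)" if t: "0 < t" for t
  proof -
    define k where "k = nat \<lceil>t / h\<rceil> - 1"
    have "0 < \<lceil>t / h\<rceil>" using t h by simp
    then have Sk: "nat \<lceil>t / h\<rceil> = Suc k" by (simp add: k_def)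
    have rk: "real k < t / h" "t / h \<le> real (Suc k)" using Sk \<open>0 < \<lceil>t / h\<rceil>\<close> by linarith+
    then have tk: "t \<in> {real k * h<..real (Suc k) * h}" using h by (simp add: pos_less_divide_eq pos_divide_le_eq)
    have "(norm (D (x, t)))\<^sup>2 = (norm (U (Suc k) x - U k x))\<^sup>2 / h\<^sup>2" for x
      using Sk h by (simp add: D power_divide)
    then have "(\<integral>\<^sup>+x. ennreal ((norm (D (x, t)))\<^sup>2) \<partial>\<mu>) = ennreal (d k / h\<^sup>2)"
      using d2_integrable[OF a[of "Suc k"] a[of k]] by (simp add: nn_integral_eq_integral d_def d2_def)
    also have "\<dots> \<le> (\<Sum>k. ennreal (d k / h\<^sup>2) * indicator {real k * h<..real (Suc k) * h} t)"
    proof -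
      define F where "F = (\<lambda>k. ennreal (d k / h\<^sup>2) * indicator {real k * h<..real (Suc k) * h} t)"
      have "sum F {k} \<le> suminf F" by (rule sum_le_suminf) (auto intro: summableI)
      moreover have "F k = ennreal (d k / h\<^sup>2)" using tk by (simp add: F_def)
      ultimately have "ennreal (d k / h\<^sup>2) \<le> suminf F" by simp
      then show ?thesis by (simp only: F_def)
    qed
    finally show ?thesis .
  qed
  have "(\<integral>\<^sup>+z. ennreal ((norm (D z))\<^sup>2) \<partial>st) = (\<integral>\<^sup>+t. (\<integral>\<^sup>+x. ennreal ((norm (D (x, t)))\<^sup>2) \<partial>\<mu>) \<partial>domain_measure {0<..})"
    unfolding st_def
  proof (rule mu_time.nn_integral_snd[symmetric])
    have "(\<lambda>z. ennreal ((norm (D z))\<^sup>2)) \<in> borel_measurable borel" by measurable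
    then show "(\<lambda>z. ennreal ((norm (D z))\<^sup>2)) \<in> borel_measurable (\<mu> \<Otimes>\<^sub>M domain_measure {0<..})"
      unfolding st_def[symmetric] by (rule borel_measurable_st)
  qed
  also have "\<dots> = (\<integral>\<^sup>+t. ennreal (indicator {0<..} t) * (\<integral>\<^sup>+x. ennreal ((norm (D (x, t)))\<^sup>2) \<partial>\<mu>) \<partial>lborel)"
  proof -
    have "(\<lambda>(t, x). ennreal ((norm (D (x, t)))\<^sup>2)) \<in> borel_measurable (lborel \<Otimes>\<^sub>M \<mu>)"
      by (rule swap_measurable[of "\<lambda>z. ennreal ((norm (D z))\<^sup>2)"]) simp_all
    then have "(\<lambda>t. \<integral>\<^sup>+x. ennreal ((norm (D (x, t)))\<^sup>2) \<partial>\<mu>) \<in> borel_measurable lborel"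
      by (rule mu.borel_measurable_nn_integral)
    then show ?thesis unfolding domain_measure_def by (intro nn_integral_density) auto
  qed
  also have "\<dots> \<le> (\<integral>\<^sup>+t. (\<Sum>k. ennreal (d k / h\<^sup>2) * indicator {real k * h<..real (Suc k) * h} t) \<partial>lborel)"
  proof (rule nn_integral_mono)
    fix t :: real
    show "ennreal (indicator {0<..} t) * (\<integral>\<^sup>+x. ennreal ((norm (D (x, t)))\<^sup>2) \<partial>\<mu>) \<le>
        (\<Sum>k. ennreal (d k / h\<^sup>2) * indicator {real k * h<..real (Suc k) * h} t)"
      using inner[of t] by (cases "0 < t") auto
  qed
  also have "\<dots> = (\<Sum>k. \<integral>\<^sup>+t. ennreal (d k / h\<^sup>2) * indicator {real k * h<..real (Suc k) * h} t \<partial>lborel)"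
    by (rule nn_integral_suminf) simp
  also have "\<dots> = (\<Sum>k. ennreal (d k / h))"
  proof (intro suminf_cong)
    fix k
    have "(\<integral>\<^sup>+t. ennreal (d k / h\<^sup>2) * indicator {real k * h<..real (Suc k) * h} t \<partial>lborel) = ennreal (d k / h\<^sup>2) * ennreal h"
      using h by (simp add: nn_integral_cmult_indicator algebra_simps)
    also have "\<dots> = ennreal (d k / h)"
      using h d0[of k] by (simp add: ennreal_mult[symmetric] power2_eq_square)
    finally show "(\<integral>\<^sup>+t. ennreal (d k / h\<^sup>2) * indicator {real k * h<..real (Suc k) * h} t \<partial>lborel) = ennreal (d k / h)" .
  qed
  also have "\<dots> \<le> ennreal (E0 u0)"
    unfolding suminf_eq_SUP
  proof (rule SUP_least)
    fix n
    have "(\<Sum>k<n. ennreal (d k / h)) = ennreal ((\<Sum>k<n. d k) / h)"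
      using h d0 by (subst sum_ennreal) (auto simp: sum_divide_distrib)
    also have "\<dots> \<le> ennreal (E0 u0)"
      using discrete_flow_bounds(2)[OF h U, of n] h by (intro ennreal_leI) (simp add: pos_divide_le_eq E0_def d_def mult_ac)
    finally show "(\<Sum>k<n. ennreal (d k / h)) \<le> ennreal (E0 u0)" .
  qed
  finally have le: "(\<integral>\<^sup>+z. ennreal ((norm (D z))\<^sup>2) \<partial>st) \<le> ennreal (E0 u0)" .
  have i: "integrable st (\<lambda>z. (norm (D z))\<^sup>2)"
    by (rule integrableI_nonneg) (use le in \<open>auto intro: le_less_trans\<close>)
  then show ?thesis using le E0_nonneg by (simp add: square_integrable_def nn_integral_eq_integral)
qed

lemma approx_exists:
  assumes h: "0 < h" and u0: "adm u0" shows "\<exists>u D. approx u0 h u D"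
proof -
  obtain U where U: "discrete_flow h u0 U" using discrete_flow_exists[OF h u0] by blast
  have a: "adm (U k)" for k using U by (simp add: discrete_flow_def)
  have [measurable]: "U k \<in> borel_measurable borel" for k by (rule admD(1)[OF a])
  \<comment> \<open>Rounding up makes the k-th step act on (k h - h, k h], and \<open>nat\<close>
    sends all nonpositive times to index 0. The flow is thus extended by u0 to negative times, and D
    is defined at every time.\<close>
  define \<kappa> where "\<kappa> t = nat \<lceil>t / h\<rceil>" for t :: real
  have [measurable]: "\<kappa> \<in> borel \<rightarrow>\<^sub>M count_space UNIV" unfolding \<kappa>_def by measurable
  define u where "u z = U (\<kappa> (snd z)) (fst z)" for z
  have u_m: "u \<in> borel_measurable borel"
  proof -
    have "(\<lambda>z. U k (fst z)) \<in> borel_measurable (borel :: ('a \<times> real) measure)" for k by measurable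
    moreover have "(\<lambda>z. \<kappa> (snd z)) \<in> (borel :: ('a \<times> real) measure) \<rightarrow>\<^sub>M count_space UNIV" by measurable
    ultimately show ?thesis unfolding u_def
      by (rule measurable_compose_countable[of "\<lambda>k z. U k (fst z)" borel borel "\<lambda>z. \<kappa> (snd z)"])
  qed
  define D where "D z = (1 / h) *\<^sub>R (u z - u (fst z, snd z - h))" for z
  have D_m: "D \<in> borel_measurable borel"
  proof -
    have "(\<lambda>z. (fst z, snd z - h)) \<in> borel_measurable (borel :: ('a \<times> real) measure)"
      by (intro borel_measurable_continuous_onI continuous_intros)
    from measurable_compose[OF this u_m] u_m show ?thesis unfolding D_def
      by (intro borel_measurable_scaleR borel_measurable_const borel_measurable_diff)
  qed
  have \<kappa>s: "\<kappa> (t - h) = \<kappa> t - 1" for t unfolding \<kappa>_def by (rule nat_ceiling_shift[OF h])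
  have fin: "finite (\<kappa> ` {..T})" for T
  proof (rule finite_subset)
    show "\<kappa> ` {..T} \<subseteq> {..\<kappa> T}"
    proof (rule image_subsetI)
      fix t assume "t \<in> {..T}"
      then have "t / h \<le> T / h" using h by (intro divide_right_mono) auto
      then show "\<kappa> t \<in> {..\<kappa> T}" unfolding \<kappa>_def atMost_iff by (intro nat_mono ceiling_mono)
    qed
  qed simp
  have EL: "(LINT x|\<mu>. D (x, t) \<bullet> (\<eta> x *\<^sub>R act A (u (x, t)))) + variation (\<lambda>x. u (x, t)) A \<eta> = 0"
    if t: "0 < t" and A: "A \<in> lie" and \<eta>: "test \<eta>" for t A \<eta>
  proof -
    have "0 < \<lceil>t / h\<rceil>" using t h by simp
    then obtain k where k: "\<kappa> t = Suc k" unfolding \<kappa>_def by (cases "nat \<lceil>t / h\<rceil>") auto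
    have "(1 / h) * (LINT x|\<mu>. (U (Suc k) x - U k x) \<bullet> (\<eta> x *\<^sub>R act A (U (Suc k) x))) + variation (U (Suc k)) A \<eta> = 0"
      using U A \<eta> by (simp add: discrete_flow_def)
    moreover have "D (x, t) \<bullet> (\<eta> x *\<^sub>R act A (u (x, t))) = (1 / h) * ((U (Suc k) x - U k x) \<bullet> (\<eta> x *\<^sub>R act A (U (Suc k) x)))" for x
      by (simp add: D_def u_def k \<kappa>s)
    ultimately show ?thesis by (simp add: u_def k)
  qed
  have DD: "square_integrable st D \<and> (LINT z|st. (norm (D z))\<^sup>2) \<le> E0 u0"
  proof (rule difference_quotient_bound[OF h U _ D_m])
    show "D (x, t) = (1 / h) *\<^sub>R (U (nat \<lceil>t / h\<rceil>) x - U (nat \<lceil>t / h\<rceil> - 1) x)" for x t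
      by (simp only: D_def u_def \<kappa>s fst_conv snd_conv) (simp only: \<kappa>_def)
  qed
  have "approx u0 h u D"
    unfolding approx_def
  proof (intro conjI allI impI ballI)
    show "\<exists>\<kappa> V. \<kappa> \<in> borel \<rightarrow>\<^sub>M count_space UNIV \<and> (\<forall>T. finite (\<kappa> ` {..T})) \<and> (\<forall>k :: nat. adm (V k)) \<and> (\<forall>x t. u (x, t) = V (\<kappa> t) x)"
      using fin a by (intro exI[of _ \<kappa>] exI[of _ U]) (simp add: u_def)
    show "d2 (\<lambda>x. u (x, t)) (\<lambda>x. u (x, s)) \<le> E0 u0 * (\<bar>t - s\<bar> + h)" for t s
      using interpolant_d2_le[OF h U, of t s] by (simp add: u_def \<kappa>_def)
    show "u (x, t) = u0 x" if "t \<le> 0" for x t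
    proof -
      have "\<kappa> t = 0" using that h by (simp add: \<kappa>_def divide_nonpos_pos)
      then show ?thesis using U by (simp add: u_def discrete_flow_def)
    qed
    show "D (x, t) = (1 / h) *\<^sub>R (u (x, t) - u (x, t - h))" for x t by (simp add: D_def u_def)
  qed (use DD EL a discrete_flow_bounds(1)[OF h U] u_m in \<open>simp_all add: u_def\<close>)
  then show ?thesis by blast
qed


lemma approxD:
  assumes "approx u0 h u D"
  shows "u \<in> borel_measurable borel" "\<And>t. adm (\<lambda>x. u (x, t))" "\<And>t. En (\<lambda>x. u (x, t)) \<le> En u0"
    "\<And>x t. t \<le> 0 \<Longrightarrow> u (x, t) = u0 x"
    "\<And>t s. d2 (\<lambda>x. u (x, t)) (\<lambda>x. u (x, s)) \<le> E0 u0 * (\<bar>t - s\<bar> + h)"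
    "\<And>x t. D (x, t) = (1 / h) *\<^sub>R (u (x, t) - u (x, t - h))"
    "square_integrable st D" "(LINT z|st. (norm (D z))\<^sup>2) \<le> E0 u0"
    "\<And>t A \<eta>. 0 < t \<Longrightarrow> A \<in> lie \<Longrightarrow> test \<eta> \<Longrightarrow>
      (LINT x|\<mu>. D (x, t) \<bullet> (\<eta> x *\<^sub>R act A (u (x, t)))) + variation (\<lambda>x. u (x, t)) A \<eta> = 0"
    "\<exists>\<kappa> V. \<kappa> \<in> borel \<rightarrow>\<^sub>M count_space UNIV \<and> (\<forall>T. finite (\<kappa> ` {..T})) \<and> (\<forall>k :: nat. adm (V k)) \<and>
      (\<forall>x t. u (x, t) = V (\<kappa> t) x)"
  using assms unfolding approx_def by blast+

lemma d2_triangle: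
  assumes "adm v" "adm w" "adm z" shows "d2 v w \<le> 2 * (d2 v z + d2 z w)"
proof -
  have "d2 v w \<le> (LINT x|\<mu>. 2 * ((norm (v x - z x))\<^sup>2 + (norm (z x - w x))\<^sup>2))"
    unfolding d2_def
  proof (rule integral_mono)
    show "(norm (v x - w x))\<^sup>2 \<le> 2 * ((norm (v x - z x))\<^sup>2 + (norm (z x - w x))\<^sup>2)" for x
      using norm_add_sq_le[of "v x - z x" "z x - w x"] by simp
  qed (use d2_integrable assms in auto)
  also have "\<dots> = 2 * (d2 v z + d2 z w)"
    using d2_integrable assms by (simp add: d2_def)
  finally show ?thesis .
qed

text \<open>At a fixed time the energy bound gives a subsequence converging almost everywhere;
  countably many times are handled diagonally. The modulus of continuity later carries the
  convergence to all other times.\<close>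

lemma rational_time_subsequence:
  fixes u :: "nat \<Rightarrow> 'a \<times> real \<Rightarrow> 'b"
  assumes u: "\<And>j t. adm (\<lambda>x. u j (x, t :: real))" "\<And>j t. En (\<lambda>x. u j (x, t)) \<le> C"
  shows "\<exists>r. strict_mono r \<and> (\<forall>q\<in>\<rat>. AE x in \<mu>. convergent (\<lambda>j. u (r j) (x, q)))"
proof (rule diagonal_subsequence[of "\<rat>" "\<lambda>q s. AE x in \<mu>. convergent (\<lambda>j. u (s j) (x, q))"])
  fix q and s :: "nat \<Rightarrow> nat"
  have "\<exists>r v'. strict_mono (r :: nat \<Rightarrow> nat) \<and> adm v' \<and> En v' \<le> C \<and> (AE x in \<mu>. (\<lambda>j. u (s (r j)) (x, q)) \<longlonglongrightarrow> v' x)"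
    by (rule bounded_energy_subsequence[of "\<lambda>j x. u (s j) (x, q)"]) (rule u)+
  then obtain r v' where "strict_mono (r :: nat \<Rightarrow> nat)" and l: "AE x in \<mu>. (\<lambda>j. u (s (r j)) (x, q)) \<longlonglongrightarrow> v' x"
    by (elim exE conjE)
  moreover have "AE x in \<mu>. convergent (\<lambda>j. u (s (r j)) (x, q))"
    using l by eventually_elim (rule convergentI)
  ultimately show "\<exists>r. strict_mono r \<and> (AE x in \<mu>. convergent (\<lambda>j. u ((s \<circ> r) j) (x, q)))" by auto
next
  fix q and s r :: "nat \<Rightarrow> nat" assume r: "strict_mono r" and s: "AE x in \<mu>. convergent (\<lambda>j. u (s j) (x, q))"
  show "AE x in \<mu>. convergent (\<lambda>j. u ((s \<circ> r) j) (x, q))"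
    using s by eventually_elim (use convergent_subseq_convergent[OF _ r] in \<open>simp add: o_def\<close>)
next
  fix q and s :: "nat \<Rightarrow> nat" and k assume s: "AE x in \<mu>. convergent (\<lambda>j. u ((s \<circ> (+) k) j) (x, q))"
  show "AE x in \<mu>. convergent (\<lambda>j. u (s j) (x, q))"
    using s
  proof eventually_elim
    case (elim x)
    then have "convergent (\<lambda>j. (\<lambda>n. u (s n) (x, q)) (j + k))" by (simp add: add.commute)
    then show ?case by (subst (asm) convergent_ignore_initial_segment)
  qed
qed (auto simp: countable_rat)

lemma d2_cauchy_of_AE_convergent:
  assumes v: "\<And>j. adm (v j)" "\<And>j. En (v j) \<le> C" and c: "AE x in \<mu>. convergent (\<lambda>j. v j x)"
  shows "\<exists>b. b \<longlonglongrightarrow> 0 \<and> (\<forall>i j. d2 (v i) (v j) \<le> b i + b j)"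
proof -
  have "\<exists>w. w \<in> borel_measurable borel \<and> (\<forall>x. w x \<in> N) \<and> (\<forall>x. convergent (\<lambda>j. v j x) \<longrightarrow> (\<lambda>j. v j x) \<longlonglongrightarrow> w x)"
    by (rule limit_in_N) (use v admD in auto)
  then obtain w where w: "w \<in> borel_measurable borel" "\<And>x. w x \<in> N" "\<And>x. convergent (\<lambda>j. v j x) \<Longrightarrow> (\<lambda>j. v j x) \<longlonglongrightarrow> w x"
    by blast
  have lim: "AE x in \<mu>. (\<lambda>j. v j x) \<longlonglongrightarrow> w x" using c by eventually_elim (rule w(3))
  have aw: "adm w" using adm_limit[OF v lim w(1,2)] by simp
  have "(\<lambda>j. 2 * d2 (v j) w) \<longlonglongrightarrow> 2 * d2 w w" by (intro tendsto_intros d2_tendsto[OF v(1) aw aw lim])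
  then have "(\<lambda>j. 2 * d2 (v j) w) \<longlonglongrightarrow> 0" by (simp add: d2_def)
  moreover have "d2 (v i) (v j) \<le> 2 * d2 (v i) w + 2 * d2 (v j) w" for i j
    using d2_triangle[OF v(1)[of i] v(1)[of j] aw] by (simp add: d2_commute)
  ultimately show ?thesis by blast
qed

text \<open>A rational time within \<delta> of t carries the convergence, since every interpolant
  moves by at most E0 (\<delta> + h j) in between. The 16 in \<delta> leaves room for the factors 2
  and 4 that two uses of the squared triangle inequality produce.\<close>

lemma d2_cauchy_at_time:
  assumes h: "h \<longlonglongrightarrow> 0" and a: "\<And>j. approx u0 (h j) (u j) (D j)"
    and c: "\<And>q. q \<in> \<rat> \<Longrightarrow> AE x in \<mu>. convergent (\<lambda>j. u j (x, q))" and e: "0 < e"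
  shows "\<exists>n. \<forall>i\<ge>n. \<forall>j\<ge>n. d2 (\<lambda>x. u i (x, t)) (\<lambda>x. u j (x, t)) < e"
proof -
  define \<delta> where "\<delta> = e / (16 * (E0 u0 + 1))"
  have \<delta>: "0 < \<delta>" using e E0_nonneg[of u0] by (simp add: \<delta>_def)
  have E\<delta>: "E0 u0 * \<delta> \<le> e / 16"
  proof -
    have "E0 u0 * \<delta> \<le> (E0 u0 + 1) * \<delta>" using \<delta> by (intro mult_right_mono) auto
    also have "\<dots> = e / 16" using E0_nonneg[of u0] by (simp add: \<delta>_def field_simps)
    finally show ?thesis .
  qed
  obtain q where q: "q \<in> \<rat>" "t < q" "q < t + \<delta>" using Rats_dense_in_real[of t "t + \<delta>"] \<delta> by auto
  let ?v = "\<lambda>j t x. u j (x, t)"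
  have adm: "adm (?v j t)" "En (?v j t) \<le> En u0" for j t by (rule approxD[OF a])+
  obtain b where b: "b \<longlonglongrightarrow> 0" "\<And>i j. d2 (?v i q) (?v j q) \<le> b i + b j"
    using d2_cauchy_of_AE_convergent[of "\<lambda>j. ?v j q", OF adm c[OF q(1)]] by blast
  have tq: "d2 (?v j t) (?v j q) \<le> e / 16 + E0 u0 * h j" for j
  proof -
    have "d2 (?v j t) (?v j q) \<le> E0 u0 * (\<bar>t - q\<bar> + h j)" by (rule approxD(5)[OF a])
    also have "\<dots> \<le> E0 u0 * (\<delta> + h j)" using q E0_nonneg by (intro mult_left_mono) auto
    also have "\<dots> \<le> e / 16 + E0 u0 * h j" using E\<delta> by (simp add: distrib_left)
    finally show ?thesis .
  qed
  define f where "f j = 4 * (E0 u0 * h j) + 4 * b j" for j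
  have "f \<longlonglongrightarrow> 4 * (E0 u0 * 0) + 4 * 0" unfolding f_def by (intro tendsto_intros h b)
  then have "\<forall>\<^sub>F j in sequentially. f j < e / 8" using e by (intro order_tendstoD) auto
  then obtain n where n: "\<And>j. n \<le> j \<Longrightarrow> f j < e / 8" by (auto simp: eventually_sequentially)
  have "\<forall>\<^sub>F j in sequentially. E0 u0 * h j < e / 8"
    using tendsto_mult_right_zero[OF h, of "E0 u0"] e by (intro order_tendstoD) auto
  then obtain n' where n': "\<And>j. n' \<le> j \<Longrightarrow> E0 u0 * h j < e / 8" by (auto simp: eventually_sequentially)
  have "d2 (?v i t) (?v j t) < e" if ij: "max n n' \<le> i" "max n n' \<le> j" for i j
  proof -
    have "d2 (?v i t) (?v j t) \<le> 2 * (d2 (?v i t) (?v i q) + d2 (?v i q) (?v j t))"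
      by (rule d2_triangle[OF adm(1) adm(1) adm(1)])
    moreover have "d2 (?v i q) (?v j t) \<le> 2 * (d2 (?v i q) (?v j q) + d2 (?v j q) (?v j t))"
      by (rule d2_triangle[OF adm(1) adm(1) adm(1)])
    moreover have "d2 (?v j q) (?v j t) \<le> e / 16 + E0 u0 * h j" using tq[of j] by (simp add: d2_commute)
    ultimately have le: "d2 (?v i t) (?v j t) \<le> 2 * (e / 16 + E0 u0 * h i) + 4 * (b i + b j) + 4 * (e / 16 + E0 u0 * h j)"
      using tq[of i] b(2)[of i j] unfolding distrib_left by linarith
    have "f i < e / 8" "f j < e / 8" "E0 u0 * h i < e / 8" using n[of i] n[of j] n'[of i] ij by auto
    moreover have "0 \<le> E0 u0 * h i \<or> E0 u0 * h i < 0" by auto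
    ultimately have "2 * (E0 u0 * h i) + 4 * b i + (4 * b j + 4 * (E0 u0 * h j)) \<le> f i - 2 * (E0 u0 * h i) + f j"
      by (simp add: f_def)
    moreover have "- 2 * (E0 u0 * h i) \<le> 2 * (e / 16)"
    proof -
      have "0 \<le> d2 (?v i t) (?v i t)" "d2 (?v i t) (?v i t) \<le> E0 u0 * (\<bar>t - t\<bar> + h i)"
        by (rule d2_nonneg, rule approxD(5)[OF a])
      then have "0 \<le> E0 u0 * h i" by simp
      then show ?thesis using e by simp
    qed
    ultimately show ?thesis using le \<open>f i < e / 8\<close> \<open>f j < e / 8\<close> e unfolding distrib_left by linarith
  qed
  then show ?thesis by blast
qed

text \<open>Convergence in L^2 at each time is integrated against a finite weight in time, which
  gives a Cauchy sequence in L^1 on space-time and hence a subsequence converging almost everywhere.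
  The weight is positive, so exceptional times for it are exceptional for Lebesgue measure
  too.\<close>

theorem space_time_limit:
  assumes h: "h \<longlonglongrightarrow> 0" and a: "\<And>j. approx u0 (h j) (u j) (D j)"
  shows "\<exists>r u'. strict_mono r \<and> u' \<in> borel_measurable borel \<and> (\<forall>z. u' z \<in> N) \<and>
    (AE t in lborel. AE x in \<mu>. (\<lambda>j. u (r j) (x, t)) \<longlonglongrightarrow> u' (x, t))"
proof -
  obtain r0 where r0: "strict_mono r0" and c: "\<And>q. q \<in> \<rat> \<Longrightarrow> AE x in \<mu>. convergent (\<lambda>j. u (r0 j) (x, q))"
    using rational_time_subsequence[of u "En u0"] approxD(2,3)[OF a] by blast
  define w where "w j = u (r0 j)" for j
  have aw: "approx u0 (h (r0 j)) (w j) (D (r0 j))" for j unfolding w_def by (rule a)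
  have hr: "(\<lambda>j. h (r0 j)) \<longlonglongrightarrow> 0" using LIMSEQ_subseq_LIMSEQ[OF h r0] by (simp add: o_def)
  have wm[measurable]: "w j \<in> borel_measurable borel" for j by (rule approxD(1)[OF aw])
  have wadm: "adm (\<lambda>x. w j (x, t))" for j t by (rule approxD(2)[OF aw])
  have wN: "w j z \<in> N" for j z using admD(2)[OF wadm[of j "snd z"], of "fst z"] by simp
  obtain \<phi> :: "real \<Rightarrow> real" where \<phi>: "\<phi> \<in> borel_measurable lborel" "\<And>x. 0 < \<phi> x" "\<And>x. \<phi> x \<le> 1" "integrable lborel \<phi>"
    by (rule sigma_finite_measure.obtain_positive_integrable_function[OF lborel.sigma_finite_measure_axioms]) blast
  define \<theta> where "\<theta> = density lborel (\<lambda>t. ennreal (\<phi> t))"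
  have sets_\<theta>: "sets \<theta> = sets borel" by (simp add: \<theta>_def)
  have fin_\<theta>: "finite_measure \<theta>"
  proof
    have "emeasure \<theta> (space \<theta>) = (\<integral>\<^sup>+t. ennreal (\<phi> t) \<partial>lborel)"
      using \<phi>(1) by (simp add: \<theta>_def emeasure_density)
    also have "\<dots> = ennreal (integral\<^sup>L lborel \<phi>)"
      using \<phi> by (intro nn_integral_eq_integral) (auto intro: less_imp_le)
    finally show "emeasure \<theta> (space \<theta>) \<noteq> \<infinity>" by simp
  qed
  interpret th: finite_measure \<theta> by fact
  interpret P: pair_sigma_finite \<mu> \<theta> ..
  interpret PF: finite_measure "\<mu> \<Otimes>\<^sub>M \<theta>" by (rule finite_measure_pair_measure) (rule fin_\<theta> finite_mu)+
  have sets_P: "sets (\<mu> \<Otimes>\<^sub>M \<theta>) = sets (borel :: ('a \<times> real) measure)"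
    using sets_pair_measure_cong[OF sets_mu sets_\<theta>] by (simp only: borel_prod)
  have wP: "w j \<in> borel_measurable (\<mu> \<Otimes>\<^sub>M \<theta>)" for j
    by (simp only: measurable_cong_sets[OF sets_P refl] wm)
  have iw: "integrable (\<mu> \<Otimes>\<^sub>M \<theta>) (w j)" for j
    by (rule PF.integrable_const_bound[of _ R]) (use wP wN norm_N in auto)
  define g where "g i j t = (LINT x|\<mu>. norm (w i (x, t) - w j (x, t)))" for i j t
  have nm: "(\<lambda>z. norm (w i z - w j z)) \<in> borel_measurable borel" for i j by measurable
  have gm: "g i j \<in> borel_measurable \<theta>" for i j
    unfolding g_def by (rule mu.borel_measurable_lebesgue_integral) (rule swap_measurable[OF nm sets_\<theta>])
  have gi: "integrable \<mu> (\<lambda>x. norm (w i (x, t) - w j (x, t)))" for i j t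
    by (rule integrable_mu_bounded[of _ "2 * R"]) (use norm_diff_N wN in auto)
  have gC: "g i j t \<le> 2 * R * measure \<mu> UNIV" for i j t
  proof -
    have "g i j t \<le> (LINT x|\<mu>. 2 * R)" unfolding g_def using gi norm_diff_N wN by (intro integral_mono) auto
    then show ?thesis by (simp add: mult_ac)
  qed
  have g0: "0 \<le> g i j t" for i j t by (simp add: g_def)
  have glim: "\<exists>n. \<forall>i\<ge>n. \<forall>j\<ge>n. g i j t < e" if e: "0 < e" for t e
  proof -
    define m where "m = measure \<mu> UNIV"
    have m: "0 \<le> m" by (simp add: m_def)
    define \<delta> where "\<delta> = e / (2 * (m + 1))"
    have \<delta>: "0 < \<delta>" using e m by (simp add: \<delta>_def)
    have \<delta>m: "\<delta> * m < e / 2"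
    proof -
      have "\<delta> * m < \<delta> * (m + 1)" using \<delta> by simp
      also have "\<dots> = e / 2" using m by (simp add: \<delta>_def field_simps)
      finally show ?thesis .
    qed
    obtain n where n: "\<And>i j. n \<le> i \<Longrightarrow> n \<le> j \<Longrightarrow> d2 (\<lambda>x. w i (x, t)) (\<lambda>x. w j (x, t)) < \<delta> * (e / 2)"
      using d2_cauchy_at_time[OF hr aw, of "\<delta> * (e / 2)" t] c \<delta> e unfolding w_def by (metis half_gt_zero mult_pos_pos)
    have "g i j t < e" if ij: "n \<le> i" "n \<le> j" for i j
    proof -
      have "g i j t \<le> (LINT x|\<mu>. \<delta> + (norm (w i (x, t) - w j (x, t)))\<^sup>2 / \<delta>)"
        unfolding g_def
      proof (rule integral_mono[OF gi])
        show "integrable \<mu> (\<lambda>x. \<delta> + (norm (w i (x, t) - w j (x, t)))\<^sup>2 / \<delta>)"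
          using d2_integrable[OF wadm wadm] by simp
        show "norm (w i (x, t) - w j (x, t)) \<le> \<delta> + (norm (w i (x, t) - w j (x, t)))\<^sup>2 / \<delta>" for x
          using product_le_eps[OF \<delta>, of 1 "norm (w i (x, t) - w j (x, t))"] by simp
      qed
      also have "\<dots> = \<delta> * m + d2 (\<lambda>x. w i (x, t)) (\<lambda>x. w j (x, t)) / \<delta>"
        using d2_integrable[OF wadm wadm] by (simp add: d2_def m_def mult.commute)
      also have "\<dots> < e / 2 + (\<delta> * (e / 2)) / \<delta>"
        using \<delta>m n[OF ij] \<delta> by (intro add_strict_mono divide_strict_right_mono) auto
      also have "\<dots> = e" using \<delta> by simp
      finally show ?thesis .
    qed
    then show ?thesis by blast
  qed
  have cauchy: "\<exists>n. \<forall>i\<ge>n. \<forall>j\<ge>n. (LINT z|(\<mu> \<Otimes>\<^sub>M \<theta>). norm (w i z - w j z)) < e" if e: "0 < e" for e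
  proof -
    have "(LINT z|(\<mu> \<Otimes>\<^sub>M \<theta>). norm (w i z - w j z)) = integral\<^sup>L \<theta> (g i j)" for i j
    proof -
      have "integrable (\<mu> \<Otimes>\<^sub>M \<theta>) (\<lambda>(x, t). norm (w i (x, t) - w j (x, t)))"
        using iw by (simp add: case_prod_beta')
      from P.integral_snd[OF this] show ?thesis by (simp add: g_def[abs_def] case_prod_beta')
    qed
    then show ?thesis using double_limit_integral[OF fin_\<theta> gm g0 gC glim e] by simp
  qed
  obtain r1 where r1: "strict_mono r1" "AE z in \<mu> \<Otimes>\<^sub>M \<theta>. Cauchy (\<lambda>i. w (r1 i) z)"
    by (rule cauchy_L1_AE_cauchy_subseq[OF iw cauchy])
  have "\<exists>u'. u' \<in> borel_measurable borel \<and> (\<forall>z. u' z \<in> N) \<and> (\<forall>z. convergent (\<lambda>j. w (r1 j) z) \<longrightarrow> (\<lambda>j. w (r1 j) z) \<longlonglongrightarrow> u' z)"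
    by (rule limit_in_N) (use wN in auto)
  then obtain u' where u': "u' \<in> borel_measurable borel" "\<And>z. u' z \<in> N"
      "\<And>z. convergent (\<lambda>j. w (r1 j) z) \<Longrightarrow> (\<lambda>j. w (r1 j) z) \<longlonglongrightarrow> u' z" by blast
  have "{z \<in> space (\<mu> \<Otimes>\<^sub>M \<theta>). Cauchy (\<lambda>i. w (r1 i) (fst z, snd z))} \<in> sets (\<mu> \<Otimes>\<^sub>M \<theta>)"
    using sets_Collect_Cauchy[where f = "\<lambda>i. w (r1 i)", OF wP] by (simp only: prod.collapse)
  from P.AE_commute[OF this] P.AE_pair[OF r1(2)]
  have "AE t in \<theta>. AE x in \<mu>. Cauchy (\<lambda>i. w (r1 i) (x, t))" by simp
  then have "AE t in lborel. AE x in \<mu>. Cauchy (\<lambda>i. w (r1 i) (x, t))"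
    unfolding \<theta>_def using \<phi>(1,2) by (subst (asm) AE_density) auto
  then have "AE t in lborel. AE x in \<mu>. (\<lambda>j. u ((r0 \<circ> r1) j) (x, t)) \<longlonglongrightarrow> u' (x, t)"
  proof eventually_elim
    case (elim t)
    then show ?case by eventually_elim (use u'(3) in \<open>simp add: w_def Cauchy_convergent_iff\<close>)
  qed
  then show ?thesis using strict_mono_o[OF r0 r1(1)] u' by blast
qed

end

subsection \<open>Passing to the limit\<close>

lemma inner_midhull_bound:
  assumes "g \<in> midhull S" and S: "\<And>f. f \<in> S \<Longrightarrow> square_integrable M f \<and> \<bar>(LINT x|M. f x \<bullet> \<Psi> x) - l\<bar> \<le> \<epsilon>"
    and \<Psi>: "square_integrable M \<Psi>"
  shows "square_integrable M g \<and> \<bar>(LINT x|M. g x \<bullet> \<Psi> x) - l\<bar> \<le> \<epsilon>"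
  using assms(1)
proof induction
  case (mid f g)
  have sq: "square_integrable M (\<lambda>x. (1 / 2) *\<^sub>R (f x + g x))"
    using mid by (intro square_integrable_scaleR square_integrable_add) auto
  have "(LINT x|M. ((1 / 2) *\<^sub>R (f x + g x)) \<bullet> \<Psi> x) = ((LINT x|M. f x \<bullet> \<Psi> x) + (LINT x|M. g x \<bullet> \<Psi> x)) / 2"
    using integrable_inner[of M f \<Psi>] integrable_inner[of M g \<Psi>] mid \<Psi> by (simp add: inner_add_left)
  then have "\<bar>(LINT x|M. ((1 / 2) *\<^sub>R (f x + g x)) \<bullet> \<Psi> x) - l\<bar> \<le> \<epsilon>"
    using mid by (auto simp: abs_le_iff field_simps)
  with sq show ?case by blast
qed (use S in blast)

text \<open>Averages over tails of f have the same limiting pairing with \<Psi>, because the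
  condition is convex; and they converge strongly to w. Hence w acts as a weak limit of f against
  every \<Psi> for which the pairings converge.\<close>

lemma midhull_limit_inner:
  fixes f :: "nat \<Rightarrow> 'a \<Rightarrow> 'b::euclidean_space"
  assumes f: "\<And>j. square_integrable M (f j)" and \<Psi>: "square_integrable M \<Psi>"
    and lim: "(\<lambda>j. LINT x|M. f j x \<bullet> \<Psi> x) \<longlonglongrightarrow> l"
    and g: "\<And>k. g k \<in> midhull (f ` {k..})" and w: "square_integrable M w"
    and gw: "(\<lambda>k. LINT x|M. (norm (g k x - w x))\<^sup>2) \<longlonglongrightarrow> 0"
  shows "(LINT x|M. w x \<bullet> \<Psi> x) = l"
proof -
  have gs: "square_integrable M (g k)" for k
    using inner_midhull_bound[OF g[of k], of M "\<lambda>x. 0" 0 0] f by (auto simp: square_integrable_def)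
  have dg: "square_integrable M (\<lambda>x. g k x - w x)" for k by (rule square_integrable_diff[OF gs w])
  have "(\<lambda>k. LINT x|M. norm (g k x - w x) * norm (\<Psi> x)) \<longlonglongrightarrow> 0"
    by (rule tendsto_integral_norm_product[OF dg gw \<Psi> order_refl])
  then have "(\<lambda>k. LINT x|M. (g k x - w x) \<bullet> \<Psi> x) \<longlonglongrightarrow> 0"
  proof (rule Lim_null_comparison[rotated], intro always_eventually allI)
    fix k
    have "norm (LINT x|M. (g k x - w x) \<bullet> \<Psi> x) \<le> (LINT x|M. norm ((g k x - w x) \<bullet> \<Psi> x))"
      by (rule integral_norm_bound)
    also have "\<dots> \<le> (LINT x|M. norm (g k x - w x) * norm (\<Psi> x))"
      using integrable_inner[OF dg \<Psi>] integrable_norm_product[OF dg \<Psi>]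
      by (intro integral_mono) (auto simp: Cauchy_Schwarz_ineq2)
    finally show "norm (LINT x|M. (g k x - w x) \<bullet> \<Psi> x) \<le> (LINT x|M. norm (g k x - w x) * norm (\<Psi> x))" .
  qed
  then have "(\<lambda>k. (LINT x|M. g k x \<bullet> \<Psi> x) - (LINT x|M. w x \<bullet> \<Psi> x)) \<longlonglongrightarrow> 0"
    using integrable_inner[OF gs \<Psi>] integrable_inner[OF w \<Psi>] by (simp add: inner_diff_left)
  then have g1: "(\<lambda>k. LINT x|M. g k x \<bullet> \<Psi> x) \<longlonglongrightarrow> (LINT x|M. w x \<bullet> \<Psi> x)" by (rule LIM_zero_cancel)
  have g2: "(\<lambda>k. LINT x|M. g k x \<bullet> \<Psi> x) \<longlonglongrightarrow> l"
  proof (rule LIMSEQ_I)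
    fix e :: real assume e: "0 < e"
    obtain k0 where k0: "\<And>j. k0 \<le> j \<Longrightarrow> norm ((LINT x|M. f j x \<bullet> \<Psi> x) - l) < e / 2"
      using LIMSEQ_D[OF lim, of "e / 2"] e by auto
    have "norm ((LINT x|M. g k x \<bullet> \<Psi> x) - l) < e" if k: "k0 \<le> k" for k
    proof -
      have "square_integrable M (g k) \<and> \<bar>(LINT x|M. g k x \<bullet> \<Psi> x) - l\<bar> \<le> e / 2"
      proof (rule inner_midhull_bound[OF g[of k] _ \<Psi>])
        fix u assume "u \<in> f ` {k..}"
        then obtain j where "k \<le> j" "u = f j" by auto
        then show "square_integrable M u \<and> \<bar>(LINT x|M. u x \<bullet> \<Psi> x) - l\<bar> \<le> e / 2"
          using f[of j] k0[of j] k by simp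
      qed
      then show ?thesis using e by simp
    qed
    then show "\<exists>k0. \<forall>k\<ge>k0. norm ((LINT x|M. g k x \<bullet> \<Psi> x) - l) < e" by blast
  qed
  from LIMSEQ_unique[OF g1 g2] show ?thesis .
qed

text \<open>A limit of the discrete flows: \<open>Z\<close> collects the times at which convergence fails; there
  \<open>u\<close> takes the initial value, which keeps it continuous at time \<open>0\<close>.\<close>

locale flow_limit = energy_flow K N \<mu> \<nu> p
  for K :: "'b::euclidean_space endo set" and N
    and \<mu> :: "'a::euclidean_space measure" and \<nu> :: "('a \<times> 'a) measure" and p :: real +
  fixes u0 :: "'a \<Rightarrow> 'b" and h :: "nat \<Rightarrow> real" and v D :: "nat \<Rightarrow> 'a \<times> real \<Rightarrow> 'b"
    and u :: "'a \<times> real \<Rightarrow> 'b" and Z :: "real set" and g :: "nat \<Rightarrow> 'a \<times> real \<Rightarrow> 'b" and w :: "'a \<times> real \<Rightarrow> 'b"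
  assumes u0: "adm u0" and h: "h \<longlonglongrightarrow> 0" "\<And>j. 0 < h j"
    and approx: "\<And>j. approx u0 (h j) (v j) (D j)"
    and u_measurable [measurable]: "u \<in> borel_measurable borel" and u_N: "\<And>z. u z \<in> N"
    and Z: "Z \<in> null_sets lborel"
    and v_tendsto: "\<And>t. t \<notin> Z \<Longrightarrow> AE x in \<mu>. (\<lambda>j. v j (x, t)) \<longlonglongrightarrow> u (x, t)"
    and u_Z: "\<And>x t. t \<in> Z \<Longrightarrow> u (x, t) = u0 x" and u_nonpos: "\<And>x t. t \<le> 0 \<Longrightarrow> u (x, t) = u0 x"
    and g_midhull: "\<And>k. g k \<in> midhull (D ` {k..})" and w: "square_integrable st w"
    and g_tendsto: "(\<lambda>k. LINT z|st. (norm (g k z - w z))\<^sup>2) \<longlonglongrightarrow> 0"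

lemma (in energy_flow) flow_limit_exists:
  assumes u0: "adm u0"
  shows "\<exists>h v D u Z g w. flow_limit K N \<mu> \<nu> p u0 h v D u Z g w"
proof -
  define h0 where "h0 j = inverse (real (Suc j))" for j
  have "\<exists>v D. approx u0 (h0 j) v D" for j by (rule approx_exists[OF _ u0]) (simp add: h0_def)
  then obtain v0 D0 where a0: "\<And>j. approx u0 (h0 j) (v0 j) (D0 j)" by metis
  have h0: "h0 \<longlonglongrightarrow> 0" unfolding h0_def by (rule LIMSEQ_inverse_real_of_nat)
  obtain r u' where r: "strict_mono (r :: nat \<Rightarrow> nat)" and u': "u' \<in> borel_measurable borel" "\<And>z. u' z \<in> N"
    and lim: "AE t in lborel. AE x in \<mu>. (\<lambda>j. v0 (r j) (x, t)) \<longlonglongrightarrow> u' (x, t)"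
    using space_time_limit[OF h0 a0] by blast
  obtain Z where Z: "{t \<in> space lborel. \<not> (AE x in \<mu>. (\<lambda>j. v0 (r j) (x, t)) \<longlonglongrightarrow> u' (x, t))} \<subseteq> Z" "emeasure lborel Z = 0" "Z \<in> sets lborel"
    using AE_E[OF lim] by blast
  have [measurable]: "Z \<in> sets borel" using Z(3) by simp
  define u where "u z = (if snd z \<in> Z \<or> snd z \<le> 0 then u0 (fst z) else u' z)" for z
  define v D where "v j = v0 (r j)" and "D j = D0 (r j)" for j
  have ap: "approx u0 (h0 (r j)) (v j) (D j)" for j unfolding v_def D_def by (rule a0)
  obtain g w where gw: "\<And>k. g k \<in> midhull (D ` {k..})" "square_integrable st w"
      "(\<lambda>k. LINT z|st. (norm (g k z - w z))\<^sup>2) \<longlonglongrightarrow> 0"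
    using st.L2_midhull_convergent[of D "E0 u0", OF approxD(7)[OF ap] approxD(8)[OF ap]] by blast
  have "flow_limit K N \<mu> \<nu> p u0 (\<lambda>j. h0 (r j)) v D u Z g w"
  proof (unfold_locales)
    show "(\<lambda>j. h0 (r j)) \<longlonglongrightarrow> 0" using LIMSEQ_subseq_LIMSEQ[OF h0 r] by (simp add: o_def)
    show "0 < h0 (r j)" for j by (simp add: h0_def)
    have [measurable]: "u0 \<in> borel_measurable borel" by (rule admD(1)[OF u0])
    show "u \<in> borel_measurable borel" unfolding u_def using u'(1) by measurable
    show "u z \<in> N" for z using u' admD(2)[OF u0] by (simp add: u_def)
    show "Z \<in> null_sets lborel" using Z by (intro null_setsI) auto
    show "AE x in \<mu>. (\<lambda>j. v j (x, t)) \<longlonglongrightarrow> u (x, t)" if t: "t \<notin> Z" for t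
    proof (cases "t \<le> 0")
      case True
      then show ?thesis using approxD(4)[OF ap] by (simp add: u_def)
    next
      case False
      have "AE x in \<mu>. (\<lambda>j. v0 (r j) (x, t)) \<longlonglongrightarrow> u' (x, t)" using Z(1) t by auto
      then show ?thesis using False t by (simp add: u_def v_def)
    qed
  qed (use u0 ap gw in \<open>simp_all add: u_def\<close>)
  then show ?thesis by blast
qed

section \<open>Estimates for the limit and passage to the limit in the equation\<close>

context flow_limit begin

lemma v_measurable [measurable]: "v j \<in> borel_measurable borel" by (rule approxD(1)[OF approx])

lemma v_N: "v j z \<in> N" using admD(2)[OF approxD(2)[OF approx[of j], of "snd z"], of "fst z"] by simp

lemma adm_u: "adm (\<lambda>x. u (x, t)) \<and> En (\<lambda>x. u (x, t)) \<le> En u0"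
proof (cases "t \<in> Z")
  case True
  then show ?thesis using u0 by (simp add: u_Z)
next
  case False
  show ?thesis
    by (rule adm_limit[OF approxD(2)[OF approx] approxD(3)[OF approx] v_tendsto[OF False]]) (simp_all add: u_N)
qed

lemma d2_u_le: assumes "t \<notin> Z" "s \<notin> Z" shows "d2 (\<lambda>x. u (x, t)) (\<lambda>x. u (x, s)) \<le> E0 u0 * \<bar>t - s\<bar>"
proof -
  have "(\<lambda>j. d2 (\<lambda>x. v j (x, t)) (\<lambda>x. v j (x, s))) \<longlonglongrightarrow> d2 (\<lambda>x. u (x, t)) (\<lambda>x. u (x, s))"
    unfolding d2_def
  proof (rule integral_dominated_convergence[where w = "\<lambda>x. (2 * R)\<^sup>2"])
    show "(\<lambda>x. (norm (u (x, t) - u (x, s)))\<^sup>2) \<in> borel_measurable \<mu>" by measurable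
    show "(\<lambda>x. (norm (v j (x, t) - v j (x, s)))\<^sup>2) \<in> borel_measurable \<mu>" for j by measurable
    show "AE x in \<mu>. (\<lambda>j. (norm (v j (x, t) - v j (x, s)))\<^sup>2) \<longlonglongrightarrow> (norm (u (x, t) - u (x, s)))\<^sup>2"
      using v_tendsto[OF assms(1)] v_tendsto[OF assms(2)] by eventually_elim (intro tendsto_intros)
    show "AE x in \<mu>. norm ((norm (v j (x, t) - v j (x, s)))\<^sup>2) \<le> (2 * R)\<^sup>2" for j
      using power_mono[OF norm_diff_N[OF v_N v_N] norm_ge_zero, of j _ j _ 2] by (intro AE_I2) simp
  qed simp
  moreover have "(\<lambda>j. E0 u0 * (\<bar>t - s\<bar> + h j)) \<longlonglongrightarrow> E0 u0 * (\<bar>t - s\<bar> + 0)" by (intro tendsto_intros h)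
  ultimately have "d2 (\<lambda>x. u (x, t)) (\<lambda>x. u (x, s)) \<le> E0 u0 * (\<bar>t - s\<bar> + 0)"
    by (rule LIMSEQ_le) (use approxD(5)[OF approx] in blast)
  then show ?thesis by simp
qed

lemma d2_u_initial: assumes "t \<ge> 0" shows "d2 (\<lambda>x. u (x, t)) u0 \<le> E0 u0 * t"
proof (cases "t \<in> Z")
  case True
  then show ?thesis using assms E0_nonneg by (simp add: u_Z d2_def)
next
  case False
  have "(\<lambda>j. d2 (\<lambda>x. v j (x, t)) u0) \<longlonglongrightarrow> d2 (\<lambda>x. u (x, t)) u0"
    by (rule d2_tendsto[OF approxD(2)[OF approx] _ u0 v_tendsto[OF False]]) (simp add: adm_u)
  moreover have "(\<lambda>j. E0 u0 * (\<bar>t - 0\<bar> + h j)) \<longlonglongrightarrow> E0 u0 * (\<bar>t - 0\<bar> + 0)" by (intro tendsto_intros h)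
  moreover have "d2 (\<lambda>x. v j (x, t)) u0 \<le> E0 u0 * (\<bar>t - 0\<bar> + h j)" for j
    using approxD(5)[OF approx[of j], of t 0] by (simp add: approxD(4)[OF approx])
  ultimately have "d2 (\<lambda>x. u (x, t)) u0 \<le> E0 u0 * (\<bar>t - 0\<bar> + 0)" by (intro LIMSEQ_le) auto
  then show ?thesis using assms by simp
qed

lemma AE_st:
  assumes ae: "AE t in lborel. AE x in \<mu>. P (x, t)" and m: "{z. P z} \<in> sets borel"
  shows "AE z in st. P z"
proof -
  have m': "{z \<in> space (\<mu> \<Otimes>\<^sub>M domain_measure {0<..}). P z} \<in> sets (\<mu> \<Otimes>\<^sub>M domain_measure {0<..})"
    unfolding st_def[symmetric] using m by simp
  have "AE t in domain_measure {0<..}. AE x in \<mu>. P (x, t)"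
    unfolding domain_measure_def using ae by (subst AE_density) auto
  then have "AE x in \<mu>. AE t in domain_measure {0<..}. P (x, t)"
    using mu_time.AE_commute[of "\<lambda>x t. P (x, t)"] m' by simp
  from mu_time.AE_pair_measure[OF m' this] show ?thesis by (simp only: st_def)
qed

lemma v_tendsto_AE_st: "AE z in st. (\<lambda>j. v j z) \<longlonglongrightarrow> u z"
proof (rule AE_st)
  show "AE t in lborel. AE x in \<mu>. (\<lambda>j. v j (x, t)) \<longlonglongrightarrow> u (x, t)"
    using AE_not_in[OF Z] by eventually_elim (rule v_tendsto)
  have "{z. (\<lambda>j. v j z) \<longlonglongrightarrow> u z} = {z \<in> space borel. Cauchy (\<lambda>j. v j z)} \<inter> {z \<in> space borel. lim (\<lambda>j. v j z) = u z}"
    by (auto simp: Cauchy_convergent_iff convergent_LIMSEQ_iff limI dest: convergentI)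
  also have "\<dots> \<in> sets borel" by (intro sets.Int sets_Collect_Cauchy v_measurable) measurable
  finally show "{z. (\<lambda>j. v j z) \<longlonglongrightarrow> u z} \<in> sets borel" .
qed

lemma incr_time_measurable:
  fixes f :: "'a \<times> real \<Rightarrow> 'c::euclidean_space"
  assumes f: "f \<in> borel_measurable borel"
  shows "(\<lambda>y :: real \<times> 'a \<times> 'a. incr (\<lambda>x. f (x, fst y)) (snd y)) \<in> borel_measurable borel"
    "(\<lambda>y :: real \<times> 'a \<times> 'a. f (snd (snd y), fst y)) \<in> borel_measurable borel"
proof -
  have "(\<lambda>y :: real \<times> 'a \<times> 'a. (fst (snd y), fst y)) \<in> borel_measurable borel"
    "(\<lambda>y :: real \<times> 'a \<times> 'a. (snd (snd y), fst y)) \<in> borel_measurable borel"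
    by (intro borel_measurable_continuous_onI continuous_intros)+
  note m = measurable_compose[OF this(1) f] measurable_compose[OF this(2) f]
  from m show "(\<lambda>y :: real \<times> 'a \<times> 'a. incr (\<lambda>x. f (x, fst y)) (snd y)) \<in> borel_measurable borel"
    unfolding incr_def by (rule borel_measurable_diff)
  from m(2) show "(\<lambda>y :: real \<times> 'a \<times> 'a. f (snd (snd y), fst y)) \<in> borel_measurable borel" .
qed

lemma time_integral_measurable:
  fixes F :: "real \<times> 'a \<times> 'a \<Rightarrow> real"
  assumes F: "F \<in> borel_measurable borel"
  shows "(\<lambda>t. LINT z|\<nu>. F (t, z)) \<in> borel_measurable (borel :: real measure)"
proof (rule nu.borel_measurable_lebesgue_integral)
  have "sets ((borel :: real measure) \<Otimes>\<^sub>M \<nu>) = sets (borel \<Otimes>\<^sub>M (borel :: ('a \<times> 'a) measure))"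
    by (rule sets_pair_measure_cong) simp_all
  then have s: "sets (borel \<Otimes>\<^sub>M \<nu>) = sets (borel :: (real \<times> 'a \<times> 'a) measure)"
    unfolding borel_prod .
  show "(\<lambda>(t, z). F (t, z)) \<in> borel_measurable (borel \<Otimes>\<^sub>M \<nu>)"
    using F unfolding measurable_cong_sets[OF s refl] case_prod_eta .
qed

lemma variation_measurable:
  assumes y: "y \<in> borel_measurable borel" and \<eta>: "\<eta> \<in> borel_measurable borel"
  shows "(\<lambda>t. variation (\<lambda>x. y (x, t)) A (\<lambda>x. \<eta> (x, t))) \<in> borel_measurable (borel :: real measure)"
proof -
  note [measurable] = incr_time_measurable[OF y] incr_time_measurable(1)[OF \<eta>]
  have "(\<lambda>y' :: real \<times> 'a \<times> 'a. var_integrand (\<lambda>x. y (x, fst y')) A (\<lambda>x. \<eta> (x, fst y')) (snd y')) \<in> borel_measurable borel"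
    unfolding var_integrand_def by measurable
  from time_integral_measurable[OF this] show ?thesis by (simp add: variation_def)
qed

lemma integrable_test_power: "test \<eta> \<Longrightarrow> integrable \<nu> (\<lambda>z. (c * \<bar>incr \<eta> z\<bar>) powr p)" if "0 \<le> c" for c
  using that by (simp add: test_def powr_mult)

lemma variation_bound:
  assumes y: "adm y" "En y \<le> En u0" and \<eta>: "test \<eta>"
  shows "\<bar>variation y A \<eta>\<bar> \<le> En u0 + (norm A * R) powr p * (LINT z|\<nu>. \<bar>incr \<eta> z\<bar> powr p)"
    and "integrable \<nu> (var_integrand y A \<eta>)"
proof -
  have [measurable]: "y \<in> borel_measurable borel" "\<eta> \<in> borel_measurable borel" using y \<eta> by (auto simp: adm_def test_def)
  let ?b = "\<lambda>z. norm (incr y z) powr p + (norm A * R) powr p * \<bar>incr \<eta> z\<bar> powr p"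
  have le: "\<bar>var_integrand y A \<eta> z\<bar> \<le> ?b z" for z
    using var_integrand_le_eps[of y z 1 A \<eta>] admD(2)[OF y(1)] R_nonneg by (simp add: powr_mult)
  have ib: "integrable \<nu> ?b" using y \<eta> by (simp add: adm_def test_def)
  show i: "integrable \<nu> (var_integrand y A \<eta>)"
  proof (rule Bochner_Integration.integrable_bound[OF ib])
    show "var_integrand y A \<eta> \<in> borel_measurable \<nu>" by measurable
    show "AE z in \<nu>. norm (var_integrand y A \<eta> z) \<le> norm (?b z)"
      by (intro AE_I2 order_trans[OF _ abs_ge_self[of "?b _", folded real_norm_def]]) (simp add: le)
  qed
  have "\<bar>variation y A \<eta>\<bar> \<le> (LINT z|\<nu>. \<bar>var_integrand y A \<eta> z\<bar>)"
    unfolding variation_def using integral_norm_bound[of \<nu> "var_integrand y A \<eta>"] by simp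
  also have "\<dots> \<le> (LINT z|\<nu>. ?b z)" using i ib le by (intro integral_mono) auto
  also have "\<dots> = En y + (norm A * R) powr p * (LINT z|\<nu>. \<bar>incr \<eta> z\<bar> powr p)"
    using y \<eta> by (simp add: adm_def test_def En_def)
  finally show "\<bar>variation y A \<eta>\<bar> \<le> En u0 + (norm A * R) powr p * (LINT z|\<nu>. \<bar>incr \<eta> z\<bar> powr p)"
    using y(2) by simp
qed

text \<open>The increments converge almost everywhere. The integrand is at most \<delta> |dv|^p plus
  a multiple of |d\<eta>|^p, so it is dominated up to a small multiple of a sequence bounded in L^1,
  which suffices.\<close>

lemma variation_tendsto:
  assumes t: "t \<notin> Z" and \<eta>: "test \<eta>"
  shows "(\<lambda>j. variation (\<lambda>x. v j (x, t)) A \<eta>) \<longlonglongrightarrow> variation (\<lambda>x. u (x, t)) A \<eta>"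
  unfolding variation_def
proof (rule tendsto_integral_nearly_dominated[where b = "\<lambda>j z. norm (incr (\<lambda>x. v j (x, t)) z) powr p"
      and b' = "\<lambda>z. norm (incr (\<lambda>x. u (x, t)) z) powr p" and C = "En u0"])
  have [measurable]: "\<eta> \<in> borel_measurable borel" using \<eta> by (simp add: test_def)
  show "var_integrand (\<lambda>x. v j (x, t)) A \<eta> \<in> borel_measurable \<nu>" for j by measurable
  show "var_integrand (\<lambda>x. u (x, t)) A \<eta> \<in> borel_measurable \<nu>" by measurable
  have "AE z in \<nu>. (\<lambda>j. v j (fst z, t)) \<longlonglongrightarrow> u (fst z, t) \<and> (\<lambda>j. v j (snd z, t)) \<longlonglongrightarrow> u (snd z, t)"
    by (rule AE_nu[OF v_tendsto[OF t]])
  then show "AE z in \<nu>. (\<lambda>j. var_integrand (\<lambda>x. v j (x, t)) A \<eta> z) \<longlonglongrightarrow> var_integrand (\<lambda>x. u (x, t)) A \<eta> z"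
  proof eventually_elim
    case (elim z)
    then have "(\<lambda>j. incr (\<lambda>x. v j (x, t)) z) \<longlonglongrightarrow> incr (\<lambda>x. u (x, t)) z"
      unfolding incr_def by (intro tendsto_diff) auto
    then show ?case unfolding var_integrand_def using elim
      by (intro tendsto_mult tendsto_inner tendsto_dual_map p act.tendsto tendsto_const) auto
  qed
  show "integrable \<nu> (\<lambda>z. norm (incr (\<lambda>x. v j (x, t)) z) powr p)" for j by (rule admD(3)[OF approxD(2)[OF approx]])
  show "(LINT z|\<nu>. norm (incr (\<lambda>x. v j (x, t)) z) powr p) \<le> En u0" for j
    using approxD(3)[OF approx, of j t] by (simp only: En_def)
  show "integrable \<nu> (\<lambda>z. norm (incr (\<lambda>x. u (x, t)) z) powr p)" using adm_u[of t] admD(3) by blast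
  show "(LINT z|\<nu>. norm (incr (\<lambda>x. u (x, t)) z) powr p) \<le> En u0" using adm_u[of t] by (simp only: En_def)
  fix \<delta> :: real assume \<delta>: "0 < \<delta>"
  let ?G = "\<lambda>z. \<delta> powr (1 - p) * (norm A * R * \<bar>incr \<eta> z\<bar>) powr p"
  have "integrable \<nu> ?G" using integrable_test_power[OF _ \<eta>, of "norm A * R"] R_nonneg by simp
  then show "\<exists>G. integrable \<nu> G \<and> (\<forall>z. 0 \<le> G z) \<and>
      (\<forall>j z. \<bar>var_integrand (\<lambda>x. v j (x, t)) A \<eta> z\<bar> \<le> \<delta> * norm (incr (\<lambda>x. v j (x, t)) z) powr p + G z) \<and>
      (\<forall>z. \<bar>var_integrand (\<lambda>x. u (x, t)) A \<eta> z\<bar> \<le> \<delta> * norm (incr (\<lambda>x. u (x, t)) z) powr p + G z)"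
    using \<delta> v_N u_N by (intro exI[of _ ?G] conjI allI var_integrand_le_eps) auto
qed simp_all

definition time_test :: "real \<Rightarrow> ('a \<times> real \<Rightarrow> real) \<Rightarrow> bool" where
  "time_test T \<eta> \<longleftrightarrow> \<eta> \<in> borel_measurable borel \<and> (\<exists>c. \<forall>z. \<bar>\<eta> z\<bar> \<le> c) \<and>
    (\<exists>C. AE t in domain_measure {0<..<T}. test (\<lambda>x. \<eta> (x, t)) \<and> (LINT z|\<nu>. \<bar>incr (\<lambda>x. \<eta> (x, t)) z\<bar> powr p) \<le> C)"

lemma finite_time: "0 \<le> T \<Longrightarrow> finite_measure (domain_measure {0<..<T :: real})"
  by (rule finite_measureI) (simp add: domain_measure_def emeasure_density ennreal_indicator)

lemma bounded_square_integrable_st: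
  fixes y :: "'a \<times> real \<Rightarrow> 'b"
  assumes [measurable]: "y \<in> borel_measurable borel" and b: "\<And>z. norm (y z) \<le> C" and T: "0 \<le> T"
  shows "integrable st (\<lambda>z. indicator {0<..<T} (snd z) * C)"
    "square_integrable st (\<lambda>z. indicator {0<..<T} (snd z) *\<^sub>R y z)"
proof -
  have s: "UNIV \<times> {0<..<T} \<in> sets (borel :: ('a \<times> real) measure)" by (rule borel_Times_open) simp_all
  have prod: "emeasure st (UNIV \<times> {0<..<T}) = emeasure \<mu> UNIV * emeasure (domain_measure {0<..}) {0<..<T}"
    unfolding st_def by (intro time.emeasure_pair_measure_Times) simp_all

  have le: "emeasure (domain_measure {0<..}) {0<..<T} \<le> ennreal T"
  proof -
    have "emeasure (domain_measure {0<..}) {0<..<T} \<le> emeasure lborel {0<..<T}"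
    proof -
      have "emeasure (domain_measure {0<..}) {0<..<T} = (\<integral>\<^sup>+t. ennreal (indicator {0<..} t) * indicator {0<..<T} t \<partial>lborel)"
        unfolding domain_measure_def by (rule emeasure_density) simp_all
      also have "\<dots> \<le> (\<integral>\<^sup>+t. indicator {0<..<T} t \<partial>lborel)"
        by (intro nn_integral_mono) (simp add: indicator_def)
      finally show ?thesis by simp
    qed
    also have "\<dots> = ennreal T" using T by simp
    finally show ?thesis .
  qed
  have "emeasure (domain_measure {0<..}) {0<..<T} < \<infinity>" unfolding infinity_ennreal_def using le ennreal_less_top by (rule le_less_trans)
  moreover have "emeasure \<mu> UNIV < \<infinity>" using mu.emeasure_finite[of UNIV] unfolding infinity_ennreal_def less_top .
  ultimately have fin: "emeasure st (UNIV \<times> {0<..<T}) < \<infinity>"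
    unfolding prod by (simp add: ennreal_mult_less_top)
  have ind: "indicator {0<..<T} (snd z) = (indicator (UNIV \<times> {0<..<T}) z :: real)" for z :: "'a \<times> real"
    unfolding indicator_def by (simp only: mem_Times_iff UNIV_I simp_thms)
  show "integrable st (\<lambda>z. indicator {0<..<T} (snd z) * C)"
  proof -
    have "integrable st (indicator (UNIV \<times> {0<..<T}) :: 'a \<times> real \<Rightarrow> real)"
      by (rule integrable_real_indicator) (simp_all only: sets_st s fin)
    from integrable_mult_left[OF this, of C] show ?thesis by (simp only: ind)
  qed
  have "integrable st (\<lambda>z. indicator (UNIV \<times> {0<..<T}) z *\<^sub>R (norm (y z))\<^sup>2)"
  proof (rule integrable_bounded_on_finite_set[OF _ fin])
    show "UNIV \<times> {0<..<T} \<in> sets st" using s by (simp only: sets_st)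
    show "(\<lambda>z. (norm (y z))\<^sup>2) \<in> borel_measurable st" by (rule borel_measurable_st) measurable
    show "norm ((norm (y z))\<^sup>2) \<le> C\<^sup>2" for z using power_mono[OF b norm_ge_zero, of z 2] by simp
  qed
  moreover have "(norm (indicator {0<..<T} (snd z) *\<^sub>R y z))\<^sup>2 = indicator (UNIV \<times> {0<..<T}) z *\<^sub>R (norm (y z))\<^sup>2" for z
    unfolding ind[symmetric] by (cases "snd z \<in> {0<..<T}") simp_all
  moreover have "(\<lambda>z. indicator {0<..<T} (snd z) *\<^sub>R y z) \<in> borel_measurable st"
    by (rule borel_measurable_st) measurable
  ultimately show "square_integrable st (\<lambda>z. indicator {0<..<T} (snd z) *\<^sub>R y z)"
    by (simp add: square_integrable_def)
qed

lemma time_integral_restrict: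
  fixes f :: "real \<Rightarrow> real"
  assumes [measurable]: "f \<in> borel_measurable borel"
  shows "(LINT t|domain_measure {0<..}. indicator {0<..<T} t * f t) = integral\<^sup>L (domain_measure {0<..<T}) f"
proof -
  have "(LINT t|domain_measure {0<..}. indicator {0<..<T} t * f t) = (LINT t|lborel. indicator {0<..} t *\<^sub>R (indicator {0<..<T} t * f t))"
    by (rule integral_domain_measure) simp_all
  also have "\<dots> = (LINT t|lborel. indicator {0<..<T} t *\<^sub>R f t)"
    by (intro Bochner_Integration.integral_cong) (auto simp: indicator_def)
  also have "\<dots> = integral\<^sup>L (domain_measure {0<..<T}) f"
    by (rule integral_domain_measure[symmetric]) simp_all
  finally show ?thesis .
qed

lemma AE_time_restrict:
  fixes T :: real
  assumes "AE t in domain_measure {0<..<T}. P t"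
  shows "AE t in domain_measure {0<..}. indicator {0<..<T} t = (1::real) \<longrightarrow> (P t \<and> 0 < t)"
proof -
  have m: "(\<lambda>t. ennreal (indicator {0<..<T} t)) \<in> borel_measurable lborel"
    "(\<lambda>t :: real. ennreal (indicator {0<..} t)) \<in> borel_measurable lborel" by simp_all
  from iffD1[OF AE_density[OF m(1), of P] assms[unfolded domain_measure_def]]
  have "AE t in lborel. 0 < ennreal (indicator {0<..<T} t) \<longrightarrow> P t" .
  then have "AE t in lborel. 0 < ennreal (indicator {0<..} t) \<longrightarrow> indicator {0<..<T} t = (1::real) \<longrightarrow> (P t \<and> 0 < t)"
  proof (rule eventually_mono, intro impI)
    fix t assume P: "0 < ennreal (indicator {0<..<T} t) \<longrightarrow> P t" and 1: "indicator {0<..<T} t = (1::real)"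
    have "t \<in> {0<..<T}" using 1 by (cases "t \<in> {0<..<T}") (simp_all only: indicator_simps zero_neq_one not_False_eq_True)
    then show "P t \<and> 0 < t" using P 1 by (simp only: ennreal_1 zero_less_one greaterThanLessThan_iff simp_thms)
  qed
  then show ?thesis
    unfolding domain_measure_def by (rule iffD2[OF AE_density[OF m(2)]])
qed

text \<open>The discrete equation is integrated over (0, T). The variations converge boundedly at
  almost every time. In the other term the fields built from \<open>v j\<close> converge strongly in
  L^2 to the one built from u, so they may be exchanged against the bounded \<open>D j\<close>; then
  w replaces \<open>D j\<close> through the averages of tails.\<close>

theorem weak_equation:
  assumes T: "0 < T" and A: "A \<in> lie" and \<eta>: "time_test T \<eta>"
  shows "integrable (domain_measure {0<..<T}) (\<lambda>t. variation (\<lambda>x. u (x, t)) A (\<lambda>x. \<eta> (x, t)))"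
    and "(LINT z|st. w z \<bullet> (indicator {0<..<T} (snd z) *\<^sub>R (\<eta> z *\<^sub>R act A (u z)))) +
      (LINT t|domain_measure {0<..<T}. variation (\<lambda>x. u (x, t)) A (\<lambda>x. \<eta> (x, t))) = 0"
proof -
  have [measurable]: "\<eta> \<in> borel_measurable borel" using \<eta> by (simp add: time_test_def)
  obtain c where c: "\<And>z. \<bar>\<eta> z\<bar> \<le> c" using \<eta> by (auto simp: time_test_def)
  obtain C where C: "AE t in domain_measure {0<..<T}. test (\<lambda>x. \<eta> (x, t)) \<and> (LINT z|\<nu>. \<bar>incr (\<lambda>x. \<eta> (x, t)) z\<bar> powr p) \<le> C"
    using \<eta> by (auto simp: time_test_def)
  have c0: "0 \<le> c" by (rule order_trans[OF abs_ge_zero c])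
  interpret tau: finite_measure "domain_measure {0<..<T}" using T by (intro finite_time) simp
  define B where "B = En u0 + (norm A * R) powr p * C"
  let ?g = "\<lambda>y t. variation (\<lambda>x. y (x, t)) A (\<lambda>x. \<eta> (x, t))"
  have gm: "?g (v j) \<in> borel_measurable borel" "?g u \<in> borel_measurable borel" for j
    by (rule variation_measurable; measurable)+
  have gm': "?g (v j) \<in> borel_measurable (domain_measure {0<..<T})" "?g u \<in> borel_measurable (domain_measure {0<..<T})" for j
    using gm by (simp_all only: measurable_cong_sets[OF sets_domain_measure refl])
  have bound: "\<bar>variation y A (\<lambda>x. \<eta> (x, t))\<bar> \<le> B"
    if "adm y" "En y \<le> En u0" "test (\<lambda>x. \<eta> (x, t))" "(LINT z|\<nu>. \<bar>incr (\<lambda>x. \<eta> (x, t)) z\<bar> powr p) \<le> C" for y t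
    using variation_bound(1)[OF that(1,2,3), of A] mult_left_mono[OF that(4), of "(norm A * R) powr p"] unfolding B_def by simp
  have AEZ: "AE t in domain_measure {0<..<T}. t \<notin> Z"
    unfolding domain_measure_def using AE_not_in[OF Z] by (subst AE_density) auto
  show iu: "integrable (domain_measure {0<..<T}) (?g u)"
  proof (rule tau.integrable_const_bound[of _ B])
    show "AE t in domain_measure {0<..<T}. norm (?g u t) \<le> B"
      using C by eventually_elim (use bound adm_u in simp)
  qed (rule gm')
  have lim_g: "(\<lambda>j. integral\<^sup>L (domain_measure {0<..<T}) (?g (v j))) \<longlonglongrightarrow> integral\<^sup>L (domain_measure {0<..<T}) (?g u)"
  proof (rule integral_dominated_convergence[where w = "\<lambda>t. B"])
    show "AE t in domain_measure {0<..<T}. (\<lambda>j. ?g (v j) t) \<longlonglongrightarrow> ?g u t"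
      using C AEZ by eventually_elim (intro variation_tendsto, auto)
    show "AE t in domain_measure {0<..<T}. norm (?g (v j) t) \<le> B" for j
      using C by eventually_elim (use bound approxD(2,3)[OF approx] in simp)
  qed (use gm' in auto)
  let ?\<Psi> = "\<lambda>y z. indicator {0<..<T} (snd z) *\<^sub>R (\<eta> z *\<^sub>R act A (y z))"
  have nb: "norm (\<eta> z *\<^sub>R act A (y z)) \<le> c * (norm A * R)" if "y z \<in> N" for y and z :: "'a \<times> real"
  proof -
    have "norm (act A (y z)) \<le> norm A * R" using norm_act_le[of A "y z"] norm_N[OF that] by simp
    then show ?thesis unfolding norm_scaleR using c[of z] c0 by (intro mult_mono) auto
  qed
  have \<Psi>: "square_integrable st (?\<Psi> y)" if [measurable]: "y \<in> borel_measurable borel" and "\<And>z. y z \<in> N" for y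
    by (rule bounded_square_integrable_st[of _ "c * (norm A * R)"]) (use nb that T in auto)
  \<comment> \<open>Fubini's theorem reduces the space-time pairing to the equation at each single
    time, which is available at positive times for which the slice of \<eta> is a test
    function.\<close>
  have fub: "(LINT z|st. D j z \<bullet> ?\<Psi> (v j) z) = - integral\<^sup>L (domain_measure {0<..<T}) (?g (v j))" for j
  proof -
    have D_sq: "square_integrable st (D j)" by (rule approxD(7)[OF approx])
    have i: "integrable st (\<lambda>z. D j z \<bullet> ?\<Psi> (v j) z)" by (rule integrable_inner[OF D_sq \<Psi>]) (auto simp: v_N)
    then have i': "integrable (\<mu> \<Otimes>\<^sub>M domain_measure {0<..}) (\<lambda>(x, t). D j (x, t) \<bullet> ?\<Psi> (v j) (x, t))"
      by (simp add: st_def case_prod_beta')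
    have "(LINT z|st. D j z \<bullet> ?\<Psi> (v j) z) = (LINT t|domain_measure {0<..}. (LINT x|\<mu>. D j (x, t) \<bullet> ?\<Psi> (v j) (x, t)))"
      using mu_time.integral_snd[OF i'] by (simp add: st_def case_prod_beta')
    also have "\<dots> = (LINT t|domain_measure {0<..}. indicator {0<..<T} t * - ?g (v j) t)"
    proof (rule integral_cong_AE)
      show "(\<lambda>t. LINT x|\<mu>. D j (x, t) \<bullet> ?\<Psi> (v j) (x, t)) \<in> borel_measurable (domain_measure {0<..})"
        using mu_time.integrable_snd[OF i'] by (simp add: borel_measurable_integrable)
      show "(\<lambda>t. indicator {0<..<T} t * - ?g (v j) t) \<in> borel_measurable (domain_measure {0<..})"
        using gm(1)[of j] by measurable
      show "AE t in domain_measure {0<..}. (LINT x|\<mu>. D j (x, t) \<bullet> ?\<Psi> (v j) (x, t)) = indicator {0<..<T} t * - ?g (v j) t"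
        using AE_time_restrict[OF C]
      proof eventually_elim
        case (elim t)
        show ?case
        proof (cases "indicator {0<..<T} t = (1::real)")
          case True
          with elim have t: "0 < t" "test (\<lambda>x. \<eta> (x, t))" by auto
          from approxD(9)[OF approx t(1) A t(2), of j] True show ?thesis by simp
        next
          case False
          then have "indicator {0<..<T} t = (0::real)" by (auto simp: indicator_def split: if_splits)
          then show ?thesis by simp
        qed
      qed
    qed
    also have "\<dots> = integral\<^sup>L (domain_measure {0<..<T}) (\<lambda>t. - ?g (v j) t)"
      by (rule time_integral_restrict) (use gm(1)[of j] in measurable)
    finally show ?thesis by simp
  qed
  have d\<Psi>: "square_integrable st (\<lambda>z. ?\<Psi> (v j) z - ?\<Psi> u z)" for j
    by (intro square_integrable_diff \<Psi>) (auto simp: v_N u_N)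
  have d0: "(\<lambda>j. LINT z|st. (norm (?\<Psi> (v j) z - ?\<Psi> u z))\<^sup>2) \<longlonglongrightarrow> (LINT z|st. 0)"
  proof (rule integral_dominated_convergence[where w = "\<lambda>z. indicator {0<..<T} (snd z) * (2 * (c * (norm A * R)))\<^sup>2"])
    show "integrable st (\<lambda>z. indicator {0<..<T} (snd z) * (2 * (c * (norm A * R)))\<^sup>2)"
      by (rule bounded_square_integrable_st(1)[of "\<lambda>z. 0"]) (use T in auto)
    show "(\<lambda>z. (norm (?\<Psi> (v j) z - ?\<Psi> u z))\<^sup>2) \<in> borel_measurable st" for j
      using d\<Psi>[of j] by (auto simp: square_integrable_def)
    show "AE z in st. (\<lambda>j. (norm (?\<Psi> (v j) z - ?\<Psi> u z))\<^sup>2) \<longlonglongrightarrow> 0"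
      using v_tendsto_AE_st
    proof eventually_elim
      case (elim z)
      then have "(\<lambda>j. ?\<Psi> (v j) z) \<longlonglongrightarrow> ?\<Psi> u z" by (intro tendsto_scaleR tendsto_const act.tendsto)
      then have "(\<lambda>j. norm (?\<Psi> (v j) z - ?\<Psi> u z)) \<longlonglongrightarrow> 0" by (intro tendsto_norm_zero LIM_zero)
      from tendsto_power[OF this, of 2] show ?case by simp
    qed
    show "AE z in st. norm ((norm (?\<Psi> (v j) z - ?\<Psi> u z))\<^sup>2) \<le> indicator {0<..<T} (snd z) * (2 * (c * (norm A * R)))\<^sup>2" for j
    proof (rule AE_I2)
      fix z
      have "norm (\<eta> z *\<^sub>R act A (v j z) - \<eta> z *\<^sub>R act A (u z)) \<le> 2 * (c * (norm A * R))"
        using norm_triangle_ineq4[of "\<eta> z *\<^sub>R act A (v j z)" "\<eta> z *\<^sub>R act A (u z)"] nb[of "v j" z] nb[of u z] v_N[of j z] u_N[of z]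
        by simp
      from power_mono[OF this norm_ge_zero, of 2]
      show "norm ((norm (?\<Psi> (v j) z - ?\<Psi> u z))\<^sup>2) \<le> indicator {0<..<T} (snd z) * (2 * (c * (norm A * R)))\<^sup>2"
        by (auto simp: indicator_def)
    qed
  qed simp
  have "(\<lambda>j. LINT z|st. norm (?\<Psi> (v j) z - ?\<Psi> u z) * norm (D j z)) \<longlonglongrightarrow> 0"
    by (rule tendsto_integral_norm_product[OF d\<Psi> _ approxD(7)[OF approx] approxD(8)[OF approx]]) (use d0 in simp)
  then have "(\<lambda>j. LINT z|st. D j z \<bullet> (?\<Psi> (v j) z - ?\<Psi> u z)) \<longlonglongrightarrow> 0"
  proof (rule Lim_null_comparison[rotated], intro always_eventually allI)
    fix j
    have "norm (LINT z|st. D j z \<bullet> (?\<Psi> (v j) z - ?\<Psi> u z)) \<le> (LINT z|st. norm (D j z \<bullet> (?\<Psi> (v j) z - ?\<Psi> u z)))"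
      by (rule integral_norm_bound)
    also have "\<dots> \<le> (LINT z|st. norm (?\<Psi> (v j) z - ?\<Psi> u z) * norm (D j z))"
    proof (rule integral_mono)
      show "integrable st (\<lambda>z. norm (D j z \<bullet> (?\<Psi> (v j) z - ?\<Psi> u z)))"
        by (rule integrable_norm[OF integrable_inner[OF approxD(7)[OF approx] d\<Psi>]])
      show "integrable st (\<lambda>z. norm (?\<Psi> (v j) z - ?\<Psi> u z) * norm (D j z))"
        by (rule integrable_norm_product[OF d\<Psi> approxD(7)[OF approx]])
      show "norm (D j z \<bullet> (?\<Psi> (v j) z - ?\<Psi> u z)) \<le> norm (?\<Psi> (v j) z - ?\<Psi> u z) * norm (D j z)" for z
        using Cauchy_Schwarz_ineq2[of "D j z" "?\<Psi> (v j) z - ?\<Psi> u z"] by (simp only: real_norm_def mult.commute)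
    qed
    finally show "norm (LINT z|st. D j z \<bullet> (?\<Psi> (v j) z - ?\<Psi> u z)) \<le> (LINT z|st. norm (?\<Psi> (v j) z - ?\<Psi> u z) * norm (D j z))" .
  qed
  moreover have "(LINT z|st. D j z \<bullet> (?\<Psi> (v j) z - ?\<Psi> u z)) = (LINT z|st. D j z \<bullet> ?\<Psi> (v j) z) - (LINT z|st. D j z \<bullet> ?\<Psi> u z)" for j
    unfolding inner_diff_right
    by (rule Bochner_Integration.integral_diff; rule integrable_inner[OF approxD(7)[OF approx] \<Psi>]; simp add: v_N u_N)
  ultimately have "(\<lambda>j. (LINT z|st. D j z \<bullet> ?\<Psi> (v j) z) - (LINT z|st. D j z \<bullet> ?\<Psi> u z)) \<longlonglongrightarrow> 0" by simp
  note diff0 = tendsto_diff[OF tendsto_minus[OF lim_g] this]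
  have eq: "- integral\<^sup>L (domain_measure {0<..<T}) (?g (v j)) - ((LINT z|st. D j z \<bullet> ?\<Psi> (v j) z) - (LINT z|st. D j z \<bullet> ?\<Psi> u z))
      = (LINT z|st. D j z \<bullet> ?\<Psi> u z)" for j
  proof -
    have "- a - (b - c) = c" if "b = - a" for a b c :: real using that by simp
    from this[OF fub[of j]] show ?thesis .
  qed
  have "(\<lambda>j. LINT z|st. D j z \<bullet> ?\<Psi> u z) \<longlonglongrightarrow> - integral\<^sup>L (domain_measure {0<..<T}) (?g u) - 0"
    by (rule Lim_transform_eventually[OF diff0 always_eventually]) (intro allI eq)
  then have "(LINT z|st. w z \<bullet> ?\<Psi> u z) = - integral\<^sup>L (domain_measure {0<..<T}) (?g u) - 0"
    using midhull_limit_inner[OF approxD(7)[OF approx] \<Psi>[OF u_measurable u_N] _ g_midhull w g_tendsto] by blast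
  then show "(LINT z|st. w z \<bullet> ?\<Psi> u z) + integral\<^sup>L (domain_measure {0<..<T}) (?g u) = 0"
    by (simp only: diff_0_right left_minus)
qed

end

section \<open>The distributional time derivative\<close>

context flow_limit begin

lemma inner_integral_measurable:
  fixes F :: "'a \<times> real \<Rightarrow> real"
  assumes F: "F \<in> borel_measurable borel"
  shows "(\<lambda>t. LINT x|\<mu>. F (x, t)) \<in> borel_measurable (borel :: real measure)"
  by (rule mu.borel_measurable_lebesgue_integral) (rule swap_measurable[OF F refl])

text \<open>Writing the integral over the whole time line makes the later translation in time free
  of boundary terms.\<close>

lemma st_iterated:
  fixes F :: "'a \<times> real \<Rightarrow> real"
  assumes F: "F \<in> borel_measurable borel" and i: "integrable st F" and F0: "\<And>x t. t \<le> 0 \<Longrightarrow> F (x, t) = 0"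
  shows "(LINT z|st. F z) = (LINT t|lborel. LINT x|\<mu>. F (x, t))"
proof -
  have i': "integrable (\<mu> \<Otimes>\<^sub>M domain_measure {0<..}) (\<lambda>(x, t). F (x, t))" using i by (simp add: st_def)
  have "(LINT z|st. F z) = (LINT t|domain_measure {0<..}. LINT x|\<mu>. F (x, t))"
    using mu_time.integral_snd[OF i'] by (simp add: st_def)
  also have "\<dots> = (LINT t|lborel. indicator {0<..} t *\<^sub>R (LINT x|\<mu>. F (x, t)))"
    by (rule integral_domain_measure[OF _ inner_integral_measurable[OF F]]) simp
  also have "\<dots> = (LINT t|lborel. LINT x|\<mu>. F (x, t))"
  proof (intro Bochner_Integration.integral_cong refl)
    fix t :: real
    show "indicator {0<..} t *\<^sub>R (LINT x|\<mu>. F (x, t)) = (LINT x|\<mu>. F (x, t))"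
      by (cases "0 < t") (simp_all add: F0)
  qed
  finally show ?thesis .
qed

lemma integral_mu_le:
  fixes f :: "'a \<Rightarrow> real"
  assumes f: "\<And>x. \<bar>f x\<bar> \<le> c" shows "\<bar>LINT x|\<mu>. f x\<bar> \<le> c * measure \<mu> UNIV"
proof (cases "integrable \<mu> f")
  case True
  have "\<bar>LINT x|\<mu>. f x\<bar> \<le> (LINT x|\<mu>. \<bar>f x\<bar>)" using integral_norm_bound[of \<mu> f] by simp
  also have "\<dots> \<le> (LINT x|\<mu>. c)" using True f by (intro integral_mono) auto
  finally show ?thesis by (simp add: mult.commute)
next
  case False
  have "0 \<le> c" by (rule order_trans[OF abs_ge_zero f])
  then show ?thesis using False by (simp add: not_integrable_integral_eq)
qed

lemma integrable_time_supported:
  fixes F :: "'a \<times> real \<Rightarrow> real"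
  assumes F: "F \<in> borel_measurable borel" and b: "\<And>z. \<bar>F z\<bar> \<le> c" and s: "\<And>x t. t \<notin> {l..r} \<Longrightarrow> F (x, t) = 0"
  shows "integrable lborel (\<lambda>t. LINT x|\<mu>. F (x, t))"
proof (rule Bochner_Integration.integrable_bound[of lborel "\<lambda>t. indicator {l..r} t * (c * measure \<mu> UNIV)"])
  show "integrable lborel (\<lambda>t. indicator {l..r} t * (c * measure \<mu> UNIV))"
    by (intro integrable_mult_left integrable_real_indicator) (simp_all add: emeasure_lborel_Icc_eq)
  show "(\<lambda>t. LINT x|\<mu>. F (x, t)) \<in> borel_measurable lborel"
    using inner_integral_measurable[OF F] by simp
  show "AE t in lborel. norm (LINT x|\<mu>. F (x, t)) \<le> norm (indicator {l..r} t * (c * measure \<mu> UNIV))"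
  proof (rule AE_I2)
    fix t
    have "\<bar>LINT x|\<mu>. F (x, t)\<bar> \<le> c * measure \<mu> UNIV" by (rule integral_mu_le[OF b])
    then show "norm (LINT x|\<mu>. F (x, t)) \<le> norm (indicator {l..r} t * (c * measure \<mu> UNIV))"
    proof (cases "t \<in> {l..r}")
      case True
      then have "indicator {l..r} t * (c * measure \<mu> UNIV) = c * measure \<mu> UNIV" by simp
      then show ?thesis using \<open>\<bar>LINT x|\<mu>. F (x, t)\<bar> \<le> c * measure \<mu> UNIV\<close> by (simp only: real_norm_def)
    next
      case False
      have "(LINT x|\<mu>. F (x, t)) = 0" by (simp only: s[OF False] Bochner_Integration.integral_zero)
      then show ?thesis by simp
    qed
  qed
qed

text \<open>Discrete integration by parts: translation in time moves the backward difference
  quotient from \<open>v j\<close> to a forward one on \<psi>, with a minus sign. The forward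
  quotients are bounded by the bound C of \<psi>' and converge to it pointwise; there are no
  boundary terms since \<psi> vanishes before \<delta> and after T.\<close>

lemma time_derivative:
  fixes \<psi> \<psi>' :: "'a \<times> real \<Rightarrow> real"
  assumes m[measurable]: "\<psi> \<in> borel_measurable borel" "\<psi>' \<in> borel_measurable borel"
    and T: "0 < \<delta>" "\<delta> < T" and supp: "\<And>x t. t \<notin> {\<delta>..T} \<Longrightarrow> \<psi> (x, t) = 0" "\<And>x t. t \<notin> {\<delta>..T} \<Longrightarrow> \<psi>' (x, t) = 0"
    and C: "\<And>z. \<bar>\<psi>' z\<bar> \<le> C"
    and d: "\<And>x t. ((\<lambda>t. \<psi> (x, t)) has_real_derivative \<psi>' (x, t)) (at t)"
  shows "(LINT z|st. \<psi>' z * (u z \<bullet> e)) = - (LINT z|st. w z \<bullet> (\<psi> z *\<^sub>R e))"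
proof -
  have C0: "0 \<le> C" by (rule order_trans[OF abs_ge_zero C])
  have lip: "\<bar>\<psi> (x, t) - \<psi> (x, s)\<bar> \<le> C * \<bar>t - s\<bar>" for x t s
  proof -
    have "norm (\<psi> (x, t) - \<psi> (x, s)) \<le> C * norm (t - s)"
      by (rule field_differentiable_bound[OF convex_UNIV, of "\<lambda>t. \<psi> (x, t)" "\<lambda>t. \<psi>' (x, t)"])
        (use d C in \<open>auto simp: has_field_derivative_at_within\<close>)
    then show ?thesis by simp
  qed
  have b\<psi>: "\<bar>\<psi> z\<bar> \<le> C * T" for z
  proof (cases "snd z \<in> {\<delta>..T}")
    case True
    have "\<psi> (fst z, 0) = 0" using T by (intro supp) auto
    then have "\<bar>\<psi> z\<bar> \<le> C * \<bar>snd z - 0\<bar>" using lip[of "fst z" "snd z" 0] by simp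
    also have "\<dots> \<le> C * T" using True T C0 by (intro mult_left_mono) auto
    finally show ?thesis .
  next
    case False
    then show ?thesis using supp(1)[of "snd z" "fst z"] C0 T by simp
  qed
  have be: "\<bar>b \<bullet> e\<bar> \<le> R * norm e" if "b \<in> N" for b
    using Cauchy_Schwarz_ineq2[of b e] norm_N[OF that] by simp
  \<comment> \<open>The forward quotients reach back by \<open>h j\<close>; with this bound all of
    them vanish outside the common time interval [-H, T].\<close>
  obtain H where H: "\<And>j. h j \<le> H"
    using convergent_imp_Bseq[OF convergentI[OF h(1)]] by (auto simp: Bseq_def abs_le_iff)
  have H0: "0 < H" using h(2)[of 0] H[of 0] by linarith
  have shift: "(\<lambda>z. f (fst z, snd z + c)) \<in> borel_measurable borel" if "f \<in> borel_measurable borel"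
    for f :: "'a \<times> real \<Rightarrow> 'z::euclidean_space" and c
  proof -
    have "(\<lambda>z :: 'a \<times> real. (fst z, snd z + c)) \<in> borel_measurable borel"
      by (intro borel_measurable_continuous_onI continuous_intros)
    from measurable_compose[OF this that] show ?thesis .
  qed
  let ?\<Psi> = "\<lambda>z. \<psi> z *\<^sub>R e"
  have \<Psi>: "square_integrable st ?\<Psi>"
  proof -
    have "square_integrable st (\<lambda>z. indicator {0<..<T + 1} (snd z) *\<^sub>R ?\<Psi> z)"
      by (rule bounded_square_integrable_st(2)[of _ "C * T * norm e"])
        (use b\<psi> T in \<open>auto intro!: mult_right_mono\<close>)
    moreover have "indicator {0<..<T + 1} (snd z) *\<^sub>R ?\<Psi> z = ?\<Psi> z" for z
    proof (cases "snd z \<in> {\<delta>..T}")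
      case True
      then show ?thesis using T by simp
    next
      case False
      then show ?thesis using supp(1)[of "snd z" "fst z"] by simp
    qed
    ultimately show ?thesis by (simp only:)
  qed
  define q where "q j z = (\<psi> (fst z, snd z + h j) - \<psi> z) / h j" for j z
  have qm[measurable]: "q j \<in> borel_measurable borel" for j
    unfolding q_def using shift[OF m(1), of "h j"] by measurable
  have q_bound: "\<bar>q j z\<bar> \<le> C" for j z
  proof -
    have "\<bar>\<psi> (fst z, snd z + h j) - \<psi> (fst z, snd z)\<bar> \<le> C * h j" using lip[of "fst z" "snd z + h j" "snd z"] h(2)[of j] by simp
    then show ?thesis using h(2)[of j] by (simp add: q_def pos_divide_le_eq)
  qed
  have q_supp: "q j (x, t) = 0" if "t \<notin> {- H..T}" for j x t
  proof -
    have "t \<notin> {\<delta>..T}" "t + h j \<notin> {\<delta>..T}" using that H[of j] h(2)[of j] T H0 by auto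
    then show ?thesis by (simp add: q_def supp)
  qed
  have q_lim: "(\<lambda>j. q j z) \<longlonglongrightarrow> \<psi>' z" for z
  proof -
    have "filterlim h (at 0) sequentially" using h by (auto simp: filterlim_at less_imp_neq[symmetric])
    moreover have "((\<lambda>k. (\<psi> (fst z, snd z + k) - \<psi> (fst z, snd z)) / k) \<longlongrightarrow> \<psi>' (fst z, snd z)) (at 0)"
      using d[of "fst z" "snd z"] by (simp add: DERIV_def)
    ultimately show ?thesis unfolding q_def using filterlim_compose by fastforce
  qed
  have parts: "(LINT z|st. D j z \<bullet> ?\<Psi> z) = - (LINT t|lborel. LINT x|\<mu>. q j (x, t) * (v j (x, t) \<bullet> e))" for j
  proof -
    have Dm: "D j \<in> borel_measurable borel"
    proof -
      have "D j = (\<lambda>z. (1 / h j) *\<^sub>R (v j z - v j (fst z, snd z + (- h j))))"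
      proof
        fix z show "D j z = (1 / h j) *\<^sub>R (v j z - v j (fst z, snd z + (- h j)))"
          using approxD(6)[OF approx[of j], of "fst z" "snd z"] by simp
      qed
      then show ?thesis using shift[OF v_measurable[of j], of "- h j"] by simp
    qed
    let ?a = "\<lambda>z. \<psi> z * (v j z \<bullet> e)" and ?b = "\<lambda>z. \<psi> z * (v j (fst z, snd z - h j) \<bullet> e)"
      and ?c = "\<lambda>z. \<psi> (fst z, snd z + h j) * (v j z \<bullet> e)"
    have bd: "\<bar>\<psi> z * (y z' \<bullet> e)\<bar> \<le> C * T * (R * norm e)" if "y z' \<in> N" for y z and z' :: "'a \<times> real"
      unfolding abs_mult using b\<psi>[of z] be[OF that] C0 T by (intro mult_mono) auto
    have shm: "(\<lambda>z. v j (fst z, snd z - h j)) \<in> borel_measurable borel" using shift[OF v_measurable[of j], of "- h j"] by simp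
    have mm: "?a \<in> borel_measurable borel" "?b \<in> borel_measurable borel" "?c \<in> borel_measurable borel"
      using shm shift[OF m(1), of "h j"] by measurable
    have ia: "integrable lborel (\<lambda>t. LINT x|\<mu>. ?a (x, t))"
      by (rule integrable_time_supported[OF mm(1), of "C * T * (R * norm e)" \<delta> T]) (use bd v_N supp in auto)
    have ib: "integrable lborel (\<lambda>t. LINT x|\<mu>. ?b (x, t))"
      by (rule integrable_time_supported[OF mm(2), of "C * T * (R * norm e)" \<delta> T]) (use bd v_N supp in auto)
    have ic: "integrable lborel (\<lambda>t. LINT x|\<mu>. ?c (x, t))"
      by (rule integrable_time_supported[OF mm(3), of "C * T * (R * norm e)" "\<delta> - h j" "T - h j"]) (use bd v_N supp in auto)
    have im: "integrable \<mu> (\<lambda>x. F (x, t))" if "F \<in> borel_measurable borel" "\<And>z. \<bar>F z\<bar> \<le> C * T * (R * norm e)" for F :: "'a \<times> real \<Rightarrow> real" and t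
      by (rule integrable_mu_bounded[of _ "C * T * (R * norm e)"]) (use that slice_measurable in auto)
    have "(LINT z|st. D j z \<bullet> ?\<Psi> z) = (LINT t|lborel. LINT x|\<mu>. D j (x, t) \<bullet> ?\<Psi> (x, t))"
    proof (rule st_iterated)
      show "(\<lambda>z. D j z \<bullet> ?\<Psi> z) \<in> borel_measurable borel" using Dm by measurable
      show "integrable st (\<lambda>z. D j z \<bullet> ?\<Psi> z)" by (rule integrable_inner[OF approxD(7)[OF approx] \<Psi>])
      show "D j (x, t) \<bullet> ?\<Psi> (x, t) = 0" if "t \<le> 0" for x t using supp(1)[of t x] that T by simp
    qed
    also have "\<dots> = (LINT t|lborel. (1 / h j) * ((LINT x|\<mu>. ?a (x, t)) - (LINT x|\<mu>. ?b (x, t))))"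
    proof (intro Bochner_Integration.integral_cong refl)
      fix t
      have "D j (x, t) \<bullet> ?\<Psi> (x, t) = (1 / h j) * (?a (x, t) - ?b (x, t))" for x
        by (simp add: approxD(6)[OF approx] inner_diff_left right_diff_distrib diff_divide_distrib)
      then have "(LINT x|\<mu>. D j (x, t) \<bullet> ?\<Psi> (x, t)) = (1 / h j) * (LINT x|\<mu>. ?a (x, t) - ?b (x, t))" by simp
      also have "(LINT x|\<mu>. ?a (x, t) - ?b (x, t)) = (LINT x|\<mu>. ?a (x, t)) - (LINT x|\<mu>. ?b (x, t))"
        by (rule Bochner_Integration.integral_diff; rule im) (use mm bd v_N in auto)
      finally show "(LINT x|\<mu>. D j (x, t) \<bullet> ?\<Psi> (x, t)) = (1 / h j) * ((LINT x|\<mu>. ?a (x, t)) - (LINT x|\<mu>. ?b (x, t)))" .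
    qed
    also have "\<dots> = (1 / h j) * ((LINT t|lborel. LINT x|\<mu>. ?a (x, t)) - (LINT t|lborel. LINT x|\<mu>. ?b (x, t)))"
      using Bochner_Integration.integral_diff[OF ia ib] by (simp only: integral_mult_right_zero)
    also have "(LINT t|lborel. LINT x|\<mu>. ?b (x, t)) = (LINT t|lborel. LINT x|\<mu>. ?c (x, t))"
      using lborel_integral_real_affine[of 1 "\<lambda>t. LINT x|\<mu>. ?b (x, t)" "h j"] by (simp add: add.commute)
    also have "(1 / h j) * ((LINT t|lborel. LINT x|\<mu>. ?a (x, t)) - (LINT t|lborel. LINT x|\<mu>. ?c (x, t)))
        = (LINT t|lborel. (1 / h j) * ((LINT x|\<mu>. ?a (x, t)) - (LINT x|\<mu>. ?c (x, t))))"
      using Bochner_Integration.integral_diff[OF ia ic] by (simp only: integral_mult_right_zero)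
    also have "\<dots> = (LINT t|lborel. - (LINT x|\<mu>. q j (x, t) * (v j (x, t) \<bullet> e)))"
    proof (intro Bochner_Integration.integral_cong refl)
      fix t
      have "(LINT x|\<mu>. ?a (x, t)) - (LINT x|\<mu>. ?c (x, t)) = (LINT x|\<mu>. ?a (x, t) - ?c (x, t))"
        by (rule Bochner_Integration.integral_diff[symmetric]; rule im) (use mm bd v_N in auto)
      moreover have "q j (x, t) * (v j (x, t) \<bullet> e) = - ((1 / h j) * (?a (x, t) - ?c (x, t)))" for x
        by (simp add: q_def diff_divide_distrib left_diff_distrib)
      ultimately show "(1 / h j) * ((LINT x|\<mu>. ?a (x, t)) - (LINT x|\<mu>. ?c (x, t))) = - (LINT x|\<mu>. q j (x, t) * (v j (x, t) \<bullet> e))"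
        by simp
    qed
    finally show ?thesis by simp
  qed
  have bq: "\<bar>f z * (y z \<bullet> e)\<bar> \<le> C * (R * norm e)" if "\<bar>f z\<bar> \<le> C" "y z \<in> N" for f y and z :: "'a \<times> real"
    unfolding abs_mult using that be[of "y z"] C0 by (intro mult_mono) auto
  have lim: "(\<lambda>j. LINT t|lborel. LINT x|\<mu>. q j (x, t) * (v j (x, t) \<bullet> e)) \<longlonglongrightarrow> (LINT t|lborel. LINT x|\<mu>. \<psi>' (x, t) * (u (x, t) \<bullet> e))"
  proof (rule integral_dominated_convergence[where w = "\<lambda>t. indicator {- H..T} t * (C * (R * norm e) * measure \<mu> UNIV)"])
    show "integrable lborel (\<lambda>t. indicator {- H..T} t * (C * (R * norm e) * measure \<mu> UNIV))"
      by (intro integrable_mult_left integrable_real_indicator) (simp_all add: emeasure_lborel_Icc_eq)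
    have "(\<lambda>z. q j z * (v j z \<bullet> e)) \<in> borel_measurable borel" for j by measurable
    from inner_integral_measurable[OF this]
    show "(\<lambda>t. LINT x|\<mu>. q j (x, t) * (v j (x, t) \<bullet> e)) \<in> borel_measurable lborel" for j by simp
    have "(\<lambda>z. \<psi>' z * (u z \<bullet> e)) \<in> borel_measurable borel" by measurable
    from inner_integral_measurable[OF this]
    show "(\<lambda>t. LINT x|\<mu>. \<psi>' (x, t) * (u (x, t) \<bullet> e)) \<in> borel_measurable lborel" by simp
    show "AE t in lborel. norm (LINT x|\<mu>. q j (x, t) * (v j (x, t) \<bullet> e)) \<le> indicator {- H..T} t * (C * (R * norm e) * measure \<mu> UNIV)" for j
    proof (rule AE_I2)
      fix t
      have "\<bar>LINT x|\<mu>. q j (x, t) * (v j (x, t) \<bullet> e)\<bar> \<le> C * (R * norm e) * measure \<mu> UNIV"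
        by (rule integral_mu_le) (use bq q_bound v_N in blast)
      then show "norm (LINT x|\<mu>. q j (x, t) * (v j (x, t) \<bullet> e)) \<le> indicator {- H..T} t * (C * (R * norm e) * measure \<mu> UNIV)"
      proof (cases "t \<in> {- H..T}")
        case True
        then have "indicator {- H..T} t * (C * (R * norm e) * measure \<mu> UNIV) = C * (R * norm e) * measure \<mu> UNIV" by simp
        then show ?thesis using \<open>\<bar>LINT x|\<mu>. q j (x, t) * (v j (x, t) \<bullet> e)\<bar> \<le> C * (R * norm e) * measure \<mu> UNIV\<close>
          by (simp only: real_norm_def)
      next
        case False
        have "(LINT x|\<mu>. q j (x, t) * (v j (x, t) \<bullet> e)) = 0"
          by (simp only: q_supp[OF False] mult_zero_left Bochner_Integration.integral_zero)
        then show ?thesis using False by simp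
      qed
    qed
    show "AE t in lborel. (\<lambda>j. LINT x|\<mu>. q j (x, t) * (v j (x, t) \<bullet> e)) \<longlonglongrightarrow> (LINT x|\<mu>. \<psi>' (x, t) * (u (x, t) \<bullet> e))"
      using AE_not_in[OF Z]
    proof eventually_elim
      case (elim t)
      show ?case
      proof (rule integral_dominated_convergence[where w = "\<lambda>x. C * (R * norm e)"])
        show "AE x in \<mu>. (\<lambda>j. q j (x, t) * (v j (x, t) \<bullet> e)) \<longlonglongrightarrow> \<psi>' (x, t) * (u (x, t) \<bullet> e)"
          using v_tendsto[OF elim] by eventually_elim (intro tendsto_intros q_lim)
        show "AE x in \<mu>. norm (q j (x, t) * (v j (x, t) \<bullet> e)) \<le> C * (R * norm e)" for j
          using bq[of "q j" _ "v j"] q_bound v_N by (intro AE_I2) simp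
        have "(\<lambda>z. \<psi>' z * (u z \<bullet> e)) \<in> borel_measurable borel" "(\<lambda>z. q j z * (v j z \<bullet> e)) \<in> borel_measurable borel" for j by measurable
        from slice_measurable[OF this(1)] slice_measurable[OF this(2)]
        show "(\<lambda>x. \<psi>' (x, t) * (u (x, t) \<bullet> e)) \<in> borel_measurable \<mu>" "(\<lambda>x. q j (x, t) * (v j (x, t) \<bullet> e)) \<in> borel_measurable \<mu>" for j
          by simp_all
      qed simp
    qed
  qed
  have "(\<lambda>j. LINT z|st. D j z \<bullet> ?\<Psi> z) \<longlonglongrightarrow> - (LINT t|lborel. LINT x|\<mu>. \<psi>' (x, t) * (u (x, t) \<bullet> e))"
    unfolding parts by (rule tendsto_minus[OF lim])
  from midhull_limit_inner[OF approxD(7)[OF approx] \<Psi> this g_midhull w g_tendsto]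
  have "(LINT z|st. w z \<bullet> ?\<Psi> z) = - (LINT t|lborel. LINT x|\<mu>. \<psi>' (x, t) * (u (x, t) \<bullet> e))" .
  moreover have "(LINT z|st. \<psi>' z * (u z \<bullet> e)) = (LINT t|lborel. LINT x|\<mu>. \<psi>' (x, t) * (u (x, t) \<bullet> e))"
  proof (rule st_iterated)
    show um: "(\<lambda>z. \<psi>' z * (u z \<bullet> e)) \<in> borel_measurable borel" by measurable
    show "\<psi>' (x, t) * (u (x, t) \<bullet> e) = 0" if "t \<le> 0" for x t using supp(2)[of t x] that T by simp
    show "integrable st (\<lambda>z. \<psi>' z * (u z \<bullet> e))"
    proof (rule Bochner_Integration.integrable_bound[OF bounded_square_integrable_st(1)[of "\<lambda>z. 0" "C * (R * norm e)" "T + 1"]])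
      show "(\<lambda>z. \<psi>' z * (u z \<bullet> e)) \<in> borel_measurable st" by (rule borel_measurable_st[OF um])
      show "AE z in st. norm (\<psi>' z * (u z \<bullet> e)) \<le> norm (indicator {0<..<T + 1} (snd z) * (C * (R * norm e)))"
      proof (rule AE_I2)
        fix z
        show "norm (\<psi>' z * (u z \<bullet> e)) \<le> norm (indicator {0<..<T + 1} (snd z) * (C * (R * norm e)))"
        proof (cases "snd z \<in> {\<delta>..T}")
          case True
          then have "indicator {0<..<T + 1} (snd z) = (1 :: real)" using T by simp
          then show ?thesis using bq[of \<psi>' z u, OF C u_N] by simp
        next
          case False
          then show ?thesis using supp(2)[of "snd z" "fst z"] by simp
        qed
      qed
    qed (use T C0 R_nonneg in auto)
  qed
  ultimately show ?thesis by simp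
qed

end

subsection \<open>Strong measurability in time\<close>

lemma not_null_subsequence:
  fixes a :: "nat \<Rightarrow> real"
  assumes "\<not> a \<longlonglongrightarrow> 0"
  shows "\<exists>e>0. \<exists>r :: nat \<Rightarrow> nat. strict_mono r \<and> (\<forall>k. e \<le> \<bar>a (r k)\<bar>)"
proof -
  obtain e where e: "0 < e" "\<And>n. \<exists>k\<ge>n. e \<le> \<bar>a k\<bar>"
    using assms by (auto simp: LIMSEQ_iff not_less)
  have inf: "infinite {k. e \<le> \<bar>a k\<bar>}" using e(2) by (simp add: infinite_nat_iff_unbounded_le)
  have "e \<le> \<bar>a (enumerate {k. e \<le> \<bar>a k\<bar>} k)\<bar>" for k using enumerate_in_set[OF inf] by simp
  then show ?thesis using e(1) strict_mono_enumerate[OF inf] by blast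
qed

context energy_flow begin

text \<open>Convergence in L^2 gives convergence almost everywhere only along subsequences. If F
  stayed away from 0 along some subsequence, a further one would converge almost everywhere and
  contradict the assumption on F.\<close>

lemma null_by_AE_subsequence:
  fixes F :: "('a \<Rightarrow> 'b) \<Rightarrow> real"
  assumes y: "\<And>k. adm (y k)" "adm y'" and d: "(\<lambda>k. d2 (y k) y') \<longlonglongrightarrow> 0"
    and F: "\<And>r. strict_mono (r :: nat \<Rightarrow> nat) \<Longrightarrow> (AE x in \<mu>. (\<lambda>k. y (r k) x) \<longlonglongrightarrow> y' x) \<Longrightarrow> (\<lambda>k. F (y (r k))) \<longlonglongrightarrow> 0"
  shows "(\<lambda>k. F (y k)) \<longlonglongrightarrow> 0"
proof (rule ccontr)
  assume "\<not> (\<lambda>k. F (y k)) \<longlonglongrightarrow> 0"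
  then obtain e and r :: "nat \<Rightarrow> nat" where e: "0 < e" "strict_mono r" "\<And>k. e \<le> \<bar>F (y (r k))\<bar>"
    using not_null_subsequence[of "\<lambda>k. F (y k)"] by auto
  have "(\<lambda>k. LINT x|\<mu>. norm ((norm (y (r k) x - y' x))\<^sup>2)) \<longlonglongrightarrow> 0"
    using LIMSEQ_subseq_LIMSEQ[OF d e(2)] by (simp add: d2_def o_def)
  then obtain s where s: "strict_mono (s :: nat \<Rightarrow> nat)" "AE x in \<mu>. (\<lambda>k. (norm (y (r (s k)) x - y' x))\<^sup>2) \<longlonglongrightarrow> 0"
    using tendsto_L1_AE_subseq[of \<mu> "\<lambda>k x. (norm (y (r k) x - y' x))\<^sup>2"] d2_integrable[OF y] by blast
  have "AE x in \<mu>. (\<lambda>k. y ((r \<circ> s) k) x) \<longlonglongrightarrow> y' x"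
    using s(2)
  proof eventually_elim
    case (elim x)
    from tendsto_real_sqrt[OF elim] have "(\<lambda>k. norm (y (r (s k)) x - y' x)) \<longlonglongrightarrow> 0" by simp
    then have "(\<lambda>k. y (r (s k)) x - y' x) \<longlonglongrightarrow> 0" by (rule tendsto_norm_zero_cancel)
    then show ?case unfolding o_def by (rule LIM_zero_cancel)
  qed
  then have "(\<lambda>k. F (y ((r \<circ> s) k))) \<longlonglongrightarrow> 0" by (rule F[OF strict_mono_o[OF e(2) s(1)]])
  then have "(\<lambda>k. \<bar>F (y ((r \<circ> s) k))\<bar>) \<longlonglongrightarrow> 0" by (rule tendsto_rabs_zero)
  then have "e \<le> 0" by (rule LIMSEQ_le_const) (use e(3) in auto)
  then show False using e(1) by simp
qed

lemma incr_powr_diff_le: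
  "norm (incr v z - incr w z) powr p \<le> 2 powr p * (norm (incr v z) powr p + norm (incr w z) powr p)"
proof -
  have "norm (incr v z - incr w z) powr p \<le> (norm (incr v z) + norm (incr w z)) powr p"
    using p by (intro powr_mono2 norm_triangle_ineq4) auto
  also have "\<dots> \<le> 2 powr p * (norm (incr v z) powr p + norm (incr w z) powr p)"
    using p by (intro powr_add_le) auto
  finally show ?thesis .
qed

lemma integrable_incr_diff:
  assumes "adm v" "adm w" shows "integrable \<nu> (\<lambda>z. norm (incr v z - incr w z) powr p)"
proof (rule Bochner_Integration.integrable_bound[of \<nu> "\<lambda>z. 2 powr p * (norm (incr v z) powr p + norm (incr w z) powr p)"])
  have [measurable]: "v \<in> borel_measurable borel" "w \<in> borel_measurable borel" using assms admD by auto
  show "(\<lambda>z. norm (incr v z - incr w z) powr p) \<in> borel_measurable \<nu>" by measurable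
  show "integrable \<nu> (\<lambda>z. 2 powr p * (norm (incr v z) powr p + norm (incr w z) powr p))"
    using admD(3)[OF assms(1)] admD(3)[OF assms(2)] by simp
qed (use incr_powr_diff_le in \<open>auto intro!: AE_I2 order_trans[OF incr_powr_diff_le]\<close>)

text \<open>Convergence almost everywhere together with convergence of the norms is strong
  convergence (Riesz, Scheffe).\<close>

lemma incr_tendsto_of_AE:
  assumes y: "\<And>k. adm (y k)" "adm y'" and E: "(\<lambda>k. En (y k)) \<longlonglongrightarrow> En y'"
    and ae: "AE x in \<mu>. (\<lambda>k. y k x) \<longlonglongrightarrow> y' x"
  shows "(\<lambda>k. LINT z|\<nu>. norm (incr (y k) z - incr y' z) powr p) \<longlonglongrightarrow> 0"
proof (rule ccontr)
  define b where "b k = (LINT z|\<nu>. norm (incr (y k) z - incr y' z) powr p)" for k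
  assume "\<not> ?thesis"
  then have "\<not> b \<longlonglongrightarrow> 0" by (simp only: b_def[abs_def] not_False_eq_True)
  from not_null_subsequence[OF this] obtain e where e: "0 < e"
    and "\<exists>r :: nat \<Rightarrow> nat. strict_mono r \<and> (\<forall>k. e \<le> \<bar>b (r k)\<bar>)" by blast
  then obtain r :: "nat \<Rightarrow> nat" where r: "strict_mono r" "\<And>k. e \<le> \<bar>b (r k)\<bar>" by blast
  have b: "e \<le> b (r k)" for k using r(2)[of k] unfolding b_def by simp
  have "(\<lambda>k. 2 powr p * En (y (r k))) \<longlonglongrightarrow> 2 powr p * En y'"
    using LIMSEQ_subseq_LIMSEQ[OF E r(1)] by (intro tendsto_intros) (simp add: o_def)
  then have "\<forall>\<^sub>F k in sequentially. 2 powr p * En (y (r k)) < 2 powr p * En y' + e / 2"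
    by (rule order_tendstoD(2)) (use e in simp)
  then obtain m where m: "\<And>k. m \<le> k \<Longrightarrow> 2 powr p * En (y (r k)) < 2 powr p * En y' + e / 2"
    by (auto simp: eventually_sequentially)
  \<comment> \<open>Nonnegative by the elementary inequality for p-th powers. Its pointwise limit
    carries no difference term, so Fatou's lemma shows that a loss of e/2 in the integrals is
    impossible.\<close>
  let ?f = "\<lambda>k z. 2 powr p * (norm (incr (y (r (k + m))) z) powr p + norm (incr y' z) powr p) - norm (incr (y (r (k + m))) z - incr y' z) powr p"
  let ?g = "\<lambda>z. 2 powr p * (2 * norm (incr y' z) powr p)"
  have i: "integrable \<nu> (\<lambda>z. norm (incr (y k) z) powr p)" "integrable \<nu> (\<lambda>z. norm (incr y' z) powr p)"
    "integrable \<nu> (\<lambda>z. norm (incr (y k) z - incr y' z) powr p)" for k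
    by (rule admD(3)[OF y(1)], rule admD(3)[OF y(2)], rule integrable_incr_diff[OF y])
  have "integrable \<nu> ?g \<and> integral\<^sup>L \<nu> ?g \<le> 2 powr p * (2 * En y') - e / 2"
  proof (rule fatou_integral_le[where f = ?f])
    show "integrable \<nu> (?f k)" for k using i by simp
    show "0 \<le> ?f k z" for k z using incr_powr_diff_le[of "y (r (k + m))" z y'] by simp
    have "integral\<^sup>L \<nu> (?f k) = 2 powr p * (En (y (r (k + m))) + En y') - b (r (k + m))" for k
      using i by (simp add: En_def b_def)
    then show "integral\<^sup>L \<nu> (?f k) \<le> 2 powr p * (2 * En y') - e / 2" for k
      using m[of "k + m"] b[of "k + m"] by (simp only: distrib_left) linarith
    have [measurable]: "y' \<in> borel_measurable borel" using y admD by auto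
    show "?g \<in> borel_measurable \<nu>" by measurable
    show "AE z in \<nu>. (\<lambda>k. ?f k z) \<longlonglongrightarrow> ?g z"
      using incr_tendsto_AE[OF ae]
    proof eventually_elim
      case (elim z)
      have l: "(\<lambda>k. incr (y (r k)) z) \<longlonglongrightarrow> incr y' z" using LIMSEQ_subseq_LIMSEQ[OF elim r(1)] unfolding o_def .
      have l': "(\<lambda>k. incr (y (r (k + m))) z) \<longlonglongrightarrow> incr y' z" using LIMSEQ_ignore_initial_segment[OF l, of m] .
      have 1: "(\<lambda>k. norm (incr (y (r (k + m))) z) powr p) \<longlonglongrightarrow> norm (incr y' z) powr p"
        by (rule tendsto_powr'[OF tendsto_norm[OF l'] tendsto_const]) (use p in simp)
      have 2: "(\<lambda>k. norm (incr (y (r (k + m))) z - incr y' z) powr p) \<longlonglongrightarrow> norm (incr y' z - incr y' z) powr p"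
        by (rule tendsto_powr'[OF tendsto_norm[OF tendsto_diff[OF l' tendsto_const]] tendsto_const]) (use p in simp)
      have "(\<lambda>k. ?f k z) \<longlonglongrightarrow> 2 powr p * (norm (incr y' z) powr p + norm (incr y' z) powr p) - norm (incr y' z - incr y' z) powr p"
        by (rule tendsto_diff[OF tendsto_mult[OF tendsto_const tendsto_add[OF 1 tendsto_const]] 2])
      moreover have "2 powr p * (norm (incr y' z) powr p + norm (incr y' z) powr p) - norm (incr y' z - incr y' z) powr p = ?g z"
        using p by simp
      ultimately show ?case by (simp only:)
    qed
  qed
  then have "2 powr p * (2 * En y') \<le> 2 powr p * (2 * En y') - e / 2" using i(2) by (simp add: En_def)
  then show False using e by simp
qed

lemma strong_convergence:
  assumes y: "\<And>k. adm (y k)" "adm y'" and d: "(\<lambda>k. d2 (y k) y') \<longlonglongrightarrow> 0" and E: "(\<lambda>k. En (y k)) \<longlonglongrightarrow> En y'"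
  shows "(\<lambda>k. LINT z|\<nu>. norm (incr (y k) z - incr y' z) powr p) \<longlonglongrightarrow> 0"
    and "(\<lambda>k. LINT x|\<mu>. norm (y k x - y' x) powr p) \<longlonglongrightarrow> 0"
proof -
  show "(\<lambda>k. LINT z|\<nu>. norm (incr (y k) z - incr y' z) powr p) \<longlonglongrightarrow> 0"
  proof (rule null_by_AE_subsequence[OF y d, where F = "\<lambda>v. LINT z|\<nu>. norm (incr v z - incr y' z) powr p"])
    fix r :: "nat \<Rightarrow> nat" assume r: "strict_mono r" "AE x in \<mu>. (\<lambda>k. y (r k) x) \<longlonglongrightarrow> y' x"
    show "(\<lambda>k. LINT z|\<nu>. norm (incr (y (r k)) z - incr y' z) powr p) \<longlonglongrightarrow> 0"
      by (rule incr_tendsto_of_AE[OF y(1) y(2) _ r(2)]) (use LIMSEQ_subseq_LIMSEQ[OF E r(1)] in \<open>simp add: o_def\<close>)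
  qed
  show "(\<lambda>k. LINT x|\<mu>. norm (y k x - y' x) powr p) \<longlonglongrightarrow> 0"
  proof (rule null_by_AE_subsequence[OF y d, where F = "\<lambda>v. LINT x|\<mu>. norm (v x - y' x) powr p"])
    fix r :: "nat \<Rightarrow> nat" assume r: "strict_mono r" "AE x in \<mu>. (\<lambda>k. y (r k) x) \<longlonglongrightarrow> y' x"
    have [measurable]: "y' \<in> borel_measurable borel" "y k \<in> borel_measurable borel" for k using y admD by auto
    have "(\<lambda>k. LINT x|\<mu>. norm (y (r k) x - y' x) powr p) \<longlonglongrightarrow> (LINT x|\<mu>. 0)"
    proof (rule integral_dominated_convergence[where w = "\<lambda>x. (2 * R) powr p"])
      show "(\<lambda>x. norm (y (r k) x - y' x) powr p) \<in> borel_measurable \<mu>" for k by measurable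
      show "AE x in \<mu>. (\<lambda>k. norm (y (r k) x - y' x) powr p) \<longlonglongrightarrow> 0"
        using r(2)
      proof eventually_elim
        case (elim x)
        then have "(\<lambda>k. norm (y (r k) x - y' x)) \<longlonglongrightarrow> 0" by (intro tendsto_norm_zero LIM_zero)
        then have "(\<lambda>k. norm (y (r k) x - y' x) powr p) \<longlonglongrightarrow> 0 powr p" using p by (intro tendsto_powr' tendsto_const) auto
        then show ?case using p by simp
      qed
      show "AE x in \<mu>. norm (norm (y (r k) x - y' x) powr p) \<le> (2 * R) powr p" for k
        using norm_diff_N[OF admD(2)[OF y(1)] admD(2)[OF y(2)]] p by (intro AE_I2) (simp add: powr_mono2)
    qed simp_all
    then show "(\<lambda>k. LINT x|\<mu>. norm (y (r k) x - y' x) powr p) \<longlonglongrightarrow> 0" by simp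
  qed
qed

text \<open>Countably many values, and finitely many up to each time; cutting off in time then gives
  simple functions. Counting from minus infinity keeps the notion stable under the shift in the
  difference quotient.\<close>

definition time_step :: "('a \<times> real \<Rightarrow> 'b) \<Rightarrow> bool" where
  "time_step f \<longleftrightarrow> (\<exists>\<kappa> V. \<kappa> \<in> borel \<rightarrow>\<^sub>M count_space UNIV \<and> (\<forall>T. finite (\<kappa> ` {..T})) \<and>
    (\<forall>k :: nat. square_integrable \<mu> (V k)) \<and> (\<forall>x t. f (x, t) = V (\<kappa> t) x))"

lemma time_step_combine:
  assumes "time_step f" "time_step g" shows "time_step (\<lambda>z. a *\<^sub>R f z + b *\<^sub>R g (fst z, snd z - c))"
proof -
  obtain \<kappa> V where f: "\<kappa> \<in> borel \<rightarrow>\<^sub>M count_space UNIV" "\<And>T. finite (\<kappa> ` {..T})"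
    "\<And>k :: nat. square_integrable \<mu> (V k)" "\<And>x t. f (x, t) = V (\<kappa> t) x" using assms(1) unfolding time_step_def by blast
  obtain \<kappa>' V' where g: "\<kappa>' \<in> borel \<rightarrow>\<^sub>M count_space UNIV" "\<And>T. finite (\<kappa>' ` {..T})"
    "\<And>k :: nat. square_integrable \<mu> (V' k)" "\<And>x t. g (x, t) = V' (\<kappa>' t) x" using assms(2) unfolding time_step_def by blast
  \<comment> \<open>A pair of step indices, one of them at the shifted time, is coded as one natural
    number.\<close>
  define \<kappa>'' where "\<kappa>'' t = prod_encode (\<kappa> t, \<kappa>' (t - c))" for t
  define V'' where "V'' n x = a *\<^sub>R V (fst (prod_decode n)) x + b *\<^sub>R V' (snd (prod_decode n)) x" for n x
  note [measurable] = f(1) g(1)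
  have "\<kappa>'' \<in> borel \<rightarrow>\<^sub>M count_space UNIV" unfolding \<kappa>''_def by measurable
  moreover have "finite (\<kappa>'' ` {..T})" for T
  proof (rule finite_subset)
    show "\<kappa>'' ` {..T} \<subseteq> prod_encode ` (\<kappa> ` {..T} \<times> \<kappa>' ` {..T - c})" unfolding \<kappa>''_def by auto
  qed (use f(2) g(2) in simp)
  moreover have "square_integrable \<mu> (V'' n)" for n unfolding V''_def
    by (intro square_integrable_add square_integrable_scaleR f g)
  moreover have "a *\<^sub>R f (x, t) + b *\<^sub>R g (fst (x, t), snd (x, t) - c) = V'' (\<kappa>'' t) x" for x t
    by (simp add: V''_def \<kappa>''_def f(4) g(4))
  ultimately show ?thesis unfolding time_step_def by blast
qed

lemma square_integrable_adm: assumes "adm v" shows "square_integrable \<mu> v"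
proof -
  have [measurable]: "v \<in> borel_measurable borel" using assms by (rule admD)
  have "integrable \<mu> (\<lambda>x. (norm (v x))\<^sup>2)"
    by (rule integrable_mu_bounded[of _ "R\<^sup>2"]) (use norm_N[OF admD(2)[OF assms]] in auto)
  then show ?thesis unfolding square_integrable_def by simp
qed

lemma time_step_difference_quotient:
  assumes "approx u0 h v D" shows "time_step D"
proof -
  obtain \<kappa> V where "\<kappa> \<in> borel \<rightarrow>\<^sub>M count_space UNIV" "\<forall>T. finite (\<kappa> ` {..T})"
    "\<forall>k :: nat. adm (V k)" "\<forall>x t. v (x, t) = V (\<kappa> t) x" using approxD(10)[OF assms] by blast
  then have "time_step v" unfolding time_step_def using square_integrable_adm by blast
  then have "time_step (\<lambda>z. (1 / h) *\<^sub>R v z + (- 1 / h) *\<^sub>R v (fst z, snd z - h))" by (intro time_step_combine)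
  moreover have "D = (\<lambda>z. (1 / h) *\<^sub>R v z + (- 1 / h) *\<^sub>R v (fst z, snd z - h))"
    using approxD(6)[OF assms] by (auto simp: fun_eq_iff scaleR_diff_right)
  ultimately show ?thesis by simp
qed

lemma time_step_midhull: assumes "g \<in> midhull S" "\<And>f. f \<in> S \<Longrightarrow> time_step f" shows "time_step g"
  using assms(1)
proof induction
  case (mid f g)
  then have "time_step (\<lambda>z. (1 / 2) *\<^sub>R f z + (1 / 2) *\<^sub>R g (fst z, snd z - 0))" by (intro time_step_combine) auto
  then show ?case by (simp add: scaleR_add_right)
qed (use assms(2) in blast)

end

context flow_limit begin

lemma energy_measurable: "(\<lambda>t. En (\<lambda>x. u (x, t))) \<in> borel_measurable borel"
proof -
  have "(\<lambda>a :: 'b. norm a powr p) \<in> borel_measurable borel" by measurable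
  from measurable_compose[OF incr_time_measurable(1)[OF u_measurable] this]
  have "(\<lambda>y :: real \<times> 'a \<times> 'a. norm (incr (\<lambda>x. u (x, fst y)) (snd y)) powr p) \<in> borel_measurable borel" .
  from time_integral_measurable[OF this] show ?thesis unfolding En_def fst_conv snd_conv .
qed

text \<open>Times are replaced by members of a countable set that is dense in the graph of the energy, so
  that along the replacements the energies converge as well.\<close>

lemma u_time_steps:
  shows "\<exists>(c :: nat \<Rightarrow> real) (I :: nat \<Rightarrow> real \<Rightarrow> nat). (\<forall>k. I k \<in> borel \<rightarrow>\<^sub>M count_space UNIV \<and> finite (range (I k))) \<and>
    (\<forall>t. t \<notin> Z \<longrightarrow>
      (\<lambda>k. LINT z|\<nu>. norm (incr (\<lambda>x. u (x, c (I k t))) z - incr (\<lambda>x. u (x, t)) z) powr p) \<longlonglongrightarrow> 0 \<and>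
      (\<lambda>k. LINT x|\<mu>. norm (u (x, c (I k t)) - u (x, t)) powr p) \<longlonglongrightarrow> 0)"
proof -
  define e where "e t = En (\<lambda>x. u (x, t))" for t
  have em[measurable]: "e \<in> borel_measurable borel" unfolding e_def by (rule energy_measurable)
  define G where "G = (\<lambda>t. (t, e t)) ` (- Z)"
  have "Z \<noteq> UNIV" using Z by auto
  then have G0: "G \<noteq> {}" by (auto simp: G_def)
  obtain T where T: "countable T" "T \<subseteq> G" "G \<subseteq> closure T" by (rule separable)
  have T0: "T \<noteq> {}" using T G0 by auto
  define q where "q = from_nat_into T"
  define c where "c i = fst (q i)" for i
  have q': "q i = (c i, e (c i)) \<and> c i \<notin> Z" for i
  proof -
    have "q i \<in> G" unfolding q_def by (rule subsetD[OF T(2) from_nat_into[OF T0]])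
    then obtain t where "q i = (t, e t)" "t \<notin> Z" unfolding G_def by (elim imageE) simp
    then show ?thesis by (simp add: c_def)
  qed
  then have q: "q i = (c i, e (c i))" "c i \<notin> Z" for i by blast+
  define \<delta> where "\<delta> t i = dist (q i) (t, e t)" for t i
  have [measurable]: "(\<lambda>t. \<delta> t i) \<in> borel_measurable borel" for i
    unfolding \<delta>_def q(1) dist_prod_def fst_conv snd_conv by measurable
  \<comment> \<open>The first best candidate among the first k + 1 sample times. Taking the least
    index makes the choice unique and measurable in t.\<close>
  define I where "I k t = (LEAST i. i \<le> k \<and> (\<forall>j\<le>k. \<delta> t i \<le> \<delta> t j))" for k t
  have I: "I k t \<le> k \<and> (\<forall>j\<le>k. \<delta> t (I k t) \<le> \<delta> t j)" for k t
  proof -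
    let ?i = "arg_min_on (\<delta> t) {..k}"
    have "?i \<in> {..k}" by (rule arg_min_if_finite) simp_all
    moreover have "\<delta> t ?i \<le> \<delta> t j" if "j \<le> k" for j
      by (rule arg_min_least) (use that in simp_all)
    ultimately have "\<exists>i. i \<le> k \<and> (\<forall>j\<le>k. \<delta> t i \<le> \<delta> t j)" by (intro exI[of _ ?i] conjI allI impI) simp_all
    from LeastI_ex[OF this] show ?thesis unfolding I_def .
  qed
  have Im: "I k \<in> borel \<rightarrow>\<^sub>M count_space UNIV" for k
    unfolding I_def by (rule measurable_Least) measurable
  have fin: "finite (range (I k))" for k by (rule finite_subset[of _ "{..k}"]) (rule image_subsetI, rule iffD2[OF atMost_iff], rule conjunct1[OF I], simp)
  have lim: "(\<lambda>k. q (I k t)) \<longlonglongrightarrow> (t, e t)" if t: "t \<notin> Z" for t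
  proof (rule metric_LIMSEQ_I)
    fix d :: real assume d: "0 < d"
    have "(t, e t) \<in> G" unfolding G_def by (rule imageI) (use t in simp)
    then have "(t, e t) \<in> closure T" by (rule subsetD[OF T(3)])
    then obtain y where y: "y \<in> T" "dist y (t, e t) < d" using d unfolding closure_approachable by blast
    obtain m where m: "q m = y" using from_nat_into_surj[OF T(1) y(1)] unfolding q_def by blast
    have "dist (q (I k t)) (t, e t) < d" if "m \<le> k" for k
    proof -
      have "\<delta> t (I k t) \<le> \<delta> t m" using I[of k t] that by blast
      then show ?thesis using y(2) by (simp add: m \<delta>_def)
    qed
    then show "\<exists>m. \<forall>k\<ge>m. dist (q (I k t)) (t, e t) < d" by blast
  qed
  have "(\<lambda>k. LINT z|\<nu>. norm (incr (\<lambda>x. u (x, c (I k t))) z - incr (\<lambda>x. u (x, t)) z) powr p) \<longlonglongrightarrow> 0 \<and>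
      (\<lambda>k. LINT x|\<mu>. norm (u (x, c (I k t)) - u (x, t)) powr p) \<longlonglongrightarrow> 0" if t: "t \<notin> Z" for t
  proof -
    have l: "(\<lambda>k. c (I k t)) \<longlonglongrightarrow> t" "(\<lambda>k. e (c (I k t))) \<longlonglongrightarrow> e t"
      using tendsto_fst[OF lim[OF t]] tendsto_snd[OF lim[OF t]] by (simp_all add: q)
    have a: "adm (\<lambda>x. u (x, s))" for s using adm_u by blast
    have d: "(\<lambda>k. d2 (\<lambda>x. u (x, c (I k t))) (\<lambda>x. u (x, t))) \<longlonglongrightarrow> 0"
    proof (rule tendsto_sandwich[OF _ _ tendsto_const])
      show "\<forall>\<^sub>F k in sequentially. 0 \<le> d2 (\<lambda>x. u (x, c (I k t))) (\<lambda>x. u (x, t))" by (simp add: d2_nonneg)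
      show "\<forall>\<^sub>F k in sequentially. d2 (\<lambda>x. u (x, c (I k t))) (\<lambda>x. u (x, t)) \<le> E0 u0 * \<bar>c (I k t) - t\<bar>"
        by (intro always_eventually allI d2_u_le q(2) t)
      have "(\<lambda>k. \<bar>c (I k t) - t\<bar>) \<longlonglongrightarrow> 0" using l(1) by (intro tendsto_rabs_zero LIM_zero)
      then show "(\<lambda>k. E0 u0 * \<bar>c (I k t) - t\<bar>) \<longlonglongrightarrow> 0" by (rule tendsto_mult_right_zero)
    qed
    show ?thesis using strong_convergence[of "\<lambda>k x. u (x, c (I k t))" "\<lambda>x. u (x, t)", OF a a d] l(2) by (simp add: e_def)
  qed
  then show ?thesis using Im fin by blast
qed

lemma time_integral_square:
  fixes f :: "'a \<times> real \<Rightarrow> 'b"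
  assumes "square_integrable st f"
  shows "integrable (domain_measure {0<..}) (\<lambda>t. LINT x|\<mu>. (norm (f (x, t)))\<^sup>2)"
    and "AE t in domain_measure {0<..}. square_integrable \<mu> (\<lambda>x. f (x, t))"
    and "(LINT t|domain_measure {0<..}. LINT x|\<mu>. (norm (f (x, t)))\<^sup>2) = (LINT z|st. (norm (f z))\<^sup>2)"
proof -
  have fm: "f \<in> borel_measurable borel"
    using assms by (simp add: square_integrable_def measurable_cong_sets[OF sets_st refl])
  have i: "integrable (\<mu> \<Otimes>\<^sub>M domain_measure {0<..}) (\<lambda>(x, t). (norm (f (x, t)))\<^sup>2)"
    using assms by (simp add: square_integrable_def st_def case_prod_beta')
  show "integrable (domain_measure {0<..}) (\<lambda>t. LINT x|\<mu>. (norm (f (x, t)))\<^sup>2)" by (rule mu_time.integrable_snd[OF i])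
  show "(LINT t|domain_measure {0<..}. LINT x|\<mu>. (norm (f (x, t)))\<^sup>2) = (LINT z|st. (norm (f z))\<^sup>2)"
    using mu_time.integral_snd[OF i] by (simp add: st_def case_prod_beta')
  have "AE t in domain_measure {0<..}. integrable \<mu> (\<lambda>x. (norm (f (x, t)))\<^sup>2)" by (rule mu_time.AE_integrable_snd[OF i])
  then show "AE t in domain_measure {0<..}. square_integrable \<mu> (\<lambda>x. f (x, t))"
    by eventually_elim (use slice_measurable[OF fm] in \<open>simp add: square_integrable_def\<close>)
qed

text \<open>The discrete time derivatives are steps in time, and midpoints preserve this, so each
  \<open>g k\<close> is one. Their strong convergence to w on space-time gives convergence in L^2 of
  the slices at almost every time along a subsequence.\<close>

lemma w_time_steps:
  shows "\<exists>(I :: nat \<Rightarrow> real \<Rightarrow> nat) (V :: nat \<Rightarrow> nat \<Rightarrow> 'a \<Rightarrow> 'b). (\<forall>k. I k \<in> borel \<rightarrow>\<^sub>M count_space UNIV \<and> (\<forall>T. finite (I k ` {..T}))) \<and>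
    (\<forall>k n. square_integrable \<mu> (V k n)) \<and>
    (AE t in domain_measure {0<..}. (\<lambda>k. LINT x|\<mu>. (norm (V k (I k t) x - w (x, t)))\<^sup>2) \<longlonglongrightarrow> 0)"
proof -
  have "time_step (g k)" for k
    by (rule time_step_midhull[OF g_midhull]) (use time_step_difference_quotient[OF approx] in auto)
  then have "\<exists>\<kappa> V. \<kappa> \<in> borel \<rightarrow>\<^sub>M count_space UNIV \<and> (\<forall>T. finite (\<kappa> ` {..T})) \<and>
    (\<forall>k :: nat. square_integrable \<mu> (V k)) \<and> (\<forall>x t. g k (x, t) = V (\<kappa> t) x)" for k by (simp add: time_step_def)
  then obtain I V where s: "\<And>k. I k \<in> borel \<rightarrow>\<^sub>M count_space UNIV" "\<And>k T. finite (I k ` {..T})"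
    "\<And>k n :: nat. square_integrable \<mu> (V k n)" "\<And>k x t. g k (x, t) = V k (I k t) x" by metis
  have gs: "square_integrable st (g k)" for k
    using midhull_square_integrable[OF g_midhull[of k], of st "E0 u0"] approxD(7,8)[OF approx] by auto
  have d: "square_integrable st (\<lambda>z. g k z - w z)" for k by (rule square_integrable_diff[OF gs w])
  let ?F = "\<lambda>k t. LINT x|\<mu>. (norm (g k (x, t) - w (x, t)))\<^sup>2"
  have "(\<lambda>k. LINT t|domain_measure {0<..}. norm (?F k t)) \<longlonglongrightarrow> 0"
    using g_tendsto time_integral_square(3)[OF d] by simp
  then obtain r where r: "strict_mono (r :: nat \<Rightarrow> nat)" "AE t in domain_measure {0<..}. (\<lambda>k. ?F (r k) t) \<longlonglongrightarrow> 0"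
    using tendsto_L1_AE_subseq[of "domain_measure {0<..}" ?F] time_integral_square(1)[OF d] by blast
  have "AE t in domain_measure {0<..}. (\<lambda>k. LINT x|\<mu>. (norm (V (r k) (I (r k) t) x - w (x, t)))\<^sup>2) \<longlonglongrightarrow> 0"
    using r(2) by (simp add: s(4))
  then show ?thesis using s(1,2,3) by (intro exI[of _ "\<lambda>k. I (r k)"] exI[of _ "\<lambda>k. V (r k)"]) blast
qed

end

subsection \<open>Lebesgue measurable functions and Borel representatives\<close>

lemma AE_domain_measure_iff:
  assumes "open S" shows "(AE x in domain_measure S. P x) \<longleftrightarrow> (AE x in lborel. x \<in> S \<longrightarrow> P x)"
proof -
  have i: "0 < ennreal (indicator S x) \<longleftrightarrow> x \<in> S" for x by (cases "x \<in> S") simp_all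
  have m: "(\<lambda>x. ennreal (indicator S x)) \<in> borel_measurable lborel" using assms by simp
  show ?thesis unfolding domain_measure_def AE_density[OF m] i ..
qed

lemma AE_lebesgue_on_iff:
  assumes "open S" shows "(AE x in lebesgue_on S. P x) \<longleftrightarrow> (AE x in domain_measure S. P x)"
proof -
  have "S \<inter> space lebesgue \<in> sets lebesgue" using assms by auto
  from AE_restrict_space_iff[OF this, of P] show ?thesis
    unfolding AE_domain_measure_iff[OF assms] AE_completion_iff .
qed

text \<open>The bridge between the two descriptions of integrals: the notion of weak solution uses
  Lebesgue measure restricted to a set, the construction uses Borel functions on the whole type. It
  allows f to be an arbitrary function that agrees almost everywhere with a Borel one.\<close>

lemma lebesgue_on_transport:
  fixes f g :: "'a::euclidean_space \<Rightarrow> 'b::euclidean_space"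
  assumes S: "open S" and g: "g \<in> borel_measurable borel" and ae: "AE x in domain_measure S. f x = g x"
  shows "f \<in> borel_measurable (lebesgue_on S)"
    and "integrable (lebesgue_on S) f \<longleftrightarrow> integrable (domain_measure S) g"
    and "integral\<^sup>L (lebesgue_on S) f = integral\<^sup>L (domain_measure S) g"
proof -
  have Ss: "S \<inter> space lebesgue \<in> sets lebesgue" "S \<in> sets lebesgue" using S by auto
  have gl: "g \<in> borel_measurable lborel" using g by simp
  have gm: "g \<in> borel_measurable (lebesgue_on S)"
    by (rule measurable_restrict_space1[OF measurable_completion[OF gl]])
  have ae': "AE x in lebesgue_on S. f x = g x" using ae by (simp only: AE_lebesgue_on_iff[OF S])
  then have "AE x in lebesgue. x \<in> S \<longrightarrow> f x = g x" by (simp only: AE_restrict_space_iff[OF Ss(1)])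
  then obtain E where E: "{x \<in> space lebesgue. \<not> (x \<in> S \<longrightarrow> f x = g x)} \<subseteq> E" "emeasure lebesgue E = 0" "E \<in> sets lebesgue"
    by (rule AE_E)
  have E0: "E \<in> null_sets lebesgue" using E by (intro null_setsI)
  show fm: "f \<in> borel_measurable (lebesgue_on S)"
    unfolding borel_measurable_lebesgue_on_preimage_borel[OF Ss(2)]
  proof (intro allI impI)
    fix T :: "'b set" assume T: "T \<in> sets borel"
    have 1: "{x \<in> S. g x \<in> T} \<in> sets lebesgue" using gm T unfolding borel_measurable_lebesgue_on_preimage_borel[OF Ss(2)] by blast
    \<comment> \<open>By completeness of Lebesgue measure every subset of the null set
      \<open>E\<close> is measurable.\<close>
    have 2: "{x \<in> S. f x \<in> T} \<inter> E \<in> sets lebesgue"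
      by (rule null_setsD2[OF null_sets_completion_subset[OF _ E0]]) blast
    have "{x \<in> S. f x \<in> T} = ({x \<in> S. g x \<in> T} - E) \<union> ({x \<in> S. f x \<in> T} \<inter> E)"
    proof -
      have *: "f x = g x" if "x \<in> S" "x \<notin> E" for x using subsetD[OF E(1), of x] that by simp blast
      show ?thesis
      proof (rule Set.set_eqI)
        fix x show "x \<in> {x \<in> S. f x \<in> T} \<longleftrightarrow> x \<in> ({x \<in> S. g x \<in> T} - E) \<union> ({x \<in> S. f x \<in> T} \<inter> E)"
          using *[of x] by (cases "x \<in> S"; cases "x \<in> E") simp_all
      qed
    qed
    moreover have "({x \<in> S. g x \<in> T} - E) \<union> ({x \<in> S. f x \<in> T} \<inter> E) \<in> sets lebesgue" by (intro sets.Un sets.Diff 1 2 E(3))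
    ultimately show "{x \<in> S. f x \<in> T} \<in> sets lebesgue" by (simp only:)
  qed
  have ig: "(\<lambda>x. indicator S x *\<^sub>R g x) \<in> borel_measurable lborel" using S g by simp
  show "integrable (lebesgue_on S) f \<longleftrightarrow> integrable (domain_measure S) g"
    using integrable_cong_AE[OF fm gm ae'] integrable_restrict_space[OF Ss(1), of g] integrable_completion[OF ig] integrable_domain_measure[OF S g]
    by blast
  show "integral\<^sup>L (lebesgue_on S) f = integral\<^sup>L (domain_measure S) g"
    using integral_cong_AE[OF fm gm ae'] integral_restrict_space[OF Ss(1), of g] integral_completion[OF ig] integral_domain_measure[OF S g]
    by (simp only:)
qed

lemma borel_representative:
  fixes f :: "'a::euclidean_space \<Rightarrow> 'b::euclidean_space"
  assumes S: "open S" and f: "f \<in> borel_measurable (lebesgue_on S)"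
  shows "\<exists>g. g \<in> borel_measurable borel \<and> (AE x in domain_measure S. f x = g x)"
proof -
  let ?F = "\<lambda>x. indicator S x *\<^sub>R f x"
  have F: "?F \<in> borel_measurable lebesgue" using f S by (simp add: borel_measurable_restrict_space_iff)
  have "\<forall>i\<in>Basis. \<exists>g'. g' \<in> borel_measurable lborel \<and> (AE x in lborel. ?F x \<bullet> i = g' x)"
  proof
    fix i :: 'b
    have "(\<lambda>x. ?F x \<bullet> i) \<in> borel_measurable lebesgue" by (intro borel_measurable_inner F borel_measurable_const)
    from completion_ex_borel_measurable_real[OF this] show "\<exists>g'. g' \<in> borel_measurable lborel \<and> (AE x in lborel. ?F x \<bullet> i = g' x)" by blast
  qed
  from bchoice[OF this] obtain g' where g': "\<And>i. i \<in> Basis \<Longrightarrow> g' i \<in> borel_measurable lborel"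
    "\<And>i. i \<in> Basis \<Longrightarrow> AE x in lborel. ?F x \<bullet> i = g' i x" by blast
  define g where "g x = (\<Sum>i\<in>Basis. g' i x *\<^sub>R i)" for x
  have "g \<in> borel_measurable borel" unfolding g_def
    by (intro borel_measurable_sum borel_measurable_scaleR borel_measurable_const) (use g'(1) in simp)
  moreover have "AE x in lborel. \<forall>i\<in>Basis. ?F x \<bullet> i = g' i x"
    using g'(2) by (intro eventually_ball_finite finite_Basis ballI)
  then have "AE x in lborel. x \<in> S \<longrightarrow> f x = g x"
  proof eventually_elim
    case (elim x)
    have "?F x = (\<Sum>i\<in>Basis. (?F x \<bullet> i) *\<^sub>R i)" by (rule euclidean_representation[symmetric])
    also have "\<dots> = g x" unfolding g_def using elim by (intro sum.cong) auto
    finally have eq: "?F x = g x" .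
    show ?case
    proof
      assume "x \<in> S"
      then show "f x = g x" using eq by simp
    qed
  qed
  then have "AE x in domain_measure S. f x = g x" by (simp only: AE_domain_measure_iff[OF S])
  ultimately show ?thesis by blast
qed

lemma gagliardo_transport:
  fixes f g :: "'a::euclidean_space \<times> 'a \<Rightarrow> real"
  assumes \<Omega>: "open \<Omega>" and g[measurable]: "g \<in> borel_measurable borel" and ae: "AE z in domain_measure (\<Omega> \<times> \<Omega>). f z = g z"
  shows "integrable (lebesgue_on (\<Omega> \<times> \<Omega>)) (\<lambda>z. f z / norm (fst z - snd z) powr \<alpha>) \<longleftrightarrow> integrable (gagliardo_measure \<alpha> \<Omega>) g"
    and "(LINT z|lebesgue_on (\<Omega> \<times> \<Omega>). f z / norm (fst z - snd z) powr \<alpha>) = integral\<^sup>L (gagliardo_measure \<alpha> \<Omega>) g"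
proof -
  have o: "open (\<Omega> \<times> \<Omega>)" using \<Omega> by (intro open_Times)
  let ?g = "\<lambda>z. g z / norm (fst z - snd z) powr \<alpha>"
  have gm: "?g \<in> borel_measurable borel" by measurable
  have ae': "AE z in domain_measure (\<Omega> \<times> \<Omega>). f z / norm (fst z - snd z) powr \<alpha> = ?g z" using ae by eventually_elim simp
  have eq: "indicator (\<Omega> \<times> \<Omega>) z *\<^sub>R ?g z = (indicator (\<Omega> \<times> \<Omega>) z / norm (fst z - snd z) powr \<alpha>) *\<^sub>R g z" for z by simp
  show "integrable (lebesgue_on (\<Omega> \<times> \<Omega>)) (\<lambda>z. f z / norm (fst z - snd z) powr \<alpha>) \<longleftrightarrow> integrable (gagliardo_measure \<alpha> \<Omega>) g"
    by (simp only: lebesgue_on_transport(2)[OF o gm ae'] integrable_domain_measure[OF o gm] eq integrable_gagliardo_measure[OF \<Omega> g])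
  show "(LINT z|lebesgue_on (\<Omega> \<times> \<Omega>). f z / norm (fst z - snd z) powr \<alpha>) = integral\<^sup>L (gagliardo_measure \<alpha> \<Omega>) g"
    by (simp only: lebesgue_on_transport(3)[OF o gm ae'] integral_domain_measure[OF o gm] eq integral_gagliardo_measure[OF \<Omega> g])
qed

lemma null_sets_lborel_Times:
  fixes E :: "'a::euclidean_space set"
  assumes "E \<in> null_sets lborel"
  shows "E \<times> (UNIV :: 'b::euclidean_space set) \<in> null_sets lborel" "(UNIV :: 'b set) \<times> E \<in> null_sets lborel"
proof -
  have E: "E \<in> sets lborel" "emeasure lborel E = 0" using assms by auto
  have U: "UNIV \<in> sets (lborel :: 'b measure)" by simp
  have "emeasure (lborel \<Otimes>\<^sub>M lborel) (E \<times> (UNIV :: 'b set)) = 0"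
    unfolding lborel.emeasure_pair_measure_Times[OF E(1) U] E(2) by (rule mult_zero_left)
  then show "E \<times> (UNIV :: 'b set) \<in> null_sets lborel"
    using pair_measureI[OF E(1) U] unfolding lborel_prod by (intro null_setsI)
  have "emeasure (lborel \<Otimes>\<^sub>M lborel) ((UNIV :: 'b set) \<times> E) = 0"
    unfolding lborel.emeasure_pair_measure_Times[OF U E(1)] E(2) by (rule mult_zero_right)
  then show "(UNIV :: 'b set) \<times> E \<in> null_sets lborel"
    using pair_measureI[OF U E(1)] unfolding lborel_prod by (intro null_setsI)
qed

lemma AE_pairs:
  fixes \<Omega> :: "'a::euclidean_space set"
  assumes \<Omega>: "open \<Omega>" and ae: "AE x in domain_measure \<Omega>. P x"
  shows "AE z in domain_measure (\<Omega> \<times> \<Omega>). P (fst z) \<and> P (snd z)"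
proof -
  have "AE x in lborel. x \<in> \<Omega> \<longrightarrow> P x" using ae by (simp only: AE_domain_measure_iff[OF \<Omega>])
  then obtain E where E: "{x \<in> space lborel. \<not> (x \<in> \<Omega> \<longrightarrow> P x)} \<subseteq> E" "emeasure lborel E = 0" "E \<in> sets lborel"
    by (rule AE_E)
  have P: "P x" if "x \<in> \<Omega>" "x \<notin> E" for x using E(1) that by auto
  have null: "E \<in> null_sets lborel" using E(2,3) by (intro null_setsI)
  have "AE z in lborel. z \<in> \<Omega> \<times> \<Omega> \<longrightarrow> P (fst z) \<and> P (snd z)"
    using AE_not_in[OF null_sets_lborel_Times(1)[OF null]] AE_not_in[OF null_sets_lborel_Times(2)[OF null]]
  proof eventually_elim
    case (elim z)
    then show ?case using P by (cases z) auto
  qed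
  then show ?thesis by (simp only: AE_domain_measure_iff[OF open_Times[OF \<Omega> \<Omega>]])
qed

lemma AE_gagliardo_measure:
  fixes \<Omega> :: "'a::euclidean_space set"
  assumes \<Omega>: "open \<Omega>" and ae: "AE z in domain_measure (\<Omega> \<times> \<Omega>). P z"
  shows "AE z in gagliardo_measure \<alpha> \<Omega>. P z"
proof -
  have o: "open (\<Omega> \<times> \<Omega>)" using \<Omega> by (intro open_Times)
  have m: "(\<lambda>z. ennreal (indicator (\<Omega> \<times> \<Omega>) z / norm (fst z - snd z) powr \<alpha>)) \<in> borel_measurable lborel"
  proof -
    have "(\<lambda>z. norm (fst z - snd z) powr \<alpha>) \<in> borel_measurable (borel :: ('a \<times> 'a) measure)" by measurable
    moreover have "indicator (\<Omega> \<times> \<Omega>) \<in> borel_measurable (borel :: ('a \<times> 'a) measure)" using o by simp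
    ultimately show ?thesis by (intro measurable_compose[OF borel_measurable_divide measurable_ennreal]) simp_all
  qed
  have "AE z in lborel. z \<in> \<Omega> \<times> \<Omega> \<longrightarrow> P z" using ae by (simp only: AE_domain_measure_iff[OF o])
  then have "AE z in lborel. 0 < ennreal (indicator (\<Omega> \<times> \<Omega>) z / norm (fst z - snd z) powr \<alpha>) \<longrightarrow> P z"
  proof eventually_elim
    case (elim z)
    then show ?case by (cases "z \<in> \<Omega> \<times> \<Omega>") (simp_all only: indicator_simps div_0 ennreal_0 less_irrefl simp_thms)
  qed
  then show ?thesis unfolding gagliardo_measure_def AE_density[OF m] .
qed

lemma sigma_finite_gagliardo_measure:
  assumes "open \<Omega>" shows "sigma_finite_measure (gagliardo_measure \<alpha> \<Omega>)"
  unfolding gagliardo_measure_def using assms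
  by (subst sigma_finite_measure.sigma_finite_iff_density_finite[OF lborel.sigma_finite_measure_axioms]) auto

lemma domain_measure_Times:
  assumes "open \<Omega>" "open I"
  shows "domain_measure \<Omega> \<Otimes>\<^sub>M domain_measure I = domain_measure (\<Omega> \<times> I)"
proof -
  have "domain_measure \<Omega> \<Otimes>\<^sub>M domain_measure I
      = density (lborel \<Otimes>\<^sub>M lborel) (\<lambda>(x, t). ennreal (indicator \<Omega> x) * ennreal (indicator I t))"
    unfolding domain_measure_def using assms sigma_finite_domain_measure[OF assms(2)]
    by (intro pair_measure_density) (auto simp: domain_measure_def lborel.sigma_finite_measure_axioms)
  also have "(\<lambda>(x, t). ennreal (indicator \<Omega> x) * ennreal (indicator I t)) = (\<lambda>z. ennreal (indicator (\<Omega> \<times> I) z))"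
    by (auto simp: fun_eq_iff indicator_def)
  finally show ?thesis by (simp only: lborel_prod domain_measure_def)
qed

text \<open>Fubini's theorem for null sets. \<open>P\<close> may fail to be measurable, so it is
  first replaced by the complement of a measurable null set.\<close>

lemma AE_slices:
  assumes o: "open \<Omega>" "open I" and ae: "AE z in domain_measure (\<Omega> \<times> I). P z"
  shows "AE t in domain_measure I. AE x in domain_measure \<Omega>. P (x, t)"
proof -
  interpret m: sigma_finite_measure "domain_measure \<Omega>" by (rule sigma_finite_domain_measure[OF o(1)])
  interpret t: sigma_finite_measure "domain_measure I" by (rule sigma_finite_domain_measure[OF o(2)])
  interpret pair_sigma_finite "domain_measure \<Omega>" "domain_measure I" ..
  have ae': "AE z in domain_measure \<Omega> \<Otimes>\<^sub>M domain_measure I. P z" using ae by (simp only: domain_measure_Times[OF o])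
  obtain E where E: "{z \<in> space (domain_measure \<Omega> \<Otimes>\<^sub>M domain_measure I). \<not> P z} \<subseteq> E"
      "emeasure (domain_measure \<Omega> \<Otimes>\<^sub>M domain_measure I) E = 0" "E \<in> sets (domain_measure \<Omega> \<Otimes>\<^sub>M domain_measure I)"
    by (rule AE_E[OF ae'])
  have "AE z in domain_measure \<Omega> \<Otimes>\<^sub>M domain_measure I. z \<notin> E" using E(2,3) by (intro AE_not_in null_setsI)
  from AE_pair[OF this] have 1: "AE x in domain_measure \<Omega>. AE t in domain_measure I. (x, t) \<notin> E" .
  have "{z \<in> space (domain_measure \<Omega> \<Otimes>\<^sub>M domain_measure I). (fst z, snd z) \<notin> E} = space (domain_measure \<Omega> \<Otimes>\<^sub>M domain_measure I) - E"
    unfolding prod.collapse by blast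
  then have m: "{z \<in> space (domain_measure \<Omega> \<Otimes>\<^sub>M domain_measure I). (fst z, snd z) \<notin> E} \<in> sets (domain_measure \<Omega> \<Otimes>\<^sub>M domain_measure I)"
    using E(3) by (simp only: sets.compl_sets)
  have "AE t in domain_measure I. AE x in domain_measure \<Omega>. (x, t) \<notin> E"
    by (rule iffD1[OF AE_commute[of "\<lambda>x t. (x, t) \<notin> E", OF m] 1])
  then show ?thesis
  proof eventually_elim
    case (elim t)
    then show ?case
    proof eventually_elim
      case (elim x)
      show ?case
      proof (rule ccontr)
        assume "\<not> P (x, t)"
        then have "(x, t) \<in> {z \<in> space (domain_measure \<Omega> \<Otimes>\<^sub>M domain_measure I). \<not> P z}" by (simp add: space_pair_measure)
        then show False using subsetD[OF E(1)] elim by blast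
      qed
    qed
  qed
qed

lemma Lp_transport:
  fixes f v :: "'a::euclidean_space \<Rightarrow> 'b::euclidean_space"
  assumes \<Omega>: "open \<Omega>" and v[measurable]: "v \<in> borel_measurable borel" and ae: "AE x in domain_measure \<Omega>. f x = v x"
  shows "f \<in> Lp_space p \<Omega> \<longleftrightarrow> integrable (domain_measure \<Omega>) (\<lambda>x. norm (v x) powr p)"
    and "Lp_norm p \<Omega> f = (LINT x|domain_measure \<Omega>. norm (v x) powr p) powr (1 / p)"
proof -
  have m: "(\<lambda>x. norm (v x) powr p) \<in> borel_measurable borel" by measurable
  have ae': "AE x in domain_measure \<Omega>. norm (f x) powr p = norm (v x) powr p" using ae by eventually_elim simp
  show "f \<in> Lp_space p \<Omega> \<longleftrightarrow> integrable (domain_measure \<Omega>) (\<lambda>x. norm (v x) powr p)"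
    using lebesgue_on_transport(1)[OF \<Omega> v ae] by (simp add: Lp_space_def lebesgue_on_transport(2)[OF \<Omega> m ae'])
  show "Lp_norm p \<Omega> f = (LINT x|domain_measure \<Omega>. norm (v x) powr p) powr (1 / p)"
    by (simp only: Lp_norm_def lebesgue_on_transport(3)[OF \<Omega> m ae'])
qed

lemma sobolev_transport:
  fixes f v :: "'a::euclidean_space \<Rightarrow> 'b::euclidean_space"
  assumes \<Omega>: "open \<Omega>" and p: "0 < p" and v[measurable]: "v \<in> borel_measurable borel" and ae: "AE x in domain_measure \<Omega>. f x = v x"
  shows "f \<in> sobolev s p \<Omega> \<longleftrightarrow> integrable (domain_measure \<Omega>) (\<lambda>x. norm (v x) powr p) \<and>
      integrable (gagliardo_measure (real DIM('a) + s * p) \<Omega>) (\<lambda>z. norm (v (fst z) - v (snd z)) powr p)"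
    and "sobolev_norm s p \<Omega> f = ((LINT x|domain_measure \<Omega>. norm (v x) powr p) +
      (LINT z|gagliardo_measure (real DIM('a) + s * p) \<Omega>. norm (v (fst z) - v (snd z)) powr p)) powr (1 / p)"
proof -
  have m: "(\<lambda>z. norm (v (fst z) - v (snd z)) powr p) \<in> borel_measurable borel" by measurable
  have ae': "AE z in domain_measure (\<Omega> \<times> \<Omega>). norm (f (fst z) - f (snd z)) powr p = norm (v (fst z) - v (snd z)) powr p"
    using AE_pairs[OF \<Omega> ae] by eventually_elim simp
  have eq: "gagliardo_integrand s p f = (\<lambda>z. norm (f (fst z) - f (snd z)) powr p / norm (fst z - snd z) powr (real DIM('a) + s * p))"
    by (simp add: gagliardo_integrand_def fun_eq_iff case_prod_beta')
  note t = gagliardo_transport[OF \<Omega> m ae', of "real DIM('a) + s * p"]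
  show "f \<in> sobolev s p \<Omega> \<longleftrightarrow> integrable (domain_measure \<Omega>) (\<lambda>x. norm (v x) powr p) \<and>
      integrable (gagliardo_measure (real DIM('a) + s * p) \<Omega>) (\<lambda>z. norm (v (fst z) - v (snd z)) powr p)"
    unfolding sobolev_def mem_Collect_eq Lp_transport(1)[OF \<Omega> v ae] eq t(1) ..
  have n: "0 \<le> (LINT x|domain_measure \<Omega>. norm (v x) powr p)" by (rule Bochner_Integration.integral_nonneg) simp
  show "sobolev_norm s p \<Omega> f = ((LINT x|domain_measure \<Omega>. norm (v x) powr p) +
      (LINT z|gagliardo_measure (real DIM('a) + s * p) \<Omega>. norm (v (fst z) - v (snd z)) powr p)) powr (1 / p)"
    unfolding sobolev_norm_def gagliardo_energy_def Lp_transport(2)[OF \<Omega> v ae] eq t(2)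
    using p n by (simp add: powr_powr)
qed

lemma simple_function_time_index:
  fixes I :: "real \<Rightarrow> nat"
  assumes I: "I \<in> borel \<rightarrow>\<^sub>M count_space UNIV" "finite (range I)"
  shows "simple_function (lebesgue_on S) (\<lambda>t. J (I t))"
proof -
  have "I \<in> lborel \<rightarrow>\<^sub>M count_space UNIV" using I(1) by (simp add: measurable_cong_sets[OF sets_lborel refl])
  then have m: "I \<in> lebesgue_on S \<rightarrow>\<^sub>M count_space UNIV"
    by (intro measurable_restrict_space1 measurable_completion)
  have "simple_function (lebesgue_on S) I"
    unfolding simple_function_def
    by (intro conjI ballI measurable_sets[OF m] finite_subset[OF image_mono[OF subset_UNIV] I(2)]) simp
  from simple_function_compose[OF this, of J] show ?thesis by (simp only: o_def)
qed

lemma test_function_time_derivative: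
  fixes \<psi> :: "'a::euclidean_space \<times> real \<Rightarrow> real"
  assumes "\<psi> \<in> test_functions (\<Omega> \<times> {0<..})"
  defines "\<psi>' \<equiv> \<lambda>z. frechet_derivative \<psi> (at z) (0, 1)"
  shows "\<psi> \<in> borel_measurable borel" "\<psi>' \<in> borel_measurable borel"
    and "\<exists>\<delta> T. 0 < \<delta> \<and> \<delta> < T \<and> (\<forall>x t. t \<notin> {\<delta>..T} \<longrightarrow> \<psi> (x, t) = 0 \<and> \<psi>' (x, t) = 0)"
    and "\<exists>C. \<forall>z. \<bar>\<psi> z\<bar> \<le> C \<and> \<bar>\<psi>' z\<bar> \<le> C"
    and "((\<lambda>t. \<psi> (x, t)) has_real_derivative \<psi>' (x, t)) (at t)"
proof -
  have sm: "higher_differentiable_on k UNIV \<psi>" for k using assms(1) by (simp add: test_functions_def smooth_on_def)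
  have c: "continuous_on UNIV \<psi>" using sm[of 0] by simp
  have c': "continuous_on UNIV \<psi>'" using sm[of "Suc 0"] by (simp add: \<psi>'_def)
  have d: "(\<psi> has_derivative frechet_derivative \<psi> (at z)) (at z)" for z
    by (rule iffD1[OF frechet_derivative_works]) (use sm[of "Suc 0"] in \<open>unfold higher_differentiable_on.simps, blast\<close>)
  define K where "K = closure {z. \<psi> z \<noteq> 0}"
  have K: "compact K" "K \<subseteq> \<Omega> \<times> {0<..}" using assms(1) by (auto simp: test_functions_def K_def)
  have out: "\<psi> z = 0" if "z \<notin> K" for z using that closure_subset[of "{z. \<psi> z \<noteq> 0}"] unfolding K_def by blast
  have out': "\<psi>' z = 0" if z: "z \<notin> K" for z
  proof -
    have "open (- K)" using K(1) by (simp add: compact_imp_closed open_Compl)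
    then have "((\<lambda>z. 0) has_derivative frechet_derivative \<psi> (at z)) (at z)"
      by (rule has_derivative_transform_within_open[OF d]) (use z out in auto)
    from has_derivative_unique[OF this has_derivative_const] show ?thesis by (simp add: \<psi>'_def)
  qed
  show "\<psi> \<in> borel_measurable borel" "\<psi>' \<in> borel_measurable borel" using c c' by (simp_all add: borel_measurable_continuous_onI)
  show "\<exists>\<delta> T. 0 < \<delta> \<and> \<delta> < T \<and> (\<forall>x t. t \<notin> {\<delta>..T} \<longrightarrow> \<psi> (x, t) = 0 \<and> \<psi>' (x, t) = 0)"
  proof (cases "K = {}")
    case True
    then show ?thesis using out out' by (intro exI[of _ 1] exI[of _ 2]) auto
  next
    case False
    have s: "compact (snd ` K)" "snd ` K \<noteq> {}" using K(1) False by (auto intro!: compact_continuous_image continuous_intros)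
    obtain \<delta> where \<delta>: "\<delta> \<in> snd ` K" "\<And>t. t \<in> snd ` K \<Longrightarrow> \<delta> \<le> t" using compact_attains_inf[OF s] by blast
    obtain T where T: "T \<in> snd ` K" "\<And>t. t \<in> snd ` K \<Longrightarrow> t \<le> T" using compact_attains_sup[OF s] by blast
    have "0 < \<delta>" using \<delta>(1) K(2) by auto
    \<comment> \<open>The upper end is moved to T + 1 so that the time interval is nondegenerate
      even when \<delta> = T.\<close>
    moreover have "(x, t) \<notin> K" if "t \<notin> {\<delta>..T + 1}" for x t
    proof
      assume "(x, t) \<in> K"
      then have "t \<in> snd ` K" by force
      then show False using \<delta>(2)[of t] T(2)[of t] that by simp
    qed
    moreover have "\<delta> < T + 1" using \<delta>(2)[OF T(1)] by simp
    ultimately show ?thesis using out out' by (intro exI[of _ \<delta>] exI[of _ "T + 1"]) blast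
  qed
  have "bounded (\<psi> ` K)" "bounded (\<psi>' ` K)"
    using K(1) continuous_on_subset[OF c subset_UNIV] continuous_on_subset[OF c' subset_UNIV]
    by (auto intro!: compact_imp_bounded compact_continuous_image)
  then obtain a b where ab: "\<And>z. z \<in> K \<Longrightarrow> \<bar>\<psi> z\<bar> \<le> a" "\<And>z. z \<in> K \<Longrightarrow> \<bar>\<psi>' z\<bar> \<le> b"
    unfolding bounded_iff by auto
  have "\<bar>\<psi> z\<bar> \<le> \<bar>a\<bar> + \<bar>b\<bar> \<and> \<bar>\<psi>' z\<bar> \<le> \<bar>a\<bar> + \<bar>b\<bar>" for z
    using ab[of z] out[of z] out'[of z] by (cases "z \<in> K") auto
  then show "\<exists>C. \<forall>z. \<bar>\<psi> z\<bar> \<le> C \<and> \<bar>\<psi>' z\<bar> \<le> C" by blast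
  have "((\<lambda>t. \<psi> (x, t)) has_derivative (\<lambda>h. frechet_derivative \<psi> (at (x, t)) (0, h))) (at t)"
    by (rule has_derivative_compose[of "\<lambda>t. (x, t)" "\<lambda>h. (0, h)", OF _ d]) (auto intro!: derivative_eq_intros)
  moreover have "frechet_derivative \<psi> (at (x, t)) (0, h) = \<psi>' (x, t) * h" for h
    using linear_cmul[OF has_derivative_linear[OF d], of "(x, t)" h "(0, 1)"] by (simp add: \<psi>'_def mult.commute)
  ultimately show "((\<lambda>t. \<psi> (x, t)) has_real_derivative \<psi>' (x, t)) (at t)"
    by (simp add: has_field_derivative_def)
qed

subsection \<open>From the abstract limit to a weak solution\<close>

locale sobolev_flow =
  flow_limit K N "domain_measure \<Omega>" "gagliardo_measure (real DIM('a) + s * p) \<Omega>" p u0 h v D u Z g w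
  for K :: "(real ^ 'n) endo set" and N and \<Omega> :: "'a::euclidean_space set" and s p u0 h v D u Z g w +
  assumes domain_open: "open \<Omega>"
begin

abbreviation \<mu> :: "'a measure" where "\<mu> \<equiv> domain_measure \<Omega>"
abbreviation \<nu> :: "('a \<times> 'a) measure" where "\<nu> \<equiv> gagliardo_measure (real DIM('a) + s * p) \<Omega>"

lemma st_eq: "st = domain_measure (\<Omega> \<times> {0<..})"
  unfolding st_def by (rule domain_measure_Times[OF domain_open]) simp

lemma space_time_open: "open (\<Omega> \<times> {0<..<T :: real})" "open (\<Omega> \<times> {0 :: real<..})"
  using domain_open by (auto intro: open_Times)

lemma sobolev_iff:
  fixes y :: "'a \<Rightarrow> real ^ 'n"
  assumes "y \<in> borel_measurable borel"
  shows "y \<in> sobolev s p \<Omega> \<longleftrightarrow> integrable \<mu> (\<lambda>x. norm (y x) powr p) \<and> integrable \<nu> (\<lambda>z. norm (incr y z) powr p)"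
    and "sobolev_norm s p \<Omega> y = ((LINT x|\<mu>. norm (y x) powr p) + (LINT z|\<nu>. norm (incr y z) powr p)) powr (1 / p)"
proof -
  have p0: "0 < p" using p by simp
  have ae: "AE x in \<mu>. y x = y x" by simp
  show "y \<in> sobolev s p \<Omega> \<longleftrightarrow> integrable \<mu> (\<lambda>x. norm (y x) powr p) \<and> integrable \<nu> (\<lambda>z. norm (incr y z) powr p)"
    unfolding incr_def by (rule sobolev_transport(1)[OF domain_open p0 assms ae])
  show "sobolev_norm s p \<Omega> y = ((LINT x|\<mu>. norm (y x) powr p) + (LINT z|\<nu>. norm (incr y z) powr p)) powr (1 / p)"
    unfolding incr_def by (rule sobolev_transport(2)[OF domain_open p0 assms ae])
qed

lemma adm_sobolev: assumes "adm y" shows "y \<in> sobolev s p \<Omega>" "integrable \<mu> (\<lambda>x. norm (y x) powr p)"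
proof -
  have [measurable]: "y \<in> borel_measurable borel" using assms by (rule admD)
  show 1: "integrable \<mu> (\<lambda>x. norm (y x) powr p)"
    by (rule integrable_mu_bounded[of _ "R powr p"]) (simp_all add: norm_N[OF admD(2)[OF assms]])
  show "y \<in> sobolev s p \<Omega>" unfolding sobolev_iff(1)[OF admD(1)[OF assms]] using 1 admD(3)[OF assms] by blast
qed

lemma AE_time: assumes "AE t in lborel. P t" "open I" shows "AE t in lebesgue_on I. P t"
  unfolding AE_lebesgue_on_iff[OF assms(2)] AE_domain_measure_iff[OF assms(2)] using assms(1) by eventually_elim simp

text \<open>The simple functions approximating u take its own slices at finitely many sample times
  as values. Convergence in the Sobolev norm at the remaining times is the strong convergence
  obtained from matching the energies.\<close>

lemma u_bochner: "(\<lambda>t x. u (x, t)) \<in> bochner_Linfty (lebesgue_on {0<..}) (sobolev s p \<Omega>) (sobolev_norm s p \<Omega>)"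
proof -
  have sob: "(\<lambda>x. u (x, t)) \<in> sobolev s p \<Omega>" for t using adm_u by (blast intro: adm_sobolev)
  have um: "(\<lambda>x. u (x, t)) \<in> borel_measurable borel" for t by (rule slice_measurable[OF u_measurable])
  obtain c :: "nat \<Rightarrow> real" and I :: "nat \<Rightarrow> real \<Rightarrow> nat" where I: "\<And>k. I k \<in> borel \<rightarrow>\<^sub>M count_space UNIV \<and> finite (range (I k))"
    and lim: "\<And>t. t \<notin> Z \<Longrightarrow>
      (\<lambda>k. LINT z|\<nu>. norm (incr (\<lambda>x. u (x, c (I k t))) z - incr (\<lambda>x. u (x, t)) z) powr p) \<longlonglongrightarrow> 0 \<and>
      (\<lambda>k. LINT x|\<mu>. norm (u (x, c (I k t)) - u (x, t)) powr p) \<longlonglongrightarrow> 0"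
    using u_time_steps by blast
  have nrm: "sobolev_norm s p \<Omega> (\<lambda>x. u (x, a) - u (x, b)) = ((LINT x|\<mu>. norm (u (x, a) - u (x, b)) powr p)
      + (LINT z|\<nu>. norm (incr (\<lambda>x. u (x, a)) z - incr (\<lambda>x. u (x, b)) z) powr p)) powr (1 / p)" for a b
  proof -
    have e: "incr (\<lambda>x. u (x, a) - u (x, b)) z = incr (\<lambda>x. u (x, a)) z - incr (\<lambda>x. u (x, b)) z" for z
      by (simp add: incr_def)
    show ?thesis unfolding sobolev_iff(2)[OF borel_measurable_diff[OF um um]] e ..
  qed
  have "(\<lambda>k. sobolev_norm s p \<Omega> (\<lambda>x. u (x, c (I k t)) - u (x, t))) \<longlonglongrightarrow> 0" if t: "t \<notin> Z" for t
    unfolding nrm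
  proof (rule tendsto_zero_powrI[OF _ tendsto_const])
    show "(\<lambda>k. (LINT x|\<mu>. norm (u (x, c (I k t)) - u (x, t)) powr p)
      + (LINT z|\<nu>. norm (incr (\<lambda>x. u (x, c (I k t))) z - incr (\<lambda>x. u (x, t)) z) powr p)) \<longlonglongrightarrow> 0"
      by (rule tendsto_add_zero[OF conjunct2[OF lim[OF t]] conjunct1[OF lim[OF t]]])
    show "\<forall>\<^sub>F k in sequentially. 0 \<le> (LINT x|\<mu>. norm (u (x, c (I k t)) - u (x, t)) powr p)
      + (LINT z|\<nu>. norm (incr (\<lambda>x. u (x, c (I k t))) z - incr (\<lambda>x. u (x, t)) z) powr p)"
      by (intro always_eventually allI add_nonneg_nonneg Bochner_Integration.integral_nonneg powr_ge_zero)
  qed (use p in simp)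
  then have "AE t in lebesgue_on {0<..}. (\<lambda>k. sobolev_norm s p \<Omega> (\<lambda>x. u (x, c (I k t)) - u (x, t))) \<longlonglongrightarrow> 0"
    by (intro AE_time[OF eventually_mono[OF AE_not_in[OF Z]]]) auto
  moreover have "simple_function (lebesgue_on {0<..}) (\<lambda>t x. u (x, c (I k t)))" for k
    using simple_function_time_index[of "I k" "{0<..}" "\<lambda>i x. u (x, c i)"] I[of k] by blast
  ultimately have "strongly_measurable (lebesgue_on {0<..}) (sobolev s p \<Omega>) (sobolev_norm s p \<Omega>) (\<lambda>t x. u (x, t))"
    unfolding strongly_measurable_def
    by (intro conjI exI[of _ "\<lambda>k t x. u (x, c (I k t))"] allI) (use sob in auto)
  moreover have "sobolev_norm s p \<Omega> (\<lambda>x. u (x, t)) \<le> (R powr p * measure \<mu> UNIV + En u0) powr (1 / p)" for t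
  proof -
    have "(LINT x|\<mu>. norm (u (x, t)) powr p) = R powr p * measure \<mu> UNIV" by (simp add: norm_N[OF u_N] mult.commute)
    moreover have "(LINT z|\<nu>. norm (incr (\<lambda>x. u (x, t)) z) powr p) \<le> En u0" using adm_u[of t] unfolding En_def by blast
    ultimately show ?thesis unfolding sobolev_iff(2)[OF um] using p
      by (intro powr_mono2) (auto intro!: add_nonneg_nonneg)
  qed
  ultimately show ?thesis unfolding bochner_Linfty_def by blast
qed

lemma w_measurable: "w \<in> borel_measurable borel"
  using w by (simp add: square_integrable_def measurable_cong_sets[OF sets_st refl])

lemma L2_iff:
  fixes y :: "'a \<Rightarrow> real ^ 'n"
  assumes "y \<in> borel_measurable borel" "AE x in \<mu>. f x = y x"
  shows "f \<in> Lp_space 2 \<Omega> \<longleftrightarrow> integrable \<mu> (\<lambda>x. (norm (y x))\<^sup>2)"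
    and "Lp_norm 2 \<Omega> f = (LINT x|\<mu>. (norm (y x))\<^sup>2) powr (1 / 2)"
  using Lp_transport[OF domain_open assms, of 2] by simp_all

lemma w_bochner: "(\<lambda>t x. w (x, t)) \<in> bochner_Lp 2 (lebesgue_on {0<..}) (Lp_space 2 \<Omega>) (Lp_norm 2 \<Omega>)"
proof -
  have wm: "(\<lambda>x. w (x, t)) \<in> borel_measurable borel" for t by (rule slice_measurable[OF w_measurable])
  have refl_AE: "AE x in \<mu>. y x = y x" for y :: "'a \<Rightarrow> real ^ 'n" by simp
  obtain I :: "nat \<Rightarrow> real \<Rightarrow> nat" and V :: "nat \<Rightarrow> nat \<Rightarrow> 'a \<Rightarrow> real ^ 'n"
    where I: "\<And>k. I k \<in> borel \<rightarrow>\<^sub>M count_space UNIV" "\<And>k T. finite (I k ` {..T})" and V: "\<And>k n. square_integrable \<mu> (V k n)"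
    and lim: "AE t in domain_measure {0<..}. (\<lambda>k. LINT x|\<mu>. (norm (V k (I k t) x - w (x, t)))\<^sup>2) \<longlonglongrightarrow> 0"
    using w_time_steps by blast
  have Vm: "V k n \<in> borel_measurable borel" for k n using V[of k n] by (simp add: square_integrable_def measurable_cong_sets[OF sets_mu refl])
  \<comment> \<open>From time k on the k-th approximation is set to 0, which makes its range finite
    on the unbounded time line. Index 0 is reserved for the zero function, hence the
    \<open>Suc\<close>.\<close>
  define I' where "I' k t = (if t < real k then Suc (I k t) else 0)" for k t
  define J where "J k n = (case n of 0 \<Rightarrow> (\<lambda>x. 0) | Suc m \<Rightarrow> V k m)" for k n
  have Im: "I' k \<in> borel \<rightarrow>\<^sub>M count_space UNIV" for k
  proof -
    note [measurable] = I(1)[of k]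
    show ?thesis unfolding I'_def by measurable
  qed
  have "finite (range (I' k))" for k
    by (rule finite_subset[of _ "insert 0 (Suc ` I k ` {..real k})"]) (use I(2)[of k "real k"] in \<open>auto simp: I'_def\<close>)
  then have simple: "simple_function (lebesgue_on {0<..}) (\<lambda>t. J k (I' k t))" for k
    by (intro simple_function_time_index Im)
  have mem: "J k n \<in> Lp_space 2 \<Omega>" for k n
  proof (cases n)
    case 0
    then have "J k n = (\<lambda>x. 0)" by (simp add: J_def)
    then show ?thesis using L2_iff(1)[OF borel_measurable_const refl_AE, of 0] by simp
  next
    case (Suc m)
    then have "J k n = V k m" by (simp add: J_def)
    then show ?thesis using L2_iff(1)[OF Vm refl_AE, of k m] V[of k m] by (simp add: square_integrable_def)
  qed
  have conv: "(\<lambda>k. Lp_norm 2 \<Omega> (\<lambda>x. J k (I' k t) x - w (x, t))) \<longlonglongrightarrow> 0"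
    if l: "(\<lambda>k. LINT x|\<mu>. (norm (V k (I k t) x - w (x, t)))\<^sup>2) \<longlonglongrightarrow> 0" for t
  proof (rule Lim_transform_eventually)
    show "(\<lambda>k. (LINT x|\<mu>. (norm (V k (I k t) x - w (x, t)))\<^sup>2) powr (1 / 2)) \<longlonglongrightarrow> 0"
      by (rule tendsto_zero_powrI[OF l tendsto_const]) (simp_all add: always_eventually)
    obtain n :: nat where n: "t < real n" using reals_Archimedean2 by blast
    have "(LINT x|\<mu>. (norm (V k (I k t) x - w (x, t)))\<^sup>2) powr (1 / 2) = Lp_norm 2 \<Omega> (\<lambda>x. J k (I' k t) x - w (x, t))"
      if k: "n \<le> k" for k
    proof -
      have "J k (I' k t) = V k (I k t)" using n k by (simp add: J_def I'_def)
      then show ?thesis using L2_iff(2)[OF borel_measurable_diff[OF Vm wm] refl_AE, of k "I k t" t] by simp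
    qed
    then show "\<forall>\<^sub>F k in sequentially. (LINT x|\<mu>. (norm (V k (I k t) x - w (x, t)))\<^sup>2) powr (1 / 2) = Lp_norm 2 \<Omega> (\<lambda>x. J k (I' k t) x - w (x, t))"
      unfolding eventually_sequentially by blast
  qed
  have "AE t in lebesgue_on {0<..}. (\<lambda>x. w (x, t)) \<in> Lp_space 2 \<Omega>"
    using time_integral_square(2)[OF w] unfolding AE_lebesgue_on_iff[OF open_greaterThan]
    by eventually_elim (simp add: L2_iff(1)[OF wm refl_AE] square_integrable_def)
  moreover have "AE t in lebesgue_on {0<..}. (\<lambda>k. Lp_norm 2 \<Omega> (\<lambda>x. J k (I' k t) x - w (x, t))) \<longlonglongrightarrow> 0"
    using lim unfolding AE_lebesgue_on_iff[OF open_greaterThan] by eventually_elim (rule conv)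
  ultimately have sm: "strongly_measurable (lebesgue_on {0<..}) (Lp_space 2 \<Omega>) (Lp_norm 2 \<Omega>) (\<lambda>t x. w (x, t))"
    unfolding strongly_measurable_def
    by (intro conjI exI[of _ "\<lambda>k t. J k (I' k t)"] allI) (use simple mem in auto)
  have "(\<lambda>z. (norm (w z))\<^sup>2) \<in> borel_measurable borel" using w_measurable by measurable
  note im = inner_integral_measurable[OF this]
  have "Lp_norm 2 \<Omega> (\<lambda>x. w (x, t)) powr 2 = (LINT x|\<mu>. (norm (w (x, t)))\<^sup>2)" for t
    using powr_powr[of "LINT x|\<mu>. (norm (w (x, t)))\<^sup>2" "1 / 2" 2] unfolding L2_iff(2)[OF wm refl_AE] by simp
  then have "integrable (lebesgue_on {0<..}) (\<lambda>t. Lp_norm 2 \<Omega> (\<lambda>x. w (x, t)) powr 2)"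
    using lebesgue_on_transport(2)[OF open_greaterThan im AE_I2[OF refl], of 0] time_integral_square(1)[OF w] by simp
  with sm show ?thesis unfolding bochner_Lp_def by blast
qed

lemma locally_integrable:
  fixes f :: "'a \<times> real \<Rightarrow> real ^ 'n"
  assumes [measurable]: "f \<in> borel_measurable borel" and i: "integrable st (\<lambda>z. (norm (f z))\<^sup>2) \<or> (\<forall>z. norm (f z) \<le> C)"
  shows "locally_integrable_on f (\<Omega> \<times> {0<..})"
  unfolding locally_integrable_on_def
proof (intro allI impI)
  fix A :: "('a \<times> real) set" assume A: "compact A \<and> A \<subseteq> \<Omega> \<times> {0<..}"
  have fin: "emeasure lborel A < \<infinity>" by (rule emeasure_bounded_finite[OF compact_imp_bounded[OF conjunct1[OF A]]])
  have As: "A \<in> sets lborel" using A by (simp add: borel_compact)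
  have m: "(\<lambda>z. indicator A z *\<^sub>R f z) \<in> borel_measurable lborel" using As by simp
  have "integrable lborel (\<lambda>z. indicator A z *\<^sub>R f z)"
    using i
  proof
    assume i: "integrable st (\<lambda>z. (norm (f z))\<^sup>2)"
    have "(\<lambda>z. (norm (f z))\<^sup>2) \<in> borel_measurable borel" by measurable
    then have i': "integrable lborel (\<lambda>z. indicator (\<Omega> \<times> {0<..}) z *\<^sub>R (norm (f z))\<^sup>2)"
      using i unfolding st_eq by (simp only: integrable_domain_measure[OF space_time_open(2)])
    show ?thesis
    proof (rule Bochner_Integration.integrable_bound[OF Bochner_Integration.integrable_add[OF integrable_real_indicator[OF As fin] i'] m])
      show "AE z in lborel. norm (indicator A z *\<^sub>R f z) \<le> norm (indicator A z + indicator (\<Omega> \<times> {0<..}) z *\<^sub>R (norm (f z))\<^sup>2)"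
      proof (rule AE_I2)
        fix z
        have "2 * norm (f z) \<le> 1 + (norm (f z))\<^sup>2" using zero_le_power2[of "norm (f z) - 1"] by (simp add: power2_diff)
        then have "norm (f z) \<le> 1 + (norm (f z))\<^sup>2" using norm_ge_zero[of "f z"] by linarith
        then show "norm (indicator A z *\<^sub>R f z) \<le> norm (indicator A z + indicator (\<Omega> \<times> {0<..}) z *\<^sub>R (norm (f z))\<^sup>2)"
        proof (cases "z \<in> A")
          case True
          then have "indicator A z = (1::real)" "indicator (\<Omega> \<times> {0<..}) z = (1::real)" using A by auto
          then show ?thesis using \<open>norm (f z) \<le> 1 + (norm (f z))\<^sup>2\<close> by simp
        qed simp
      qed
    qed
  next
    assume "\<forall>z. norm (f z) \<le> C"
    then show ?thesis using As fin by (intro integrable_bounded_on_finite_set[of _ _ _ C]) auto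
  qed
  then show "f absolutely_integrable_on A" unfolding set_integrable_def integrable_completion[OF m] .
qed

lemma integrable_st_bounded:
  fixes f :: "'a \<times> real \<Rightarrow> 'c::euclidean_space"
  assumes m: "f \<in> borel_measurable borel" and b: "\<And>z. norm (f z) \<le> C" and s: "\<And>x t. t \<notin> {\<delta>..T} \<Longrightarrow> f (x, t) = 0" and T: "0 < \<delta>" "\<delta> < T"
  shows "integrable st f"
proof (rule Bochner_Integration.integrable_bound[OF bounded_square_integrable_st(1)[of "\<lambda>z. 0" C "T + 1"] borel_measurable_st[OF m]])
  have C0: "0 \<le> C" by (rule order_trans[OF norm_ge_zero b])
  then show "norm (0 :: real ^ 'n) \<le> C" by simp
  show "AE z in st. norm (f z) \<le> norm (indicator {0<..<T + 1} (snd z) * C)"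
  proof (rule AE_I2)
    fix z
    show "norm (f z) \<le> norm (indicator {0<..<T + 1} (snd z) * C)"
    proof (cases "snd z \<in> {\<delta>..T}")
      case True
      then have "indicator {0<..<T + 1} (snd z) = (1 :: real)" using T by simp
      then show ?thesis using b[of z] C0 by simp
    next
      case False
      then show ?thesis using s[of "snd z" "fst z"] by simp
    qed
  qed
qed (use T in simp_all)

lemma distributional_derivative: "distributional_time_deriv \<Omega> u w"
  unfolding distributional_time_deriv_def
proof (intro conjI allI impI)
  show "locally_integrable_on u (\<Omega> \<times> {0<..})" by (rule locally_integrable[OF u_measurable, of R]) (simp add: norm_N[OF u_N])
  show "locally_integrable_on w (\<Omega> \<times> {0<..})" by (rule locally_integrable[OF w_measurable]) (use w in \<open>simp add: square_integrable_def\<close>)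
  fix \<psi> :: "'a \<times> real \<Rightarrow> real" assume test: "\<psi> \<in> test_functions (\<Omega> \<times> {0<..})"
  define \<psi>' where "\<psi>' z = frechet_derivative \<psi> (at z) (0, 1)" for z
  note t = test_function_time_derivative[OF test, folded \<psi>'_def]
  obtain \<delta> T where T: "0 < \<delta>" "\<delta> < T" and supp: "\<And>x t. t \<notin> {\<delta>..T} \<Longrightarrow> \<psi> (x, t) = 0 \<and> \<psi>' (x, t) = 0" using t(3) by blast
  obtain C where C: "\<And>z. \<bar>\<psi> z\<bar> \<le> C \<and> \<bar>\<psi>' z\<bar> \<le> C" using t(4) by blast
  have \<psi>m[measurable]: "\<psi> \<in> borel_measurable borel" "\<psi>' \<in> borel_measurable borel"
    using t(1,2) by (simp_all add: \<psi>'_def[abs_def])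
  note [measurable] = w_measurable
  have m: "(\<lambda>z. \<psi>' z *\<^sub>R u z) \<in> borel_measurable borel" "(\<lambda>z. \<psi> z *\<^sub>R w z) \<in> borel_measurable borel" by measurable
  have i1: "integrable st (\<lambda>z. \<psi>' z *\<^sub>R u z)"
  proof (rule integrable_st_bounded[OF m(1) _ _ T])
    show "norm (\<psi>' z *\<^sub>R u z) \<le> C * R" for z using C[of z] R_nonneg by (simp add: norm_N[OF u_N] mult_right_mono)
    show "\<psi>' (x, t) *\<^sub>R u (x, t) = 0" if "t \<notin> {\<delta>..T}" for x t using supp[OF that] by simp
  qed
  have "square_integrable st \<psi>"
    unfolding square_integrable_def
  proof
    show "integrable st (\<lambda>z. (norm (\<psi> z))\<^sup>2)"
    proof (rule integrable_st_bounded[OF _ _ _ T])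
      show "norm ((norm (\<psi> z))\<^sup>2) \<le> C\<^sup>2" for z using C[of z] power_mono[of "\<bar>\<psi> z\<bar>" C 2] by simp
      show "(norm (\<psi> (x, t)))\<^sup>2 = 0" if "t \<notin> {\<delta>..T}" for x t using supp[OF that] by simp
    qed measurable
  qed (rule borel_measurable_st[OF \<psi>m(1)])
  from integrable_norm_product[OF this w] have i2: "integrable st (\<lambda>z. \<psi> z *\<^sub>R w z)"
    by (rule Bochner_Integration.integrable_bound[OF _ borel_measurable_st[OF m(2)]]) simp
  have "(LINT z|st. \<psi>' z *\<^sub>R u z) = - (LINT z|st. \<psi> z *\<^sub>R w z)"
  proof (rule euclidean_eqI)
    fix e :: "real ^ 'n"
    have "(LINT z|st. \<psi>' z *\<^sub>R u z) \<bullet> e = (LINT z|st. (\<psi>' z *\<^sub>R u z) \<bullet> e)" by (rule integral_inner_left[symmetric]) (rule i1)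
    also have "\<dots> = (LINT z|st. \<psi>' z * (u z \<bullet> e))" by (simp only: inner_scaleR_left)
    also have "\<dots> = - (LINT z|st. w z \<bullet> (\<psi> z *\<^sub>R e))"
    proof (rule time_derivative[OF \<psi>m T, where C = C and e = e])
      show "\<psi> (x, t) = 0" "\<psi>' (x, t) = 0" if "t \<notin> {\<delta>..T}" for x t using supp[OF that] by blast+
      show "\<bar>\<psi>' z\<bar> \<le> C" for z using C by blast
      show "((\<lambda>t. \<psi> (x, t)) has_real_derivative \<psi>' (x, t)) (at t)" for x t using t(5) unfolding \<psi>'_def .
    qed
    also have "(LINT z|st. w z \<bullet> (\<psi> z *\<^sub>R e)) = (LINT z|st. (\<psi> z *\<^sub>R w z) \<bullet> e)" by (simp only: inner_scaleR_left inner_scaleR_right)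
    also have "\<dots> = (LINT z|st. \<psi> z *\<^sub>R w z) \<bullet> e" by (rule integral_inner_left) (rule i2)
    finally show "(LINT z|st. \<psi>' z *\<^sub>R u z) \<bullet> e = (- (LINT z|st. \<psi> z *\<^sub>R w z)) \<bullet> e" by simp
  qed
  moreover have "(LINT z|lebesgue_on (\<Omega> \<times> {0<..}). f z) = (LINT z|st. f z)" if "f \<in> borel_measurable borel" for f :: "'a \<times> real \<Rightarrow> real ^ 'n"
    unfolding st_eq by (rule lebesgue_on_transport(3)[OF space_time_open(2) that]) simp
  ultimately show "(LINT z|lebesgue_on (\<Omega> \<times> {0<..}). frechet_derivative \<psi> (at z) (0, 1) *\<^sub>R u z) = - (LINT z|lebesgue_on (\<Omega> \<times> {0<..}). \<psi> z *\<^sub>R w z)"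
    using m unfolding \<psi>'_def[symmetric] by (simp only:)
qed

lemma initial_value:
  assumes f: "AE x in \<mu>. f x = u0 x"
  shows "(\<forall>\<^sub>F t in at_right 0. (\<lambda>x. u (x, t) - f x) \<in> Lp_space 2 \<Omega>) \<and>
    ((\<lambda>t. Lp_norm 2 \<Omega> (\<lambda>x. u (x, t) - f x)) \<longlongrightarrow> 0) (at_right 0)"
proof -
  have m: "(\<lambda>x. u (x, t) - u0 x) \<in> borel_measurable borel" for t
    by (rule borel_measurable_diff[OF slice_measurable[OF u_measurable] admD(1)[OF u0]])
  have ae: "AE x in \<mu>. u (x, t) - f x = u (x, t) - u0 x" for t using f by eventually_elim simp
  have a: "adm (\<lambda>x. u (x, t))" for t using adm_u by blast
  have n: "Lp_norm 2 \<Omega> (\<lambda>x. u (x, t) - f x) = d2 (\<lambda>x. u (x, t)) u0 powr (1 / 2)" for t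
    unfolding L2_iff(2)[OF m ae] d2_def ..
  have "((\<lambda>t. d2 (\<lambda>x. u (x, t)) u0) \<longlongrightarrow> 0) (at_right 0)"
  proof (rule tendsto_sandwich[OF _ _ tendsto_const])
    show "\<forall>\<^sub>F t in at_right 0. 0 \<le> d2 (\<lambda>x. u (x, t)) u0" by (simp add: d2_nonneg)
    show "\<forall>\<^sub>F t in at_right 0. d2 (\<lambda>x. u (x, t)) u0 \<le> E0 u0 * t"
      using eventually_at_right_less[of "0::real"] by eventually_elim (simp add: d2_u_initial)
    show "((\<lambda>t. E0 u0 * t) \<longlongrightarrow> 0) (at_right 0)" by (rule tendsto_mult_right_zero[OF tendsto_ident_at])
  qed
  then have "((\<lambda>t. Lp_norm 2 \<Omega> (\<lambda>x. u (x, t) - f x)) \<longlongrightarrow> 0) (at_right 0)"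
    unfolding n by (rule tendsto_zero_powrI[OF _ tendsto_const]) (simp_all add: d2_nonneg)
  then show ?thesis using L2_iff(1)[OF m ae] d2_integrable[OF a u0] by (simp add: always_eventually)
qed

end

section \<open>The weak equation for general test maps\<close>

context sobolev_flow begin

text \<open>The bound makes the coefficient continuous on N times the whole space, and the pair of u
  and \<psi> takes all its values there.\<close>

lemma coefficient_measurable:
  fixes k :: "real ^ 'n \<Rightarrow> real ^ 'n \<Rightarrow> real"
  assumes k: "\<And>q q' \<phi> \<phi>'. q \<in> N \<Longrightarrow> q' \<in> N \<Longrightarrow> \<bar>k q \<phi> - k q' \<phi>'\<bar> \<le> L * (norm (q - q') * norm \<phi> + norm (\<phi> - \<phi>'))"
    and \<psi>: "\<psi> \<in> borel_measurable borel"
  shows "(\<lambda>z. k (u z) (\<psi> z)) \<in> borel_measurable borel"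
proof -
  have c: "continuous_on (N \<times> UNIV) (\<lambda>y. k (fst y) (snd y))"
    unfolding continuous_on_def
  proof
    fix y assume y: "y \<in> N \<times> (UNIV :: (real ^ 'n) set)"
    let ?b = "\<lambda>y'. L * (norm (fst y' - fst y) * norm (snd y') + norm (snd y' - snd y))"
    have "(?b \<longlongrightarrow> L * (norm (fst y - fst y) * norm (snd y) + norm (snd y - snd y))) (at y within N \<times> UNIV)"
      by (intro tendsto_intros)
    then have b: "(?b \<longlongrightarrow> 0) (at y within N \<times> UNIV)" by simp
    have e: "\<forall>\<^sub>F y' in at y within N \<times> UNIV. norm (k (fst y') (snd y') - k (fst y) (snd y)) \<le> ?b y'"
      unfolding eventually_at_filter
    proof (intro always_eventually allI impI)
      fix y' assume "y' \<in> N \<times> (UNIV :: (real ^ 'n) set)"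
      then show "norm (k (fst y') (snd y') - k (fst y) (snd y)) \<le> ?b y'"
        using k[of "fst y'" "fst y" "snd y'" "snd y"] y by auto
    qed
    show "((\<lambda>y. k (fst y) (snd y)) \<longlongrightarrow> k (fst y) (snd y)) (at y within N \<times> UNIV)"
      by (rule LIM_zero_cancel[OF Lim_null_comparison[OF e b]])
  qed
  have "(\<lambda>z. (u z, \<psi> z)) \<in> borel_measurable borel" by (rule borel_measurable_Pair[OF u_measurable \<psi>])
  then have "(\<lambda>z. (u z, \<psi> z)) \<in> borel \<rightarrow>\<^sub>M restrict_space borel (N \<times> UNIV)"
    by (intro measurable_restrict_space2) (simp_all add: u_N)
  from measurable_compose[OF this borel_measurable_continuous_on_restrict[OF c]] show ?thesis by simp
qed

text \<open>The increment of the coefficient is at most L (|du| |\<psi>| + |d\<psi>|). Since \<psi>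
  is bounded, its p-th power is controlled by the energies of u and \<psi>; this is where the
  boundedness of test maps and the Lipschitz choice of coefficients meet.\<close>

lemma coefficient_time_test:
  fixes k :: "real ^ 'n \<Rightarrow> real ^ 'n \<Rightarrow> real"
  assumes k: "\<And>q \<phi>. q \<in> N \<Longrightarrow> \<bar>k q \<phi>\<bar> \<le> L * norm \<phi>"
    "\<And>q q' \<phi> \<phi>'. q \<in> N \<Longrightarrow> q' \<in> N \<Longrightarrow> \<bar>k q \<phi> - k q' \<phi>'\<bar> \<le> L * (norm (q - q') * norm \<phi> + norm (\<phi> - \<phi>'))"
    and L: "0 \<le> L" and \<psi>: "\<psi> \<in> borel_measurable borel" and C: "\<And>z. norm (\<psi> z) \<le> C"
    and B: "AE t in domain_measure {0<..<T}. integrable \<nu> (\<lambda>z. norm (incr (\<lambda>x. \<psi> (x, t)) z) powr p) \<and>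
      (LINT z|\<nu>. norm (incr (\<lambda>x. \<psi> (x, t)) z) powr p) \<le> B"
  shows "time_test T (\<lambda>z. k (u z) (\<psi> z))"
proof -
  have km: "(\<lambda>z. k (u z) (\<psi> z)) \<in> borel_measurable borel" by (rule coefficient_measurable[OF k(2) \<psi>])
  have C0: "0 \<le> C" by (rule order_trans[OF norm_ge_zero C])
  have b: "\<bar>k (u z) (\<psi> z)\<bar> \<le> L * C" for z
    by (rule order_trans[OF k(1)[OF u_N] mult_left_mono[OF C L]])
  let ?du = "\<lambda>t z. norm (incr (\<lambda>x. u (x, t)) z)" and ?d\<psi> = "\<lambda>t z. norm (incr (\<lambda>x. \<psi> (x, t)) z)"
    and ?dk = "\<lambda>t z. \<bar>incr (\<lambda>x. k (u (x, t)) (\<psi> (x, t))) z\<bar>"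
  let ?g = "\<lambda>t z. L powr p * (2 powr p * (C powr p * ?du t z powr p + ?d\<psi> t z powr p))"
  have le: "?dk t z powr p \<le> ?g t z" for t z
  proof -
    have "?dk t z \<le> L * (?du t z * norm (\<psi> (fst z, t)) + ?d\<psi> t z)"
      using k(2)[OF u_N u_N, of "(fst z, t)" "\<psi> (fst z, t)" "(snd z, t)" "\<psi> (snd z, t)"] by (simp add: incr_def)
    also have "\<dots> \<le> L * (?du t z * C + ?d\<psi> t z)"
      by (intro mult_left_mono add_right_mono C L norm_ge_zero)
    finally have "?dk t z powr p \<le> (L * (?du t z * C + ?d\<psi> t z)) powr p" using p by (intro powr_mono2) auto
    also have "\<dots> = L powr p * (?du t z * C + ?d\<psi> t z) powr p" by (rule powr_mult)
    also have "\<dots> \<le> L powr p * (2 powr p * ((?du t z * C) powr p + ?d\<psi> t z powr p))"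
      using p C0 by (intro mult_left_mono powr_add_le) auto
    also have "(?du t z * C) powr p = C powr p * ?du t z powr p" using C0 by (simp add: powr_mult mult.commute)
    finally show ?thesis .
  qed
  have "AE t in domain_measure {0<..<T}. test (\<lambda>x. k (u (x, t)) (\<psi> (x, t))) \<and>
      (LINT z|\<nu>. ?dk t z powr p) \<le> L powr p * (2 powr p * (C powr p * En u0 + B))"
    using B
  proof eventually_elim
    case (elim t)
    have iu: "integrable \<nu> (\<lambda>z. ?du t z powr p)" using adm_u[of t] admD(3) by blast
    have ig: "integrable \<nu> (?g t)" using iu elim by simp
    have sm: "(\<lambda>x. k (u (x, t)) (\<psi> (x, t))) \<in> borel_measurable borel" by (rule slice_measurable[OF km])
    have dm: "(\<lambda>z. ?dk t z powr p) \<in> borel_measurable borel"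
    proof -
      have "(\<lambda>a :: real. \<bar>a\<bar> powr p) \<in> borel_measurable borel" by measurable
      from measurable_compose[OF incr_measurable[OF sm] this] show ?thesis .
    qed
    have ik: "integrable \<nu> (\<lambda>z. ?dk t z powr p)"
    proof (rule Bochner_Integration.integrable_bound[OF ig])
      show "(\<lambda>z. ?dk t z powr p) \<in> borel_measurable \<nu>" using dm by (simp only: measurable_cong_sets[OF sets_nu refl])
      show "AE z in \<nu>. norm (?dk t z powr p) \<le> norm (?g t z)"
        by (intro AE_I2 order_trans[OF _ abs_ge_self[of "?g t _", folded real_norm_def]]) (simp only: real_norm_def abs_of_nonneg[OF powr_ge_zero] le)
    qed
    have "test (\<lambda>x. k (u (x, t)) (\<psi> (x, t)))" unfolding test_def using sm b ik by blast
    moreover have "(LINT z|\<nu>. ?dk t z powr p) \<le> (LINT z|\<nu>. ?g t z)" by (rule integral_mono[OF ik ig le])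
    moreover have "(LINT z|\<nu>. ?g t z) = L powr p * (2 powr p * (C powr p * En (\<lambda>x. u (x, t)) + (LINT z|\<nu>. ?d\<psi> t z powr p)))"
      using iu elim by (simp add: En_def)
    moreover have "\<dots> \<le> L powr p * (2 powr p * (C powr p * En u0 + B))"
      using adm_u[of t] elim by (intro mult_left_mono add_mono) auto
    ultimately show ?case by linarith
  qed
  then show ?thesis unfolding time_test_def using km b by blast
qed

text \<open>The projected test map is a finite sum of terms \<eta> A u with admissible \<eta>, so
  the assertion is a sum of instances of \<open>weak_equation\<close>. The energy derivative in the
  direction of each term is its variation, again by skew-symmetry.\<close>

theorem weak_formulation:
  assumes T: "0 < T"
    and \<phi>: "(\<lambda>t x. \<phi> (x, t)) \<in> bochner_Linfty (lebesgue_on {0<..<T}) (sobolev0 s p \<Omega>) (sobolev_norm s p \<Omega>)"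
      "\<phi> \<in> Linfty_space (\<Omega> \<times> {0..T})"
  shows "integrable (lebesgue_on (\<Omega> \<times> {0<..<T})) (\<lambda>z. w z \<bullet> tangent_proj N (u z) (\<phi> z)) \<and>
    (AE t in lebesgue_on {0<..<T}. integrable (lebesgue_on (\<Omega> \<times> \<Omega>))
      (energy_deriv_integrand s p (\<lambda>x. u (x, t)) (\<lambda>x. tangent_proj N (u (x, t)) (\<phi> (x, t))))) \<and>
    integrable (lebesgue_on {0<..<T}) (\<lambda>t. energy_deriv s p \<Omega> (\<lambda>x. u (x, t)) (\<lambda>x. tangent_proj N (u (x, t)) (\<phi> (x, t)))) \<and>
    (LINT t|lebesgue_on {0<..<T}. LINT x|lebesgue_on \<Omega>. w (x, t) \<bullet> tangent_proj N (u (x, t)) (\<phi> (x, t))) +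
    (LINT t|lebesgue_on {0<..<T}. energy_deriv s p \<Omega> (\<lambda>x. u (x, t)) (\<lambda>x. tangent_proj N (u (x, t)) (\<phi> (x, t)))) = 0"
proof -
  let ?S = "\<Omega> \<times> {0<..<T}"
  have oS: "open ?S" by (rule space_time_open(1))
  have oT: "open {0<..<T}" by simp
  have p0: "0 < p" using p by simp
  obtain C0 where C0: "AE z in lebesgue_on (\<Omega> \<times> {0..T}). norm (\<phi> z) \<le> C0" and \<phi>m: "\<phi> \<in> borel_measurable (lebesgue_on (\<Omega> \<times> {0..T}))"
    using \<phi>(2) unfolding Linfty_space_def by blast
  define C where "C = max C0 0"
  have sub: "?S \<subseteq> \<Omega> \<times> {0..T}" by auto
  have sets: "(\<Omega> \<times> {0..T}) \<inter> space lebesgue \<in> sets lebesgue" "?S \<inter> space lebesgue \<in> sets lebesgue"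
    using borel_Times[of \<Omega> "{0..T}"] domain_open oS by auto
  have "AE z in lebesgue_on ?S. norm (\<phi> z) \<le> C0"
    using C0 unfolding AE_restrict_space_iff[OF sets(1)] AE_restrict_space_iff[OF sets(2)]
    by eventually_elim (use sub in blast)
  then have bd: "AE z in domain_measure ?S. norm (\<phi> z) \<le> C0" unfolding AE_lebesgue_on_iff[OF oS] .
  obtain \<phi>' where \<phi>': "\<phi>' \<in> borel_measurable borel" "AE z in domain_measure ?S. \<phi> z = \<phi>' z"
    using borel_representative[OF oS measurable_restrict_mono[OF \<phi>m sub]] by blast
  \<comment> \<open>Truncation at the essential bound changes the Borel representative on a null set
    only and makes it bounded everywhere. The maximum with 0 keeps the bound valid for the value 0
    as well.\<close>
  define \<psi> where "\<psi> z = (if norm (\<phi>' z) \<le> C then \<phi>' z else 0)" for z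
  note [measurable] = \<phi>'(1) w_measurable
  have \<psi>m[measurable]: "\<psi> \<in> borel_measurable borel" unfolding \<psi>_def by measurable
  have \<psi>C: "norm (\<psi> z) \<le> C" for z by (simp add: \<psi>_def C_def)
  have ae: "AE z in domain_measure ?S. \<phi> z = \<psi> z"
    using bd \<phi>'(2) by eventually_elim (simp add: \<psi>_def C_def)
  have aet: "AE t in domain_measure {0<..<T}. AE x in \<mu>. \<phi> (x, t) = \<psi> (x, t)"
    by (rule AE_slices[OF domain_open oT ae])
  have \<psi>t: "(\<lambda>x. \<psi> (x, t)) \<in> borel_measurable borel" for t by (rule slice_measurable[OF \<psi>m])
  obtain c where sob: "AE t in lebesgue_on {0<..<T}. (\<lambda>x. \<phi> (x, t)) \<in> sobolev0 s p \<Omega>"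
    and nrm: "AE t in lebesgue_on {0<..<T}. sobolev_norm s p \<Omega> (\<lambda>x. \<phi> (x, t)) \<le> c"
    using \<phi>(1) unfolding bochner_Linfty_def strongly_measurable_def by blast
  have B: "AE t in domain_measure {0<..<T}. integrable \<nu> (\<lambda>z. norm (incr (\<lambda>x. \<psi> (x, t)) z) powr p) \<and>
      (LINT z|\<nu>. norm (incr (\<lambda>x. \<psi> (x, t)) z) powr p) \<le> c powr p"
    using sob nrm aet unfolding AE_lebesgue_on_iff[OF oT]
  proof eventually_elim
    case (elim t)
    note tr = sobolev_transport[OF domain_open p0 \<psi>t elim(3), of s]
    have "(\<lambda>x. \<phi> (x, t)) \<in> sobolev s p \<Omega>" using elim(1) unfolding sobolev0_def by blast
    then have i: "integrable \<nu> (\<lambda>z. norm (incr (\<lambda>x. \<psi> (x, t)) z) powr p)" unfolding tr(1) incr_def by blast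
    let ?a = "LINT x|\<mu>. norm (\<psi> (x, t)) powr p" and ?b = "LINT z|\<nu>. norm (incr (\<lambda>x. \<psi> (x, t)) z) powr p"
    have a: "0 \<le> ?a" "0 \<le> ?b" by (simp_all add: Bochner_Integration.integral_nonneg)
    have n: "(?a + ?b) powr (1 / p) \<le> c" using elim(2) unfolding tr(2) incr_def .
    have "?a + ?b = ((?a + ?b) powr (1 / p)) powr p" using a p0 by (simp add: powr_powr)
    also have "\<dots> \<le> c powr p" using n p0 by (intro powr_mono2) auto
    finally have "?b \<le> c powr p" using a(1) by linarith
    with i show ?case by blast
  qed
  obtain I :: "(real ^ 'n) endo set" and k L where I: "finite I" "I \<subseteq> lie" "0 \<le> (L::real)"
    and rep: "\<And>q \<phi>. q \<in> N \<Longrightarrow> tangent_proj N q \<phi> = (\<Sum>A\<in>I. k A q \<phi> *\<^sub>R act A q)"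
    and k: "\<And>A q \<phi>. A \<in> I \<Longrightarrow> q \<in> N \<Longrightarrow> \<bar>k A q \<phi>\<bar> \<le> L * norm \<phi>"
      "\<And>A q q' \<phi> \<phi>'. A \<in> I \<Longrightarrow> q \<in> N \<Longrightarrow> q' \<in> N \<Longrightarrow>
         \<bar>k A q \<phi> - k A q' \<phi>'\<bar> \<le> L * (norm (q - q') * norm \<phi> + norm (\<phi> - \<phi>'))"
    by (rule tangent_proj_representation[OF homogeneous_orbit_axioms]) (rule that; assumption)
  define \<eta> where "\<eta> A z = k A (u z) (\<psi> z)" for A z
  define P where "P z = (\<Sum>A\<in>I. \<eta> A z *\<^sub>R act A (u z))" for z
  have tt: "time_test T (\<eta> A)" if "A \<in> I" for A
    unfolding \<eta>_def by (rule coefficient_time_test[OF k(1)[OF that] k(2)[OF that] I(3) \<psi>m \<psi>C B])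
  have \<eta>m: "\<eta> A \<in> borel_measurable borel" if "A \<in> I" for A using tt[OF that] by (simp add: time_test_def)
  have am: "(\<lambda>z. act A (u z)) \<in> borel_measurable borel" for A by (rule act_measurable[OF u_measurable])
  have Pm: "P \<in> borel_measurable borel" unfolding P_def
    by (intro borel_measurable_sum borel_measurable_scaleR \<eta>m am)
  have PC: "norm (P z) \<le> (\<Sum>A\<in>I. L * C * (norm A * R))" for z
    unfolding P_def
  proof (rule order_trans[OF norm_sum sum_mono])
    fix A assume A: "A \<in> I"
    have "\<bar>\<eta> A z\<bar> \<le> L * C" unfolding \<eta>_def by (rule order_trans[OF k(1)[OF A u_N] mult_left_mono[OF \<psi>C I(3)]])
    moreover have "norm (act A (u z)) \<le> norm A * R" using norm_act_le[of A "u z"] by (simp only: norm_N[OF u_N])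
    ultimately show "norm (\<eta> A z *\<^sub>R act A (u z)) \<le> L * C * (norm A * R)"
      unfolding norm_scaleR using I(3) by (intro mult_mono) (auto simp: C_def)
  qed
  have tp: "tangent_proj N (u z) (\<psi> z) = P z" for z
    unfolding rep[OF u_N] P_def \<eta>_def ..
  let ?G = "\<lambda>z. w z \<bullet> P z" and ?i = "\<lambda>z. indicator {0<..<T} (snd z) :: real"
  have Gm: "?G \<in> borel_measurable borel" using Pm by measurable
  have aeG: "AE z in domain_measure ?S. w z \<bullet> tangent_proj N (u z) (\<phi> z) = ?G z"
    using ae by eventually_elim (simp only: tp)
  have iP: "square_integrable st (\<lambda>z. ?i z *\<^sub>R P z)"
    by (rule bounded_square_integrable_st(2)[OF Pm PC]) (use T in simp)
  have iG: "integrable st (\<lambda>z. ?i z * ?G z)" using integrable_inner[OF w iP] by simp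
  have ind: "indicator (\<Omega> \<times> {0<..}) z *\<^sub>R (?i z * ?G z) = indicator ?S z *\<^sub>R ?G z" for z
    by (cases z) (auto simp: indicator_def)
  have iGm: "(\<lambda>z. ?i z * ?G z) \<in> borel_measurable borel" using Gm by measurable
  have "integrable (domain_measure ?S) ?G"
    using iG unfolding st_eq integrable_domain_measure[OF space_time_open(2) iGm] integrable_domain_measure[OF oS Gm] ind .
  then have 1: "integrable (lebesgue_on ?S) (\<lambda>z. w z \<bullet> tangent_proj N (u z) (\<phi> z))"
    unfolding lebesgue_on_transport(2)[OF oS Gm aeG] .
  have tests: "AE t in domain_measure {0<..<T}. \<forall>A\<in>I. test (\<lambda>x. \<eta> A (x, t))"
  proof (intro eventually_ball_finite[OF I(1)] ballI)
    fix A assume "A \<in> I"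
    then show "AE t in domain_measure {0<..<T}. test (\<lambda>x. \<eta> A (x, t))"
      using tt unfolding time_test_def by (auto elim: eventually_mono)
  qed
  let ?E = "\<lambda>t. \<Sum>A\<in>I. variation (\<lambda>x. u (x, t)) A (\<lambda>x. \<eta> A (x, t))"
  have deriv: "AE t in domain_measure {0<..<T}.
      integrable (lebesgue_on (\<Omega> \<times> \<Omega>)) (energy_deriv_integrand s p (\<lambda>x. u (x, t)) (\<lambda>x. tangent_proj N (u (x, t)) (\<phi> (x, t)))) \<and>
      energy_deriv s p \<Omega> (\<lambda>x. u (x, t)) (\<lambda>x. tangent_proj N (u (x, t)) (\<phi> (x, t))) = ?E t"
    using tests aet
  proof eventually_elim
    case (elim t)
    let ?f = "\<lambda>z. dual_map p (incr (\<lambda>x. u (x, t)) z) \<bullet> incr (\<lambda>x. tangent_proj N (u (x, t)) (\<phi> (x, t))) z"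
    let ?g = "\<lambda>z. \<Sum>A\<in>I. var_integrand (\<lambda>x. u (x, t)) A (\<lambda>x. \<eta> A (x, t)) z"
    have gi: "integrable \<nu> (var_integrand (\<lambda>x. u (x, t)) A (\<lambda>x. \<eta> A (x, t)))" if "A \<in> I" for A
      using variation_bound(2)[of "\<lambda>x. u (x, t)"] adm_u[of t] elim(1) that by blast
    have gm: "?g \<in> borel_measurable borel"
      by (intro borel_measurable_sum var_integrand_measurable slice_measurable[OF u_measurable] slice_measurable[OF \<eta>m])
    have "AE z in domain_measure (\<Omega> \<times> \<Omega>). \<phi> (fst z, t) = \<psi> (fst z, t) \<and> \<phi> (snd z, t) = \<psi> (snd z, t)"
      by (rule AE_pairs[OF domain_open elim(2)])
    then have fg: "AE z in domain_measure (\<Omega> \<times> \<Omega>). ?f z = ?g z"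
    proof eventually_elim
      case (elim z)
      then have "incr (\<lambda>x. tangent_proj N (u (x, t)) (\<phi> (x, t))) z = incr (\<lambda>x. P (x, t)) z"
        by (simp only: incr_def tp)
      also have "\<dots> = (\<Sum>A\<in>I. incr (\<lambda>x. \<eta> A (x, t) *\<^sub>R act A (u (x, t))) z)" by (simp only: incr_def P_def sum_subtractf)
      finally show ?case unfolding inner_sum_right
        by (simp only: inner_sum_right, intro sum.cong refl var_integrand_eq subsetD[OF I(2)])
    qed
    have eq: "energy_deriv_integrand s p (\<lambda>x. u (x, t)) (\<lambda>x. tangent_proj N (u (x, t)) (\<phi> (x, t)))
        = (\<lambda>z. ?f z / norm (fst z - snd z) powr (real DIM('a) + s * p))"
      by (simp add: energy_deriv_integrand_def incr_def dual_map_def fun_eq_iff)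
    note tr = gagliardo_transport[OF domain_open gm fg, of "real DIM('a) + s * p"]
    have "integral\<^sup>L \<nu> ?g = ?E t" unfolding variation_def by (rule Bochner_Integration.integral_sum) (rule gi)
    moreover have "integrable \<nu> ?g" by (intro Bochner_Integration.integrable_sum gi)
    ultimately show ?case unfolding energy_deriv_def eq tr by blast
  qed
  have 2: "AE t in lebesgue_on {0<..<T}. integrable (lebesgue_on (\<Omega> \<times> \<Omega>))
      (energy_deriv_integrand s p (\<lambda>x. u (x, t)) (\<lambda>x. tangent_proj N (u (x, t)) (\<phi> (x, t))))"
    unfolding AE_lebesgue_on_iff[OF oT] using deriv by eventually_elim blast
  have aeE: "AE t in domain_measure {0<..<T}. energy_deriv s p \<Omega> (\<lambda>x. u (x, t)) (\<lambda>x. tangent_proj N (u (x, t)) (\<phi> (x, t))) = ?E t"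
    using deriv by eventually_elim blast
  have Em: "?E \<in> borel_measurable borel" by (intro borel_measurable_sum variation_measurable u_measurable \<eta>m)
  note we = weak_equation[OF T subsetD[OF I(2)] tt]
  have iE: "integrable (domain_measure {0<..<T}) ?E" by (intro Bochner_Integration.integrable_sum we(1))
  have 3: "integrable (lebesgue_on {0<..<T}) (\<lambda>t. energy_deriv s p \<Omega> (\<lambda>x. u (x, t)) (\<lambda>x. tangent_proj N (u (x, t)) (\<phi> (x, t))))"
    unfolding lebesgue_on_transport(2)[OF oT Em aeE] by (rule iE)
  let ?m = "\<lambda>t. LINT x|\<mu>. ?G (x, t)"
  have mm: "?m \<in> borel_measurable borel" by (rule inner_integral_measurable[OF Gm])
  have aem: "AE t in domain_measure {0<..<T}. (LINT x|lebesgue_on \<Omega>. w (x, t) \<bullet> tangent_proj N (u (x, t)) (\<phi> (x, t))) = ?m t"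
    using aet
  proof eventually_elim
    case (elim t)
    have "AE x in \<mu>. w (x, t) \<bullet> tangent_proj N (u (x, t)) (\<phi> (x, t)) = ?G (x, t)"
      using elim by eventually_elim (simp only: tp)
    then show ?case by (rule lebesgue_on_transport(3)[OF domain_open slice_measurable[OF Gm]])
  qed
  have "(LINT t|lebesgue_on {0<..<T}. LINT x|lebesgue_on \<Omega>. w (x, t) \<bullet> tangent_proj N (u (x, t)) (\<phi> (x, t)))
      = integral\<^sup>L (domain_measure {0<..<T}) ?m"
    by (rule lebesgue_on_transport(3)[OF oT mm aem])
  also have "\<dots> = (LINT t|domain_measure {0<..}. indicator {0<..<T} t * ?m t)" by (rule time_integral_restrict[OF mm, symmetric])
  also have "\<dots> = (LINT t|domain_measure {0<..}. LINT x|\<mu>. ?i (x, t) * ?G (x, t))" by simp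
  also have "\<dots> = (LINT z|st. ?i z * ?G z)"
  proof -
    have "integrable (\<mu> \<Otimes>\<^sub>M domain_measure {0<..}) (\<lambda>(x, t). ?i (x, t) * ?G (x, t))" using iG by (simp add: st_def case_prod_beta')
    from mu_time.integral_snd[OF this] show ?thesis by (simp add: st_def case_prod_beta')
  qed
  also have "\<dots> = (LINT z|st. (\<Sum>A\<in>I. w z \<bullet> (?i z *\<^sub>R (\<eta> A z *\<^sub>R act A (u z)))))"
    by (simp only: P_def inner_sum_right inner_scaleR_right sum_distrib_left)
  also have "\<dots> = (\<Sum>A\<in>I. LINT z|st. w z \<bullet> (?i z *\<^sub>R (\<eta> A z *\<^sub>R act A (u z))))"
  proof (rule Bochner_Integration.integral_sum)
    fix A assume A: "A \<in> I"
    have m: "(\<lambda>z. \<eta> A z *\<^sub>R act A (u z)) \<in> borel_measurable borel" by (rule borel_measurable_scaleR[OF \<eta>m[OF A] am])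
    have "norm (\<eta> A z *\<^sub>R act A (u z)) \<le> L * C * (norm A * R)" for z
    proof -
      have "\<bar>\<eta> A z\<bar> \<le> L * C" unfolding \<eta>_def by (rule order_trans[OF k(1)[OF A u_N] mult_left_mono[OF \<psi>C I(3)]])
      moreover have "norm (act A (u z)) \<le> norm A * R" using norm_act_le[of A "u z"] by (simp only: norm_N[OF u_N])
      ultimately show ?thesis unfolding norm_scaleR using I(3) by (intro mult_mono) (auto simp: C_def)
    qed
    from bounded_square_integrable_st(2)[OF m this, of T] show "integrable st (\<lambda>z. w z \<bullet> (?i z *\<^sub>R (\<eta> A z *\<^sub>R act A (u z))))"
      using T by (intro integrable_inner[OF w]) simp
  qed
  finally have 4: "(LINT t|lebesgue_on {0<..<T}. LINT x|lebesgue_on \<Omega>. w (x, t) \<bullet> tangent_proj N (u (x, t)) (\<phi> (x, t)))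
      = (\<Sum>A\<in>I. LINT z|st. w z \<bullet> (?i z *\<^sub>R (\<eta> A z *\<^sub>R act A (u z))))" .
  have 5: "(LINT t|lebesgue_on {0<..<T}. energy_deriv s p \<Omega> (\<lambda>x. u (x, t)) (\<lambda>x. tangent_proj N (u (x, t)) (\<phi> (x, t))))
      = (\<Sum>A\<in>I. LINT t|domain_measure {0<..<T}. variation (\<lambda>x. u (x, t)) A (\<lambda>x. \<eta> A (x, t)))"
    unfolding lebesgue_on_transport(3)[OF oT Em aeE] by (rule Bochner_Integration.integral_sum) (rule we(1))
  have "(\<Sum>A\<in>I. LINT z|st. w z \<bullet> (?i z *\<^sub>R (\<eta> A z *\<^sub>R act A (u z)))) +
      (\<Sum>A\<in>I. LINT t|domain_measure {0<..<T}. variation (\<lambda>x. u (x, t)) A (\<lambda>x. \<eta> A (x, t))) = 0"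
    unfolding sum.distrib[symmetric] by (rule sum.neutral) (intro ballI we(2))
  then show ?thesis unfolding 4 5 using 1 2 3 by blast
qed

end

section \<open>The concrete measures, the degenerate orbit, and existence\<close>

lemma (in energy_flow) adm_iff:
  "adm y \<longleftrightarrow> y \<in> borel_measurable borel \<and> (\<forall>x. y x \<in> N) \<and> integrable \<nu> (\<lambda>z. norm (y (fst z) - y (snd z)) powr p)"
  by (simp add: adm_def incr_def)

lemma energy_flow_gagliardo:
  fixes \<Omega> :: "'a::euclidean_space set" and K :: "'b::euclidean_space endo set"
  assumes K: "homogeneous_orbit K N" and N: "N \<noteq> {}" and p: "1 < p" and s: "0 < s"
    and \<Omega>: "open \<Omega>" "emeasure lborel \<Omega> < \<infinity>"
  shows "energy_flow K N (domain_measure \<Omega>) (gagliardo_measure (real DIM('a) + s * p) \<Omega>) p"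
proof (rule energy_flow.intro[OF K], rule energy_flow_axioms.intro)
  show "finite_measure (domain_measure \<Omega>)"
    by (rule finite_measureI) (use \<Omega> in \<open>simp add: domain_measure_def emeasure_density ennreal_indicator\<close>)
  show "sigma_finite_measure (gagliardo_measure (real DIM('a) + s * p) \<Omega>)" by (rule sigma_finite_gagliardo_measure[OF \<Omega>(1)])
  show "AE z in gagliardo_measure (real DIM('a) + s * p) \<Omega>. P (fst z) \<and> P (snd z)" if "AE x in domain_measure \<Omega>. P x" for P
    by (rule AE_gagliardo_measure[OF \<Omega>(1) AE_pairs[OF \<Omega>(1) that]])
  interpret homogeneous_orbit K N by (rule K)
  obtain b where b: "\<And>q. q \<in> N \<Longrightarrow> norm q \<le> b" using compact_imp_bounded[OF compact_orbit] unfolding bounded_iff by blast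
  fix v :: "nat \<Rightarrow> 'a \<Rightarrow> 'b" and C
  assume v: "\<And>j. v j \<in> borel_measurable borel" "\<And>j x. v j x \<in> N"
    "\<And>j. integrable (gagliardo_measure (real DIM('a) + s * p) \<Omega>) (\<lambda>z. norm (v j (fst z) - v j (snd z)) powr p)"
    "\<And>j. (LINT z|gagliardo_measure (real DIM('a) + s * p) \<Omega>. norm (v j (fst z) - v j (snd z)) powr p) \<le> C"
  have sp: "1 \<le> p" "0 < s * p" using p s by simp_all
  obtain r :: "nat \<Rightarrow> nat" where "strict_mono r" "AE x in domain_measure \<Omega>. convergent (\<lambda>j. v (r j) x)"
    by (rule gagliardo_compactness[OF v(1) b[OF v(2)] sp \<Omega> v(3,4)])
  then show "\<exists>r :: nat \<Rightarrow> nat. strict_mono r \<and> (AE x in domain_measure \<Omega>. convergent (\<lambda>j. v (r j) x))" by blast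
qed (use p N in simp_all)

text \<open>This covers the orbit consisting of the origin, where the domain may have infinite
  measure. With u and its time derivative both zero, every integrand in (iii) vanishes, whatever
  value \<open>tangent_proj\<close> has.\<close>

lemma weak_solution_zero:
  fixes \<Omega> :: "'a::euclidean_space set" and u0 :: "'a \<Rightarrow> 'b::euclidean_space"
  assumes \<Omega>: "open \<Omega>" and p: "1 < p" and u0: "AE x in domain_measure \<Omega>. u0 x = 0"
  shows "weak_solution s p \<Omega> N u0 (\<lambda>z. 0)"
proof -
  have g: "gagliardo_integrand s p (\<lambda>x. 0 :: 'b) = (\<lambda>z :: 'a \<times> 'a. 0)" by (simp add: gagliardo_integrand_def fun_eq_iff)
  have L: "(\<lambda>x. 0 :: 'b) \<in> Lp_space q \<Omega>" "Lp_norm q \<Omega> (\<lambda>x. 0 :: 'b) = 0" for q by (simp_all add: Lp_space_def Lp_norm_def)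
  have S: "(\<lambda>x. 0 :: 'b) \<in> sobolev s p \<Omega>" "sobolev_norm s p \<Omega> (\<lambda>x. 0 :: 'b) = 0"
    by (simp_all add: sobolev_def sobolev_norm_def gagliardo_energy_def g L)
  have st: "strongly_measurable M X nrm (\<lambda>t x. 0 :: 'b)" if "(\<lambda>x :: 'a. 0) \<in> X" "nrm (\<lambda>x. 0) = 0" for M :: "real measure" and X nrm
    unfolding strongly_measurable_def using that
    by (intro conjI exI[of _ "\<lambda>k t x. 0"]) (auto simp: simple_function_def)
  have e: "energy_deriv_integrand s p (\<lambda>x. 0 :: 'b) \<phi> = (\<lambda>z :: 'a \<times> 'a. 0)" for \<phi>
    by (simp add: energy_deriv_integrand_def fun_eq_iff)
  have ae: "AE x in domain_measure \<Omega>. 0 - u0 x = 0" using u0 by eventually_elim simp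
  have m: "(\<lambda>x. 0 :: 'b) \<in> borel_measurable (borel :: 'a measure)" by simp
  have i: "(\<lambda>x. 0 - u0 x) \<in> Lp_space 2 \<Omega>" "Lp_norm 2 \<Omega> (\<lambda>x. 0 - u0 x) = 0"
    using Lp_transport[OF \<Omega> m ae, of 2] by simp_all
  have l: "locally_integrable_on (\<lambda>z :: 'a \<times> real. 0 :: 'b) (\<Omega> \<times> {0<..})"
    by (simp add: locally_integrable_on_def set_integrable_def)
  have 1: "(\<lambda>t x. 0 :: 'b) \<in> bochner_Linfty (lebesgue_on {0 :: real<..}) (sobolev s p \<Omega>) (sobolev_norm s p \<Omega>)"
    unfolding bochner_Linfty_def mem_Collect_eq by (intro conjI exI[of _ 0] st[where nrm = "sobolev_norm s p \<Omega>", OF S]) (simp add: S)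
  have 2: "(\<lambda>t x. 0 :: 'b) \<in> bochner_Lp 2 (lebesgue_on {0 :: real<..}) (Lp_space 2 \<Omega>) (Lp_norm 2 \<Omega>)"
    unfolding bochner_Lp_def mem_Collect_eq by (intro conjI st[where nrm = "Lp_norm 2 \<Omega>", OF L[where q = 2]]) (simp add: L)
  have 3: "distributional_time_deriv \<Omega> (\<lambda>z. 0 :: 'b) (\<lambda>z. 0)" unfolding distributional_time_deriv_def using l by simp
  show ?thesis unfolding weak_solution_def
    by (intro conjI exI[of _ "\<lambda>z. 0"] 1 2 3 allI impI) (simp_all add: e energy_deriv_def i[simplified])
qed

lemma finite_measure_of_integrable_norm:
  fixes g :: "'a::euclidean_space \<Rightarrow> 'b::euclidean_space"
  assumes \<Omega>: "open \<Omega>" and g: "integrable (domain_measure \<Omega>) (\<lambda>x. norm (g x) powr p)"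
    and r: "AE x in domain_measure \<Omega>. norm (g x) = r" "0 < r"
  shows "emeasure lborel \<Omega> < \<infinity>"
proof -
  have "AE x in domain_measure \<Omega>. norm (g x) powr p = r powr p" using r(1) by eventually_elim simp
  from integrable_cong_AE_imp[OF g _ this] have "integrable (domain_measure \<Omega>) (\<lambda>x. r powr p)" by simp
  then have "integrable lborel (\<lambda>x. indicator \<Omega> x *\<^sub>R r powr p)"
    by (subst (asm) integrable_domain_measure[OF \<Omega>]) simp_all
  then have "integrable lborel (\<lambda>x. (indicator \<Omega> x * r powr p) * (1 / r powr p))" by (intro integrable_mult_left) simp
  then have "integrable lborel (indicator \<Omega> :: 'a \<Rightarrow> real)" using r(2) by simp
  then show ?thesis using \<Omega> by (simp add: integrable_indicator_iff)
qed

text \<open>A nonempty open set is not negligible, so a statement independent of the point cannot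
  hold almost everywhere on it without being true. This excludes an empty target.\<close>

lemma AE_domain_measure_const:
  fixes \<Omega> :: "'a::euclidean_space set"
  assumes \<Omega>: "open \<Omega>" "\<Omega> \<noteq> {}" and P: "AE x in domain_measure \<Omega>. P" shows P
proof (rule ccontr)
  assume "\<not> P"
  then have "AE x in lborel. x \<notin> \<Omega>" using P unfolding AE_domain_measure_iff[OF \<Omega>(1)] by simp
  then have "AE x in lebesgue. x \<notin> \<Omega>" by (rule AE_completion)
  then have "\<Omega> \<in> null_sets lebesgue" using \<Omega>(1) by (subst AE_iff_null_sets) auto
  then show False using open_not_negligible[OF \<Omega>] by (simp add: negligible_iff_null_sets)
qed

lemma flow_exists:
  fixes K :: "(real ^ 'L) endo set" and \<Omega> :: "'a::euclidean_space set" and u0 :: "'a \<Rightarrow> real ^ 'L"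
  assumes K: "homogeneous_orbit K N" and p: "1 < p" and s: "0 < s" and \<Omega>: "open \<Omega>" "\<Omega> \<noteq> {}"
    and u0: "u0 \<in> sobolev_into s p \<Omega> N"
  shows "\<exists>u. u \<in> borel_measurable (lebesgue_on (\<Omega> \<times> {0<..})) \<and>
    (AE z in lebesgue_on (\<Omega> \<times> {0<..}). u z \<in> N) \<and> weak_solution s p \<Omega> N u0 u"
proof -
  interpret homogeneous_orbit K N by (rule K)
  have p0: "0 < p" using p by simp
  have u0s: "u0 \<in> sobolev s p \<Omega>" and u0N: "AE x in domain_measure \<Omega>. u0 x \<in> N"
    using u0 unfolding sobolev_into_def AE_lebesgue_on_iff[OF \<Omega>(1)] by blast+
  have "u0 \<in> borel_measurable (lebesgue_on \<Omega>)" using u0s unfolding sobolev_def Lp_space_def by blast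
  from borel_representative[OF \<Omega>(1) this] obtain y where y[measurable]: "y \<in> borel_measurable borel"
    and uy: "AE x in domain_measure \<Omega>. u0 x = y x" by blast
  have "N \<noteq> {}"
  proof
    assume "N = {}"
    then have "AE x in domain_measure \<Omega>. False" using u0N by simp
    then show False by (rule AE_domain_measure_const[OF \<Omega>])
  qed
  then obtain q where q: "q \<in> N" by blast
  have nq: "norm q' = norm q" if "q' \<in> N" for q' by (rule norm_orbit_eq[OF that q])
  show ?thesis
  proof (cases "norm q = 0")
    case True
    then have N0: "q' = 0" if "q' \<in> N" for q' using nq[OF that] by simp
    have "AE x in domain_measure \<Omega>. u0 x = 0" using u0N by eventually_elim (rule N0)
    from weak_solution_zero[OF \<Omega>(1) p this] show ?thesis using N0[OF q] q
      by (intro exI[of _ "\<lambda>z. 0"]) simp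
  next
    case False
    \<comment> \<open>The Borel representative of u0 lies in \<open>N\<close> almost everywhere;
      moving its other values to q makes it admissible without changing its class.\<close>
    define y' where "y' x = (if y x \<in> N then y x else q)" for x
    have "N \<in> sets borel" using compact_orbit by (simp add: borel_compact)
    then have ym: "y' \<in> borel_measurable borel" unfolding y'_def by measurable
    have uy': "AE x in domain_measure \<Omega>. u0 x = y' x" using uy u0N by eventually_elim (simp add: y'_def)
    have yN: "y' x \<in> N" for x by (simp add: y'_def q)
    note tr = sobolev_transport(1)[OF \<Omega>(1) p0 ym uy', of s]
    have fin: "emeasure lborel \<Omega> < \<infinity>"
      by (rule finite_measure_of_integrable_norm[OF \<Omega>(1), of y' p "norm q"]) (use u0s tr nq[OF yN] False in auto)
    interpret energy_flow K N "domain_measure \<Omega>" "gagliardo_measure (real DIM('a) + s * p) \<Omega>" p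
      by (rule energy_flow_gagliardo[OF K \<open>N \<noteq> {}\<close> p s \<Omega>(1) fin])
    have "adm y'" unfolding adm_iff using ym yN u0s tr by blast
    from flow_limit_exists[OF this] obtain h v D u Z g w
      where fl: "flow_limit K N (domain_measure \<Omega>) (gagliardo_measure (real DIM('a) + s * p) \<Omega>) p y' h v D u Z g w" by blast
    have "sobolev_flow K N \<Omega> s p y' h v D u Z g w"
      by (rule sobolev_flow.intro[OF fl sobolev_flow_axioms.intro[OF \<Omega>(1)]])
    then interpret F: sobolev_flow K N \<Omega> s p y' h v D u Z g w .
    have "weak_solution s p \<Omega> N u0 u"
      unfolding weak_solution_def
      by (intro conjI exI[of _ w] F.u_bochner F.distributional_derivative F.w_bochner allI impI
          F.initial_value[OF uy', THEN conjunct1] F.initial_value[OF uy', THEN conjunct2]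
          F.weak_formulation[THEN conjunct1] F.weak_formulation[THEN conjunct2, THEN conjunct1]
          F.weak_formulation[THEN conjunct2, THEN conjunct2, THEN conjunct1]
          F.weak_formulation[THEN conjunct2, THEN conjunct2, THEN conjunct2]; assumption)
    moreover have "u \<in> borel_measurable (lebesgue_on (\<Omega> \<times> {0<..}))"
      by (rule lebesgue_on_transport(1)[OF F.space_time_open(2) F.u_measurable]) simp
    ultimately show ?thesis using F.u_N by (intro exI[of _ u]) simp
  qed
qed

theorem theorem1p1:
  fixes s p :: real
    and \<Omega> :: "(real ^ 'n) set"
    and N :: "(real ^ 'L) set"
    and G :: "('g::euclidean_space) monoid"
    and \<rho> :: "'g \<Rightarrow> real ^ 'L \<Rightarrow> real ^ 'L"
    and u0 :: "real ^ 'n \<Rightarrow> real ^ 'L"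
  assumes "1 < p"
    and "0 < s" and "s < 1"
    and "lipschitz_domain \<Omega>"
    and "N = sphere 0 1 \<or> equivariant_homogeneous_manifold G \<rho> N"
    and "u0 \<in> sobolev_into s p \<Omega> N"
  shows "\<exists>u :: (real ^ 'n) \<times> real \<Rightarrow> real ^ 'L.
    u \<in> borel_measurable (lebesgue_on (\<Omega> \<times> {0<..})) \<and>
    (AE z in lebesgue_on (\<Omega> \<times> {0<..}). u z \<in> N) \<and>
    weak_solution s p \<Omega> N u0 u"
proof -
  obtain K where K: "homogeneous_orbit K N"
    using assms(5) homogeneous_orbit_sphere homogeneous_orbit_equivariant by blast
  have "open \<Omega>" "\<Omega> \<noteq> {}" using assms(4) by (auto simp: lipschitz_domain_def)
  from flow_exists[OF K assms(1,2) this assms(6)] show ?thesis .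
qed

end
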